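(* Let $G$ be a finite group. For $\mathbb{D}\in\{\mathbb{R},\mathbb{C},\mathbb{H}\}$ let $\mathrm{Ir}_{\mathbb{D}}(G)$ be the set of isomorphism classes of irreducible real representations $\pi$ of $G$ with $\mathrm{End}_G(\pi)\cong\mathbb{D}$. For $\mathbb{K}=\mathbb{R}$ or $\mathbb{C}$ let $H_G^{\mathbb{K}}$ be the regular equipped Cardy--Frobenius algebra of $G$ over $\mathbb{K}$. Then there are isomorphisms of equipped Cardy--Frobenius algebras $$H_G^{\mathbb{R}}\cong\bigoplus_{\mathbb{D}=\mathbb{R},\mathbb{C},\mathbb{H}}\ \bigoplus_{\pi\in\mathrm{Ir}_{\mathbb{D}}(G)}H^{\mathbb{D}}_{\frac{\dim\pi}{\dim\mathbb{D}},\frac{\dim\pi}{|G|}},\qquad H_G^{\mathbb{C}}\cong\bigoplus_{\mathbb{D}=\mathbb{R},\mathbb{C},\mathbb{H}}\ \bigoplus_{\pi\in\mathrm{Ir}_{\mathbb{D}}(G)}H^{\mathbb{D}}_{\frac{\dim\pi}{\dim\mathbb{D}},\frac{\dim\pi}{|G|}}\otimes\mathbb{C},$$ where all dimensions are over $\mathbb{R}$.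
   Context: All algebras are finite-dimensional, associative and unital over a field $\mathbb{K}$. A Frobenius pair $(C,l_C)$ is an algebra $C$ with a linear functional $l_C:C\to\mathbb{K}$ such that the bilinear form $(c_1,c_2)_C=l_C(c_1c_2)$ is symmetric and non-degenerate. A Cardy--Frobenius algebra $((A,l_A),(B,l_B),\phi)$ consists of: (1) a commutative Frobenius pair $(A,l_A)$; (2) a Frobenius pair $(B,l_B)$, not necessarily commutative; (3) an algebra homomorphism $\phi:A\to B$ whose image is contained in the center of $B$ and which satisfies the Cardy condition $(\phi^*(b'),\phi^*(b''))_A=\mathrm{Tr}\,W^B_{b'b''}$ for all $b',b''\in B$. Here $\phi^*:B\to A$ is the dual map, defined by $(\phi^*(b),a)_A=(b,\phi(a))_B$, and $W^B_{b'b''}:B\to B$ is the linear operator $b\mapsto b'bb''$. An equipped Cardy--Frobenius algebra $((A,l_A),(B,l_B),\phi,U,\star)$ is a Cardy--Frobenius algebra together with: involutive linear anti-automorphisms $\star:A\to A$ and $\star:B\to B$ such that $l_A(x^\star)=l_A(x)$, $l_B(x^\star)=l_B(x)$, $\phi(x^\star)=\phi(x)^\star$; and an element $U\in A$ such that $U^2=K_A^\star$ and $\phi(U)=K_B^\star$. Here, for a Frobenius pair $(C,l_C)$ with basis $\gamma_1,\dots,\gamma_N$ and with $(F_C^{ij})$ the inverse of the matrix $((\gamma_i,\gamma_j)_C)$, one puts $K_C^\star=\sum_{i,j}F_C^{ij}\gamma_i\gamma_j^\star$. Direct sums are taken componentwise (in $A$, $B$, $l_A$, $l_B$, $\phi$,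 $U$, $\star$). An isomorphism is a pair of algebra isomorphisms of the $A$- and $B$-parts compatible with $l_A,l_B,\phi,U,\star$. Regular algebra $H_G^{\mathbb{K}}$: $B=\mathbb{K}[G]$ with $l_B(f)=f(1)$ (coefficient at the unit element); $A=Z(\mathbb{K}[G])$ with $l_A(f)=f(1)/|G|$; $\phi$ the inclusion; $\star$ the linear map with $g^\star=g^{-1}$ on $B$, and its restriction on $A$; $U=\sum_{g\in G}g^2$. The algebras $H^{\mathbb{D}}_{n,\mu}$: let $\mathbb{D}\in\{\mathbb{R},\mathbb{C},\mathbb{H}\}$, $d=\dim_{\mathbb{R}}\mathbb{D}$, $n$ a positive integer, $\mu$ a non-zero real number. The $A$-part is $A_R=Z(\mathbb{D})$ with $l_{A_R}(a)=\mu^2\,\mathrm{Re}(a)/d$; the $B$-part is $B_R=\mathrm{Mat}_n(\mathbb{D})$ with $l_{B_R}(x)=\mu\,\mathrm{Re}\,\mathrm{Tr}(x)$; $\phi_R(a)=a\,\mathrm{Id}$; $a^{\star_R}=\overline{a}$, $x^{\star_R}=\overline{x}^{\,t}$ (standard conjugation of $\mathbb{D}$ and matrix transposition); $U_R=(2-d)/\mu$. $H^{\mathbb{D}}_{n,\mu}\otimes\mathbb{C}$ is its complexification: $A_R\otimes_{\mathbb{R}}\mathbb{C}$, $B_R\otimes_{\mathbb{R}}\mathbb{C}$ with all maps extended $\mathbb{C}$-linearly and $U=U_R\otimes 1$. *)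

theory Defs
  imports "Jordan_Normal_Form.VS_Connect" "HOL-Algebra.QuotRing" Complex_Main
begin

section \<open>Finite-dimensional algebras over a field\<close>

text \<open>The ground field is a type \<open>'k::field\<close>, turned into a \<open>HOL-Algebra\<close> ring by \<open>class_ring\<close>.
  The locale \<open>algebra\<close> of \<open>HOL-Algebra\<close> covers commutative algebras only.\<close>

locale fd_algebra =
  ring C + vectorspace "class_ring :: 'k ring" C
  for C :: "('k::field, 'c) module" (structure) +
  assumes smult_mult_left:
      "\<lbrakk>x \<in> carrier C; y \<in> carrier C\<rbrakk> \<Longrightarrow> (k \<odot> x) \<otimes> y = k \<odot> (x \<otimes> y)"
    and smult_mult_right:
      "\<lbrakk>x \<in> carrier C; y \<in> carrier C\<rbrakk> \<Longrightarrow> x \<otimes> (k \<odot> y) = k \<odot> (x \<otimes> y)"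
    and finite_dimensional: "fin_dim"

definition lin_maps ::
  "('k::field, 'c) module \<Rightarrow> ('k, 'd) module \<Rightarrow> ('c \<Rightarrow> 'd) set" where
  "lin_maps C D = LinearCombinations.module_hom class_ring C D"

definition alg_isos ::
  "('k::field, 'c) module \<Rightarrow> ('k, 'd) module \<Rightarrow> ('c \<Rightarrow> 'd) set" where
  "alg_isos C D = ring_iso C D \<inter> lin_maps C D"

definition center :: "('c, 'm) monoid_scheme \<Rightarrow> 'c set" where
  "center C = {z \<in> carrier C. \<forall>x \<in> carrier C. z \<otimes>\<^bsub>C\<^esub> x = x \<otimes>\<^bsub>C\<^esub> z}"

definition center_alg :: "('k, 'c) module \<Rightarrow> ('k, 'c) module" where
  "center_alg C = C\<lparr>carrier := center C\<rparr>"

subsection \<open>Ordered bases, coordinates and traces\<close>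

definition ordered_basis :: "('k::field, 'c) module \<Rightarrow> 'c list \<Rightarrow> bool" where
  "ordered_basis C \<gamma> \<longleftrightarrow> distinct \<gamma> \<and> vectorspace.basis class_ring C (set \<gamma>)"

text \<open>Quantities that do not depend on the basis are computed in this one.\<close>

definition some_basis :: "('k::field, 'c) module \<Rightarrow> 'c list" where
  "some_basis C = (SOME \<gamma>. ordered_basis C \<gamma>)"

definition coords :: "('k::field, 'c) module \<Rightarrow> 'c list \<Rightarrow> 'c \<Rightarrow> 'k vec" where
  "coords C \<gamma> x = (THE v. v \<in> carrier_vec (length \<gamma>) \<and>
     x = (\<Oplus>\<^bsub>C\<^esub>i \<in> {..<length \<gamma>}. v $ i \<odot>\<^bsub>C\<^esub> \<gamma> ! i))"

definition op_mat :: "('k::field, 'c) module \<Rightarrow> 'c list \<Rightarrow> ('c \<Rightarrow> 'c) \<Rightarrow> 'k mat" where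
  "op_mat C \<gamma> T = mat (length \<gamma>) (length \<gamma>) (\<lambda>(i, j). coords C \<gamma> (T (\<gamma> ! j)) $ i)"

definition mat_trace :: "'a::comm_monoid_add mat \<Rightarrow> 'a" where
  "mat_trace M = (\<Sum>i<dim_row M. M $$ (i, i))"

definition op_trace :: "('k::field, 'c) module \<Rightarrow> ('c \<Rightarrow> 'c) \<Rightarrow> 'k" where
  "op_trace C T = mat_trace (op_mat C (some_basis C) T)"

section \<open>Cardy--Frobenius algebras\<close>

locale frobenius_pair = fd_algebra C
  for C :: "('k::field, 'c) module" (structure) and l :: "'c \<Rightarrow> 'k" +
  assumes functional_add:
      "\<lbrakk>x \<in> carrier C; y \<in> carrier C\<rbrakk> \<Longrightarrow> l (x \<oplus> y) = l x + l y"
    and functional_smult: "x \<in> carrier C \<Longrightarrow> l (k \<odot> x) = k * l x"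
    and form_symmetric:
      "\<lbrakk>x \<in> carrier C; y \<in> carrier C\<rbrakk> \<Longrightarrow> l (x \<otimes> y) = l (y \<otimes> x)"
    and form_nondegenerate:
      "\<lbrakk>x \<in> carrier C; \<And>y. y \<in> carrier C \<Longrightarrow> l (x \<otimes> y) = 0\<rbrakk> \<Longrightarrow> x = \<zero>"

definition dual_map ::
  "('k::field, 'a) module \<Rightarrow> ('a \<Rightarrow> 'k) \<Rightarrow> ('k, 'b) module \<Rightarrow> ('b \<Rightarrow> 'k) \<Rightarrow> ('a \<Rightarrow> 'b) \<Rightarrow> 'b \<Rightarrow> 'a" where
  "dual_map A l\<^sub>A B l\<^sub>B \<phi> b =
     (THE x. x \<in> carrier A \<and> (\<forall>a \<in> carrier A. l\<^sub>A (x \<otimes>\<^bsub>A\<^esub> a) = l\<^sub>B (b \<otimes>\<^bsub>B\<^esub> \<phi> a)))"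

locale cardy_frobenius =
  A: frobenius_pair A l\<^sub>A + B: frobenius_pair B l\<^sub>B
  for A :: "('k::field, 'a) module" and l\<^sub>A :: "'a \<Rightarrow> 'k"
    and B :: "('k, 'b) module" and l\<^sub>B :: "'b \<Rightarrow> 'k" +
  fixes \<phi> :: "'a \<Rightarrow> 'b"
  assumes A_commutative:
      "\<lbrakk>x \<in> carrier A; y \<in> carrier A\<rbrakk> \<Longrightarrow> x \<otimes>\<^bsub>A\<^esub> y = y \<otimes>\<^bsub>A\<^esub> x"
    and phi_hom: "\<phi> \<in> Ring.ring_hom A B \<inter> lin_maps A B"
    and phi_central: "\<phi> ` carrier A \<subseteq> center B"
    and cardy: "\<lbrakk>b' \<in> carrier B; b'' \<in> carrier B\<rbrakk> \<Longrightarrow>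
      l\<^sub>A (dual_map A l\<^sub>A B l\<^sub>B \<phi> b' \<otimes>\<^bsub>A\<^esub> dual_map A l\<^sub>A B l\<^sub>B \<phi> b'')
        = op_trace B (\<lambda>b. b' \<otimes>\<^bsub>B\<^esub> b \<otimes>\<^bsub>B\<^esub> b'')"

definition involutive_anti_aut :: "('k::field, 'c) module \<Rightarrow> ('c \<Rightarrow> 'c) \<Rightarrow> bool" where
  "involutive_anti_aut C s \<longleftrightarrow> s \<in> lin_maps C C \<and>
     (\<forall>x \<in> carrier C. \<forall>y \<in> carrier C. s (x \<otimes>\<^bsub>C\<^esub> y) = s y \<otimes>\<^bsub>C\<^esub> s x) \<and>
     (\<forall>x \<in> carrier C. s (s x) = x)"

definition gram :: "('k::field, 'c) module \<Rightarrow> ('c \<Rightarrow> 'k) \<Rightarrow> 'c list \<Rightarrow> 'k mat" where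
  "gram C l \<gamma> = mat (length \<gamma>) (length \<gamma>) (\<lambda>(i, j). l (\<gamma> ! i \<otimes>\<^bsub>C\<^esub> \<gamma> ! j))"

definition gram_inv :: "('k::field, 'c) module \<Rightarrow> ('c \<Rightarrow> 'k) \<Rightarrow> 'c list \<Rightarrow> 'k mat" where
  "gram_inv C l \<gamma> = (THE F. F \<in> carrier_mat (length \<gamma>) (length \<gamma>) \<and>
     inverts_mat (gram C l \<gamma>) F \<and> inverts_mat F (gram C l \<gamma>))"

definition K_star :: "('k::field, 'c) module \<Rightarrow> ('c \<Rightarrow> 'k) \<Rightarrow> ('c \<Rightarrow> 'c) \<Rightarrow> 'c" where
  "K_star C l s = (let \<gamma> = some_basis C; N = length \<gamma> in
     \<Oplus>\<^bsub>C\<^esub>i \<in> {..<N}. \<Oplus>\<^bsub>C\<^esub>j \<in> {..<N}.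
       gram_inv C l \<gamma> $$ (i, j) \<odot>\<^bsub>C\<^esub> (\<gamma> ! i \<otimes>\<^bsub>C\<^esub> s (\<gamma> ! j)))"

locale equipped_cardy_frobenius = cardy_frobenius A l\<^sub>A B l\<^sub>B \<phi>
  for A :: "('k::field, 'a) module" and l\<^sub>A :: "'a \<Rightarrow> 'k"
    and B :: "('k, 'b) module" and l\<^sub>B :: "'b \<Rightarrow> 'k" and \<phi> :: "'a \<Rightarrow> 'b" +
  fixes U :: 'a and s\<^sub>A :: "'a \<Rightarrow> 'a" and s\<^sub>B :: "'b \<Rightarrow> 'b"
  assumes star_A: "involutive_anti_aut A s\<^sub>A"
    and star_B: "involutive_anti_aut B s\<^sub>B"
    and functional_star_A: "x \<in> carrier A \<Longrightarrow> l\<^sub>A (s\<^sub>A x) = l\<^sub>A x"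
    and functional_star_B: "y \<in> carrier B \<Longrightarrow> l\<^sub>B (s\<^sub>B y) = l\<^sub>B y"
    and phi_star: "x \<in> carrier A \<Longrightarrow> \<phi> (s\<^sub>A x) = s\<^sub>B (\<phi> x)"
    and U_closed: "U \<in> carrier A"
    and U_square: "U \<otimes>\<^bsub>A\<^esub> U = K_star A l\<^sub>A s\<^sub>A"
    and phi_U: "\<phi> U = K_star B l\<^sub>B s\<^sub>B"

record ('k, 'a, 'b) ecf_data =
  A_alg :: "('k, 'a) module"
  A_fun :: "'a \<Rightarrow> 'k"
  B_alg :: "('k, 'b) module"
  B_fun :: "'b \<Rightarrow> 'k"
  AB_hom :: "'a \<Rightarrow> 'b"
  U_elem :: 'a
  A_star :: "'a \<Rightarrow> 'a"
  B_star :: "'b \<Rightarrow> 'b"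

definition is_ecf :: "('k::field, 'a, 'b) ecf_data \<Rightarrow> bool" where
  "is_ecf X \<longleftrightarrow> equipped_cardy_frobenius (A_alg X) (A_fun X) (B_alg X) (B_fun X)
     (AB_hom X) (U_elem X) (A_star X) (B_star X)"

definition ecf_isos ::
  "('k::field, 'a, 'b) ecf_data \<Rightarrow> ('k, 'c, 'd) ecf_data \<Rightarrow> (('a \<Rightarrow> 'c) \<times> ('b \<Rightarrow> 'd)) set" where
  "ecf_isos X Y = {(f, g). f \<in> alg_isos (A_alg X) (A_alg Y) \<and> g \<in> alg_isos (B_alg X) (B_alg Y) \<and>
     (\<forall>x \<in> carrier (A_alg X). A_fun Y (f x) = A_fun X x) \<and>
     (\<forall>y \<in> carrier (B_alg X). B_fun Y (g y) = B_fun X y) \<and>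
     (\<forall>x \<in> carrier (A_alg X). AB_hom Y (f x) = g (AB_hom X x)) \<and>
     U_elem Y = f (U_elem X) \<and>
     (\<forall>x \<in> carrier (A_alg X). A_star Y (f x) = f (A_star X x)) \<and>
     (\<forall>y \<in> carrier (B_alg X). B_star Y (g y) = g (B_star X y))}"

text \<open>Isomorphism of equipped Cardy--Frobenius algebras; it includes the assertion that both
  sides satisfy the axioms.\<close>

definition ecf_isomorphic ::
  "('k::field, 'a, 'b) ecf_data \<Rightarrow> ('k, 'c, 'd) ecf_data \<Rightarrow> bool" (infix \<open>\<cong>\<^sub>E\<close> 50) where
  "X \<cong>\<^sub>E Y \<longleftrightarrow> is_ecf X \<and> is_ecf Y \<and> ecf_isos X Y \<noteq> {}"

section \<open>Direct sums and complexification\<close>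

definition alg_sum :: "'i set \<Rightarrow> ('i \<Rightarrow> ('k, 'c) module) \<Rightarrow> ('k, 'i \<Rightarrow> 'c) module" where
  "alg_sum I C = \<lparr>
     carrier = (\<Pi>\<^sub>E i\<in>I. carrier (C i)),
     mult = (\<lambda>x y. \<lambda>i\<in>I. x i \<otimes>\<^bsub>C i\<^esub> y i),
     one = (\<lambda>i\<in>I. \<one>\<^bsub>C i\<^esub>),
     zero = (\<lambda>i\<in>I. \<zero>\<^bsub>C i\<^esub>),
     add = (\<lambda>x y. \<lambda>i\<in>I. x i \<oplus>\<^bsub>C i\<^esub> y i),
     smult = (\<lambda>k x. \<lambda>i\<in>I. k \<odot>\<^bsub>C i\<^esub> x i)\<rparr>"

text \<open>Meant for finite \<open>I\<close>, where direct sum and product coincide.\<close>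

definition ecf_sum ::
  "'i set \<Rightarrow> ('i \<Rightarrow> ('k::field, 'a, 'b) ecf_data) \<Rightarrow> ('k, 'i \<Rightarrow> 'a, 'i \<Rightarrow> 'b) ecf_data" where
  "ecf_sum I X = \<lparr>
     A_alg = alg_sum I (\<lambda>i. A_alg (X i)),
     A_fun = (\<lambda>x. \<Sum>i\<in>I. A_fun (X i) (x i)),
     B_alg = alg_sum I (\<lambda>i. B_alg (X i)),
     B_fun = (\<lambda>y. \<Sum>i\<in>I. B_fun (X i) (y i)),
     AB_hom = (\<lambda>x. \<lambda>i\<in>I. AB_hom (X i) (x i)),
     U_elem = (\<lambda>i\<in>I. U_elem (X i)),
     A_star = (\<lambda>x. \<lambda>i\<in>I. A_star (X i) (x i)),
     B_star = (\<lambda>y. \<lambda>i\<in>I. B_star (X i) (y i))\<rparr>"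

text \<open>The pair \<open>(x, y)\<close> stands for \<open>x \<otimes> 1 + y \<otimes> \<i>\<close> in \<open>C \<otimes> \<complex>\<close> (tensor product over the reals).\<close>

definition alg_complexification :: "(real, 'c) module \<Rightarrow> (complex, 'c \<times> 'c) module" where
  "alg_complexification C = \<lparr>
     carrier = carrier C \<times> carrier C,
     mult = (\<lambda>(x, y) (x', y').
       ((x \<otimes>\<^bsub>C\<^esub> x') \<ominus>\<^bsub>C\<^esub> (y \<otimes>\<^bsub>C\<^esub> y'), (x \<otimes>\<^bsub>C\<^esub> y') \<oplus>\<^bsub>C\<^esub> (y \<otimes>\<^bsub>C\<^esub> x'))),
     one = (\<one>\<^bsub>C\<^esub>, \<zero>\<^bsub>C\<^esub>),
     zero = (\<zero>\<^bsub>C\<^esub>, \<zero>\<^bsub>C\<^esub>),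
     add = (\<lambda>(x, y) (x', y'). (x \<oplus>\<^bsub>C\<^esub> x', y \<oplus>\<^bsub>C\<^esub> y')),
     smult = (\<lambda>z (x, y).
       ((Re z \<odot>\<^bsub>C\<^esub> x) \<ominus>\<^bsub>C\<^esub> (Im z \<odot>\<^bsub>C\<^esub> y), (Re z \<odot>\<^bsub>C\<^esub> y) \<oplus>\<^bsub>C\<^esub> (Im z \<odot>\<^bsub>C\<^esub> x)))\<rparr>"

definition ecf_complexification ::
  "(real, 'a, 'b) ecf_data \<Rightarrow> (complex, 'a \<times> 'a, 'b \<times> 'b) ecf_data" where
  "ecf_complexification X = \<lparr>
     A_alg = alg_complexification (A_alg X),
     A_fun = (\<lambda>(x, y). Complex (A_fun X x) (A_fun X y)),
     B_alg = alg_complexification (B_alg X),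
     B_fun = (\<lambda>(x, y). Complex (B_fun X x) (B_fun X y)),
     AB_hom = map_prod (AB_hom X) (AB_hom X),
     U_elem = (U_elem X, \<zero>\<^bsub>A_alg X\<^esub>),
     A_star = map_prod (A_star X) (A_star X),
     B_star = map_prod (B_star X) (B_star X)\<rparr>"

section \<open>The regular algebra of a finite group\<close>

text \<open>Elements of the group algebra are functions on the type of the group that vanish outside
  the carrier; multiplication is convolution.\<close>

definition group_alg :: "('g, 'm) monoid_scheme \<Rightarrow> ('k::field, 'g \<Rightarrow> 'k) module" where
  "group_alg G = \<lparr>
     carrier = {f. \<forall>x. x \<notin> carrier G \<longrightarrow> f x = 0},
     mult = (\<lambda>f h x. \<Sum>(y, z) \<in> {(y, z) \<in> carrier G \<times> carrier G. y \<otimes>\<^bsub>G\<^esub> z = x}. f y * h z),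
     one = (\<lambda>x. if x = \<one>\<^bsub>G\<^esub> then 1 else 0),
     zero = (\<lambda>x. 0),
     add = (\<lambda>f h x. f x + h x),
     smult = (\<lambda>k f x. k * f x)\<rparr>"

definition group_elem :: "'g \<Rightarrow> 'g \<Rightarrow> 'k::field" where
  "group_elem g = (\<lambda>x. if x = g then 1 else 0)"

text \<open>The linear map with \<open>g \<mapsto> g\<^sup>-\<^sup>1\<close>.\<close>

definition group_star :: "('g, 'm) monoid_scheme \<Rightarrow> ('g \<Rightarrow> 'k::field) \<Rightarrow> 'g \<Rightarrow> 'k" where
  "group_star G f = (\<lambda>x. if x \<in> carrier G then f (inv\<^bsub>G\<^esub> x) else 0)"

definition regular_ecf ::
  "('g, 'm) monoid_scheme \<Rightarrow> ('k::field, 'g \<Rightarrow> 'k, 'g \<Rightarrow> 'k) ecf_data" where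
  "regular_ecf G = \<lparr>
     A_alg = center_alg (group_alg G),
     A_fun = (\<lambda>f. f \<one>\<^bsub>G\<^esub> / of_nat (Coset.order G)),
     B_alg = group_alg G,
     B_fun = (\<lambda>f. f \<one>\<^bsub>G\<^esub>),
     AB_hom = (\<lambda>f. f),
     U_elem = (\<Oplus>\<^bsub>group_alg G\<^esub>g \<in> carrier G. group_elem (g \<otimes>\<^bsub>G\<^esub> g)),
     A_star = group_star G,
     B_star = group_star G\<rparr>"

section \<open>Quaternions and the real division algebras\<close>

text \<open>\<open>Quat a b c d\<close> is \<open>a + b i + c j + d k\<close>.\<close>

datatype quat = Quat (qre: real) (qi: real) (qj: real) (qk: real)

lemma quat_eq_iff: "p = q \<longleftrightarrow> qre p = qre q \<and> qi p = qi q \<and> qj p = qj q \<and> qk p = qk q"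
  by (auto intro: quat.expand)

instantiation quat :: real_algebra_1
begin

definition "0 = Quat 0 0 0 0"
definition "1 = Quat 1 0 0 0"
definition "p + q = Quat (qre p + qre q) (qi p + qi q) (qj p + qj q) (qk p + qk q)"
definition "p - q = Quat (qre p - qre q) (qi p - qi q) (qj p - qj q) (qk p - qk q)"
definition "- p = Quat (- qre p) (- qi p) (- qj p) (- qk p)"
definition "r *\<^sub>R p = Quat (r * qre p) (r * qi p) (r * qj p) (r * qk p)"
definition "p * q = Quat
  (qre p * qre q - qi p * qi q - qj p * qj q - qk p * qk q)
  (qre p * qi q + qi p * qre q + qj p * qk q - qk p * qj q)
  (qre p * qj q - qi p * qk q + qj p * qre q + qk p * qi q)
  (qre p * qk q + qi p * qj q - qj p * qi q + qk p * qre q)"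

instance
  by standard
    (simp_all add: quat_eq_iff zero_quat_def one_quat_def plus_quat_def minus_quat_def
      uminus_quat_def scaleR_quat_def times_quat_def algebra_simps)

end

definition qcnj :: "quat \<Rightarrow> quat" where
  "qcnj p = Quat (qre p) (- qi p) (- qj p) (- qk p)"

text \<open>The three division algebras are taken inside the quaternions.\<close>

datatype divalg = DReal | DComplex | DQuat

fun div_carrier :: "divalg \<Rightarrow> quat set" where
  "div_carrier DReal = {q. qi q = 0 \<and> qj q = 0 \<and> qk q = 0}"
| "div_carrier DComplex = {q. qj q = 0 \<and> qk q = 0}"
| "div_carrier DQuat = UNIV"

definition div_alg :: "divalg \<Rightarrow> (real, quat) module" where
  "div_alg D = \<lparr>carrier = div_carrier D, mult = (*), one = 1, zero = 0, add = (+), smult = (*\<^sub>R)\<rparr>"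

definition div_dim :: "divalg \<Rightarrow> nat" where
  "div_dim D = vectorspace.dim class_ring (div_alg D)"

definition mat_alg :: "divalg \<Rightarrow> nat \<Rightarrow> (real, quat mat) module" where
  "mat_alg D n = \<lparr>
     carrier = {M \<in> carrier_mat n n. \<forall>i<n. \<forall>j<n. M $$ (i, j) \<in> div_carrier D},
     mult = (*),
     one = 1\<^sub>m n,
     zero = 0\<^sub>m n n,
     add = (+),
     smult = (\<lambda>r. map_mat ((*\<^sub>R) r))\<rparr>"

definition H_ecf :: "divalg \<Rightarrow> nat \<Rightarrow> real \<Rightarrow> (real, quat, quat mat) ecf_data" where
  "H_ecf D n \<mu> = \<lparr>
     A_alg = center_alg (div_alg D),
     A_fun = (\<lambda>a. \<mu>\<^sup>2 * qre a / real (div_dim D)),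
     B_alg = mat_alg D n,
     B_fun = (\<lambda>x. \<mu> * qre (mat_trace x)),
     AB_hom = (\<lambda>a. a \<cdot>\<^sub>m 1\<^sub>m n),
     U_elem = of_real ((2 - real (div_dim D)) / \<mu>),
     A_star = qcnj,
     B_star = (\<lambda>x. transpose_mat (map_mat qcnj x))\<rparr>"

section \<open>Real representations of a group\<close>

text \<open>A representation is a pair of a degree \<open>n\<close> and a homomorphism into \<open>GL\<^sub>n(\<real>)\<close>.\<close>

type_synonym 'g real_rep = "nat \<times> ('g \<Rightarrow> real mat)"

definition GL :: "nat \<Rightarrow> real mat monoid" where
  "GL n = units_of (ring_mat TYPE(real) n ())"

definition real_reps :: "('g, 'm) monoid_scheme \<Rightarrow> 'g real_rep set" where
  "real_reps G = {(n, \<rho>). \<rho> \<in> hom G (GL n) \<inter> extensional (carrier G)}"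

definition irreducible_reps :: "('g, 'm) monoid_scheme \<Rightarrow> 'g real_rep set" where
  "irreducible_reps G = {(n, \<rho>) \<in> real_reps G. n > 0 \<and>
     (\<forall>W. VectorSpace.subspace class_ring W (module_vec TYPE(real) n) \<and>
          (\<forall>g \<in> carrier G. \<forall>w \<in> W. \<rho> g *\<^sub>v w \<in> W)
        \<longrightarrow> W = {0\<^sub>v n} \<or> W = carrier_vec n)}"

definition rep_iso_rel :: "('g, 'm) monoid_scheme \<Rightarrow> ('g real_rep \<times> 'g real_rep) set" where
  "rep_iso_rel G = {((n, \<rho>), (m, \<sigma>)). (n, \<rho>) \<in> real_reps G \<and> (m, \<sigma>) \<in> real_reps G \<and> n = m \<and>
     (\<exists>P \<in> carrier (GL n). \<forall>g \<in> carrier G. P * \<rho> g = \<sigma> g * P)}"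

definition End_alg :: "('g, 'm) monoid_scheme \<Rightarrow> 'g real_rep \<Rightarrow> (real, real mat) module" where
  "End_alg G = (\<lambda>(n, \<rho>). (module_mat TYPE(real) n n)
     \<lparr>carrier := {M \<in> carrier_mat n n. \<forall>g \<in> carrier G. M * \<rho> g = \<rho> g * M}\<rparr>)"

definition Ir :: "('g, 'm) monoid_scheme \<Rightarrow> divalg \<Rightarrow> 'g real_rep set set" where
  "Ir G D =
     {r \<in> irreducible_reps G. alg_isos (End_alg G r) (div_alg D) \<noteq> {}} // rep_iso_rel G"

text \<open>The common degree of the representations in an isomorphism class.\<close>

definition rep_dim :: "'g real_rep set \<Rightarrow> nat" where
  "rep_dim \<pi> = fst (SOME r. r \<in> \<pi>)"

text \<open>For \<open>\<pi> \<in> Ir G D\<close> the natural-number division below is exact.\<close>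

definition H_rep ::
  "('g, 'm) monoid_scheme \<Rightarrow> divalg \<Rightarrow> 'g real_rep set \<Rightarrow> (real, quat, quat mat) ecf_data" where
  "H_rep G D \<pi> = H_ecf D (rep_dim \<pi> div div_dim D) (real (rep_dim \<pi>) / real (Coset.order G))"

end

theory Submission
  imports Defs "Jordan_Normal_Form.Spectral_Radius"
begin

text \<open>The axioms for the regular algebra are checked by hand.  Traces and the elements \<open>K\<^sup>\<star>\<close> do not
  depend on the choice of dual bases, nor does the definition of a dual family need linear
  independence, so one may use \<open>g, g\<^sup>-\<^sup>1\<close> in \<open>K[G]\<close> and the (redundant) class sums in the center.
  Everything then moves to the other side along the Fourier transform, which need only be known to be a
  structure-preserving bijection.

  For an irreducible real representation, unitarized to an orthogonal one \<open>\<sigma>\<close> on \<open>\<real>\<^sup>N\<close>, self-adjoint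
  endomorphisms are scalar, so transposition on the endomorphism algebra \<open>D\<close> is the conjugation.  Hence
  \<open>\<real>\<^sup>N\<close> carries a hermitian \<open>D\<close>-valued form, and in a \<open>D\<close>-orthonormal basis \<open>\<sigma>\<close> becomes a unitary matrix
  representation \<open>R\<^sub>\<pi>\<close> over \<open>D\<close>.  The transform is \<open>x \<mapsto> (\<Sum>g. x g R\<^sub>\<pi> g)\<^sub>\<pi>\<close>.  Schur orthogonality, in the form
  \<open>\<Sum>g. Re (p R(g)\<^sub>k\<^sub>l) Re (q R(g)\<^sub>k\<^sub>'\<^sub>l\<^sub>') = \<delta> |G|/N Re (p q\<^sup>*)\<close>, gives the inverse transform, the functional
  (inversion at \<open>1\<close>) and the value \<open>(2 - d)/\<mu>\<close> of \<open>\<Sum>g. R(g)\<^sup>2\<close>.  Injectivity is the completeness of the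
  matrix coefficients, proved by taking a minimal invariant subspace of the functions orthogonal to
  all of them.  The complex case is the real one applied to real and imaginary parts.\<close>

section \<open>Traces and Casimir elements from dual frames\<close>

text \<open>The constants come from three places. Let \<open>N = dim \<pi>\<close>,
  \<open>d = dim D\<close>, \<open>m = N/d\<close>. Schur orthogonality has the factor
  \<open>|G|/N\<close>, so the inversion formula carries the weight \<open>\<mu> = N/|G|\<close>,
  which appears in \<open>l_B\<close>. A central element acts by a scalar \<open>a\<close> of trace
  \<open>m a\<close>, and division by \<open>|G|\<close> turns \<open>\<mu> m\<close> into
  \<open>\<mu>^2/d\<close>, the constant of \<open>l_A\<close>. Finally \<open>2 - d\<close> is the
  sum of the squares of the standard units of \<open>D\<close>. Two devices keep the linear algebra
  elementary. Euclidean spaces are sets of real functions on a finite set, where Bessel's inequality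
  for point masses replaces dimension counting. Identities in \<open>D\<close> are tested by the
  real parts of \<open>p\<close> times both sides for all \<open>p\<close> in \<open>D\<close>,
  which reduces them to real inner products. Scalars enter through one fact, that a real symmetric
  matrix has a real eigenvector; Schur's lemma, the theorem of Frobenius and the hermitian form rest
  on it. The type \<open>D\<close> of a class is given by an arbitrary isomorphism, so it has to be
  shown that each irreducible class has a type and only one; otherwise the sums would miss a class
  or count it twice.\<close>

definition lin_functional :: "('k::field, 'c) module \<Rightarrow> ('c \<Rightarrow> 'k) \<Rightarrow> bool" where
  "lin_functional C L \<longleftrightarrow>
     (\<forall>x \<in> carrier C. \<forall>y \<in> carrier C. L (x \<oplus>\<^bsub>C\<^esub> y) = L x + L y) \<and>
     (\<forall>k. \<forall>x \<in> carrier C. L (k \<odot>\<^bsub>C\<^esub> x) = k * L x)"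

text \<open>By non-degeneracy this says \<open>x = (\<Sum>i\<in>I. (x, f i) e i)\<close>: the families are dual bases, except
  that \<open>e\<close> need not be independent.\<close>

definition dual_frames ::
  "('k::field, 'c) module \<Rightarrow> ('c \<Rightarrow> 'k) \<Rightarrow> 'i set \<Rightarrow> ('i \<Rightarrow> 'c) \<Rightarrow> ('i \<Rightarrow> 'c) \<Rightarrow> bool" where
  "dual_frames C l I e f \<longleftrightarrow> finite I \<and> e \<in> I \<rightarrow> carrier C \<and> f \<in> I \<rightarrow> carrier C \<and>
     (\<forall>x \<in> carrier C. \<forall>y \<in> carrier C.
        l (x \<otimes>\<^bsub>C\<^esub> y) = (\<Sum>i\<in>I. l (x \<otimes>\<^bsub>C\<^esub> f i) * l (e i \<otimes>\<^bsub>C\<^esub> y)))"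

lemma ex1_unique: "\<exists>!x. P x \<Longrightarrow> P a \<Longrightarrow> P b \<Longrightarrow> a = b"
  by blast

section \<open>Coordinates with respect to an ordered basis\<close>

context fd_algebra
begin

lemma ring_C: "ring C" by unfold_locales

lemma abelian_monoid_C: "abelian_monoid C"
  using ring_C by (simp add: ring_def abelian_group_def)

lemmas C_finsum_insert = abelian_monoid.finsum_insert[OF abelian_monoid_C]
lemmas C_finsum_closed = abelian_monoid.finsum_closed[OF abelian_monoid_C]
lemmas C_finsum_cong = abelian_monoid.finsum_cong[OF abelian_monoid_C]
lemmas C_finsum_reindex = abelian_monoid.finsum_reindex[OF abelian_monoid_C]
lemmas C_finsum_addf = abelian_monoid.finsum_addf[OF abelian_monoid_C]
lemmas C_finsum_singleton = abelian_monoid.finsum_singleton[OF abelian_monoid_C]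
lemmas C_distr = ring.ring_simprules(13,23)[OF ring_C]
lemmas C_m_closed = ring.ring_simprules(5)[OF ring_C]
lemmas C_a_closed = abelian_monoid.a_closed[OF abelian_monoid_C]

lemma smult_carrier: "x \<in> carrier C \<Longrightarrow> k \<odot> x \<in> carrier C"
  by (simp add: smult_closed)

lemma smult_add_left: "x \<in> carrier C \<Longrightarrow> (a + b) \<odot> x = a \<odot> x \<oplus> b \<odot> x"
  using smult_l_distr[of a b x] by simp

lemma smult_smult: "x \<in> carrier C \<Longrightarrow> (a * b) \<odot> x = a \<odot> (b \<odot> x)"
  using smult_assoc1[of a b x] by simp

lemma smult_one_zero: "x \<in> carrier C \<Longrightarrow> 1 \<odot> x = x" "x \<in> carrier C \<Longrightarrow> 0 \<odot> x = \<zero>"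
  using smult_one[of x] smult_l_null[of x] by simp_all

lemma lin_functional_zero: "lin_functional C L \<Longrightarrow> L \<zero> = 0"
proof -
  assume "lin_functional C L"
  then have "L (\<zero> \<oplus> \<zero>) = L \<zero> + L \<zero>"
    using ring.ring_simprules(2)[OF ring_C] unfolding lin_functional_def by blast
  moreover have "\<zero> \<oplus> \<zero> = \<zero>"
    using ring.ring_simprules(2,8)[OF ring_C] by blast
  ultimately show "L \<zero> = 0" by (metis add_cancel_right_right)
qed

lemma lin_functional_finsum:
  assumes L: "lin_functional C L" and "finite I" "f \<in> I \<rightarrow> carrier C"
  shows "L (\<Oplus>i\<in>I. f i) = (\<Sum>i\<in>I. L (f i))"
  using assms(2,3)
proof (induction I)
  case empty
  then show ?case using lin_functional_zero[OF L] by simp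
next
  case (insert a I)
  then have "(\<Oplus>i\<in>insert a I. f i) = f a \<oplus> (\<Oplus>i\<in>I. f i)"
    by (intro C_finsum_insert) auto
  moreover have "f a \<in> carrier C" "(\<Oplus>i\<in>I. f i) \<in> carrier C"
    using insert by (auto intro!: C_finsum_closed)
  ultimately show ?case
    using insert L unfolding lin_functional_def by simp
qed

lemma lin_functional_lincomb:
  assumes L: "lin_functional C L" and "finite I" "f \<in> I \<rightarrow> carrier C"
  shows "L (\<Oplus>i\<in>I. c i \<odot> f i) = (\<Sum>i\<in>I. c i * L (f i))"
proof -
  have "L (\<Oplus>i\<in>I. c i \<odot> f i) = (\<Sum>i\<in>I. L (c i \<odot> f i))"
    using assms by (intro lin_functional_finsum) (auto intro: smult_carrier)
  also have "\<dots> = (\<Sum>i\<in>I. c i * L (f i))"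
    using assms by (intro sum.cong) (auto simp: lin_functional_def Pi_iff)
  finally show ?thesis .
qed

lemma ordered_basis_some_basis: "ordered_basis C (some_basis C)"
proof -
  obtain \<beta> where "finite \<beta>" "basis \<beta>"
    using finite_basis_exists[OF finite_dimensional] by auto
  then obtain \<gamma> where "set \<gamma> = \<beta>" "distinct \<gamma>" "basis (set \<gamma>)"
    using finite_distinct_list by blast
  then have "ordered_basis C \<gamma>" by (simp add: ordered_basis_def)
  then show ?thesis unfolding some_basis_def by (rule someI)
qed

text \<open>\<open>basis_criterion\<close> speaks of extensional coefficient functions on the set of
  basis vectors. As \<open>\<gamma>\<close> is distinct, they correspond to families indexed by
  positions, the form used by \<open>coords\<close>.\<close>

lemma ordered_basis_expansion:
  assumes "ordered_basis C \<gamma>"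
  shows "set \<gamma> \<subseteq> carrier C"
    and "x \<in> carrier C \<Longrightarrow> \<exists>c. x = (\<Oplus>i\<in>{..<length \<gamma>}. c i \<odot> \<gamma> ! i)"
    and "\<lbrakk>(\<Oplus>i\<in>{..<length \<gamma>}. c i \<odot> \<gamma> ! i) = (\<Oplus>i\<in>{..<length \<gamma>}. d i \<odot> \<gamma> ! i); j < length \<gamma>\<rbrakk>
      \<Longrightarrow> c j = d j"
proof -
  have dist: "distinct \<gamma>" and bas: "basis (set \<gamma>)"
    using assms by (auto simp: ordered_basis_def)
  show sub: "set \<gamma> \<subseteq> carrier C" using bas by (simp add: basis_def)
  have crit: "\<forall>v. v \<in> carrier C \<longrightarrow> (\<exists>!a. a \<in> set \<gamma> \<rightarrow>\<^sub>E UNIV \<and> lincomb a (set \<gamma>) = v)"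
    using bas basis_criterion[OF _ sub] by simp
  have lc: "lincomb a (set \<gamma>) = (\<Oplus>i\<in>{..<length \<gamma>}. a (\<gamma> ! i) \<odot> \<gamma> ! i)" for a
  proof -
    have inj: "inj_on ((!) \<gamma>) {..<length \<gamma>}" using dist by (simp add: inj_on_nth)
    have im: "set \<gamma> = (!) \<gamma> ` {..<length \<gamma>}"
      by (auto simp: set_conv_nth)
    have "(\<Oplus>v\<in>(!) \<gamma> ` {..<length \<gamma>}. a v \<odot> v) = (\<Oplus>i\<in>{..<length \<gamma>}. a (\<gamma> ! i) \<odot> \<gamma> ! i)"
      by (rule C_finsum_reindex[OF _ inj]) (use sub in \<open>auto intro!: smult_carrier\<close>)
    then show ?thesis unfolding lincomb_def im .
  qed
  show "\<exists>c. x = (\<Oplus>i\<in>{..<length \<gamma>}. c i \<odot> \<gamma> ! i)" if x: "x \<in> carrier C"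
  proof -
    obtain a where "a \<in> set \<gamma> \<rightarrow>\<^sub>E UNIV \<and> lincomb a (set \<gamma>) = x"
      using ex1_implies_ex[OF crit[rule_format, OF x]] by (elim exE)
    then have a: "lincomb a (set \<gamma>) = x" ..
    show ?thesis by (rule exI[of _ "\<lambda>i. a (\<gamma> ! i)"]) (rule a[symmetric, unfolded lc])
  qed
  show "c j = d j"
    if eq: "(\<Oplus>i\<in>{..<length \<gamma>}. c i \<odot> \<gamma> ! i) = (\<Oplus>i\<in>{..<length \<gamma>}. d i \<odot> \<gamma> ! i)"
      and j: "j < length \<gamma>"
  proof -
    \<comment> \<open>\<open>ix\<close> inverts the indexing of \<open>\<gamma>\<close>;
      \<open>r b\<close> is then the extensional function on basis vectors to which the uniqueness
      in \<open>crit\<close> applies.\<close>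
    define ix where "ix v = (THE i. i < length \<gamma> \<and> \<gamma> ! i = v)" for v
    have ix: "ix (\<gamma> ! i) = i" if "i < length \<gamma>" for i
      unfolding ix_def using that dist nth_eq_iff_index_eq by (intro the_equality) auto
    define r where "r b = restrict (\<lambda>v. b (ix v)) (set \<gamma>)" for b :: "nat \<Rightarrow> 'k"
    have r: "r b (\<gamma> ! i) = b i" if "i < length \<gamma>" for b i
      using that by (simp add: r_def ix)
    have rl: "lincomb (r b) (set \<gamma>) = (\<Oplus>i\<in>{..<length \<gamma>}. b i \<odot> \<gamma> ! i)" for b
      unfolding lc using sub by (intro C_finsum_cong) (auto simp: r simp_implies_def intro!: smult_carrier)
    have carr: "lincomb (r c) (set \<gamma>) \<in> carrier C"
      unfolding rl using sub by (intro C_finsum_closed) (auto intro!: smult_carrier)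
    have rE: "r c \<in> set \<gamma> \<rightarrow>\<^sub>E UNIV" "r d \<in> set \<gamma> \<rightarrow>\<^sub>E UNIV"
      by (auto simp: r_def)
    have "lincomb (r d) (set \<gamma>) = lincomb (r c) (set \<gamma>)"
      unfolding rl by (rule eq[symmetric])
    then have "r c = r d"
      using rE by (intro ex1_unique[OF crit[rule_format, OF carr]] conjI refl)
    then show ?thesis using r[OF j, of c] r[OF j, of d] by simp
  qed
qed

definition coord :: "'c list \<Rightarrow> nat \<Rightarrow> 'c \<Rightarrow> 'k" where
  "coord \<gamma> i x = coords C \<gamma> x $ i"

context
  fixes \<gamma> assumes \<gamma>: "ordered_basis C \<gamma>"
begin

lemma coord_expansion:
  assumes x: "x \<in> carrier C"
  shows "x = (\<Oplus>i\<in>{..<length \<gamma>}. coord \<gamma> i x \<odot> \<gamma> ! i)"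
proof -
  note ob = ordered_basis_expansion[OF \<gamma>]
  obtain c where c: "x = (\<Oplus>i\<in>{..<length \<gamma>}. c i \<odot> \<gamma> ! i)" using ob(2)[OF x] by auto
  have "coords C \<gamma> x = vec (length \<gamma>) c"
    unfolding coords_def
  proof (rule the_equality)
    show "vec (length \<gamma>) c \<in> carrier_vec (length \<gamma>) \<and>
       x = (\<Oplus>i\<in>{..<length \<gamma>}. vec (length \<gamma>) c $ i \<odot> \<gamma> ! i)"
      using ob(1) by (subst c) (auto intro!: C_finsum_cong smult_carrier simp: simp_implies_def)
    fix v assume v: "v \<in> carrier_vec (length \<gamma>) \<and> x = (\<Oplus>i\<in>{..<length \<gamma>}. v $ i \<odot> \<gamma> ! i)"
    have "v $ i = c i" if "i < length \<gamma>" for i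
      using ob(3)[OF trans[OF conjunct2[OF v, symmetric] c] that] .
    then show "v = vec (length \<gamma>) c"
      using conjunct1[OF v] by (intro eq_vecI) auto
  qed
  then have "coord \<gamma> i x = c i" if "i < length \<gamma>" for i using that by (simp add: coord_def)
  then show ?thesis
    using ob(1) by (subst c) (auto intro!: C_finsum_cong smult_carrier simp: simp_implies_def)
qed

lemma coord_eqI:
  assumes "x = (\<Oplus>i\<in>{..<length \<gamma>}. c i \<odot> \<gamma> ! i)" "x \<in> carrier C" "i < length \<gamma>"
  shows "coord \<gamma> i x = c i"
  using ordered_basis_expansion(3)[OF \<gamma> trans[OF coord_expansion[OF assms(2), symmetric] assms(1)] assms(3)] .

lemma basis_nth_carrier: "i < length \<gamma> \<Longrightarrow> \<gamma> ! i \<in> carrier C"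
  using ordered_basis_expansion(1)[OF \<gamma>] by auto

lemma lin_functional_coord:
  assumes "i < length \<gamma>"
  shows "lin_functional C (coord \<gamma> i)"
  unfolding lin_functional_def
proof (intro conjI ballI allI)
  have g: "(\<lambda>i. c i \<odot> \<gamma> ! i) \<in> {..<length \<gamma>} \<rightarrow> carrier C" for c :: "nat \<Rightarrow> 'k"
    by (auto intro!: smult_carrier basis_nth_carrier)
  show "coord \<gamma> i (x \<oplus> y) = coord \<gamma> i x + coord \<gamma> i y" if x: "x \<in> carrier C" and y: "y \<in> carrier C" for x y
  proof (rule coord_eqI[OF _ _ assms])
    have "x \<oplus> y = (\<Oplus>i\<in>{..<length \<gamma>}. coord \<gamma> i x \<odot> \<gamma> ! i) \<oplus> (\<Oplus>i\<in>{..<length \<gamma>}. coord \<gamma> i y \<odot> \<gamma> ! i)"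
      using coord_expansion[OF x] coord_expansion[OF y] by simp
    also have "\<dots> = (\<Oplus>i\<in>{..<length \<gamma>}. (coord \<gamma> i x \<odot> \<gamma> ! i) \<oplus> (coord \<gamma> i y \<odot> \<gamma> ! i))"
      by (rule C_finsum_addf[OF g g, symmetric])
    also have "\<dots> = (\<Oplus>i\<in>{..<length \<gamma>}. (coord \<gamma> i x + coord \<gamma> i y) \<odot> \<gamma> ! i)"
      by (intro C_finsum_cong)
        (auto intro!: smult_carrier basis_nth_carrier a_closed simp: simp_implies_def basis_nth_carrier smult_add_left Pi_def)
    finally show "x \<oplus> y = (\<Oplus>i\<in>{..<length \<gamma>}. (coord \<gamma> i x + coord \<gamma> i y) \<odot> \<gamma> ! i)" .
  qed (use that in auto)
  show "coord \<gamma> i (k \<odot> x) = k * coord \<gamma> i x" if x: "x \<in> carrier C" for k x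
  proof (rule coord_eqI[OF _ _ assms])
    have "k \<odot> x = k \<odot> (\<Oplus>i\<in>{..<length \<gamma>}. coord \<gamma> i x \<odot> \<gamma> ! i)"
      using coord_expansion[OF x] by simp
    also have "\<dots> = (\<Oplus>i\<in>{..<length \<gamma>}. k \<odot> (coord \<gamma> i x \<odot> \<gamma> ! i))"
      by (rule finsum_smult[OF _ g]) simp
    also have "\<dots> = (\<Oplus>i\<in>{..<length \<gamma>}. (k * coord \<gamma> i x) \<odot> \<gamma> ! i)"
      by (intro C_finsum_cong)
        (auto intro!: smult_carrier basis_nth_carrier a_closed simp: simp_implies_def basis_nth_carrier smult_smult Pi_def)
    finally show "k \<odot> x = (\<Oplus>i\<in>{..<length \<gamma>}. (k * coord \<gamma> i x) \<odot> \<gamma> ! i)" .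
  qed (use that in \<open>auto intro: smult_carrier\<close>)
qed

lemma lin_functional_eq_coord:
  assumes "lin_functional C L" "x \<in> carrier C"
  shows "L x = (\<Sum>i<length \<gamma>. coord \<gamma> i x * L (\<gamma> ! i))"
proof -
  have "L x = L (\<Oplus>i\<in>{..<length \<gamma>}. coord \<gamma> i x \<odot> \<gamma> ! i)"
    by (rule arg_cong[OF coord_expansion[OF assms(2)]])
  also have "\<dots> = (\<Sum>i<length \<gamma>. coord \<gamma> i x * L (\<gamma> ! i))"
    by (rule lin_functional_lincomb[OF assms(1)]) (simp_all add: basis_nth_carrier)
  finally show ?thesis .
qed

lemma coord_nth:
  assumes ij: "i < length \<gamma>" "j < length \<gamma>"
  shows "coord \<gamma> i (\<gamma> ! j) = (if i = j then 1 else 0)"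
proof (rule coord_eqI)
  have "(\<Oplus>i\<in>{..<length \<gamma>}. (if i = j then 1 else 0) \<odot> \<gamma> ! i)
      = (\<Oplus>i\<in>{..<length \<gamma>}. if j = i then \<gamma> ! i else \<zero>)"
    by (intro C_finsum_cong) (auto simp: simp_implies_def basis_nth_carrier smult_one_zero
        intro!: basis_nth_carrier)
  also have "\<dots> = \<gamma> ! j"
    by (rule C_finsum_singleton) (use ij in \<open>auto intro!: basis_nth_carrier\<close>)
  finally show "\<gamma> ! j = (\<Oplus>i\<in>{..<length \<gamma>}. (if i = j then 1 else 0) \<odot> \<gamma> ! i)" by simp
qed (use ij basis_nth_carrier in auto)

end

end

section \<open>Dual frames in a Frobenius pair\<close>

context frobenius_pair
begin

lemma lin_functional_l: "lin_functional C l"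
  by (simp add: lin_functional_def functional_add functional_smult)

lemma lin_functional_comp:
  assumes "lin_functional C L" "T \<in> lin_maps C C"
  shows "lin_functional C (\<lambda>x. L (T x))"
  using assms unfolding lin_functional_def lin_maps_def LinearCombinations.module_hom_def by (auto simp: Pi_iff)

lemma lin_functional_mult:
  assumes "lin_functional C L" "a \<in> carrier C"
  shows "lin_functional C (\<lambda>x. L (a \<otimes> x))" "lin_functional C (\<lambda>x. L (x \<otimes> a))"
  using assms unfolding lin_functional_def
  by (auto simp: C_distr smult_mult_left smult_mult_right C_m_closed)

text \<open>Non-degeneracy applied to the difference. Elements defined through chosen bases or
  \<open>THE\<close> are identified in this way, since their pairings are easier to reach than the
  elements themselves.\<close>

lemma form_eqI:
  assumes "x \<in> carrier C" "y \<in> carrier C" "\<And>z. z \<in> carrier C \<Longrightarrow> l (x \<otimes> z) = l (y \<otimes> z)"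
  shows "x = y"
proof -
  have "x \<ominus> y = \<zero>"
  proof (rule form_nondegenerate)
    fix z assume z: "z \<in> carrier C"
    have *: "x = (x \<ominus> y) \<oplus> y" using assms by algebra
    have "l (x \<otimes> z) = l ((x \<ominus> y) \<otimes> z) + l (y \<otimes> z)"
      by (subst *) (use assms z in \<open>simp add: C_distr functional_add C_m_closed minus_closed\<close>)
    then show "l ((x \<ominus> y) \<otimes> z) = 0" using assms(3)[OF z] by simp
  qed (use assms in auto)
  then show ?thesis using assms by simp
qed

context
  fixes I :: "'i set" and e f
  assumes fr: "dual_frames C l I e f"
begin

lemma frame_carrier: "i \<in> I \<Longrightarrow> e i \<in> carrier C" "i \<in> I \<Longrightarrow> f i \<in> carrier C"
  using fr by (auto simp: dual_frames_def)

lemma frame_form: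
  "\<lbrakk>x \<in> carrier C; y \<in> carrier C\<rbrakk> \<Longrightarrow> l (x \<otimes> y) = (\<Sum>i\<in>I. l (x \<otimes> f i) * l (e i \<otimes> y))"
  using fr unfolding dual_frames_def by blast

lemma lin_functional_frame:
  assumes "lin_functional C L" "x \<in> carrier C"
  shows "L x = (\<Sum>i\<in>I. l (x \<otimes> f i) * L (e i))"
proof -
  have fin: "finite I" using fr by (simp add: dual_frames_def)
  have c: "(\<Oplus>i\<in>I. l (x \<otimes> f i) \<odot> e i) \<in> carrier C"
    using frame_carrier by (intro C_finsum_closed) (auto intro!: smult_carrier)
  have "x = (\<Oplus>i\<in>I. l (x \<otimes> f i) \<odot> e i)"
  proof (rule form_eqI[OF assms(2) c])
    fix z assume z: "z \<in> carrier C"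
    have "l ((\<Oplus>i\<in>I. l (x \<otimes> f i) \<odot> e i) \<otimes> z) = (\<Sum>i\<in>I. l (x \<otimes> f i) * l (e i \<otimes> z))"
      by (rule lin_functional_lincomb[OF lin_functional_mult(2)[OF lin_functional_l z] fin])
        (simp add: frame_carrier)
    then show "l (x \<otimes> z) = l ((\<Oplus>i\<in>I. l (x \<otimes> f i) \<odot> e i) \<otimes> z)"
      unfolding frame_form[OF assms(2) z] ..
  qed
  then have "L x = L (\<Oplus>i\<in>I. l (x \<otimes> f i) \<odot> e i)" by (rule arg_cong)
  also have "\<dots> = (\<Sum>i\<in>I. l (x \<otimes> f i) * L (e i))"
    by (rule lin_functional_lincomb[OF assms(1) fin]) (simp add: frame_carrier)
  finally show ?thesis .
qed

lemma dual_frames_swap: "dual_frames C l I f e"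
  unfolding dual_frames_def
proof (intro conjI ballI)
  fix x y assume xy: "x \<in> carrier C" "y \<in> carrier C"
  have "l (x \<otimes> y) = l (y \<otimes> x)" by (rule form_symmetric[OF xy])
  also have "\<dots> = (\<Sum>i\<in>I. l (y \<otimes> f i) * l (e i \<otimes> x))"
    using xy by (intro frame_form)
  also have "\<dots> = (\<Sum>i\<in>I. l (x \<otimes> e i) * l (f i \<otimes> y))"
    using xy frame_carrier
    by (intro sum.cong refl) (simp add: form_symmetric[of y] form_symmetric[of x] mult.commute)
  finally show "l (x \<otimes> y) = (\<Sum>i\<in>I. l (x \<otimes> e i) * l (f i \<otimes> y))" .
qed (use fr frame_carrier in \<open>auto simp: dual_frames_def\<close>)

text \<open>Insert the frame expansion of the basis vectors into the sum of the diagonal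
  coordinates, swap the sums, and let the coordinates recombine. The chosen basis disappears, so
  traces can be computed with group elements.\<close>

lemma op_trace_frame:
  assumes T: "T \<in> lin_maps C C"
  shows "op_trace C T = (\<Sum>i\<in>I. l (T (e i) \<otimes> f i))"
proof -
  define \<gamma> where "\<gamma> = some_basis C"
  have \<gamma>: "ordered_basis C \<gamma>" unfolding \<gamma>_def by (rule ordered_basis_some_basis)
  have Tc: "T x \<in> carrier C" if "x \<in> carrier C" for x
    using T that by (auto simp: lin_maps_def LinearCombinations.module_hom_def)
  have "op_trace C T = (\<Sum>j<length \<gamma>. coord \<gamma> j (T (\<gamma> ! j)))"
    by (simp add: op_trace_def mat_trace_def op_mat_def \<gamma>_def[symmetric] coord_def)
  also have "\<dots> = (\<Sum>j<length \<gamma>. \<Sum>i\<in>I. l (\<gamma> ! j \<otimes> f i) * coord \<gamma> j (T (e i)))"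
    by (intro sum.cong refl lin_functional_frame[OF lin_functional_comp[OF lin_functional_coord[OF \<gamma>] T]])
      (auto intro: basis_nth_carrier[OF \<gamma>])
  also have "\<dots> = (\<Sum>i\<in>I. \<Sum>j<length \<gamma>. coord \<gamma> j (T (e i)) * l (\<gamma> ! j \<otimes> f i))"
    by (subst sum.swap) (simp add: mult.commute)
  also have "\<dots> = (\<Sum>i\<in>I. l (T (e i) \<otimes> f i))"
    by (intro sum.cong refl lin_functional_eq_coord[OF \<gamma>, symmetric]
        lin_functional_mult(2)[OF lin_functional_l] Tc frame_carrier) auto
  finally show ?thesis .
qed

text \<open>The inverse Gram matrix is the coordinate matrix of the Casimir tensor, the sum of the
  tensors of \<open>e a\<close> with \<open>f a\<close>. Multiplication by the Gram matrix contracts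
  one leg, and the swapped frame then returns the identity.\<close>

lemma gram_inv_frame:
  assumes \<gamma>: "ordered_basis C \<gamma>"
  shows "gram_inv C l \<gamma> = mat (length \<gamma>) (length \<gamma>)
    (\<lambda>(i, j). \<Sum>a\<in>I. coord \<gamma> i (e a) * coord \<gamma> j (f a))" (is "_ = ?F")
proof -
  let ?n = "length \<gamma>" and ?G = "gram C l \<gamma>"
  have [simp]: "?G \<in> carrier_mat ?n ?n" "?F \<in> carrier_mat ?n ?n" by (auto simp: gram_def)
  note b = basis_nth_carrier[OF \<gamma>]
  have GF: "?G * ?F = 1\<^sub>m ?n"
  proof (rule eq_matI)
    fix i k assume "i < dim_row (1\<^sub>m ?n)" "k < dim_col (1\<^sub>m ?n)"
    then have i: "i < ?n" and k: "k < ?n" by auto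
    have "(?G * ?F) $$ (i, k) = (\<Sum>j<?n. l (\<gamma> ! i \<otimes> \<gamma> ! j) * (\<Sum>a\<in>I. coord \<gamma> j (e a) * coord \<gamma> k (f a)))"
      using i k by (simp add: gram_def scalar_prod_def lessThan_atLeast0)
    also have "\<dots> = (\<Sum>a\<in>I. (\<Sum>j<?n. coord \<gamma> j (e a) * l (\<gamma> ! i \<otimes> \<gamma> ! j)) * coord \<gamma> k (f a))"
      unfolding sum_distrib_left sum_distrib_right by (subst sum.swap) (simp add: mult_ac)
    also have "\<dots> = (\<Sum>a\<in>I. l (\<gamma> ! i \<otimes> e a) * coord \<gamma> k (f a))"
      by (intro sum.cong refl arg_cong2[where f = "(*)"] lin_functional_eq_coord[OF \<gamma>, symmetric]
          lin_functional_mult(1)[OF lin_functional_l] frame_carrier b i) auto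
    also have "\<dots> = coord \<gamma> k (\<gamma> ! i)"
      by (rule frobenius_pair.lin_functional_frame[OF frobenius_pair_axioms dual_frames_swap, symmetric])
        (auto intro: lin_functional_coord[OF \<gamma>] b i k)
    finally show "(?G * ?F) $$ (i, k) = 1\<^sub>m ?n $$ (i, k)"
      using i k by (simp add: coord_nth[OF \<gamma>])
  qed (auto simp: gram_def)
  then have FG: "?F * ?G = 1\<^sub>m ?n"
    by (rule mat_mult_left_right_inverse[rotated 2]) auto
  show ?thesis
    unfolding gram_inv_def
  proof (rule the_equality)
    show "?F \<in> carrier_mat ?n ?n \<and> inverts_mat ?G ?F \<and> inverts_mat ?F ?G"
      using GF FG carrier_matD[of ?G ?n ?n] by (simp add: inverts_mat_def)
    fix H assume H: "H \<in> carrier_mat ?n ?n \<and> inverts_mat ?G H \<and> inverts_mat H ?G"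
    then have Hc: "H \<in> carrier_mat ?n ?n" and "H * ?G = 1\<^sub>m ?n" by (auto simp: inverts_mat_def)
    then have "(H * ?G) * ?F = ?F" by simp
    moreover have "(H * ?G) * ?F = H * (?G * ?F)"
      by (rule assoc_mult_mat[OF Hc]) auto
    ultimately show "H = ?F" using Hc by (simp only: GF right_mult_one_mat[OF Hc])
  qed
qed

text \<open>The element is described by its pairings, which determine it, so that only sums in the
  field occur and no sums in \<open>C\<close> have to be compared.\<close>

lemma K_star_frame:
  assumes s: "s \<in> lin_maps C C"
  shows "K_star C l s \<in> carrier C"
    and "y \<in> carrier C \<Longrightarrow> l (K_star C l s \<otimes> y) = (\<Sum>a\<in>I. l ((e a \<otimes> s (f a)) \<otimes> y))"
proof -
  define \<gamma> where "\<gamma> = some_basis C"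
  have \<gamma>: "ordered_basis C \<gamma>" unfolding \<gamma>_def by (rule ordered_basis_some_basis)
  let ?n = "length \<gamma>"
  have sc: "s x \<in> carrier C" if "x \<in> carrier C" for x
    using s that by (auto simp: lin_maps_def LinearCombinations.module_hom_def)
  note b = basis_nth_carrier[OF \<gamma>]
  have K: "K_star C l s = (\<Oplus>i\<in>{..<?n}. \<Oplus>j\<in>{..<?n}. gram_inv C l \<gamma> $$ (i, j) \<odot> (\<gamma> ! i \<otimes> s (\<gamma> ! j)))"
    by (simp add: K_star_def \<gamma>_def[symmetric] Let_def)
  have inner: "(\<lambda>j. gram_inv C l \<gamma> $$ (i, j) \<odot> (\<gamma> ! i \<otimes> s (\<gamma> ! j))) \<in> {..<?n} \<rightarrow> carrier C" if "i < ?n" for i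
    using b sc that by (auto intro!: smult_carrier)
  have outer: "(\<lambda>i. \<Oplus>j\<in>{..<?n}. gram_inv C l \<gamma> $$ (i, j) \<odot> (\<gamma> ! i \<otimes> s (\<gamma> ! j))) \<in> {..<?n} \<rightarrow> carrier C"
    using inner by (auto intro!: C_finsum_closed)
  show "K_star C l s \<in> carrier C" unfolding K using outer by (rule C_finsum_closed)
  show "l (K_star C l s \<otimes> y) = (\<Sum>a\<in>I. l ((e a \<otimes> s (f a)) \<otimes> y))" if y: "y \<in> carrier C"
  proof -
    define L where "L x = l (x \<otimes> y)" for x
    have L: "lin_functional C L" unfolding L_def by (rule lin_functional_mult(2)[OF lin_functional_l y])
    have "L (K_star C l s) = (\<Sum>i<?n. L (\<Oplus>j\<in>{..<?n}. gram_inv C l \<gamma> $$ (i, j) \<odot> (\<gamma> ! i \<otimes> s (\<gamma> ! j))))"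
      unfolding K using outer by (intro lin_functional_finsum[OF L]) auto
    also have "\<dots> = (\<Sum>i<?n. \<Sum>j<?n. gram_inv C l \<gamma> $$ (i, j) * L (\<gamma> ! i \<otimes> s (\<gamma> ! j)))"
      using b sc by (intro sum.cong refl lin_functional_lincomb[OF L]) auto
    also have "\<dots> = (\<Sum>i<?n. \<Sum>j<?n. \<Sum>a\<in>I. coord \<gamma> i (e a) * (coord \<gamma> j (f a) * L (\<gamma> ! i \<otimes> s (\<gamma> ! j))))"
      by (simp add: gram_inv_frame[OF \<gamma>] sum_distrib_left sum_distrib_right mult_ac)
    also have "\<dots> = (\<Sum>i<?n. \<Sum>a\<in>I. \<Sum>j<?n. coord \<gamma> i (e a) * (coord \<gamma> j (f a) * L (\<gamma> ! i \<otimes> s (\<gamma> ! j))))"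
      by (intro sum.cong refl sum.swap)
    also have "\<dots> = (\<Sum>a\<in>I. \<Sum>i<?n. \<Sum>j<?n. coord \<gamma> i (e a) * (coord \<gamma> j (f a) * L (\<gamma> ! i \<otimes> s (\<gamma> ! j))))"
      by (rule sum.swap)
    also have "\<dots> = (\<Sum>a\<in>I. \<Sum>i<?n. coord \<gamma> i (e a) * L (\<gamma> ! i \<otimes> s (f a)))"
      unfolding sum_distrib_left[symmetric]
      by (intro sum.cong refl arg_cong2[where f = "(*)"]
          lin_functional_eq_coord[OF \<gamma> lin_functional_comp[OF lin_functional_mult(1)[OF L] s], symmetric] frame_carrier b) auto
    also have "\<dots> = (\<Sum>a\<in>I. L (e a \<otimes> s (f a)))"
      by (intro sum.cong refl lin_functional_eq_coord[OF \<gamma> lin_functional_mult(2)[OF L], symmetric]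
          sc frame_carrier) auto
    finally show ?thesis by (simp add: L_def)
  qed
qed

end

end

section \<open>Transport of structure\<close>

text \<open>Additive inverses are obtained as \<open>(-1) \<odot> x\<close>. The spanning family may
  be redundant, which allows the class sums, indexed by all group elements, to be used for the
  center.\<close>

lemma fd_algebraI:
  fixes C :: "('k::field, 'c) module" (structure)
  assumes zero: "\<zero> \<in> carrier C" and one: "\<one> \<in> carrier C"
    and add: "\<And>x y. \<lbrakk>x \<in> carrier C; y \<in> carrier C\<rbrakk> \<Longrightarrow> x \<oplus> y \<in> carrier C"
    and mult: "\<And>x y. \<lbrakk>x \<in> carrier C; y \<in> carrier C\<rbrakk> \<Longrightarrow> x \<otimes> y \<in> carrier C"
    and smult: "\<And>k x. x \<in> carrier C \<Longrightarrow> k \<odot> x \<in> carrier C"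
    and add_assoc: "\<And>x y z. \<lbrakk>x \<in> carrier C; y \<in> carrier C; z \<in> carrier C\<rbrakk> \<Longrightarrow> (x \<oplus> y) \<oplus> z = x \<oplus> (y \<oplus> z)"
    and add_comm: "\<And>x y. \<lbrakk>x \<in> carrier C; y \<in> carrier C\<rbrakk> \<Longrightarrow> x \<oplus> y = y \<oplus> x"
    and add_zero: "\<And>x. x \<in> carrier C \<Longrightarrow> \<zero> \<oplus> x = x"
    and mult_assoc: "\<And>x y z. \<lbrakk>x \<in> carrier C; y \<in> carrier C; z \<in> carrier C\<rbrakk> \<Longrightarrow> (x \<otimes> y) \<otimes> z = x \<otimes> (y \<otimes> z)"
    and mult_one: "\<And>x. x \<in> carrier C \<Longrightarrow> \<one> \<otimes> x = x" "\<And>x. x \<in> carrier C \<Longrightarrow> x \<otimes> \<one> = x"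
    and distr: "\<And>x y z. \<lbrakk>x \<in> carrier C; y \<in> carrier C; z \<in> carrier C\<rbrakk> \<Longrightarrow> (x \<oplus> y) \<otimes> z = x \<otimes> z \<oplus> y \<otimes> z"
      "\<And>x y z. \<lbrakk>x \<in> carrier C; y \<in> carrier C; z \<in> carrier C\<rbrakk> \<Longrightarrow> z \<otimes> (x \<oplus> y) = z \<otimes> x \<oplus> z \<otimes> y"
    and smult_add: "\<And>a b x. x \<in> carrier C \<Longrightarrow> (a + b) \<odot> x = a \<odot> x \<oplus> b \<odot> x"
      "\<And>a x y. \<lbrakk>x \<in> carrier C; y \<in> carrier C\<rbrakk> \<Longrightarrow> a \<odot> (x \<oplus> y) = a \<odot> x \<oplus> a \<odot> y"
    and smult_smult: "\<And>a b x. x \<in> carrier C \<Longrightarrow> (a * b) \<odot> x = a \<odot> (b \<odot> x)"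
    and smult_scalar: "\<And>x. x \<in> carrier C \<Longrightarrow> 1 \<odot> x = x" "\<And>x. x \<in> carrier C \<Longrightarrow> 0 \<odot> x = \<zero>"
    and smult_mult: "\<And>k x y. \<lbrakk>x \<in> carrier C; y \<in> carrier C\<rbrakk> \<Longrightarrow> (k \<odot> x) \<otimes> y = k \<odot> (x \<otimes> y)"
      "\<And>k x y. \<lbrakk>x \<in> carrier C; y \<in> carrier C\<rbrakk> \<Longrightarrow> x \<otimes> (k \<odot> y) = k \<odot> (x \<otimes> y)"
    and span: "finite I" "e \<in> I \<rightarrow> carrier C"
      "\<And>x. x \<in> carrier C \<Longrightarrow> \<exists>c. x = (\<Oplus>i\<in>I. c i \<odot> e i)"
  shows "fd_algebra C"
proof -
  have inv: "\<exists>y\<in>carrier C. y \<oplus> x = \<zero>" if x: "x \<in> carrier C" for x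
  proof
    show "(-1) \<odot> x \<oplus> x = \<zero>"
      using smult_add(1)[OF x, of "-1" 1] smult_scalar[OF x] by simp
  qed (rule smult[OF x])
  have ab: "abelian_group C"
    by (rule abelian_groupI) (fact zero add add_assoc add_comm add_zero inv)+
  have mon: "monoid C"
    by (rule monoidI) (fact one mult mult_assoc mult_one)+
  have ring: "ring C"
    by (rule ringI[OF ab mon]) (fact distr)+
  have "Module.module (class_ring :: 'k ring) C"
    by (intro moduleI ab) (simp_all add: class_cring.is_cring smult smult_add smult_smult smult_scalar)
  then have vs: "vectorspace (class_ring :: 'k ring) C"
    by (intro vectorspace.intro class_field)
  interpret vectorspace "class_ring :: 'k ring" C by (rule vs)
  have sp: "VectorSpace.subspace class_ring (span (e ` I)) C"
    using span(2) by (intro span_is_subspace) auto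
  then have subm: "submodule class_ring (span (e ` I)) C" by simp
  have "(\<Oplus>i\<in>J. c i \<odot> e i) \<in> span (e ` I)" if "finite J" "J \<subseteq> I" for c J
    using that
  proof (induction J)
    case empty
    then show ?case using sp unfolding VectorSpace.subspace_def LinearCombinations.submodule_def by auto
  next
    case (insert j J)
    have e: "e i \<in> carrier C" if "i \<in> insert j J" for i using insert span(2) that by auto
    have "e j \<in> span (e ` I)"
      using insert span(2) in_own_span[of "e ` I"] by auto
    then have "c j \<odot> e j \<in> span (e ` I)"
      using subm by (auto simp: submodule_def)
    moreover have "(\<Oplus>i\<in>insert j J. c i \<odot> e i) = c j \<odot> e j \<oplus> (\<Oplus>i\<in>J. c i \<odot> e i)"
      using insert e by (intro M.finsum_insert) (auto intro: smult)
    ultimately show ?case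
      using insert subm by (auto simp: submodule_def)
  qed
  then have "carrier C \<subseteq> span (e ` I)" using span(1,3) by (metis subsetI subset_refl)
  then have "gen_set (e ` I)"
    using sp unfolding VectorSpace.subspace_def LinearCombinations.submodule_def by auto
  then have "fin_dim"
    unfolding fin_dim_def using span(1,2) by (intro exI[of _ "e ` I"]) auto
  then show ?thesis
    by (intro fd_algebra.intro fd_algebra_axioms.intro ring vs smult_mult)
qed

text \<open>Nothing is presupposed about algebra laws in \<open>D\<close>: they are to be deduced
  through the bijection. This is why the zero is listed, as additivity preserves it only if the
  target is known to be a group.\<close>

definition structure_map :: "('k::field, 'c) module \<Rightarrow> ('k, 'd) module \<Rightarrow> ('c \<Rightarrow> 'd) \<Rightarrow> bool" where
  "structure_map C D h \<longleftrightarrow> bij_betw h (carrier C) (carrier D) \<and>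
     h \<zero>\<^bsub>C\<^esub> = \<zero>\<^bsub>D\<^esub> \<and> h \<one>\<^bsub>C\<^esub> = \<one>\<^bsub>D\<^esub> \<and>
     (\<forall>x \<in> carrier C. \<forall>y \<in> carrier C. h (x \<oplus>\<^bsub>C\<^esub> y) = h x \<oplus>\<^bsub>D\<^esub> h y \<and> h (x \<otimes>\<^bsub>C\<^esub> y) = h x \<otimes>\<^bsub>D\<^esub> h y) \<and>
     (\<forall>k. \<forall>x \<in> carrier C. h (k \<odot>\<^bsub>C\<^esub> x) = k \<odot>\<^bsub>D\<^esub> h x)"

lemma structure_map_surj:
  assumes "structure_map C D h" "y \<in> carrier D"
  obtains x where "x \<in> carrier C" "y = h x"
  using assms unfolding structure_map_def bij_betw_def by blast

lemma structure_map_inj: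
  assumes "structure_map C D h" "x \<in> carrier C" "y \<in> carrier C"
  shows "h x = h y \<longleftrightarrow> x = y"
  using assms unfolding structure_map_def bij_betw_def inj_on_def by blast

text \<open>The equations are oriented so that rewriting pulls the operations of \<open>D\<close>
  back into \<open>C\<close>, where the algebra laws are available.\<close>

lemma structure_mapD:
  assumes "structure_map C D h"
  shows "h \<zero>\<^bsub>C\<^esub> = \<zero>\<^bsub>D\<^esub>" "h \<one>\<^bsub>C\<^esub> = \<one>\<^bsub>D\<^esub>"
    "x \<in> carrier C \<Longrightarrow> h x \<in> carrier D"
    "\<lbrakk>x \<in> carrier C; y \<in> carrier C\<rbrakk> \<Longrightarrow> h x \<oplus>\<^bsub>D\<^esub> h y = h (x \<oplus>\<^bsub>C\<^esub> y)"
    "\<lbrakk>x \<in> carrier C; y \<in> carrier C\<rbrakk> \<Longrightarrow> h x \<otimes>\<^bsub>D\<^esub> h y = h (x \<otimes>\<^bsub>C\<^esub> y)"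
    "x \<in> carrier C \<Longrightarrow> k \<odot>\<^bsub>D\<^esub> h x = h (k \<odot>\<^bsub>C\<^esub> x)"
  using assms unfolding structure_map_def by (auto dest: bij_betwE)

lemma structure_map_alg_isos:
  assumes "structure_map C D h"
  shows "h \<in> alg_isos C D"
  using assms structure_mapD(3)[OF assms]
  by (auto simp: alg_isos_def lin_maps_def LinearCombinations.module_hom_def structure_map_def
      intro!: ring_iso_memI)

lemma fd_algebra_transport:
  fixes C :: "('k::field, 'c) module"
  assumes "fd_algebra C" and h: "structure_map C D h"
  shows "fd_algebra D"
proof -
  interpret C: fd_algebra C by fact
  note hD = structure_mapD[OF h]
  note R = ring.ring_simprules[OF C.ring_C]
  define g where "g = inv_into (carrier C) h"
  have g: "g y \<in> carrier C" "h (g y) = y" if "y \<in> carrier D" for y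
    using h that unfolding g_def structure_map_def
    by (auto simp: bij_betw_def inv_into_into f_inv_into_f)
  have P: "P y" if "\<And>x. x \<in> carrier C \<Longrightarrow> P (h x)" "y \<in> carrier D" for P y
    using that g by metis
  have closed: "\<zero>\<^bsub>D\<^esub> \<in> carrier D" "\<one>\<^bsub>D\<^esub> \<in> carrier D"
    using hD(3)[of "\<zero>\<^bsub>C\<^esub>"] hD(3)[of "\<one>\<^bsub>C\<^esub>"] R by (simp_all add: hD(1,2))
  have inv: "\<exists>y\<in>carrier D. y \<oplus>\<^bsub>D\<^esub> h x = h \<zero>\<^bsub>C\<^esub>" if "x \<in> carrier C" for x
    using that R by (intro bexI[of _ "h (\<ominus>\<^bsub>C\<^esub> x)"]) (simp_all add: hD(3,4))
  have ab: "abelian_group D"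
    by (rule abelian_groupI; (elim structure_map_surj[OF h])?)
      (auto simp: closed hD R hD(1)[symmetric] simp del: hD(1) intro: inv)
  have mon: "monoid D"
    by (rule monoidI; (elim structure_map_surj[OF h])?)
      (auto simp: closed hD R hD(2)[symmetric] simp del: hD(2))
  have ring: "ring D"
    by (rule ringI[OF ab mon]; (elim structure_map_surj[OF h])?)
      (auto simp: closed hD R C.C_distr)
  have mod: "Module.module (class_ring :: 'k ring) D"
    by (rule moduleI; (elim structure_map_surj[OF h])?)
      (auto simp: class_cring.is_cring ab hD R C.smult_carrier C.smult_add_left C.smult_smult
        C.smult_one_zero C.smult_r_distr[simplified])
  then have vs: "vectorspace (class_ring :: 'k ring) D"
    by (intro vectorspace.intro class_field)
  \<comment> \<open>Rank-nullity supplies the finite dimension of the image of a finite-dimensional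
    space.\<close>
  have "linear_map class_ring C D h"
    by (intro linear_map.intro vs mod_hom.intro mod_hom_axioms.intro C.vectorspace_axioms C.module_axioms mod)
      (use h hD(3) in \<open>auto simp: LinearCombinations.module_hom_def structure_map_def\<close>)
  then have "vectorspace.fin_dim class_ring D"
    by (rule linear_map.rank_nullity_main(2)[OF _ C.finite_dimensional])
      (use h in \<open>auto simp: structure_map_def bij_betw_def\<close>)
  then show ?thesis
    by (intro fd_algebra.intro fd_algebra_axioms.intro ring vs; (elim structure_map_surj[OF h])?)
      (auto simp: hD R C.smult_carrier C.smult_mult_left C.smult_mult_right)
qed

lemma frobenius_pair_transport:
  assumes "frobenius_pair C l" and h: "structure_map C D h"
    and l: "\<And>x. x \<in> carrier C \<Longrightarrow> m (h x) = l x"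
  shows "frobenius_pair D m"
proof -
  interpret C: frobenius_pair C l by fact
  note hD = structure_mapD[OF h]
  note R = ring.ring_simprules[OF C.ring_C]
  show ?thesis
  proof (intro frobenius_pair.intro frobenius_pair_axioms.intro fd_algebra_transport[OF _ h] C.fd_algebra_axioms)
    fix y assume y: "y \<in> carrier D" and y0: "\<And>z. z \<in> carrier D \<Longrightarrow> m (y \<otimes>\<^bsub>D\<^esub> z) = 0"
    obtain x where x: "x \<in> carrier C" "y = h x" using structure_map_surj[OF h y] .
    have "x = \<zero>\<^bsub>C\<^esub>"
    proof (rule C.form_nondegenerate[OF x(1)])
      fix z assume z: "z \<in> carrier C"
      show "l (x \<otimes>\<^bsub>C\<^esub> z) = 0"
        using y0[OF hD(3)[OF z]] x z l[of "x \<otimes>\<^bsub>C\<^esub> z"] by (simp add: hD R)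
    qed
    then show "y = \<zero>\<^bsub>D\<^esub>" using x by (simp add: hD)
  qed ((elim structure_map_surj[OF h])?;
    simp add: hD R l C.functional_add C.functional_smult C.smult_carrier C.form_symmetric)+
qed

lemma dual_frames_transport:
  assumes fr: "dual_frames C l I e f" and "ring C" and h: "structure_map C D h"
    and l: "\<And>x. x \<in> carrier C \<Longrightarrow> m (h x) = l x"
  shows "dual_frames D m I (\<lambda>i. h (e i)) (\<lambda>i. h (f i))"
  unfolding dual_frames_def
proof (intro conjI ballI)
  note hD = structure_mapD[OF h]
  note R = ring.ring_simprules[OF \<open>ring C\<close>]
  have ef: "e i \<in> carrier C" "f i \<in> carrier C" if "i \<in> I" for i
    using fr that by (auto simp: dual_frames_def)
  show "(\<lambda>i. h (e i)) \<in> I \<rightarrow> carrier D" "(\<lambda>i. h (f i)) \<in> I \<rightarrow> carrier D"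
    using ef hD(3) by auto
  fix y z assume "y \<in> carrier D" "z \<in> carrier D"
  then obtain x w where x: "x \<in> carrier C" "y = h x" and w: "w \<in> carrier C" "z = h w"
    using structure_map_surj[OF h] by metis
  have "l (x \<otimes>\<^bsub>C\<^esub> w) = (\<Sum>i\<in>I. l (x \<otimes>\<^bsub>C\<^esub> f i) * l (e i \<otimes>\<^bsub>C\<^esub> w))"
    using fr x w unfolding dual_frames_def by blast
  then show "m (y \<otimes>\<^bsub>D\<^esub> z) = (\<Sum>i\<in>I. m (y \<otimes>\<^bsub>D\<^esub> h (f i)) * m (h (e i) \<otimes>\<^bsub>D\<^esub> z))"
    using x w ef by (simp add: hD R l cong: sum.cong)
qed (use fr in \<open>simp add: dual_frames_def\<close>)

text \<open>The bases chosen in \<open>C\<close> and in \<open>D\<close> are unrelated, so the two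
  elements are compared through their pairings, which the frame and its image turn into the same
  sum.\<close>

lemma (in frobenius_pair) K_star_transport:
  assumes fr: "dual_frames C l I e f" and h: "structure_map C D h"
    and m: "\<And>x. x \<in> carrier C \<Longrightarrow> m (h x) = l x"
    and s: "s \<in> lin_maps C C" and t: "t \<in> lin_maps D D" and st: "\<And>x. x \<in> carrier C \<Longrightarrow> t (h x) = h (s x)"
  shows "K_star D m t = h (K_star C l s)"
proof -
  interpret D: frobenius_pair D m
    by (rule frobenius_pair_transport[OF frobenius_pair_axioms h m])
  note frD = dual_frames_transport[OF fr ring_C h m]
  note hD = structure_mapD[OF h]
  note R = ring.ring_simprules[OF ring_C]
  note K = K_star_frame[OF fr s] and KD = D.K_star_frame[OF frD t]
  have sc: "s x \<in> carrier C" if "x \<in> carrier C" for x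
    using s that by (auto simp: lin_maps_def LinearCombinations.module_hom_def)
  show ?thesis
  proof (rule D.form_eqI[OF KD(1) hD(3)[OF K(1)]])
    fix z assume "z \<in> carrier D"
    then obtain y where y: "y \<in> carrier C" "z = h y" using structure_map_surj[OF h] by metis
    have "m (K_star D m t \<otimes>\<^bsub>D\<^esub> z) = (\<Sum>a\<in>I. m ((h (e a) \<otimes>\<^bsub>D\<^esub> t (h (f a))) \<otimes>\<^bsub>D\<^esub> z))"
      using y hD(3) by (intro KD(2)) auto
    also have "\<dots> = (\<Sum>a\<in>I. l ((e a \<otimes> s (f a)) \<otimes> y))"
      using y frame_carrier[OF fr] by (intro sum.cong refl) (simp add: hD R m st sc)
    also have "\<dots> = m (h (K_star C l s) \<otimes>\<^bsub>D\<^esub> z)"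
      using y K(1) by (simp add: K(2)[symmetric] hD R m)
    finally show "m (K_star D m t \<otimes>\<^bsub>D\<^esub> z) = m (h (K_star C l s) \<otimes>\<^bsub>D\<^esub> z)" .
  qed
qed

lemma lin_maps_transport:
  assumes h: "structure_map C D h" and "fd_algebra C" and s: "s \<in> lin_maps C C"
    and st: "\<And>x. x \<in> carrier C \<Longrightarrow> t (h x) = h (s x)"
  shows "t \<in> lin_maps D D"
proof -
  interpret C: fd_algebra C by fact
  note hD = structure_mapD[OF h]
  note R = ring.ring_simprules[OF C.ring_C]
  have sc: "s x \<in> carrier C" if "x \<in> carrier C" for x
    using s that by (auto simp: lin_maps_def LinearCombinations.module_hom_def)
  show ?thesis
    unfolding lin_maps_def LinearCombinations.module_hom_def
  proof (intro CollectI conjI allI impI funcsetI; (elim conjE)?; (elim structure_map_surj[OF h])?)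
  qed (use s in \<open>auto simp: hD st sc R C.smult_carrier lin_maps_def LinearCombinations.module_hom_def\<close>)
qed

lemma (in frobenius_pair) op_trace_transport:
  assumes fr: "dual_frames C l I e f" and h: "structure_map C D h"
    and m: "\<And>x. x \<in> carrier C \<Longrightarrow> m (h x) = l x"
    and s: "s \<in> lin_maps C C" and st: "\<And>x. x \<in> carrier C \<Longrightarrow> t (h x) = h (s x)"
  shows "op_trace D t = op_trace C s"
proof -
  interpret D: frobenius_pair D m
    by (rule frobenius_pair_transport[OF frobenius_pair_axioms h m])
  note hD = structure_mapD[OF h]
  note R = ring.ring_simprules[OF ring_C]
  have sc: "s x \<in> carrier C" if "x \<in> carrier C" for x
    using s that by (auto simp: lin_maps_def LinearCombinations.module_hom_def)
  have t: "t \<in> lin_maps D D" by (rule lin_maps_transport[OF h fd_algebra_axioms s st])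
  have "op_trace D t = (\<Sum>i\<in>I. m (t (h (e i)) \<otimes>\<^bsub>D\<^esub> h (f i)))"
    by (rule D.op_trace_frame[OF dual_frames_transport[OF fr ring_C h m] t])
  also have "\<dots> = (\<Sum>i\<in>I. l (s (e i) \<otimes> f i))"
    using frame_carrier[OF fr] by (intro sum.cong refl) (simp add: hD R m st sc)
  also have "\<dots> = op_trace C s" by (rule op_trace_frame[OF fr s, symmetric])
  finally show ?thesis .
qed

text \<open>Riesz representation, with the explicit representative given by the frame. It makes the
  \<open>THE\<close> in \<open>dual_map\<close> refer to something.\<close>

lemma (in frobenius_pair) ex1_representing_element:
  assumes fr: "dual_frames C l I e f" and L: "lin_functional C L"
  shows "\<exists>!x. x \<in> carrier C \<and> (\<forall>a \<in> carrier C. l (x \<otimes> a) = L a)"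
proof (rule ex_ex1I)
  let ?x = "\<Oplus>i\<in>I. L (e i) \<odot> f i"
  have fin: "finite I" using fr by (simp add: dual_frames_def)
  have "l (?x \<otimes> a) = L a" if a: "a \<in> carrier C" for a
  proof -
    have "l (?x \<otimes> a) = (\<Sum>i\<in>I. L (e i) * l (f i \<otimes> a))"
      by (rule lin_functional_lincomb[OF lin_functional_mult(2)[OF lin_functional_l a] fin])
        (simp add: frame_carrier[OF fr])
    also have "\<dots> = (\<Sum>i\<in>I. l (a \<otimes> f i) * L (e i))"
      using frame_carrier[OF fr] a by (intro sum.cong refl) (simp add: form_symmetric[of a] mult.commute)
    also have "\<dots> = L a" by (rule lin_functional_frame[OF fr L a, symmetric])
    finally show ?thesis .
  qed
  moreover have "?x \<in> carrier C"
    using frame_carrier[OF fr] by (intro C_finsum_closed) (auto intro: smult_carrier)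
  ultimately show "\<exists>x. x \<in> carrier C \<and> (\<forall>a \<in> carrier C. l (x \<otimes> a) = L a)" by blast
  fix x y
  assume "x \<in> carrier C \<and> (\<forall>a \<in> carrier C. l (x \<otimes> a) = L a)"
    and "y \<in> carrier C \<and> (\<forall>a \<in> carrier C. l (y \<otimes> a) = L a)"
  then show "x = y" by (intro form_eqI) auto
qed

lemma (in cardy_frobenius) lin_functional_phi:
  assumes b: "b \<in> carrier B"
  shows "lin_functional A (\<lambda>a. l\<^sub>B (b \<otimes>\<^bsub>B\<^esub> \<phi> a))"
  using B.lin_functional_mult(1)[OF B.lin_functional_l b] phi_hom
  by (auto simp: lin_functional_def lin_maps_def LinearCombinations.module_hom_def Pi_iff)

text \<open>\<open>X \<cong>\<^sub>E Y\<close> contains the axioms for \<open>Y\<close>, so neither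
  algebra laws nor the Cardy condition are checked on the side of the matrices. The frames of
  \<open>X\<close> are what moves dual maps, traces and \<open>K_star\<close>, since their images
  are frames of \<open>Y\<close>.\<close>

lemma ecf_transport:
  assumes X: "is_ecf X"
    and frA: "dual_frames (A_alg X) (A_fun X) I e e'"
    and frB: "dual_frames (B_alg X) (B_fun X) J b b'"
    and f: "structure_map (A_alg X) (A_alg Y) f" and g: "structure_map (B_alg X) (B_alg Y) g"
    and lA: "\<And>x. x \<in> carrier (A_alg X) \<Longrightarrow> A_fun Y (f x) = A_fun X x"
    and lB: "\<And>y. y \<in> carrier (B_alg X) \<Longrightarrow> B_fun Y (g y) = B_fun X y"
    and phi: "\<And>x. x \<in> carrier (A_alg X) \<Longrightarrow> AB_hom Y (f x) = g (AB_hom X x)"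
    and U: "U_elem Y = f (U_elem X)"
    and sA: "\<And>x. x \<in> carrier (A_alg X) \<Longrightarrow> A_star Y (f x) = f (A_star X x)"
    and sB: "\<And>y. y \<in> carrier (B_alg X) \<Longrightarrow> B_star Y (g y) = g (B_star X y)"
  shows "X \<cong>\<^sub>E Y"
proof -
  interpret X: equipped_cardy_frobenius "A_alg X" "A_fun X" "B_alg X" "B_fun X"
    "AB_hom X" "U_elem X" "A_star X" "B_star X"
    using X by (simp add: is_ecf_def)
  note fD = structure_mapD[OF f] and gD = structure_mapD[OF g]
  note RA = ring.ring_simprules[OF X.A.ring_C] and RB = ring.ring_simprules[OF X.B.ring_C]
  note surjA = structure_map_surj[OF f] and surjB = structure_map_surj[OF g]
  interpret A: frobenius_pair "A_alg Y" "A_fun Y"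
    by (rule frobenius_pair_transport[OF X.A.frobenius_pair_axioms f lA])
  interpret B: frobenius_pair "B_alg Y" "B_fun Y"
    by (rule frobenius_pair_transport[OF X.B.frobenius_pair_axioms g lB])
  have phi_carrier: "AB_hom X x \<in> carrier (B_alg X)" if "x \<in> carrier (A_alg X)" for x
    using X.phi_hom that by (auto simp: lin_maps_def LinearCombinations.module_hom_def)
  have phi_maps: "AB_hom X (x \<oplus>\<^bsub>A_alg X\<^esub> y) = AB_hom X x \<oplus>\<^bsub>B_alg X\<^esub> AB_hom X y"
    "AB_hom X (x \<otimes>\<^bsub>A_alg X\<^esub> y) = AB_hom X x \<otimes>\<^bsub>B_alg X\<^esub> AB_hom X y"
    "AB_hom X (k \<odot>\<^bsub>A_alg X\<^esub> x) = k \<odot>\<^bsub>B_alg X\<^esub> AB_hom X x"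
    if "x \<in> carrier (A_alg X)" "y \<in> carrier (A_alg X)" for x y k
    using X.phi_hom that
    by (auto simp: lin_maps_def LinearCombinations.module_hom_def ring_hom_mult)
  have phi_one: "AB_hom X \<one>\<^bsub>A_alg X\<^esub> = \<one>\<^bsub>B_alg X\<^esub>"
    using X.phi_hom by (auto simp: ring_hom_one)
  let ?dX = "dual_map (A_alg X) (A_fun X) (B_alg X) (B_fun X) (AB_hom X)"
  let ?dY = "dual_map (A_alg Y) (A_fun Y) (B_alg Y) (B_fun Y) (AB_hom Y)"
  have dual: "?dX y \<in> carrier (A_alg X)" "?dY (g y) = f (?dX y)" if y: "y \<in> carrier (B_alg X)" for y
  proof -
    have "?dX y \<in> carrier (A_alg X) \<and> (\<forall>a \<in> carrier (A_alg X).
        A_fun X (?dX y \<otimes>\<^bsub>A_alg X\<^esub> a) = B_fun X (y \<otimes>\<^bsub>B_alg X\<^esub> AB_hom X a))"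
      unfolding dual_map_def
      by (rule theI'[OF X.A.ex1_representing_element[OF frA X.lin_functional_phi[OF y]]])
    then have d: "?dX y \<in> carrier (A_alg X)"
      and dl: "\<And>a. a \<in> carrier (A_alg X) \<Longrightarrow>
        A_fun X (?dX y \<otimes>\<^bsub>A_alg X\<^esub> a) = B_fun X (y \<otimes>\<^bsub>B_alg X\<^esub> AB_hom X a)" by auto
    show "?dX y \<in> carrier (A_alg X)" by (rule d)
    have Yl: "A_fun Y (f (?dX y) \<otimes>\<^bsub>A_alg Y\<^esub> a) = B_fun Y (g y \<otimes>\<^bsub>B_alg Y\<^esub> AB_hom Y a)"
      if "a \<in> carrier (A_alg Y)" for a
      using that by (elim surjA) (simp add: fD gD RA RB lA lB phi phi_carrier d dl y)
    show "?dY (g y) = f (?dX y)"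
      unfolding dual_map_def[of "A_alg Y"]
    proof (rule the_equality)
      fix z assume "z \<in> carrier (A_alg Y) \<and> (\<forall>a\<in>carrier (A_alg Y).
        A_fun Y (z \<otimes>\<^bsub>A_alg Y\<^esub> a) = B_fun Y (g y \<otimes>\<^bsub>B_alg Y\<^esub> AB_hom Y a))"
      then show "z = f (?dX y)"
        using Yl fD(3)[OF d] by (intro A.form_eqI) auto
    qed (use Yl fD(3)[OF d] in blast)
  qed
  have starA: "A_star X \<in> lin_maps (A_alg X) (A_alg X)" and starB: "B_star X \<in> lin_maps (B_alg X) (B_alg X)"
    using X.star_A X.star_B by (auto simp: involutive_anti_aut_def)
  have starYA: "A_star Y \<in> lin_maps (A_alg Y) (A_alg Y)" and starYB: "B_star Y \<in> lin_maps (B_alg Y) (B_alg Y)"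
    by (rule lin_maps_transport[OF f X.A.fd_algebra_axioms starA sA], assumption)
      (rule lin_maps_transport[OF g X.B.fd_algebra_axioms starB sB], assumption)
  have sAc: "A_star X x \<in> carrier (A_alg X)" if "x \<in> carrier (A_alg X)" for x
    using starA that by (auto simp: lin_maps_def LinearCombinations.module_hom_def)
  have sBc: "B_star X x \<in> carrier (B_alg X)" if "x \<in> carrier (B_alg X)" for x
    using starB that by (auto simp: lin_maps_def LinearCombinations.module_hom_def)
  have mult2: "(\<lambda>x. y \<otimes>\<^bsub>B_alg X\<^esub> x \<otimes>\<^bsub>B_alg X\<^esub> z) \<in> lin_maps (B_alg X) (B_alg X)"
    if "y \<in> carrier (B_alg X)" "z \<in> carrier (B_alg X)" for y z
    using that by (auto simp: lin_maps_def LinearCombinations.module_hom_def RB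
        X.B.smult_mult_left X.B.smult_mult_right X.B.smult_carrier)
  have ecf: "equipped_cardy_frobenius (A_alg Y) (A_fun Y) (B_alg Y) (B_fun Y) (AB_hom Y) (U_elem Y) (A_star Y) (B_star Y)"
  proof (intro equipped_cardy_frobenius.intro cardy_frobenius.intro A.frobenius_pair_axioms
      B.frobenius_pair_axioms cardy_frobenius_axioms.intro equipped_cardy_frobenius_axioms.intro)
    show "AB_hom Y \<in> Ring.ring_hom (A_alg Y) (B_alg Y) \<inter> lin_maps (A_alg Y) (B_alg Y)"
      unfolding lin_maps_def LinearCombinations.module_hom_def
      by (intro IntI ring_hom_memI CollectI conjI allI impI funcsetI; (elim conjE)?; (elim surjA)?)
        (simp_all add: fD gD RA phi phi_carrier phi_maps phi_one X.A.smult_carrier fD(2)[symmetric] del: fD(2))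
    show "AB_hom Y ` carrier (A_alg Y) \<subseteq> center (B_alg Y)"
    proof (clarsimp simp: center_def, elim surjA, intro conjI ballI; (elim surjB)?)
      fix x assume x: "x \<in> carrier (A_alg X)"
      have c: "AB_hom X x \<in> center (B_alg X)" using X.phi_central x by auto
      show "AB_hom Y z \<in> carrier (B_alg Y)" if "z = f x" for z
        using x that by (simp add: phi gD phi_carrier)
      show "AB_hom Y z \<otimes>\<^bsub>B_alg Y\<^esub> w = w \<otimes>\<^bsub>B_alg Y\<^esub> AB_hom Y z"
        if "z = f x" "w = g v" "v \<in> carrier (B_alg X)" for z w v
        using x c that by (simp add: phi gD phi_carrier center_def)
    qed
    show "A_fun Y (?dY y \<otimes>\<^bsub>A_alg Y\<^esub> ?dY z) = op_trace (B_alg Y) (\<lambda>x. y \<otimes>\<^bsub>B_alg Y\<^esub> x \<otimes>\<^bsub>B_alg Y\<^esub> z)"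
      if yz: "y \<in> carrier (B_alg Y)" "z \<in> carrier (B_alg Y)" for y z
    proof -
      obtain v where v: "v \<in> carrier (B_alg X)" "y = g v" using surjB[OF yz(1)] .
      obtain w where w: "w \<in> carrier (B_alg X)" "z = g w" using surjB[OF yz(2)] .
      have "op_trace (B_alg Y) (\<lambda>x. y \<otimes>\<^bsub>B_alg Y\<^esub> x \<otimes>\<^bsub>B_alg Y\<^esub> z)
          = op_trace (B_alg X) (\<lambda>x. v \<otimes>\<^bsub>B_alg X\<^esub> x \<otimes>\<^bsub>B_alg X\<^esub> w)"
        by (rule X.B.op_trace_transport[OF frB g lB mult2[OF v(1) w(1)]]) (use v w in \<open>simp_all add: gD RB\<close>)
      also have "\<dots> = A_fun Y (?dY y \<otimes>\<^bsub>A_alg Y\<^esub> ?dY z)"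
        using v w by (simp add: X.cardy[symmetric] dual fD RA lA)
      finally show ?thesis ..
    qed
    show "involutive_anti_aut (A_alg Y) (A_star Y)"
      unfolding involutive_anti_aut_def
      by (intro conjI ballI starYA; (elim surjA)?)
        (use X.star_A in \<open>auto simp: fD RA sA sAc involutive_anti_aut_def\<close>)
    show "involutive_anti_aut (B_alg Y) (B_star Y)"
      unfolding involutive_anti_aut_def
      by (intro conjI ballI starYB; (elim surjB)?)
        (use X.star_B in \<open>auto simp: gD RB sB sBc involutive_anti_aut_def\<close>)
    show "U_elem Y \<otimes>\<^bsub>A_alg Y\<^esub> U_elem Y = K_star (A_alg Y) (A_fun Y) (A_star Y)"
      using X.A.K_star_transport[OF frA f lA starA starYA sA] X.U_square X.U_closed
      by (simp add: U fD)
    show "AB_hom Y (U_elem Y) = K_star (B_alg Y) (B_fun Y) (B_star Y)"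
      using X.B.K_star_transport[OF frB g lB starB starYB sB] X.phi_U X.U_closed
      by (simp add: U phi)
  qed ((elim surjA surjB)?; simp add: fD gD RA RB lA lB sA sB sAc sBc phi phi_carrier U
      X.A_commutative X.functional_star_A X.functional_star_B X.phi_star X.U_closed)+
  moreover have "(f, g) \<in> ecf_isos X Y"
    using structure_map_alg_isos[OF f] structure_map_alg_isos[OF g]
    by (simp add: ecf_isos_def lA lB phi U sA sB)
  ultimately show ?thesis using X by (auto simp: ecf_isomorphic_def is_ecf_def)
qed

section \<open>The regular algebra\<close>

locale fin_group = group G for G :: "('g, 'm) monoid_scheme" (structure) +
  assumes finite_G: "finite (carrier G)"
begin

lemma order_pos: "Coset.order G > 0"
  using finite_G one_closed unfolding Coset.order_def by (auto simp: card_gt_0_iff)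

lemma sum_left_mult: "a \<in> carrier G \<Longrightarrow> (\<Sum>x\<in>carrier G. F (a \<otimes> x)) = (\<Sum>x\<in>carrier G. F x)"
  by (rule sum.reindex_bij_witness[where i = "\<lambda>x. inv a \<otimes> x" and j = "\<lambda>x. a \<otimes> x"])
    (auto simp: m_assoc[symmetric])

lemma sum_right_mult: "a \<in> carrier G \<Longrightarrow> (\<Sum>x\<in>carrier G. F (x \<otimes> a)) = (\<Sum>x\<in>carrier G. F x)"
  by (rule sum.reindex_bij_witness[where i = "\<lambda>x. x \<otimes> inv a" and j = "\<lambda>x. x \<otimes> a"])
    (auto simp: m_assoc)

lemma sum_inverse: "(\<Sum>x\<in>carrier G. F (inv x)) = (\<Sum>x\<in>carrier G. F x)"
  by (rule sum.reindex_bij_witness[where i = "\<lambda>x. inv x" and j = "\<lambda>x. inv x"]) auto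

lemma sum_conj: "a \<in> carrier G \<Longrightarrow> (\<Sum>x\<in>carrier G. F (inv a \<otimes> x \<otimes> a)) = (\<Sum>x\<in>carrier G. F x)"
  using sum_left_mult[of "inv a" "\<lambda>x. F (x \<otimes> a)"] sum_right_mult[of a F] by simp

section \<open>Convolution in the group algebra\<close>

abbreviation KG :: "('k::field_char_0, 'g \<Rightarrow> 'k) module" where "KG \<equiv> group_alg G"

abbreviation conv :: "('g \<Rightarrow> 'k::field_char_0) \<Rightarrow> ('g \<Rightarrow> 'k) \<Rightarrow> 'g \<Rightarrow> 'k" (infixl "\<star>" 70)
  where "f \<star> h \<equiv> monoid.mult (group_alg G) f h"

abbreviation \<delta> :: "'g \<Rightarrow> 'g \<Rightarrow> 'k::field_char_0" where "\<delta> \<equiv> group_elem"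

lemma KG_simps:
  "carrier KG = {f. \<forall>x. x \<notin> carrier G \<longrightarrow> f x = 0}"
  "\<one>\<^bsub>KG\<^esub> = (\<lambda>x. if x = \<one> then 1 else 0)" "\<zero>\<^bsub>KG\<^esub> = (\<lambda>x. 0)"
  "f \<oplus>\<^bsub>KG\<^esub> h = (\<lambda>x. f x + h x)" "k \<odot>\<^bsub>KG\<^esub> f = (\<lambda>x. k * f x)"
  by (simp_all add: group_alg_def)

text \<open>All pairs are summed with a test, instead of the pairs in a fibre; in this shape sums
  can be swapped and bilinearity is termwise.\<close>

lemma conv_eq_sum:
  "(f \<star> h) x = (\<Sum>y\<in>carrier G. \<Sum>z\<in>carrier G. if y \<otimes> z = x then f y * h z else 0)"
proof -
  have "(f \<star> h) x = (\<Sum>(y, z)\<in>{(y, z) \<in> carrier G \<times> carrier G. y \<otimes> z = x}. f y * h z)"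
    by (simp add: group_alg_def)
  also have "\<dots> = (\<Sum>(y, z)\<in>carrier G \<times> carrier G. if y \<otimes> z = x then f y * h z else 0)"
    using finite_G by (intro sum.mono_neutral_cong_left) (auto split: if_splits)
  also have "\<dots> = (\<Sum>y\<in>carrier G. \<Sum>z\<in>carrier G. if y \<otimes> z = x then f y * h z else 0)"
    by (rule sum.cartesian_product[symmetric])
  finally show ?thesis .
qed

lemma conv_carrier: "f \<star> h \<in> carrier KG"
  unfolding KG_simps conv_eq_sum by (auto intro!: sum.neutral)

lemma conv_outside: "x \<notin> carrier G \<Longrightarrow> (f \<star> h) x = 0"
  using conv_carrier[of f h] by (simp add: KG_simps)

lemma conv_left: "x \<in> carrier G \<Longrightarrow> (f \<star> h) x = (\<Sum>y\<in>carrier G. f y * h (inv y \<otimes> x))"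
  unfolding conv_eq_sum
proof (rule sum.cong[OF refl])
  fix y assume x: "x \<in> carrier G" and y: "y \<in> carrier G"
  have "(\<Sum>z\<in>carrier G. if y \<otimes> z = x then f y * h z else 0)
      = (\<Sum>z\<in>carrier G. if z = inv y \<otimes> x then f y * h z else 0)"
    using x y by (intro sum.cong refl if_cong) (auto simp: inv_solve_left)
  then show "(\<Sum>z\<in>carrier G. if y \<otimes> z = x then f y * h z else 0) = f y * h (inv y \<otimes> x)"
    using x y finite_G by simp
qed

lemma conv_right: "x \<in> carrier G \<Longrightarrow> (f \<star> h) x = (\<Sum>z\<in>carrier G. f (x \<otimes> inv z) * h z)"
  unfolding conv_eq_sum
proof (subst sum.swap, rule sum.cong[OF refl])
  fix z assume x: "x \<in> carrier G" and z: "z \<in> carrier G"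
  have "(\<Sum>y\<in>carrier G. if y \<otimes> z = x then f y * h z else 0)
      = (\<Sum>y\<in>carrier G. if y = x \<otimes> inv z then f y * h z else 0)"
    using x z by (intro sum.cong refl if_cong) (auto simp: inv_solve_right)
  then show "(\<Sum>y\<in>carrier G. if y \<otimes> z = x then f y * h z else 0) = f (x \<otimes> inv z) * h z"
    using x z finite_G by simp
qed

text \<open>The factor \<open>F\<close> plays the part of a linear functional on the algebra, given
  by its values on group elements. Associativity and the multiplicativity of the Fourier transform
  both come from here.\<close>

lemma sum_conv: "(\<Sum>a\<in>carrier G. (f \<star> h) a * F a) = (\<Sum>y\<in>carrier G. \<Sum>z\<in>carrier G. f y * h z * F (y \<otimes> z))"
proof -
  have "(\<Sum>a\<in>carrier G. (f \<star> h) a * F a) = (\<Sum>a\<in>carrier G. \<Sum>y\<in>carrier G. f y * h (inv y \<otimes> a) * F a)"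
    by (simp add: conv_left sum_distrib_right)
  also have "\<dots> = (\<Sum>y\<in>carrier G. \<Sum>a\<in>carrier G. f y * h (inv y \<otimes> a) * F a)"
    by (rule sum.swap)
  also have "\<dots> = (\<Sum>y\<in>carrier G. \<Sum>z\<in>carrier G. f y * h z * F (y \<otimes> z))"
  proof (rule sum.cong[OF refl])
    fix y assume y: "y \<in> carrier G"
    show "(\<Sum>a\<in>carrier G. f y * h (inv y \<otimes> a) * F a) = (\<Sum>z\<in>carrier G. f y * h z * F (y \<otimes> z))"
      using sum_left_mult[OF y, of "\<lambda>a. f y * h (inv y \<otimes> a) * F a"] y
      by (simp add: m_assoc[symmetric] cong: sum.cong)
  qed
  finally show ?thesis .
qed

lemma conv_assoc: "(f \<star> h) \<star> k = f \<star> (h \<star> k)"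
proof
  fix x
  show "((f \<star> h) \<star> k) x = (f \<star> (h \<star> k)) x"
  proof (cases "x \<in> carrier G")
    case x: True
    have "((f \<star> h) \<star> k) x = (\<Sum>y\<in>carrier G. \<Sum>z\<in>carrier G. f y * h z * k (inv (y \<otimes> z) \<otimes> x))"
      unfolding conv_left[OF x] by (rule sum_conv)
    also have "\<dots> = (\<Sum>y\<in>carrier G. f y * (h \<star> k) (inv y \<otimes> x))"
      using x by (intro sum.cong refl) (simp add: conv_left sum_distrib_left inv_mult_group m_assoc mult.assoc)
    also have "\<dots> = (f \<star> (h \<star> k)) x" by (rule conv_left[OF x, symmetric])
    finally show ?thesis .
  qed (simp add: conv_outside)
qed

lemma group_elem_carrier: "g \<in> carrier G \<Longrightarrow> \<delta> g \<in> carrier KG"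
  by (auto simp: KG_simps group_elem_def)

lemma group_elem_conv: "\<lbrakk>g \<in> carrier G; x \<in> carrier G\<rbrakk> \<Longrightarrow> (\<delta> g \<star> f) x = f (inv g \<otimes> x)"
  using finite_G by (simp add: conv_left group_elem_def if_distrib[of "\<lambda>c. c * _"] cong: if_cong)

lemma conv_group_elem: "\<lbrakk>g \<in> carrier G; x \<in> carrier G\<rbrakk> \<Longrightarrow> (f \<star> \<delta> g) x = f (x \<otimes> inv g)"
  using finite_G by (simp add: conv_right group_elem_def if_distrib[of "\<lambda>c. _ * c"] cong: if_cong)

lemma conv_one: "f \<in> carrier KG \<Longrightarrow> \<one>\<^bsub>KG\<^esub> \<star> f = f" "f \<in> carrier KG \<Longrightarrow> f \<star> \<one>\<^bsub>KG\<^esub> = f"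
proof -
  have one: "\<one>\<^bsub>KG\<^esub> = \<delta> \<one>" by (simp add: KG_simps group_elem_def)
  show "\<one>\<^bsub>KG\<^esub> \<star> f = f" if "f \<in> carrier KG"
  proof
    fix x show "(\<one>\<^bsub>KG\<^esub> \<star> f) x = f x"
      using that by (cases "x \<in> carrier G") (auto simp: one group_elem_conv conv_outside KG_simps(1))
  qed
  show "f \<star> \<one>\<^bsub>KG\<^esub> = f" if "f \<in> carrier KG"
  proof
    fix x show "(f \<star> \<one>\<^bsub>KG\<^esub>) x = f x"
      using that by (cases "x \<in> carrier G") (auto simp: one conv_group_elem conv_outside KG_simps(1))
  qed
qed

lemma conv_bilinear:
  "(\<lambda>x. f x + f' x) \<star> h = (\<lambda>x. (f \<star> h) x + (f' \<star> h) x)"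
  "f \<star> (\<lambda>x. h x + h' x) = (\<lambda>x. (f \<star> h) x + (f \<star> h') x)"
  "(\<lambda>x. k * f x) \<star> h = (\<lambda>x. k * (f \<star> h) x)"
  "f \<star> (\<lambda>x. k * h x) = (\<lambda>x. k * (f \<star> h) x)"
  "(\<lambda>x. f x / k) \<star> h = (\<lambda>x. (f \<star> h) x / k)"
  "f \<star> (\<lambda>x. h x / k) = (\<lambda>x. (f \<star> h) x / k)"
  unfolding fun_eq_iff conv_eq_sum sum.distrib[symmetric] sum_distrib_left sum_divide_distrib
  by (intro allI sum.cong refl; simp add: algebra_simps)+

lemma pointwise_finsum:
  fixes C :: "('k::field_char_0, 'g \<Rightarrow> 'k) module"
  assumes "abelian_monoid C" and "\<And>f h. f \<oplus>\<^bsub>C\<^esub> h = (\<lambda>x. f x + h x)" "\<zero>\<^bsub>C\<^esub> = (\<lambda>x. 0)"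
    and "finite I" "F \<in> I \<rightarrow> carrier C"
  shows "(\<Oplus>\<^bsub>C\<^esub>i\<in>I. F i) = (\<lambda>x. \<Sum>i\<in>I. F i x)"
  using assms(4,5)
proof (induction I)
  case empty
  then show ?case using assms by (simp add: abelian_monoid.finsum_empty)
next
  case (insert i I)
  then have "(\<Oplus>\<^bsub>C\<^esub>i\<in>insert i I. F i) = F i \<oplus>\<^bsub>C\<^esub> (\<Oplus>\<^bsub>C\<^esub>i\<in>I. F i)"
    by (intro abelian_monoid.finsum_insert[OF assms(1)]) auto
  then show ?case using insert by (simp add: assms(2))
qed

lemma conv_at_one: "(f \<star> h) \<one> = (\<Sum>y\<in>carrier G. f y * h (inv y))"
  by (simp add: conv_left)

lemma conv_at_one_commute: "(f \<star> h) \<one> = (h \<star> f) \<one>"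
  using sum_inverse[of "\<lambda>y. h y * f (inv y)"] by (simp add: conv_at_one mult.commute)

lemma frobenius_pair_group_alg: "frobenius_pair (KG :: ('k::field_char_0, _) module) (\<lambda>f. f \<one>)"
proof -
  have ab: "abelian_monoid (KG :: ('k, _) module)"
    by (rule abelian_monoidI) (auto simp: KG_simps algebra_simps)
  have "fd_algebra (KG :: ('k, _) module)"
  proof (rule fd_algebraI[where I = "carrier G" and e = "\<lambda>g. \<delta> g"])
    fix f :: "'g \<Rightarrow> 'k" assume f: "f \<in> carrier KG"
    have "(\<Oplus>\<^bsub>KG\<^esub>g\<in>carrier G. f g \<odot>\<^bsub>KG\<^esub> \<delta> g) = (\<lambda>x. \<Sum>g\<in>carrier G. (f g \<odot>\<^bsub>KG\<^esub> \<delta> g) x)"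
      by (rule pointwise_finsum[OF ab]) (auto simp: KG_simps finite_G group_elem_def)
    also have "\<dots> = f"
    proof
      fix x show "(\<Sum>g\<in>carrier G. (f g \<odot>\<^bsub>KG\<^esub> \<delta> g) x) = f x"
        using f finite_G
        by (cases "x \<in> carrier G") (auto simp: KG_simps group_elem_def if_distrib cong: if_cong intro!: sum.neutral)
    qed
    finally show "\<exists>c. f = (\<Oplus>\<^bsub>KG\<^esub>g\<in>carrier G. c g \<odot>\<^bsub>KG\<^esub> \<delta> g)" by metis
  qed (simp_all add: conv_carrier conv_assoc conv_one[unfolded KG_simps] finite_G group_elem_carrier[unfolded KG_simps]
      conv_carrier[unfolded KG_simps] conv_bilinear KG_simps, auto simp: algebra_simps fun_eq_iff group_elem_def conv_outside)
  then show ?thesis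
  proof (rule frobenius_pair.intro, intro frobenius_pair_axioms.intro)
    fix f :: "'g \<Rightarrow> 'k"
    assume f: "f \<in> carrier KG" and *: "\<And>h. h \<in> carrier KG \<Longrightarrow> (f \<star> h) \<one> = 0"
    \<comment> \<open>Pairing with \<open>\<delta> (inv g)\<close> reads off the coefficient at
      \<open>g\<close>.\<close>
    have "f g = 0" if g: "g \<in> carrier G" for g
      using *[OF group_elem_carrier[of "inv g"]] g conv_group_elem[of "inv g" \<one> f] by simp
    then show "f = \<zero>\<^bsub>KG\<^esub>" using f by (auto simp: KG_simps fun_eq_iff)
  qed (simp_all add: KG_simps conv_at_one_commute)
qed

text \<open>Commuting with the group elements is enough. The condition
  \<open>z (a \<otimes> b) = z (b \<otimes> a)\<close> is invariance under conjugation, written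
  without inverses so that it fits the two formulas for a convolution.\<close>

lemma center_iff:
  "z \<in> center KG \<longleftrightarrow> z \<in> carrier KG \<and> (\<forall>a\<in>carrier G. \<forall>b\<in>carrier G. z (a \<otimes> b) = z (b \<otimes> a))"
proof (intro iffI conjI ballI)
  fix a b assume z: "z \<in> center KG" and ab: "a \<in> carrier G" "b \<in> carrier G"
  have "z \<star> \<delta> (inv a) = \<delta> (inv a) \<star> z"
    using z group_elem_carrier[of "inv a"] ab unfolding center_def by blast
  then have "(z \<star> \<delta> (inv a)) b = (\<delta> (inv a) \<star> z) b" by (rule fun_cong)
  then show "z (a \<otimes> b) = z (b \<otimes> a)"
    using ab by (simp add: group_elem_conv conv_group_elem)
next
  assume z: "z \<in> carrier KG \<and> (\<forall>a\<in>carrier G. \<forall>b\<in>carrier G. z (a \<otimes> b) = z (b \<otimes> a))"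
  have "z \<star> f = f \<star> z" for f
  proof
    fix x show "(z \<star> f) x = (f \<star> z) x"
    proof (cases "x \<in> carrier G")
      case x: True
      show ?thesis unfolding conv_left[OF x, of f] conv_right[OF x, of z]
        using x z by (intro sum.cong refl) (simp add: mult.commute)
    qed (simp add: conv_outside)
  qed
  then show "z \<in> center KG" using z by (simp add: center_def)
qed (simp add: center_def)

text \<open>On functions supported in \<open>G\<close> this is \<open>|G|\<close> times the
  projection onto class functions; it turns out to be the dual map of the inclusion of the center.
  The factor \<open>1/|G|\<close> that seems to be missing sits in \<open>l_A\<close>.\<close>

definition class_sum :: "('g \<Rightarrow> 'k::field_char_0) \<Rightarrow> 'g \<Rightarrow> 'k" where
  "class_sum b = (\<lambda>x. if x \<in> carrier G then \<Sum>h\<in>carrier G. b (inv h \<otimes> x \<otimes> h) else 0)"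

lemma class_sum_center: "class_sum b \<in> center KG"
  unfolding center_iff
proof (intro conjI ballI)
  fix c d assume cd: "c \<in> carrier G" "d \<in> carrier G"
  \<comment> \<open>Replacing \<open>h\<close> by \<open>c \<otimes> h\<close> turns the conjugates
    of \<open>c \<otimes> d\<close> into those of \<open>d \<otimes> c\<close>.\<close>
  have "(\<Sum>h\<in>carrier G. b (inv h \<otimes> (c \<otimes> d) \<otimes> h)) = (\<Sum>h\<in>carrier G. b (inv (c \<otimes> h) \<otimes> (c \<otimes> d) \<otimes> (c \<otimes> h)))"
    using sum_left_mult[OF cd(1), of "\<lambda>h. b (inv h \<otimes> (c \<otimes> d) \<otimes> h)"] by simp
  also have "\<dots> = (\<Sum>h\<in>carrier G. b (inv h \<otimes> (d \<otimes> c) \<otimes> h))"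
  proof (intro sum.cong refl arg_cong[where f = b])
    fix h assume h: "h \<in> carrier G"
    have "inv (c \<otimes> h) \<otimes> (c \<otimes> d) \<otimes> (c \<otimes> h) = inv h \<otimes> (inv c \<otimes> c) \<otimes> d \<otimes> c \<otimes> h"
      using h cd by (simp only: inv_mult_group m_assoc inv_closed m_closed)
    then show "inv (c \<otimes> h) \<otimes> (c \<otimes> d) \<otimes> (c \<otimes> h) = inv h \<otimes> (d \<otimes> c) \<otimes> h"
      using h cd by (simp add: m_assoc)
  qed
  finally show "class_sum b (c \<otimes> d) = class_sum b (d \<otimes> c)"
    using cd by (simp add: class_sum_def)
qed (simp add: KG_simps class_sum_def)

lemma class_function_conj:
  assumes "z \<in> center KG" "h \<in> carrier G" "x \<in> carrier G"
  shows "z (inv h \<otimes> x \<otimes> h) = z x"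
proof -
  have "z (inv h \<otimes> x \<otimes> h) = z (h \<otimes> (inv h \<otimes> x))"
    using assms unfolding center_iff by simp
  then show ?thesis using assms by (simp add: m_assoc[symmetric])
qed

text \<open>The conjugation moves from \<open>b\<close> to the class function \<open>a\<close>,
  which is invariant, so each of the \<open>|G|\<close> conjugators contributes
  \<open>(b \<star> a) \<one>\<close>. This is the adjunction between \<open>class_sum\<close> and
  the inclusion.\<close>

lemma class_sum_conv:
  assumes a: "a \<in> center KG"
  shows "(class_sum b \<star> a) \<one> = of_nat (Coset.order G) * (b \<star> a) \<one>"
proof -
  have "(class_sum b \<star> a) \<one> = (\<Sum>y\<in>carrier G. \<Sum>h\<in>carrier G. b (inv h \<otimes> y \<otimes> h) * a (inv y))"
    by (simp add: conv_at_one class_sum_def sum_distrib_right)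
  also have "\<dots> = (\<Sum>h\<in>carrier G. \<Sum>y\<in>carrier G. b (inv h \<otimes> y \<otimes> h) * a (inv (inv h \<otimes> y \<otimes> h)))"
  proof (subst sum.swap, intro sum.cong refl arg_cong2[where f = "(*)"])
    fix h y assume h: "h \<in> carrier G" and y: "y \<in> carrier G"
    have "inv (inv h \<otimes> y \<otimes> h) = inv h \<otimes> inv y \<otimes> h"
      using h y by (simp add: inv_mult_group m_assoc)
    then show "a (inv y) = a (inv (inv h \<otimes> y \<otimes> h))"
      using class_function_conj[OF a h, of "inv y"] y by simp
  qed
  also have "\<dots> = of_nat (Coset.order G) * (b \<star> a) \<one>"
    using sum_conj[where F = "\<lambda>y. b y * a (inv y)"] by (simp add: conv_at_one Coset.order_def)
  finally show ?thesis .
qed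

lemma center_alg_simps:
  "carrier (center_alg KG) = center KG" "monoid.mult (center_alg KG) = monoid.mult KG"
  "\<one>\<^bsub>center_alg KG\<^esub> = \<one>\<^bsub>KG\<^esub>" "\<zero>\<^bsub>center_alg KG\<^esub> = \<zero>\<^bsub>KG\<^esub>"
  "add (center_alg KG) = add KG" "module.smult (center_alg KG) = module.smult KG"
  by (simp_all add: center_alg_def)

abbreviation norm_coeff :: "('g \<Rightarrow> 'k::field_char_0) \<Rightarrow> 'k" where
  "norm_coeff \<equiv> \<lambda>f. f \<one> / of_nat (Coset.order G)"

lemma frobenius_pair_center: "frobenius_pair (center_alg (KG :: ('k::field_char_0, _) module)) norm_coeff"
proof -
  let ?Z = "center_alg (KG :: ('k, _) module)"
  interpret B: frobenius_pair "KG :: ('k, _) module" "\<lambda>f. f \<one>" by (rule frobenius_pair_group_alg)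
  have c: "x \<in> carrier KG" if "x \<in> center KG" for x :: "'g \<Rightarrow> 'k"
    using that by (simp add: center_def)
  have closed: "\<zero>\<^bsub>KG\<^esub> \<in> center (KG :: ('k, _) module)" "\<one>\<^bsub>KG\<^esub> \<in> center (KG :: ('k, _) module)"
    "\<And>x y :: 'g \<Rightarrow> 'k. \<lbrakk>x \<in> center KG; y \<in> center KG\<rbrakk> \<Longrightarrow> x \<oplus>\<^bsub>KG\<^esub> y \<in> center KG"
    "\<And>k x :: 'g \<Rightarrow> 'k. x \<in> center KG \<Longrightarrow> k \<odot>\<^bsub>KG\<^esub> x \<in> center KG"
    "\<And>x y :: 'g \<Rightarrow> 'k. \<lbrakk>x \<in> center KG; y \<in> center KG\<rbrakk> \<Longrightarrow> x \<star> y \<in> center KG"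
  proof -
    show "x \<star> y \<in> center KG" if xy: "x \<in> center KG" "y \<in> center KG" for x y :: "'g \<Rightarrow> 'k"
    proof -
      have "(x \<star> y) \<star> f = f \<star> (x \<star> y)" if "f \<in> carrier KG" for f
      proof -
        have comm: "z \<star> f = f \<star> z" if "z \<in> center KG" for z
          using that \<open>f \<in> carrier KG\<close> unfolding center_def by blast
        have "(x \<star> y) \<star> f = x \<star> (f \<star> y)" by (simp only: conv_assoc comm[OF xy(2)])
        also have "\<dots> = (f \<star> x) \<star> y" by (simp only: conv_assoc[symmetric] comm[OF xy(1)])
        finally show ?thesis by (simp only: conv_assoc)
      qed
      then show ?thesis by (simp add: center_def conv_carrier)
    qed
    show "\<zero>\<^bsub>KG\<^esub> \<in> center (KG :: ('k, _) module)" by (simp add: center_iff KG_simps)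
    show "\<one>\<^bsub>KG\<^esub> \<in> center (KG :: ('k, _) module)"
      by (auto simp: center_def conv_one conv_one[unfolded KG_simps] KG_simps)
  qed (auto simp: center_iff KG_simps)
  note closed' = closed[unfolded KG_simps]
  have ab: "abelian_monoid ?Z"
    by (rule abelian_monoidI) (auto simp: center_alg_simps closed closed' KG_simps algebra_simps)
  note R = ring.ring_simprules[OF B.ring_C]
  have "fd_algebra ?Z"
  proof (rule fd_algebraI[where I = "carrier G" and e = "\<lambda>g. class_sum (\<delta> g)"])
    fix f :: "'g \<Rightarrow> 'k" assume "f \<in> carrier ?Z"
    then have f: "f \<in> center KG" by (simp add: center_alg_simps)
    \<comment> \<open>Adding up \<open>f g\<close> times the class sum of \<open>g\<close> over all
      \<open>g\<close> sums \<open>f\<close> over all conjugates of the argument, hence gives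
      \<open>|G|\<close> times \<open>f\<close>.\<close>
    let ?c = "\<lambda>g. f g / of_nat (Coset.order G)"
    have "(\<Oplus>\<^bsub>?Z\<^esub>g\<in>carrier G. ?c g \<odot>\<^bsub>?Z\<^esub> class_sum (\<delta> g)) = (\<lambda>x. \<Sum>g\<in>carrier G. (?c g \<odot>\<^bsub>?Z\<^esub> class_sum (\<delta> g)) x)"
      by (rule pointwise_finsum[OF ab])
        (auto simp: finite_G center_alg_simps closed class_sum_center, auto simp: KG_simps)
    also have "\<dots> = f"
    proof
      fix x show "(\<Sum>g\<in>carrier G. (?c g \<odot>\<^bsub>?Z\<^esub> class_sum (\<delta> g)) x) = f x"
      proof (cases "x \<in> carrier G")
        case x: True
        have "(\<Sum>g\<in>carrier G. (?c g \<odot>\<^bsub>?Z\<^esub> class_sum (\<delta> g)) x)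
            = (\<Sum>g\<in>carrier G. \<Sum>h\<in>carrier G. ?c g * (if inv h \<otimes> x \<otimes> h = g then 1 else 0))"
          using x by (simp add: center_alg_simps KG_simps class_sum_def group_elem_def sum_distrib_left sum_divide_distrib)
        also have "\<dots> = (\<Sum>h\<in>carrier G. ?c (inv h \<otimes> x \<otimes> h))"
          by (subst sum.swap) (use x finite_G in \<open>simp add: if_distrib cong: if_cong\<close>)
        also have "\<dots> = f x"
          using x order_pos by (simp add: class_function_conj[OF f]) (simp add: Coset.order_def)
        finally show ?thesis .
      next
        case False
        then show ?thesis using c[OF f] by (simp add: center_alg_simps KG_simps class_sum_def)
      qed
    qed
    finally show "\<exists>c. f = (\<Oplus>\<^bsub>?Z\<^esub>g\<in>carrier G. c g \<odot>\<^bsub>?Z\<^esub> class_sum (\<delta> g))" by metis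
  qed (simp_all add: center_alg_simps closed c R class_sum_center finite_G B.C_distr B.smult_carrier B.smult_add_left
      B.smult_smult B.smult_one_zero B.smult_r_distr[simplified] B.smult_mult_left B.smult_mult_right)
  then show ?thesis
  proof (rule frobenius_pair.intro, intro frobenius_pair_axioms.intro)
    fix f assume "f \<in> carrier ?Z" and *: "\<And>h. h \<in> carrier ?Z \<Longrightarrow> norm_coeff (f \<otimes>\<^bsub>?Z\<^esub> h) = 0"
    then have f: "f \<in> center KG" by (simp add: center_alg_simps)
    have "(f \<star> h) \<one> = 0" if "h \<in> carrier KG" for h
    proof -
      \<comment> \<open>Only central elements may serve as tests in the center; by
        \<open>class_sum_conv\<close>, testing with \<open>class_sum h\<close> is as good as testing
        with \<open>h\<close>.\<close>
      have "(class_sum h \<star> f) \<one> = 0"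
        using *[of "class_sum h"] order_pos
        by (simp add: center_alg_simps class_sum_center conv_at_one_commute[of f])
      then show ?thesis
        using class_sum_conv[OF f, of h] order_pos by (simp add: conv_at_one_commute[of f])
    qed
    then show "f = \<zero>\<^bsub>?Z\<^esub>"
      using B.form_nondegenerate[OF c[OF f]] by (simp add: center_alg_simps)
  qed (simp_all add: center_alg_simps KG_simps conv_at_one_commute add_divide_distrib)
qed

text \<open>The pairings with the two families are \<open>x g\<close> and \<open>y (inv g)\<close>,
  so the frame identity is the formula for a convolution at the unit.\<close>

lemma dual_frames_group_alg:
  "dual_frames (KG :: ('k::field_char_0, _) module) (\<lambda>f. f \<one>) (carrier G) \<delta> (\<lambda>g. \<delta> (inv g))"
  by (auto simp: dual_frames_def finite_G group_elem_carrier conv_group_elem group_elem_conv)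
    (simp add: conv_at_one)

text \<open>The class sums repeat within each conjugacy class, and the division by
  \<open>|G|\<close> in the second family compensates for it: the two pairings are
  \<open>x g / |G|\<close> and \<open>y (inv g)\<close>.\<close>

lemma dual_frames_center:
  "dual_frames (center_alg (KG :: ('k::field_char_0, _) module)) norm_coeff (carrier G)
     (\<lambda>g. class_sum (\<delta> g)) (\<lambda>g x. class_sum (\<delta> (inv g)) x / of_nat (Coset.order G))"
proof -
  have sc: "(\<lambda>x. z x / k) \<in> center KG" if "z \<in> center KG" for k and z :: "'g \<Rightarrow> 'k"
    using that by (auto simp: center_iff KG_simps)
  have "(x \<star> class_sum (\<delta> (inv g))) \<one> = of_nat (Coset.order G) * x g"
    "(class_sum (\<delta> g) \<star> x) \<one> = of_nat (Coset.order G) * x (inv g)"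
    if x: "x \<in> center KG" and g: "g \<in> carrier G" for x :: "'g \<Rightarrow> 'k" and g
    using g class_sum_conv[OF x, of "\<delta> (inv g)"] class_sum_conv[OF x, of "\<delta> g"]
    by (simp_all add: conv_at_one_commute[of x] group_elem_conv)
  then show ?thesis
    using order_pos
    by (auto simp: dual_frames_def finite_G class_sum_center center_alg_simps sc conv_bilinear sum_divide_distrib
        cong: sum.cong) (simp add: conv_at_one sum_divide_distrib divide_inverse sum_distrib_left mult_ac)
qed

text \<open>The value at \<open>x\<close> is the number of square roots of \<open>x\<close>, the
  counting function of Frobenius and Schur.\<close>

definition square_sum :: "'g \<Rightarrow> 'k::field_char_0" where
  "square_sum = (\<lambda>x. \<Sum>g\<in>carrier G. if x = g \<otimes> g then 1 else 0)"

lemma square_sum_eq: "(\<Oplus>\<^bsub>KG\<^esub>g\<in>carrier G. group_elem (g \<otimes> g)) = (square_sum :: 'g \<Rightarrow> 'k::field_char_0)"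
proof -
  interpret B: frobenius_pair "KG :: ('k, _) module" "\<lambda>f. f \<one>" by (rule frobenius_pair_group_alg)
  show ?thesis
    unfolding square_sum_def
    by (subst pointwise_finsum[OF B.abelian_monoid_C])
      (auto simp: KG_simps finite_G, auto simp: group_elem_def)
qed

text \<open>Conjugation by \<open>a\<close> maps the square roots of \<open>b \<otimes> a\<close>
  onto those of \<open>a \<otimes> b\<close>.\<close>

lemma square_sum_center: "square_sum \<in> center (KG :: ('k::field_char_0, _) module)"
  unfolding center_iff
proof (intro conjI ballI)
  fix a b assume ab: "a \<in> carrier G" "b \<in> carrier G"
  have eq: "(a \<otimes> b = a \<otimes> (h \<otimes> inv a) \<otimes> (a \<otimes> (h \<otimes> inv a))) = (b \<otimes> a = h \<otimes> h)" if h: "h \<in> carrier G" for h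
  proof -
    have "a \<otimes> (h \<otimes> inv a) \<otimes> (a \<otimes> (h \<otimes> inv a)) = a \<otimes> (h \<otimes> (inv a \<otimes> a) \<otimes> h \<otimes> inv a)"
      using ab h by (simp only: m_assoc inv_closed m_closed)
    then have "(a \<otimes> b = a \<otimes> (h \<otimes> inv a) \<otimes> (a \<otimes> (h \<otimes> inv a))) = (b = h \<otimes> h \<otimes> inv a)"
      using ab h by simp
    then show ?thesis using ab h by (auto simp: inv_solve_right)
  qed
  show "square_sum (a \<otimes> b) = (square_sum (b \<otimes> a) :: 'k)"
    unfolding square_sum_def
    using sum_left_mult[OF ab(1), of "\<lambda>g. if a \<otimes> b = g \<otimes> g then 1 else 0 :: 'k"]
      sum_right_mult[of "inv a" "\<lambda>g. if a \<otimes> b = a \<otimes> g \<otimes> (a \<otimes> g) then 1 else 0 :: 'k"] ab eq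
    by (simp cong: sum.cong)
qed (auto simp: KG_simps square_sum_def intro!: sum.neutral)

lemma square_sum_conv: "x \<in> carrier G \<Longrightarrow> (square_sum \<star> f) x = (\<Sum>g\<in>carrier G. f (inv (g \<otimes> g) \<otimes> x))"
proof -
  assume x: "x \<in> carrier G"
  have "(square_sum \<star> f) x = (\<Sum>y\<in>carrier G. \<Sum>g\<in>carrier G. if y = g \<otimes> g then f (inv y \<otimes> x) else 0)"
    using x by (simp add: conv_left square_sum_def sum_distrib_right if_distrib[of "\<lambda>c. c * _"] cong: if_cong)
  also have "\<dots> = (\<Sum>g\<in>carrier G. f (inv (g \<otimes> g) \<otimes> x))"
    by (subst sum.swap) (use x finite_G in simp)
  finally show ?thesis .
qed

text \<open>Substitute \<open>k = x g\<close>: then \<open>x g x g\<^sup>-\<^sup>1 = k\<^sup>2 g\<^sup>-\<^sup>2\<close>.\<close>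

lemma sum_square_commutator:
  "(\<Sum>x\<in>carrier G. \<Sum>g\<in>carrier G. F (x \<otimes> (g \<otimes> x \<otimes> inv g))) = (\<Sum>k\<in>carrier G. \<Sum>g\<in>carrier G. F (k \<otimes> k \<otimes> (g \<otimes> g)))"
proof -
  have "(\<Sum>x\<in>carrier G. \<Sum>g\<in>carrier G. F (x \<otimes> (g \<otimes> x \<otimes> inv g))) = (\<Sum>g\<in>carrier G. \<Sum>x\<in>carrier G. F (x \<otimes> (g \<otimes> x \<otimes> inv g)))"
    by (rule sum.swap)
  also have "\<dots> = (\<Sum>g\<in>carrier G. \<Sum>k\<in>carrier G. F (k \<otimes> k \<otimes> (inv g \<otimes> inv g)))"
  proof (rule sum.cong[OF refl])
    fix g assume g: "g \<in> carrier G"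
    have "(\<Sum>x\<in>carrier G. F (x \<otimes> (g \<otimes> x \<otimes> inv g))) = (\<Sum>k\<in>carrier G. F ((k \<otimes> inv g) \<otimes> (g \<otimes> (k \<otimes> inv g) \<otimes> inv g)))"
      using g by (intro sum_right_mult[symmetric]) simp
    also have "\<dots> = (\<Sum>k\<in>carrier G. F (k \<otimes> k \<otimes> (inv g \<otimes> inv g)))"
    proof (intro sum.cong refl arg_cong[where f = F])
      fix k assume k: "k \<in> carrier G"
      have "(k \<otimes> inv g) \<otimes> (g \<otimes> (k \<otimes> inv g) \<otimes> inv g) = k \<otimes> ((inv g \<otimes> g) \<otimes> k) \<otimes> (inv g \<otimes> inv g)"
        using g k by (simp only: m_assoc inv_closed m_closed)
      then show "(k \<otimes> inv g) \<otimes> (g \<otimes> (k \<otimes> inv g) \<otimes> inv g) = k \<otimes> k \<otimes> (inv g \<otimes> inv g)"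
        using g k by simp
    qed
    finally show "(\<Sum>x\<in>carrier G. F (x \<otimes> (g \<otimes> x \<otimes> inv g))) = (\<Sum>k\<in>carrier G. F (k \<otimes> k \<otimes> (inv g \<otimes> inv g)))" .
  qed
  also have "\<dots> = (\<Sum>g\<in>carrier G. \<Sum>k\<in>carrier G. F (k \<otimes> k \<otimes> (g \<otimes> g)))"
    by (rule sum_inverse)
  also have "\<dots> = (\<Sum>k\<in>carrier G. \<Sum>g\<in>carrier G. F (k \<otimes> k \<otimes> (g \<otimes> g)))"
    by (rule sum.swap)
  finally show ?thesis .
qed

lemma group_star_maps:
  "group_star G \<in> lin_maps KG (KG :: ('k::field_char_0, _) module)"
  "f \<in> center KG \<Longrightarrow> group_star G f \<in> center (KG :: ('k, _) module)"
  "group_star G (f \<star> h) = group_star G h \<star> (group_star G f :: 'g \<Rightarrow> 'k)"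
  "f \<in> carrier KG \<Longrightarrow> group_star G (group_star G f) = (f :: 'g \<Rightarrow> 'k)"
proof -
  show "group_star G \<in> lin_maps KG (KG :: ('k, _) module)"
    by (auto simp: lin_maps_def LinearCombinations.module_hom_def KG_simps group_star_def)
  show "group_star G f \<in> center (KG :: ('k, _) module)" if "f \<in> center KG"
    using that by (auto simp: center_iff KG_simps group_star_def inv_mult_group)
  show "group_star G (f \<star> h) = group_star G h \<star> (group_star G f :: 'g \<Rightarrow> 'k)"
  proof
    fix x show "group_star G (f \<star> h) x = (group_star G h \<star> (group_star G f :: 'g \<Rightarrow> 'k)) x"
    proof (cases "x \<in> carrier G")
      case x: True
      have "group_star G (f \<star> h) x = (\<Sum>y\<in>carrier G. f y * h (inv y \<otimes> inv x))"
        using x by (simp add: group_star_def conv_left)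
      also have "\<dots> = (\<Sum>y\<in>carrier G. f (inv y) * h (y \<otimes> inv x))"
        using sum_inverse[of "\<lambda>y. f y * h (inv y \<otimes> inv x)"] by (simp cong: sum.cong)
      also have "\<dots> = (group_star G h \<star> group_star G f) x"
        using x by (simp add: group_star_def conv_right inv_mult_group mult.commute)
      finally show ?thesis .
    qed (simp add: group_star_def conv_outside)
  qed
qed (auto simp: KG_simps group_star_def)

lemma group_star_group_elem: "g \<in> carrier G \<Longrightarrow> group_star G (\<delta> (inv g)) = \<delta> g"
  by (auto simp: group_star_def group_elem_def fun_eq_iff)

text \<open>The star exchanges the two families of the central frame up to the factor, so the
  twisted Casimir element becomes a sum of squares of class sums.\<close>

lemma group_star_class_sum:
  "g \<in> carrier G \<Longrightarrow> group_star G (\<lambda>x. class_sum (\<delta> (inv g)) x / k) = (\<lambda>x. class_sum (\<delta> g) x / k)"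
proof
  fix x assume g: "g \<in> carrier G"
  have "inv h \<otimes> inv x \<otimes> h = inv g \<longleftrightarrow> inv h \<otimes> x \<otimes> h = g" if "x \<in> carrier G" "h \<in> carrier G" for h
  proof -
    have "inv h \<otimes> inv x \<otimes> h = inv (inv h \<otimes> x \<otimes> h)" using that by (simp add: inv_mult_group m_assoc)
    then show ?thesis using that g inv_inv[of "inv h \<otimes> x \<otimes> h"] inv_inv[of g] by auto
  qed
  then show "group_star G (\<lambda>x. class_sum (\<delta> (inv g)) x / k) x = class_sum (\<delta> g) x / k"
    by (auto simp: group_star_def class_sum_def group_elem_def cong: sum.cong)
qed

text \<open>Once traces and \<open>K_star\<close> are read off from the frames, the Cardy condition
  and the two conditions on \<open>U\<close> become identities between sums over the group.\<close>

theorem is_ecf_regular: "is_ecf (regular_ecf G :: ('k::field_char_0, 'g \<Rightarrow> 'k, 'g \<Rightarrow> 'k) ecf_data)"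
proof -
  let ?B = "KG :: ('k, _) module"
  let ?Z = "center_alg ?B"
  let ?lB = "\<lambda>f :: 'g \<Rightarrow> 'k. f \<one>"
  interpret B: frobenius_pair ?B ?lB by (rule frobenius_pair_group_alg)
  interpret A: frobenius_pair ?Z norm_coeff by (rule frobenius_pair_center)
  have c: "x \<in> carrier KG" if "x \<in> center KG" for x :: "'g \<Rightarrow> 'k"
    using that by (simp add: center_def)
  have starA: "group_star G \<in> lin_maps ?Z ?Z"
    using group_star_maps(1,2)[where 'k = 'k] c
    by (auto simp: lin_maps_def LinearCombinations.module_hom_def center_alg_simps)
  have dual: "dual_map ?Z norm_coeff ?B ?lB (\<lambda>f. f) b = class_sum b" if b: "b \<in> carrier KG" for b
    unfolding dual_map_def
  proof (rule the_equality)
    have cl: "norm_coeff (class_sum b \<star> a) = (b \<star> a) \<one>" if "a \<in> center KG" for a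
      using class_sum_conv[OF that, of b] order_pos by simp
    then show "class_sum b \<in> carrier ?Z \<and> (\<forall>a\<in>carrier ?Z. norm_coeff (class_sum b \<otimes>\<^bsub>?Z\<^esub> a) = (b \<star> a) \<one>)"
      by (simp add: center_alg_simps class_sum_center)
    fix x assume "x \<in> carrier ?Z \<and> (\<forall>a\<in>carrier ?Z. norm_coeff (x \<otimes>\<^bsub>?Z\<^esub> a) = (b \<star> a) \<one>)"
    then show "x = class_sum b"
      using cl by (intro A.form_eqI) (auto simp: center_alg_simps class_sum_center)
  qed
  have "equipped_cardy_frobenius ?Z norm_coeff ?B ?lB (\<lambda>f. f) square_sum (group_star G) (group_star G)"
  proof (intro equipped_cardy_frobenius.intro cardy_frobenius.intro A.frobenius_pair_axioms
      B.frobenius_pair_axioms cardy_frobenius_axioms.intro equipped_cardy_frobenius_axioms.intro)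
    show "(\<lambda>f. f) \<in> Ring.ring_hom ?Z ?B \<inter> lin_maps ?Z ?B"
      by (auto simp: lin_maps_def LinearCombinations.module_hom_def center_alg_simps c intro!: ring_hom_memI)
    \<comment> \<open>Both sides are the sum of \<open>b y\<close> times \<open>b'\<close> at the
      conjugates of \<open>inv y\<close>: on the left through \<open>class_sum\<close>, on the right
      through the trace in the basis of group elements.\<close>
    show "norm_coeff (dual_map ?Z norm_coeff ?B ?lB (\<lambda>f. f) b \<otimes>\<^bsub>?Z\<^esub> dual_map ?Z norm_coeff ?B ?lB (\<lambda>f. f) b')
        = op_trace ?B (\<lambda>x. b \<star> x \<star> b')" if b: "b \<in> carrier KG" "b' \<in> carrier KG" for b b'
    proof -
      have "norm_coeff (class_sum b \<star> class_sum b') = (b \<star> class_sum b') \<one>"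
        using class_sum_conv[OF class_sum_center, of b b'] order_pos by simp
      also have "\<dots> = (\<Sum>g\<in>carrier G. \<Sum>y\<in>carrier G. b y * b' (inv g \<otimes> inv y \<otimes> g))"
        by (subst sum.swap) (simp add: conv_at_one class_sum_def sum_distrib_left)
      also have "\<dots> = (\<Sum>g\<in>carrier G. (b \<star> \<delta> g \<star> b' \<star> \<delta> (inv g)) \<one>)"
      proof (rule sum.cong[OF refl])
        fix g assume g: "g \<in> carrier G"
        have eq: "(b \<star> \<delta> g \<star> b' \<star> \<delta> (inv g)) \<one> = (b \<star> (\<delta> g \<star> b')) g"
          using conv_group_elem[of "inv g" \<one> "b \<star> \<delta> g \<star> b'"] g by (simp add: conv_assoc)
        show "(\<Sum>y\<in>carrier G. b y * b' (inv g \<otimes> inv y \<otimes> g)) = (b \<star> \<delta> g \<star> b' \<star> \<delta> (inv g)) \<one>"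
          unfolding eq using g by (simp add: conv_left[of g b] group_elem_conv m_assoc)
      qed
      also have "\<dots> = op_trace ?B (\<lambda>x. b \<star> x \<star> b')"
        by (rule B.op_trace_frame[OF dual_frames_group_alg, symmetric])
          (auto simp: lin_maps_def LinearCombinations.module_hom_def conv_carrier, auto simp: KG_simps conv_bilinear)
      finally show ?thesis by (simp add: dual b center_alg_simps)
    qed
    \<comment> \<open>Paired with \<open>y\<close>, the Casimir element gives a sum of
      \<open>y\<close> over the inverses of \<open>g (h g h^-1)\<close>, the square of
      \<open>U\<close> one over the inverses of \<open>g^2 h^2\<close>;
      \<open>sum_square_commutator\<close> equates them.\<close>
    show "square_sum \<otimes>\<^bsub>?Z\<^esub> square_sum = K_star ?Z norm_coeff (group_star G)"
    proof (rule A.form_eqI)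
      fix y assume "y \<in> carrier ?Z"
      then have y: "y \<in> center KG" by (simp add: center_alg_simps)
      note K = A.K_star_frame[OF dual_frames_center starA]
      have "norm_coeff (K_star ?Z norm_coeff (group_star G) \<otimes>\<^bsub>?Z\<^esub> y)
          = (\<Sum>g\<in>carrier G. norm_coeff (class_sum (\<delta> g) \<star> (group_star G (\<lambda>x. class_sum (\<delta> (inv g)) x / of_nat (Coset.order G))) \<star> y))"
        using K(2)[of y] y by (simp add: center_alg_simps)
      also have "\<dots> = (\<Sum>g\<in>carrier G. (class_sum (\<delta> g) \<star> (class_sum (\<delta> g) \<star> y)) \<one>) / (of_nat (Coset.order G) * of_nat (Coset.order G))"
        by (simp add: group_star_class_sum conv_bilinear conv_assoc sum_divide_distrib divide_simps)
      also have "(\<Sum>g\<in>carrier G. (class_sum (\<delta> g) \<star> (class_sum (\<delta> g) \<star> y)) \<one>)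
          = of_nat (Coset.order G) * (\<Sum>g\<in>carrier G. \<Sum>h\<in>carrier G. y (inv (g \<otimes> (h \<otimes> g \<otimes> inv h))))"
        unfolding sum_distrib_left[of "of_nat (Coset.order G)"]
      proof (rule sum.cong[OF refl])
        fix g assume g: "g \<in> carrier G"
        have z: "class_sum (\<delta> g) \<star> y \<in> center (KG :: ('k, _) module)"
          using ring.ring_simprules(5)[OF A.ring_C, of "class_sum (\<delta> g)" y] y
          by (simp add: center_alg_simps class_sum_center)
        have "(class_sum (\<delta> g) \<star> y) (inv g)
            = (\<Sum>x\<in>carrier G. \<Sum>h\<in>carrier G. if inv h \<otimes> x \<otimes> h = g then y (inv x \<otimes> inv g) else 0)"
          using g by (simp add: conv_left class_sum_def group_elem_def sum_distrib_right if_distrib[of "\<lambda>c. c * _"] cong: if_cong)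
        also have "\<dots> = (\<Sum>h\<in>carrier G. \<Sum>x\<in>carrier G. if x = h \<otimes> g \<otimes> inv h then y (inv x \<otimes> inv g) else 0)"
        proof (subst sum.swap, intro sum.cong refl if_cong)
          fix h x assume "h \<in> carrier G" "x \<in> carrier G"
          then show "(inv h \<otimes> x \<otimes> h = g) = (x = h \<otimes> g \<otimes> inv h)"
            using g by (metis inv_closed inv_solve_left inv_solve_right m_assoc m_closed)
        qed
        also have "\<dots> = (\<Sum>h\<in>carrier G. y (inv (g \<otimes> (h \<otimes> g \<otimes> inv h))))"
          using g finite_G by (simp add: inv_mult_group)
        finally have "(class_sum (\<delta> g) \<star> (class_sum (\<delta> g) \<star> y)) \<one>
            = of_nat (Coset.order G) * (\<Sum>h\<in>carrier G. y (inv (g \<otimes> (h \<otimes> g \<otimes> inv h))))"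
          using class_sum_conv[OF z, of "\<delta> g"] g by (simp add: group_elem_conv)
        then show "(class_sum (\<delta> g) \<star> (class_sum (\<delta> g) \<star> y)) \<one>
            = (\<Sum>h\<in>carrier G. of_nat (Coset.order G) * y (inv (g \<otimes> (h \<otimes> g \<otimes> inv h))))"
          by (simp only: sum_distrib_left)
      qed
      also have "(\<Sum>g\<in>carrier G. \<Sum>h\<in>carrier G. y (inv (g \<otimes> (h \<otimes> g \<otimes> inv h))))
          = (\<Sum>g\<in>carrier G. \<Sum>h\<in>carrier G. y (inv (g \<otimes> g \<otimes> (h \<otimes> h))))"
        by (rule sum_square_commutator)
      also have "\<dots> = (square_sum \<star> (square_sum \<star> y)) \<one>"
        by (simp add: square_sum_conv inv_mult_group m_assoc)
      finally have "norm_coeff (K_star ?Z norm_coeff (group_star G) \<otimes>\<^bsub>?Z\<^esub> y)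
          = (square_sum \<star> (square_sum \<star> y)) \<one> / of_nat (Coset.order G)"
        using order_pos by (simp only: mult_divide_mult_cancel_left of_nat_eq_0_iff neq0_conv simp_thms)
      then show "norm_coeff (square_sum \<otimes>\<^bsub>?Z\<^esub> square_sum \<otimes>\<^bsub>?Z\<^esub> y) = norm_coeff (K_star ?Z norm_coeff (group_star G) \<otimes>\<^bsub>?Z\<^esub> y)"
        by (simp only: center_alg_simps conv_assoc)
    next
      show "K_star ?Z norm_coeff (group_star G) \<in> carrier ?Z"
        by (rule A.K_star_frame(1)[OF dual_frames_center starA])
      show "square_sum \<otimes>\<^bsub>?Z\<^esub> square_sum \<in> carrier ?Z"
        by (rule ring.ring_simprules(5)[OF A.ring_C]) (simp_all add: center_alg_simps square_sum_center)
    qed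
    \<comment> \<open>In the basis of group elements \<open>K_star\<close> is the sum of
      \<open>g\<close> times the star of its inverse, which is \<open>g^2\<close>.\<close>
    show "square_sum = K_star ?B ?lB (group_star G)"
    proof (rule B.form_eqI)
      note K = B.K_star_frame[OF dual_frames_group_alg group_star_maps(1)]
      fix y assume y: "y \<in> carrier ?B"
      have "(K_star ?B ?lB (group_star G) \<star> y) \<one> = (\<Sum>g\<in>carrier G. (\<delta> g \<star> group_star G (\<delta> (inv g)) \<star> y) \<one>)"
        by (rule K(2)[OF y])
      also have "\<dots> = (\<Sum>g\<in>carrier G. y (inv (g \<otimes> g)))"
        by (intro sum.cong refl) (simp add: group_star_group_elem conv_assoc group_elem_conv inv_mult_group)
      also have "\<dots> = (square_sum \<star> y) \<one>" by (simp add: square_sum_conv)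
      finally show "(square_sum \<star> y) \<one> = (K_star ?B ?lB (group_star G) \<star> y) \<one>" ..
    next
      show "K_star ?B ?lB (group_star G) \<in> carrier ?B"
        by (rule B.K_star_frame(1)[OF dual_frames_group_alg group_star_maps(1)])
      show "square_sum \<in> carrier ?B" by (rule c[OF square_sum_center])
    qed
    show "involutive_anti_aut ?Z (group_star G)"
      unfolding involutive_anti_aut_def center_alg_simps
      by (intro conjI starA ballI group_star_maps(3) group_star_maps(4) c)
    show "involutive_anti_aut ?B (group_star G)"
      unfolding involutive_anti_aut_def
      by (intro conjI group_star_maps(1) ballI group_star_maps(3) group_star_maps(4))
    show "square_sum \<in> carrier ?Z" by (simp add: center_alg_simps square_sum_center)
    show "x \<otimes>\<^bsub>?Z\<^esub> y = y \<otimes>\<^bsub>?Z\<^esub> x" if "x \<in> carrier ?Z" "y \<in> carrier ?Z" for x y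
      using that(1) c[OF that(2)[unfolded center_alg_simps]] unfolding center_alg_simps center_def by blast
    show "(\<lambda>f. f) ` carrier ?Z \<subseteq> center ?B" by (simp add: center_alg_simps)
  qed (simp_all add: group_star_def)
  then show ?thesis by (simp add: is_ecf_def regular_ecf_def square_sum_eq)
qed

end

section \<open>Orthonormal families of functions on a finite set\<close>

text \<open>Euclidean spaces are represented by functions on a finite set. The same facts then serve
  for functions on the group, for functions on the group times an index range, and for plain
  vectors.\<close>

definition inner_on :: "'a set \<Rightarrow> ('a \<Rightarrow> real) \<Rightarrow> ('a \<Rightarrow> real) \<Rightarrow> real" where
  "inner_on X f h = (\<Sum>x\<in>X. f x * h x)"

definition orthonormal_on :: "'a set \<Rightarrow> 'i set \<Rightarrow> ('i \<Rightarrow> 'a \<Rightarrow> real) \<Rightarrow> bool" where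
  "orthonormal_on X I c \<longleftrightarrow> (\<forall>i\<in>I. \<forall>j\<in>I. inner_on X (c i) (c j) = (if i = j then 1 else 0))"

lemma inner_on_commute: "inner_on X f h = inner_on X h f"
  by (simp add: inner_on_def mult.commute)

lemma inner_on_sum:
  "inner_on X (\<lambda>x. \<Sum>i\<in>I. a i * c i x) h = (\<Sum>i\<in>I. a i * inner_on X (c i) h)"
  "inner_on X h (\<lambda>x. \<Sum>i\<in>I. a i * c i x) = (\<Sum>i\<in>I. a i * inner_on X h (c i))"
proof -
  show 1: "inner_on X (\<lambda>x. \<Sum>i\<in>I. a i * c i x) h = (\<Sum>i\<in>I. a i * inner_on X (c i) h)" for h
    unfolding inner_on_def sum_distrib_left sum_distrib_right
    by (subst sum.swap) (simp add: mult.assoc)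
  then show "inner_on X h (\<lambda>x. \<Sum>i\<in>I. a i * c i x) = (\<Sum>i\<in>I. a i * inner_on X h (c i))"
    by (subst inner_on_commute) (simp add: inner_on_commute)
qed

lemma inner_on_diff: "inner_on X (\<lambda>x. f x - f' x) h = inner_on X f h - inner_on X f' h"
  by (simp add: inner_on_def sum_subtractf algebra_simps)

lemma inner_on_nonneg: "inner_on X f f \<ge> 0"
  by (auto simp: inner_on_def intro: sum_nonneg)

lemma inner_on_eq_0: "\<lbrakk>finite X; inner_on X f f = 0; x \<in> X\<rbrakk> \<Longrightarrow> f x = 0"
  by (auto simp: inner_on_def sum_nonneg_eq_0_iff)

text \<open>The residual is what Gram-Schmidt leaves over; the second claim is Pythagoras, and
  non-negativity of its left side is Bessel's inequality.\<close>

lemma inner_on_residual: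
  assumes "finite I" "orthonormal_on X I c"
  defines "r \<equiv> \<lambda>f x. f x - (\<Sum>i\<in>I. inner_on X f (c i) * c i x)"
  shows "j \<in> I \<Longrightarrow> inner_on X (r f) (c j) = 0"
    and "inner_on X (r f) (r f) = inner_on X f f - (\<Sum>i\<in>I. (inner_on X f (c i))\<^sup>2)"
proof -
  have ort: "inner_on X (r f) (c j) = 0" if "j \<in> I" for j
  proof -
    have "(\<Sum>i\<in>I. inner_on X f (c i) * inner_on X (c i) (c j)) = (\<Sum>i\<in>I. if i = j then inner_on X f (c i) else 0)"
      using assms(2) that by (intro sum.cong) (auto simp: orthonormal_on_def)
    then show ?thesis
      using assms(1) that by (simp add: r_def inner_on_diff inner_on_sum)
  qed
  then show "j \<in> I \<Longrightarrow> inner_on X (r f) (c j) = 0" .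
  let ?S = "\<lambda>x. \<Sum>i\<in>I. inner_on X f (c i) * c i x"
  have "inner_on X (r f) (r f) = inner_on X f (r f) - inner_on X ?S (r f)"
    by (subst (1) r_def) (rule inner_on_diff)
  also have "inner_on X ?S (r f) = 0"
    by (simp add: inner_on_sum(1) inner_on_commute[of X _ "r f"] ort)
  also have "inner_on X f (r f) = inner_on X (r f) f" by (rule inner_on_commute)
  also have "\<dots> = inner_on X f f - inner_on X ?S f"
    by (subst r_def) (rule inner_on_diff)
  also have "inner_on X ?S f = (\<Sum>i\<in>I. (inner_on X f (c i))\<^sup>2)"
    by (simp add: inner_on_sum(1) inner_on_commute[of X "c _" f] power2_eq_square)
  finally show "inner_on X (r f) (r f) = inner_on X f f - (\<Sum>i\<in>I. (inner_on X f (c i))\<^sup>2)" by simp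
qed

text \<open>Bessel's inequality for the point mass at \<open>x\<close> says that the squares of the
  values \<open>c i x\<close> sum to at most 1; now sum over \<open>x\<close>. This serves as the
  bound on dimensions.\<close>

lemma orthonormal_card_le:
  assumes "finite X" "finite I" "orthonormal_on X I c"
  shows "card I \<le> card X"
proof -
  have "(\<Sum>i\<in>I. (c i x)\<^sup>2) \<le> 1" if x: "x \<in> X" for x
  proof -
    define d where "d y = (if y = x then 1 else 0 :: real)" for y
    have d: "inner_on X d h = h x" for h
      using x assms(1) by (simp add: inner_on_def d_def if_distrib[of "\<lambda>c. c * _"] cong: if_cong)
    show ?thesis
      using inner_on_residual(2)[OF assms(2,3), of d]
        inner_on_nonneg[of X "\<lambda>y. d y - (\<Sum>i\<in>I. inner_on X d (c i) * c i y)"]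
      by (simp add: d) (simp add: d_def)
  qed
  then have "(\<Sum>x\<in>X. \<Sum>i\<in>I. (c i x)\<^sup>2) \<le> (\<Sum>x\<in>X. 1)" by (intro sum_mono)
  moreover have "(\<Sum>x\<in>X. \<Sum>i\<in>I. (c i x)\<^sup>2) = (\<Sum>i\<in>I. inner_on X (c i) (c i))"
    by (subst sum.swap) (simp add: inner_on_def power2_eq_square)
  moreover have "(\<Sum>i\<in>I. inner_on X (c i) (c i)) = real (card I)"
    using assms(3) by (simp add: orthonormal_on_def)
  ultimately show ?thesis by simp
qed

definition function_space :: "('a \<Rightarrow> real) set \<Rightarrow> bool" where
  "function_space V \<longleftrightarrow> (\<lambda>x. 0) \<in> V \<and> (\<forall>f\<in>V. \<forall>h\<in>V. \<forall>c. (\<lambda>x. f x + c * h x) \<in> V)"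

lemma function_spaceD:
  assumes "function_space V"
  shows "(\<lambda>x. 0) \<in> V" "\<lbrakk>f \<in> V; h \<in> V\<rbrakk> \<Longrightarrow> (\<lambda>x. f x + c * h x) \<in> V"
  using assms by (simp_all add: function_space_def)

lemma function_space_sum:
  assumes "function_space V" "finite I" "\<And>i. i \<in> I \<Longrightarrow> c i \<in> V"
  shows "(\<lambda>x. \<Sum>i\<in>I. a i * c i x) \<in> V"
  using assms(2,3)
proof (induction I)
  case empty
  then show ?case using assms(1) by (simp add: function_space_def)
next
  case (insert i I)
  then have "(\<lambda>x. (\<Sum>i\<in>I. a i * c i x) + a i * c i x) \<in> V"
    by (intro function_spaceD(2)[OF assms(1)]) simp_all
  then show ?case using insert by (simp add: add.commute)
qed

text \<open>For \<open>U\<close> a basis of a division algebra acting on \<open>V\<close> by similarities, this is an orthonormal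
  basis over that algebra.\<close>

lemma orthonormal_basis_exists:
  fixes V :: "('a \<Rightarrow> real) set" and E :: "'u \<Rightarrow> ('a \<Rightarrow> real) \<Rightarrow> 'a \<Rightarrow> real"
  assumes X: "finite X" and U: "finite U" "U \<noteq> {}" and V: "function_space V"
    and E: "\<And>u f. \<lbrakk>u \<in> U; f \<in> V\<rbrakk> \<Longrightarrow> E u f \<in> V"
    and diag: "\<And>u u' f. \<lbrakk>u \<in> U; u' \<in> U; f \<in> V\<rbrakk> \<Longrightarrow>
      inner_on X (E u f) (E u' f) = (if u = u' then inner_on X f f else 0)"
    and adj: "\<And>u u'. \<lbrakk>u \<in> U; u' \<in> U\<rbrakk> \<Longrightarrow>
      \<exists>u''\<in>U. \<exists>s. \<forall>f\<in>V. \<forall>h\<in>V. inner_on X (E u f) (E u' h) = s * inner_on X f (E u'' h)"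
  obtains n :: nat and b where "\<And>i. i < n \<Longrightarrow> b i \<in> V"
    and "orthonormal_on X ({..<n} \<times> U) (\<lambda>(i, u). E u (b i))"
    and "\<And>f x. \<lbrakk>f \<in> V; x \<in> X\<rbrakk> \<Longrightarrow> f x = (\<Sum>(i, u)\<in>{..<n} \<times> U. inner_on X f (E u (b i)) * E u (b i) x)"
proof -
  \<comment> \<open>\<open>P n\<close> says that an orthonormal family of \<open>n\<close> orbits
    exists. The cardinality bound makes a maximal \<open>n\<close> available, and maximality will
    force the expansion.\<close>
  define P where "P n \<longleftrightarrow> (\<exists>b. (\<forall>i<n. b i \<in> V) \<and> orthonormal_on X ({..<n} \<times> U) (\<lambda>(i, u). E u (b i)))"
    for n :: nat
  have "P 0" by (simp add: P_def orthonormal_on_def)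
  moreover have bound: "n \<le> card X" if Pn: "P n" for n
  proof -
    obtain b where "orthonormal_on X ({..<n} \<times> U) (\<lambda>(i, u). E u (b i))"
      using Pn unfolding P_def by blast
    then have "card ({..<n} \<times> U) \<le> card X"
      using X U by (intro orthonormal_card_le) auto
    then have le: "n * card U \<le> card X" by (simp add: card_cartesian_product)
    have "card U > 0" using U by (simp add: card_gt_0_iff)
    then have "n * 1 \<le> n * card U" by (intro mult_le_mono2) simp
    with le show ?thesis by (metis le_trans mult_1_right)
  qed
  ultimately have "{n. P n} \<subseteq> {..card X}" "0 \<in> {n. P n}" by auto
  then have "finite {n. P n}" "{n. P n} \<noteq> {}" by (auto intro: finite_subset)
  then have n: "P (Max {n. P n})" "\<And>m. P m \<Longrightarrow> m \<le> Max {n. P n}"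
    using Max_in[of "{n. P n}"] by auto
  define n where "n = Max {n. P n}"
  note n = n[folded n_def]
  obtain b where b: "\<And>i. i < n \<Longrightarrow> b i \<in> V"
    and on: "orthonormal_on X ({..<n} \<times> U) (\<lambda>(i, u). E u (b i))"
    using n(1) unfolding P_def by blast
  let ?I = "{..<n} \<times> U" and ?c = "\<lambda>(i, u). E u (b i)"
  have fin: "finite ?I" using U by simp
  have cV: "?c p \<in> V" if "p \<in> ?I" for p using that b E by auto
  have exp: "f x = (\<Sum>p\<in>?I. inner_on X f (?c p) * ?c p x)" if f: "f \<in> V" and x: "x \<in> X" for f x
  proof -
    define r where "r = (\<lambda>x. f x - (\<Sum>p\<in>?I. inner_on X f (?c p) * ?c p x))"
    have "(\<lambda>x. f x + (-1) * (\<Sum>p\<in>?I. inner_on X f (?c p) * ?c p x)) \<in> V"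
      by (intro function_spaceD(2)[OF V f] function_space_sum[OF V fin] cV)
    then have r: "r \<in> V" by (simp add: r_def)
    have ort: "inner_on X r (?c p) = 0" if "p \<in> ?I" for p
      unfolding r_def by (rule inner_on_residual(1)[OF fin on that])
    have "inner_on X r r = 0"
    proof (rule ccontr)
      assume "inner_on X r r \<noteq> 0"
      then have pos: "inner_on X r r > 0" using inner_on_nonneg[of X r] by simp
      define k where "k = 1 / sqrt (inner_on X r r)"
      define w where "w = (\<lambda>x. k * r x)"
      have wV: "w \<in> V" using function_space_sum[OF V, of "{()}" "\<lambda>_. r" "\<lambda>_. k"] r by (simp add: w_def)
      have ww: "inner_on X w w = 1"
        using pos by (simp add: w_def inner_on_def k_def sum_divide_distrib[symmetric] power2_eq_square[symmetric]
            power_divide)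
      have wc: "inner_on X w (?c p) = 0" if "p \<in> ?I" for p
      proof -
        have "inner_on X w (?c p) = k * inner_on X r (?c p)"
          by (simp add: w_def inner_on_def sum_distrib_left mult.assoc)
        then show ?thesis using ort[OF that] by simp
      qed
      \<comment> \<open>Two operators can be moved to one side, where they amount to a single one up
        to a factor; so the whole orbit of \<open>w\<close> is orthogonal to the old orbits.\<close>
      have Ew: "inner_on X (E u w) (E u' (b i)) = 0" if uu: "u \<in> U" "u' \<in> U" "i < n" for u u' i
      proof -
        obtain u'' s where "u'' \<in> U" "inner_on X (E u w) (E u' (b i)) = s * inner_on X w (E u'' (b i))"
          using adj[OF uu(1,2)] wV b[OF uu(3)] by blast
        then show ?thesis using wc[of "(i, u'')"] uu by simp
      qed
      let ?b = "b(n := w)"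
      have "orthonormal_on X ({..<Suc n} \<times> U) (\<lambda>(i, u). E u (?b i))"
        unfolding orthonormal_on_def
      proof (intro ballI)
        fix p q assume pq: "p \<in> {..<Suc n} \<times> U" "q \<in> {..<Suc n} \<times> U"
        obtain i u j v where pq': "p = (i, u)" "q = (j, v)" by (metis surj_pair)
        with pq have *: "i < Suc n" "u \<in> U" "j < Suc n" "v \<in> U" by auto
        consider "i < n" "j < n" | "i = n" "j < n" | "i < n" "j = n" | "i = n" "j = n"
          using * by force
        then have "inner_on X (E u (?b i)) (E v (?b j)) = (if (i, u) = (j, v) then 1 else 0)"
        proof cases
          case 1
          then show ?thesis using on * unfolding orthonormal_on_def by force
        next
          case 3
          then show ?thesis using Ew[of v u i] * by (simp add: inner_on_commute)
        qed (use * Ew diag wV ww in auto)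
        then show "inner_on X ((\<lambda>(i, u). E u (?b i)) p) ((\<lambda>(i, u). E u (?b i)) q) = (if p = q then 1 else 0)"
          by (simp add: pq')
      qed
      then have "P (Suc n)"
        unfolding P_def using b wV by (intro exI[of _ ?b]) (auto simp: less_Suc_eq)
      then show False using n(2) by force
    qed
    then have "r x = 0" using inner_on_eq_0[OF X _ x] by blast
    then show ?thesis by (simp add: r_def)
  qed
  show ?thesis
    by (rule that[of n b]) (use b on exp in \<open>auto simp: case_prod_beta\<close>)
qed

text \<open>The expansion is claimed on \<open>X\<close> alone, because the inner product does not
  see values elsewhere; equality of functions takes a separate argument off
  \<open>X\<close>.\<close>

definition onb_on :: "'a set \<Rightarrow> ('a \<Rightarrow> real) set \<Rightarrow> nat \<Rightarrow> (nat \<Rightarrow> 'a \<Rightarrow> real) \<Rightarrow> bool" where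
  "onb_on X V n b \<longleftrightarrow> (\<forall>i<n. b i \<in> V) \<and> orthonormal_on X {..<n} b \<and>
     (\<forall>f\<in>V. \<forall>x\<in>X. f x = (\<Sum>i<n. inner_on X f (b i) * b i x))"

lemma onb_exists:
  assumes "finite X" "function_space V"
  shows "\<exists>n b. onb_on X V n b"
proof (rule orthonormal_basis_exists[OF assms(1) _ _ assms(2), where U = "{()}" and E = "\<lambda>_ f. f"])
  fix n and b :: "nat \<Rightarrow> 'a \<Rightarrow> real"
  assume b: "\<And>i. i < n \<Longrightarrow> b i \<in> V"
    and on: "orthonormal_on X ({..<n} \<times> {()}) (\<lambda>(i, u). b i)"
    and ex: "\<And>f x. \<lbrakk>f \<in> V; x \<in> X\<rbrakk> \<Longrightarrow> f x = (\<Sum>(i, u)\<in>{..<n} \<times> {()}. inner_on X f (b i) * b i x)"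
  have "onb_on X V n b"
    unfolding onb_on_def
  proof (intro conjI allI impI ballI)
    show "orthonormal_on X {..<n} b" using on by (simp add: orthonormal_on_def)
    show "f x = (\<Sum>i<n. inner_on X f (b i) * b i x)" if "f \<in> V" "x \<in> X" for f x
      by (rule trans[OF ex[OF that]]) (simp add: sum.cartesian_product[symmetric])
  qed (use b in auto)
  then show "\<exists>n b. onb_on X V n b" by blast
next
  show "\<exists>u''\<in>{()}. \<exists>s. \<forall>f\<in>V. \<forall>h\<in>V. inner_on X f h = s * inner_on X f h" for u u' :: unit
    by (intro bexI[of _ "()"] exI[of _ 1]) auto
qed auto

lemma onb_parseval:
  assumes "onb_on X V n b" "f \<in> V"
  shows "inner_on X f h = (\<Sum>i<n. inner_on X f (b i) * inner_on X (b i) h)"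
proof -
  have "inner_on X f h = inner_on X (\<lambda>x. \<Sum>i<n. inner_on X f (b i) * b i x) h"
    unfolding inner_on_def[of X _ h]
    by (intro sum.cong refl arg_cong2[where f = "(*)"]) (use assms in \<open>unfold onb_on_def, blast\<close>)
  then show ?thesis by (simp only: inner_on_sum)
qed

section \<open>Orthogonal representations\<close>

lemma mat_mult_entry:
  "\<lbrakk>A \<in> carrier_mat m n; B \<in> carrier_mat n p; i < m; j < p\<rbrakk> \<Longrightarrow>
    (A * B) $$ (i, j) = (\<Sum>k<n. A $$ (i, k) * B $$ (k, j))"
  by (simp add: scalar_prod_def lessThan_atLeast0)

lemma mult_mat_vec_entry:
  "\<lbrakk>A \<in> carrier_mat m n; v \<in> carrier_vec n; i < m\<rbrakk> \<Longrightarrow> (A *\<^sub>v v) $ i = (\<Sum>k<n. A $$ (i, k) * v $ k)"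
  by (simp add: scalar_prod_def lessThan_atLeast0)

lemma mat_trace_commute:
  fixes A :: "'a::comm_semiring_0 mat"
  assumes "A \<in> carrier_mat m n" "B \<in> carrier_mat n m"
  shows "mat_trace (A * B) = mat_trace (B * A)"
proof -
  have "mat_trace (A * B) = (\<Sum>i<m. \<Sum>k<n. A $$ (i, k) * B $$ (k, i))"
    using assms by (simp add: mat_trace_def scalar_prod_def lessThan_atLeast0)
  also have "\<dots> = (\<Sum>k<n. \<Sum>i<m. B $$ (k, i) * A $$ (i, k))"
    by (subst sum.swap) (simp add: mult.commute)
  also have "\<dots> = mat_trace (B * A)"
    using assms by (simp add: mat_trace_def scalar_prod_def lessThan_atLeast0)
  finally show ?thesis .
qed

text \<open>Compare the traces of the two products, which are \<open>m\<close> and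
  \<open>n\<close>.\<close>

lemma inverse_mats_square:
  fixes A :: "real mat"
  assumes "A \<in> carrier_mat m n" "B \<in> carrier_mat n m" "A * B = 1\<^sub>m m" "B * A = 1\<^sub>m n"
  shows "m = n"
  using mat_trace_commute[OF assms(1,2)] assms(3,4) by (simp add: mat_trace_def)

lemma GL_iff:
  "A \<in> carrier (GL n) \<longleftrightarrow> A \<in> carrier_mat n n \<and> (\<exists>B \<in> carrier_mat n n. A * B = 1\<^sub>m n \<and> B * A = 1\<^sub>m n)"
  by (auto simp: GL_def units_of_def Units_def ring_mat_simps)

lemma GL_mult: "A \<otimes>\<^bsub>GL n\<^esub> B = A * B"
  by (simp add: GL_def units_of_def ring_mat_simps)

lemma irreducible_reps_iff:
  "(n, \<rho>) \<in> irreducible_reps G \<longleftrightarrow> (n, \<rho>) \<in> real_reps G \<and> n > 0 \<and>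
    (\<forall>W \<subseteq> carrier_vec n. 0\<^sub>v n \<in> W \<longrightarrow> (\<forall>v\<in>W. \<forall>w\<in>W. v + w \<in> W) \<longrightarrow> (\<forall>c. \<forall>v\<in>W. c \<cdot>\<^sub>v v \<in> W) \<longrightarrow>
       (\<forall>g\<in>carrier G. \<forall>w\<in>W. \<rho> g *\<^sub>v w \<in> W) \<longrightarrow> W = {0\<^sub>v n} \<or> W = carrier_vec n)"
proof -
  interpret vec_space "TYPE(real)" n .
  have "vectorspace class_ring (module_vec TYPE(real) n)" by unfold_locales
  then have sub: "VectorSpace.subspace class_ring W (module_vec TYPE(real) n) \<longleftrightarrow> W \<subseteq> carrier_vec n \<and> 0\<^sub>v n \<in> W \<and>
      (\<forall>v\<in>W. \<forall>w\<in>W. v + w \<in> W) \<and> (\<forall>c. \<forall>v\<in>W. c \<cdot>\<^sub>v v \<in> W)" for W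
    unfolding VectorSpace.subspace_def submodule_def vectorspace_def module_vec_simps
    by auto
  show ?thesis
    by (simp only: irreducible_reps_def mem_Collect_eq prod.case sub imp_conjL)
qed

context fin_group
begin

text \<open>Invertibility of the values is traded for \<open>\<rho> \<one>\<close> being the
  identity matrix. In one direction an invertible idempotent is the identity; in the other
  \<open>\<rho> (inv g)\<close> is the inverse.\<close>

lemma real_reps_iff:
  "(n, \<rho>) \<in> real_reps G \<longleftrightarrow> \<rho> \<in> extensional (carrier G) \<and> (\<forall>g\<in>carrier G. \<rho> g \<in> carrier_mat n n) \<and>
    (\<forall>g\<in>carrier G. \<forall>h\<in>carrier G. \<rho> (g \<otimes> h) = \<rho> g * \<rho> h) \<and> \<rho> \<one> = 1\<^sub>m n"
proof (intro iffI)
  assume r: "(n, \<rho>) \<in> real_reps G"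
  then have h: "\<And>g. g \<in> carrier G \<Longrightarrow> \<rho> g \<in> carrier (GL n)"
    "\<And>g h. \<lbrakk>g \<in> carrier G; h \<in> carrier G\<rbrakk> \<Longrightarrow> \<rho> (g \<otimes> h) = \<rho> g * \<rho> h"
    by (auto simp: real_reps_def hom_def GL_mult Pi_iff)
  obtain B where B: "B \<in> carrier_mat n n" "B * \<rho> \<one> = 1\<^sub>m n"
    using h(1)[OF one_closed] by (auto simp: GL_iff)
  have c: "\<rho> \<one> \<in> carrier_mat n n" using h(1)[OF one_closed] by (auto simp: GL_iff)
  have "\<rho> \<one> = \<rho> \<one> * \<rho> \<one>" using h(2)[OF one_closed one_closed] by simp
  then have "B * \<rho> \<one> = B * (\<rho> \<one> * \<rho> \<one>)" by (rule arg_cong)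
  also have "\<dots> = (B * \<rho> \<one>) * \<rho> \<one>" by (rule assoc_mult_mat[OF B(1) c c, symmetric])
  finally have "\<rho> \<one> = 1\<^sub>m n" using c by (simp add: B(2))
  then show "\<rho> \<in> extensional (carrier G) \<and> (\<forall>g\<in>carrier G. \<rho> g \<in> carrier_mat n n) \<and>
    (\<forall>g\<in>carrier G. \<forall>h\<in>carrier G. \<rho> (g \<otimes> h) = \<rho> g * \<rho> h) \<and> \<rho> \<one> = 1\<^sub>m n"
    using r h by (auto simp: real_reps_def GL_iff)
next
  assume r: "\<rho> \<in> extensional (carrier G) \<and> (\<forall>g\<in>carrier G. \<rho> g \<in> carrier_mat n n) \<and>
    (\<forall>g\<in>carrier G. \<forall>h\<in>carrier G. \<rho> (g \<otimes> h) = \<rho> g * \<rho> h) \<and> \<rho> \<one> = 1\<^sub>m n"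
  have "\<rho> g \<in> carrier (GL n)" if g: "g \<in> carrier G" for g
  proof -
    have *: "\<rho> (x \<otimes> y) = \<rho> x * \<rho> y" if "x \<in> carrier G" "y \<in> carrier G" for x y
      using r that by blast
    have "\<rho> g * \<rho> (inv g) = 1\<^sub>m n" "\<rho> (inv g) * \<rho> g = 1\<^sub>m n"
      unfolding *[symmetric, OF g inv_closed[OF g]] *[symmetric, OF inv_closed[OF g] g]
      using r g by simp_all
    then show ?thesis unfolding GL_iff using r g by (intro conjI bexI[of _ "\<rho> (inv g)"]) simp_all
  qed
  then show "(n, \<rho>) \<in> real_reps G" using r by (auto simp: real_reps_def hom_def GL_mult)
qed

definition orth_rep :: "nat \<Rightarrow> ('g \<Rightarrow> real mat) \<Rightarrow> bool" where
  "orth_rep n \<sigma> \<longleftrightarrow> (n, \<sigma>) \<in> real_reps G \<and> (\<forall>g\<in>carrier G. transpose_mat (\<sigma> g) = \<sigma> (inv g))"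

lemma repD:
  assumes "(n, \<rho>) \<in> real_reps G"
  shows "g \<in> carrier G \<Longrightarrow> \<rho> g \<in> carrier_mat n n"
    "\<lbrakk>g \<in> carrier G; h \<in> carrier G\<rbrakk> \<Longrightarrow> \<rho> (g \<otimes> h) = \<rho> g * \<rho> h"
    "\<rho> \<one> = 1\<^sub>m n"
  using assms by (auto simp: real_reps_iff)

lemma orth_repD:
  assumes "orth_rep n \<sigma>"
  shows "(n, \<sigma>) \<in> real_reps G" "g \<in> carrier G \<Longrightarrow> transpose_mat (\<sigma> g) = \<sigma> (inv g)"
  using assms by (auto simp: orth_rep_def)

text \<open>For an orthonormal basis \<open>b\<close> of an invariant space this is the matrix of
  the action \<open>L\<close>. It is cut off outside the carrier, as \<open>real_reps\<close>
  demands.\<close>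

definition matrix_rep ::
  "'x set \<Rightarrow> nat \<Rightarrow> (nat \<Rightarrow> 'x \<Rightarrow> real) \<Rightarrow> ('g \<Rightarrow> ('x \<Rightarrow> real) \<Rightarrow> 'x \<Rightarrow> real) \<Rightarrow> 'g \<Rightarrow> real mat" where
  "matrix_rep X n b L = (\<lambda>g\<in>carrier G. mat n n (\<lambda>(k, l). inner_on X (b k) (L g (b l))))"

context
  fixes X :: "'x set" and V n b and L :: "'g \<Rightarrow> ('x \<Rightarrow> real) \<Rightarrow> 'x \<Rightarrow> real"
  assumes b: "onb_on X V n b"
    and L: "\<And>g f. \<lbrakk>g \<in> carrier G; f \<in> V\<rbrakk> \<Longrightarrow> L g f \<in> V"
    and L_inner: "\<And>g f h. \<lbrakk>g \<in> carrier G; f \<in> V; h \<in> V\<rbrakk> \<Longrightarrow> inner_on X (L g f) (L g h) = inner_on X f h"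
    and L_mult: "\<And>g h f. \<lbrakk>g \<in> carrier G; h \<in> carrier G; f \<in> V\<rbrakk> \<Longrightarrow> L (g \<otimes> h) f = L g (L h f)"
    and L_one: "\<And>f. f \<in> V \<Longrightarrow> L \<one> f = f"
begin

lemma action_adjoint:
  assumes g: "g \<in> carrier G" and fh: "f \<in> V" "h \<in> V"
  shows "inner_on X h (L g f) = inner_on X (L (inv g) h) f"
proof -
  have "inner_on X h (L g f) = inner_on X (L g (L (inv g) h)) (L g f)"
    using L_mult[of g "inv g" h] g fh L_one by simp
  also have "\<dots> = inner_on X (L (inv g) h) f"
    using g fh L by (intro L_inner) auto
  finally show ?thesis .
qed

lemma matrix_rep_action:
  assumes g: "g \<in> carrier G" and f: "f \<in> V" and k: "k < n"
  shows "inner_on X (b k) (L g f) = (\<Sum>l<n. matrix_rep X n b L g $$ (k, l) * inner_on X (b l) f)"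
proof -
  let ?R = "matrix_rep X n b L"
  have bV: "b l \<in> V" if "l < n" for l using b that by (simp add: onb_on_def)
  have "inner_on X (b k) (L g f) = inner_on X (L (inv g) (b k)) f"
    by (rule action_adjoint[OF g f bV[OF k]])
  also have "\<dots> = (\<Sum>l<n. inner_on X (L (inv g) (b k)) (b l) * inner_on X (b l) f)"
    using g by (intro onb_parseval[OF b] L bV k) auto
  also have "\<dots> = (\<Sum>l<n. ?R g $$ (k, l) * inner_on X (b l) f)"
    using g k by (intro sum.cong refl) (simp add: matrix_rep_def action_adjoint bV)
  finally show ?thesis .
qed

lemma orth_rep_matrix_rep: "orth_rep n (matrix_rep X n b L)"
proof -
  let ?R = "matrix_rep X n b L"
  have bV: "b l \<in> V" if "l < n" for l using b that by (simp add: onb_on_def)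
  have "?R (g \<otimes> h) = ?R g * ?R h" if gh: "g \<in> carrier G" "h \<in> carrier G" for g h
  proof (rule eq_matI)
    fix i j assume "i < dim_row (?R g * ?R h)" "j < dim_col (?R g * ?R h)"
    then have ij: "i < n" "j < n" using gh by (auto simp: matrix_rep_def)
    have "?R (g \<otimes> h) $$ (i, j) = inner_on X (b i) (L g (L h (b j)))"
      using gh ij by (simp add: matrix_rep_def L_mult bV)
    also have "\<dots> = (\<Sum>l<n. ?R g $$ (i, l) * inner_on X (b l) (L h (b j)))"
      using gh ij by (intro matrix_rep_action L bV)
    also have "\<dots> = (\<Sum>l<n. ?R g $$ (i, l) * ?R h $$ (l, j))"
      using gh ij by (intro sum.cong refl) (simp add: matrix_rep_def)
    also have "\<dots> = (?R g * ?R h) $$ (i, j)"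
      using gh ij by (intro mat_mult_entry[symmetric, of _ n n _ n]) (auto simp: matrix_rep_def)
    finally show "?R (g \<otimes> h) $$ (i, j) = (?R g * ?R h) $$ (i, j)" .
  qed (use that in \<open>auto simp: matrix_rep_def\<close>)
  moreover have "?R \<one> = 1\<^sub>m n"
  proof (rule eq_matI)
    fix i j assume "i < dim_row (1\<^sub>m n)" "j < dim_col (1\<^sub>m n)"
    then show "?R \<one> $$ (i, j) = 1\<^sub>m n $$ (i, j)"
      using b L_one bV by (simp add: matrix_rep_def onb_on_def orthonormal_on_def)
  qed (auto simp: matrix_rep_def)
  moreover have "transpose_mat (?R g) = ?R (inv g)" if g: "g \<in> carrier G" for g
  proof (rule eq_matI)
    fix i j assume "i < dim_row (?R (inv g))" "j < dim_col (?R (inv g))"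
    then have ij: "i < n" "j < n" using g by (auto simp: matrix_rep_def)
    then show "transpose_mat (?R g) $$ (i, j) = ?R (inv g) $$ (i, j)"
      using g action_adjoint[of g "b i" "b j"] by (simp add: matrix_rep_def bV inner_on_commute[of X "b i"])
  qed (use g in \<open>auto simp: matrix_rep_def\<close>)
  ultimately show ?thesis
    by (auto simp: orth_rep_def real_reps_iff) (auto simp: matrix_rep_def)
qed

end

lemma rep_iso_rel_iff:
  "((n, \<rho>), (m, \<sigma>)) \<in> rep_iso_rel G \<longleftrightarrow> (n, \<rho>) \<in> real_reps G \<and> (m, \<sigma>) \<in> real_reps G \<and> n = m \<and>
    (\<exists>P Q. P \<in> carrier_mat n n \<and> Q \<in> carrier_mat n n \<and> P * Q = 1\<^sub>m n \<and> Q * P = 1\<^sub>m n \<and>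
      (\<forall>g\<in>carrier G. P * \<rho> g = \<sigma> g * P))"
  by (simp add: rep_iso_rel_def Bex_def GL_iff) blast

text \<open>Weyl's averaging, arranged so that no new inner product is introduced:
  \<open>\<Phi>\<close> embeds the space into functions on the group times the index range by
  sending \<open>v\<close> to all the entries of \<open>\<rho> g v\<close>, and there the standard
  inner product is the averaged one. Right translation restricts to \<open>\<rho>\<close> and is
  orthogonal.\<close>

lemma equivalent_orth_rep:
  assumes r: "(N, \<rho>) \<in> real_reps G"
  shows "\<exists>\<sigma>. orth_rep N \<sigma> \<and> ((N, \<rho>), (N, \<sigma>)) \<in> rep_iso_rel G"
proof -
  note rD = repD[OF r]
  define X where "X = carrier G \<times> {..<N}"
  define \<Phi> where "\<Phi> v = (\<lambda>(g, i). if g \<in> carrier G \<and> i < N then (\<rho> g *\<^sub>v v) $ i else 0)" for v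
  define V where "V = \<Phi> ` carrier_vec N"
  define L where "L h F = (\<lambda>(g, i). if g \<in> carrier G then F (g \<otimes> h, i) else 0)" for h and F :: "'g \<times> nat \<Rightarrow> real"
  have X: "finite X" using finite_G by (simp add: X_def)
  have \<Phi>_entry: "\<Phi> v (g, i) = (\<Sum>j<N. v $ j * \<Phi> (unit_vec N j) (g, i))" if v: "v \<in> carrier_vec N" for v g i
  proof (cases "g \<in> carrier G \<and> i < N")
    case True
    have "\<Phi> (unit_vec N j) (g, i) = \<rho> g $$ (i, j)" if "j < N" for j
    proof -
      have "\<Phi> (unit_vec N j) (g, i) = (\<Sum>k<N. \<rho> g $$ (i, k) * unit_vec N j $ k)"
        using True rD(1)[of g] by (simp add: \<Phi>_def mult_mat_vec_entry[of _ N N] del: index_mult_mat_vec)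
      also have "\<dots> = (\<Sum>k<N. if k = j then \<rho> g $$ (i, k) else 0)"
        using that by (intro sum.cong refl) (auto simp: unit_vec_def)
      finally show ?thesis using that by simp
    qed
    then show ?thesis
      using True rD(1)[of g] v by (simp add: \<Phi>_def mult_mat_vec_entry[of _ N N] mult.commute del: index_mult_mat_vec)
  qed (auto simp: \<Phi>_def)
  have \<Phi>_L: "L h (\<Phi> v) = \<Phi> (\<rho> h *\<^sub>v v)" if h: "h \<in> carrier G" and v: "v \<in> carrier_vec N" for h v
  proof
    fix p :: "'g \<times> nat"
    obtain g i where p: "p = (g, i)" by (cases p)
    show "L h (\<Phi> v) p = \<Phi> (\<rho> h *\<^sub>v v) p"
      using h v rD(1)[of g] rD(1)[of h] rD(2)[of g h]
      by (simp add: p L_def \<Phi>_def assoc_mult_mat_vec[of _ N N _ N] del: index_mult_mat_vec)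
  qed
  have \<Phi>_one: "\<Phi> v (\<one>, i) = v $ i" if "v \<in> carrier_vec N" "i < N" for v i
    using that by (simp add: \<Phi>_def rD(3))
  have V: "function_space V"
    unfolding function_space_def
  proof (intro conjI ballI allI)
    have "\<Phi> (0\<^sub>v N) = (\<lambda>x. 0)"
      by (auto simp: fun_eq_iff \<Phi>_entry[OF zero_carrier_vec])
    then show "(\<lambda>x. 0) \<in> V" unfolding V_def by (metis image_eqI zero_carrier_vec)
    fix f h c assume "f \<in> V" "h \<in> V"
    then obtain v w where v: "v \<in> carrier_vec N" "f = \<Phi> v" and w: "w \<in> carrier_vec N" "h = \<Phi> w"
      by (auto simp: V_def)
    have "\<Phi> (v + c \<cdot>\<^sub>v w) = (\<lambda>x. f x + c * h x)"
    proof
      fix p :: "'g \<times> nat"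
    obtain g i where p: "p = (g, i)" by (cases p)
      show "\<Phi> (v + c \<cdot>\<^sub>v w) p = f p + c * h p"
      proof -
        have "\<Phi> (v + c \<cdot>\<^sub>v w) (g, i) = (\<Sum>j<N. (v + c \<cdot>\<^sub>v w) $ j * \<Phi> (unit_vec N j) (g, i))"
          by (rule \<Phi>_entry) (use v w in simp)
        also have "\<dots> = (\<Sum>j<N. v $ j * \<Phi> (unit_vec N j) (g, i)) + c * (\<Sum>j<N. w $ j * \<Phi> (unit_vec N j) (g, i))"
          unfolding sum_distrib_left sum.distrib[symmetric]
          using v(1) w(1) by (intro sum.cong refl) (simp add: algebra_simps)
        also have "\<dots> = f (g, i) + c * h (g, i)"
          by (simp only: v(2) w(2) \<Phi>_entry[OF v(1), symmetric] \<Phi>_entry[OF w(1), symmetric])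
        finally show ?thesis by (simp only: p)
      qed
    qed
    then show "(\<lambda>x. f x + c * h x) \<in> V" unfolding V_def using v w by (metis add_carrier_vec image_eqI smult_carrier_vec)
  qed
  obtain n b where b: "onb_on X V n b" using onb_exists[OF X V] by blast
  have bV: "b l \<in> V" if "l < n" for l using b that by (simp add: onb_on_def)
  have LV: "L g f \<in> V" if "g \<in> carrier G" "f \<in> V" for g f
    using that rD(1)[of g] by (auto simp: V_def \<Phi>_L intro!: imageI mult_mat_vec_carrier)
  have L_inner: "inner_on X (L g f) (L g h) = inner_on X f h" if g: "g \<in> carrier G" for g f h
  proof -
    have "inner_on X (L g f) (L g h) = (\<Sum>x\<in>carrier G. \<Sum>i<N. f (x \<otimes> g, i) * h (x \<otimes> g, i))"
      unfolding inner_on_def X_def sum.cartesian_product' by (simp add: L_def)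
    also have "\<dots> = inner_on X f h"
      unfolding inner_on_def X_def sum.cartesian_product' by (rule sum_right_mult[OF g])
    finally show ?thesis .
  qed
  have L_mult: "L (g \<otimes> h) f = L g (L h f)" if "g \<in> carrier G" "h \<in> carrier G" for g h f
    using that by (auto simp: L_def fun_eq_iff m_assoc)
  have L_one: "L \<one> f = f" if "f \<in> V" for f
    using that by (auto simp: L_def fun_eq_iff V_def \<Phi>_def)
  define \<sigma> where "\<sigma> = matrix_rep X n b L"
  have orth: "orth_rep n \<sigma>"
    unfolding \<sigma>_def by (rule orth_rep_matrix_rep[OF b LV L_inner L_mult L_one])
  have act: "inner_on X (b k) (L g f) = (\<Sum>l<n. \<sigma> g $$ (k, l) * inner_on X (b l) f)"
    if "g \<in> carrier G" "f \<in> V" "k < n" for g f k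
    unfolding \<sigma>_def by (rule matrix_rep_action[OF b LV L_inner L_mult L_one that])
  \<comment> \<open>\<open>P\<close> takes coordinates in the orthonormal basis, and
    \<open>Q\<close> recovers a vector from a function by evaluation at the unit.\<close>
  define P where "P = mat n N (\<lambda>(k, j). inner_on X (b k) (\<Phi> (unit_vec N j)))"
  define Q where "Q = mat N n (\<lambda>(j, k). b k (\<one>, j))"
  have P_entry: "inner_on X (b k) (\<Phi> v) = (\<Sum>j<N. P $$ (k, j) * v $ j)" if v: "v \<in> carrier_vec N" and k: "k < n" for v k
  proof -
    have "\<Phi> v = (\<lambda>p. \<Sum>j<N. v $ j * \<Phi> (unit_vec N j) p)"
      using \<Phi>_entry[OF v] by (auto simp: fun_eq_iff)
    then have "inner_on X (b k) (\<Phi> v) = inner_on X (b k) (\<lambda>p. \<Sum>j<N. v $ j * \<Phi> (unit_vec N j) p)" by simp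
    also have "\<dots> = (\<Sum>j<N. v $ j * inner_on X (b k) (\<Phi> (unit_vec N j)))" by (rule inner_on_sum(2))
    finally show ?thesis using k by (simp add: P_def mult.commute)
  qed
  have PQ: "P * Q = 1\<^sub>m n"
  proof (rule eq_matI)
    fix k l assume "k < dim_row (1\<^sub>m n)" "l < dim_col (1\<^sub>m n)"
    then have kl: "k < n" "l < n" by auto
    obtain w where w: "w \<in> carrier_vec N" "b l = \<Phi> w" using bV[OF kl(2)] by (auto simp: V_def)
    have "(P * Q) $$ (k, l) = (\<Sum>j<N. P $$ (k, j) * Q $$ (j, l))"
      by (rule mat_mult_entry[of _ n N _ n]) (use kl in \<open>auto simp: P_def Q_def\<close>)
    also have "\<dots> = (\<Sum>j<N. P $$ (k, j) * w $ j)"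
      using kl w by (intro sum.cong refl) (simp add: Q_def \<Phi>_one)
    also have "\<dots> = inner_on X (b k) (b l)" using P_entry[OF w(1) kl(1)] w by simp
    also have "\<dots> = 1\<^sub>m n $$ (k, l)" using b kl by (simp add: onb_on_def orthonormal_on_def)
    finally show "(P * Q) $$ (k, l) = 1\<^sub>m n $$ (k, l)" .
  qed (auto simp: P_def Q_def)
  have QP: "Q * P = 1\<^sub>m N"
  proof (rule eq_matI)
    fix i j assume "i < dim_row (1\<^sub>m N)" "j < dim_col (1\<^sub>m N)"
    then have ij: "i < N" "j < N" by auto
    have "(Q * P) $$ (i, j) = (\<Sum>k<n. Q $$ (i, k) * P $$ (k, j))"
      by (rule mat_mult_entry[of _ N n _ N]) (use ij in \<open>auto simp: P_def Q_def\<close>)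
    also have "\<dots> = (\<Sum>k<n. inner_on X (\<Phi> (unit_vec N j)) (b k) * b k (\<one>, i))"
      using ij by (intro sum.cong refl) (simp add: P_def Q_def inner_on_commute[of X "b _"])
    also have "\<dots> = \<Phi> (unit_vec N j) (\<one>, i)"
      using b ij unfolding onb_on_def by (auto simp: V_def X_def)
    also have "\<dots> = 1\<^sub>m N $$ (i, j)" using ij by (simp add: \<Phi>_one)
    finally show "(Q * P) $$ (i, j) = 1\<^sub>m N $$ (i, j)" .
  qed (auto simp: P_def Q_def)
  have c: "P \<in> carrier_mat n N" "Q \<in> carrier_mat N n" by (auto simp: P_def Q_def)
  \<comment> \<open>The orthonormal basis has the right length because the two matrices are inverse
    to each other.\<close>
  have nN: "n = N" by (rule inverse_mats_square[OF c PQ QP])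
  have "P * \<rho> g = \<sigma> g * P" if g: "g \<in> carrier G" for g
  proof (rule eq_matI)
    note sg = repD(1)[OF orth_repD(1)[OF orth] g]
    fix k j assume "k < dim_row (\<sigma> g * P)" "j < dim_col (\<sigma> g * P)"
    then have kj: "k < n" "j < N" using sg c by auto
    have "(P * \<rho> g) $$ (k, j) = (\<Sum>i<N. P $$ (k, i) * (\<rho> g *\<^sub>v unit_vec N j) $ i)"
      using kj rD(1)[OF g] c by (subst mat_mult_entry[of _ n N _ N]) auto
    also have "\<dots> = inner_on X (b k) (L g (\<Phi> (unit_vec N j)))"
      using kj g rD(1)[OF g] by (simp add: P_entry \<Phi>_L mult_mat_vec_carrier[of _ N N] del: index_mult_mat_vec)
    also have "\<dots> = (\<Sum>l<n. \<sigma> g $$ (k, l) * inner_on X (b l) (\<Phi> (unit_vec N j)))"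
      using kj g by (intro act) (auto simp: V_def)
    also have "\<dots> = (\<sigma> g * P) $$ (k, j)"
      using kj sg c by (subst mat_mult_entry[of _ n n _ N]) (auto simp: P_def)
    finally show "(P * \<rho> g) $$ (k, j) = (\<sigma> g * P) $$ (k, j)" .
  qed (use repD(1)[OF orth_repD(1)[OF orth] g] rD(1)[OF g] c in auto)
  then show ?thesis
    using orth r c PQ QP orth_repD(1)[OF orth] unfolding nN rep_iso_rel_iff by blast
qed

end

section \<open>Completeness of the matrix coefficients\<close>

context fin_group
begin

definition left_translate :: "'g \<Rightarrow> ('g \<Rightarrow> real) \<Rightarrow> 'g \<Rightarrow> real" where
  "left_translate h f = (\<lambda>x. if x \<in> carrier G then f (inv h \<otimes> x) else 0)"

text \<open>The functions orthogonal to all matrix coefficients form an invariant subspace.  A minimal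
  invariant subspace of it is irreducible, and each of its elements is a combination of its own
  matrix coefficients, hence orthogonal to itself.\<close>

lemma coefficients_complete:
  assumes f0: "\<And>x. x \<notin> carrier G \<Longrightarrow> f x = 0"
    and orth0: "\<And>n \<sigma> a b. \<lbrakk>orth_rep n \<sigma>; (n, \<sigma>) \<in> irreducible_reps G; a < n; b < n\<rbrakk> \<Longrightarrow>
      (\<Sum>g\<in>carrier G. f g * \<sigma> g $$ (a, b)) = 0"
  shows "f = (\<lambda>x. 0)"
proof (rule ccontr)
  assume nz: "f \<noteq> (\<lambda>x. 0)"
  let ?X = "carrier G" and ?L = left_translate
  define Z where "Z = {f. (\<forall>x. x \<notin> carrier G \<longrightarrow> f x = 0) \<and>
    (\<forall>n \<sigma> a b. orth_rep n \<sigma> \<longrightarrow> (n, \<sigma>) \<in> irreducible_reps G \<longrightarrow> a < n \<longrightarrow> b < n \<longrightarrow>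
      (\<Sum>g\<in>carrier G. f g * \<sigma> g $$ (a, b)) = 0)}"
  have ZD: "x \<notin> carrier G \<Longrightarrow> f x = 0"
    "\<lbrakk>orth_rep n \<sigma>; (n, \<sigma>) \<in> irreducible_reps G; a < n; b < n\<rbrakk> \<Longrightarrow> (\<Sum>g\<in>carrier G. f g * \<sigma> g $$ (a, b)) = 0"
    if "f \<in> Z" for f x n \<sigma> a b
    using that by (auto simp: Z_def)
  define inv_space where "inv_space W \<longleftrightarrow> function_space W \<and> W \<subseteq> Z \<and> (\<forall>h\<in>carrier G. \<forall>f\<in>W. ?L h f \<in> W)" for W
  have fZ: "f \<in> Z" using f0 orth0 by (simp add: Z_def)
  have Z: "inv_space Z"
    unfolding inv_space_def function_space_def
  proof (intro conjI ballI allI order_refl)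
    show "(\<lambda>x. 0) \<in> Z" by (simp add: Z_def)
    show "(\<lambda>x. f x + c * h x) \<in> Z" if "f \<in> Z" "h \<in> Z" for f h c
      using that by (simp add: Z_def algebra_simps sum.distrib sum_distrib_left[symmetric])
    fix h f assume h: "h \<in> carrier G" and f: "f \<in> Z"
    have "(\<Sum>g\<in>carrier G. ?L h f g * \<sigma> g $$ (a, b)) = 0"
      if s: "orth_rep n \<sigma>" "(n, \<sigma>) \<in> irreducible_reps G" and ab: "a < n" "b < n" for n \<sigma> a b
    proof -
      note sD = repD[OF orth_repD(1)[OF s(1)]]
      have "(\<Sum>g\<in>carrier G. ?L h f g * \<sigma> g $$ (a, b)) = (\<Sum>g\<in>carrier G. ?L h f (h \<otimes> g) * \<sigma> (h \<otimes> g) $$ (a, b))"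
        by (rule sum_left_mult[OF h, symmetric])
      also have "\<dots> = (\<Sum>g\<in>carrier G. \<Sum>k<n. \<sigma> h $$ (a, k) * (f g * \<sigma> g $$ (k, b)))"
      proof (rule sum.cong[OF refl])
        fix g assume g: "g \<in> carrier G"
        have "\<sigma> (h \<otimes> g) $$ (a, b) = (\<Sum>k<n. \<sigma> h $$ (a, k) * \<sigma> g $$ (k, b))"
          unfolding sD(2)[OF h g] by (rule mat_mult_entry[OF sD(1)[OF h] sD(1)[OF g] ab])
        then show "?L h f (h \<otimes> g) * \<sigma> (h \<otimes> g) $$ (a, b) = (\<Sum>k<n. \<sigma> h $$ (a, k) * (f g * \<sigma> g $$ (k, b)))"
          using g h by (simp add: left_translate_def m_assoc[symmetric] sum_distrib_left mult_ac)
      qed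
      also have "\<dots> = (\<Sum>k<n. \<sigma> h $$ (a, k) * (\<Sum>g\<in>carrier G. f g * \<sigma> g $$ (k, b)))"
        by (subst sum.swap) (simp add: sum_distrib_left)
      also have "\<dots> = 0" using ZD(2)[OF f s _ ab(2)] by simp
      finally show ?thesis .
    qed
    then show "?L h f \<in> Z" by (simp add: Z_def left_translate_def)
  qed
  \<comment> \<open>The size of an invariant space is measured by the length of an orthonormal
    basis; \<open>n\<close> will be the smallest positive length.\<close>
  define Q where "Q n \<longleftrightarrow> n > 0 \<and> (\<exists>W b. inv_space W \<and> onb_on ?X W n b)" for n
  have onb: "\<exists>n b. onb_on ?X W n b" if "inv_space W" for W
    using onb_exists[OF finite_G] that by (auto simp: inv_space_def)
  obtain n0 b0 where b0: "onb_on ?X Z n0 b0" using onb[OF Z] by blast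
  have "n0 \<noteq> 0"
  proof
    assume "n0 = 0"
    then have "f x = 0" for x
      using b0 fZ f0[of x] by (cases "x \<in> carrier G") (auto simp: onb_on_def)
    then show False using nz by auto
  qed
  then have "Q n0" using Z b0 by (auto simp: Q_def)
  then have Qn: "Q (LEAST n. Q n)" and least: "\<And>m. Q m \<Longrightarrow> (LEAST n. Q n) \<le> m"
    by (auto intro: LeastI Least_le)
  define n where "n = (LEAST n. Q n)"
  note Qn = Qn[folded n_def] and least = least[folded n_def]
  obtain W b where W: "inv_space W" and b: "onb_on ?X W n b" and n: "n > 0"
    using Qn by (auto simp: Q_def)
  have WZ: "W \<subseteq> Z" and LW: "\<And>h f. \<lbrakk>h \<in> carrier G; f \<in> W\<rbrakk> \<Longrightarrow> ?L h f \<in> W" and Wf: "function_space W"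
    using W by (auto simp: inv_space_def)
  have W0: "f x = 0" if "f \<in> W" "x \<notin> carrier G" for f x using ZD(1) WZ that by blast
  have bW: "b k \<in> W" if "k < n" for k using b that by (simp add: onb_on_def)
  have L_inner: "inner_on ?X (?L g f) (?L g h) = inner_on ?X f h" if "g \<in> carrier G" for g f h
    using sum_left_mult[of "inv g" "\<lambda>x. f x * h x"] that by (simp add: inner_on_def left_translate_def)
  have L_mult: "?L (g \<otimes> h) f = ?L g (?L h f)" if "g \<in> carrier G" "h \<in> carrier G" for g h f
    using that by (auto simp: left_translate_def fun_eq_iff inv_mult_group m_assoc)
  have L_one: "?L \<one> f = f" if "f \<in> W" for f
    using W0[OF that] by (auto simp: left_translate_def fun_eq_iff)
  define \<sigma> where "\<sigma> = matrix_rep ?X n b ?L"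
  have orth: "orth_rep n \<sigma>"
    unfolding \<sigma>_def by (rule orth_rep_matrix_rep[OF b LW L_inner L_mult L_one])
  note sD = repD[OF orth_repD(1)[OF orth]]
  have act: "inner_on ?X (b k) (?L g f) = (\<Sum>l<n. \<sigma> g $$ (k, l) * inner_on ?X (b l) f)"
    if "g \<in> carrier G" "f \<in> W" "k < n" for g f k
    unfolding \<sigma>_def by (rule matrix_rep_action[OF b LW L_inner L_mult L_one that])
  have ext: "f = h" if "f \<in> W" "h \<in> W" "\<And>k. k < n \<Longrightarrow> inner_on ?X (b k) f = inner_on ?X (b k) h" for f h
  proof
    fix x show "f x = h x"
    proof (cases "x \<in> carrier G")
      case x: True
      have "f x = (\<Sum>i<n. inner_on ?X f (b i) * b i x)" using b that x unfolding onb_on_def by blast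
      also have "\<dots> = (\<Sum>i<n. inner_on ?X h (b i) * b i x)"
        using that(3) by (intro sum.cong refl) (simp add: inner_on_commute[of _ f] inner_on_commute[of _ h])
      also have "\<dots> = h x" using b that x unfolding onb_on_def by metis
      finally show ?thesis .
    qed (simp add: W0 that)
  qed
  \<comment> \<open>\<open>comb\<close> identifies coordinate vectors with functions in
    \<open>W\<close>. An invariant subspace of vectors becomes an invariant function space, to which
    minimality applies.\<close>
  define comb where "comb v = (\<lambda>x. \<Sum>k<n. v $ k * b k x)" for v :: "real vec"
  have combW: "comb v \<in> W" for v
    unfolding comb_def using function_space_sum[OF Wf, of "{..<n}" b "\<lambda>k. v $ k"] bW by simp
  have comb_inner: "inner_on ?X (b k) (comb v) = v $ k" if "k < n" for k v
  proof -
    have "inner_on ?X (b k) (comb v) = (\<Sum>l<n. v $ l * (if k = l then 1 else 0))"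
      unfolding comb_def inner_on_sum(2) using b that
      by (intro sum.cong refl) (simp add: onb_on_def orthonormal_on_def)
    then show ?thesis using that by (simp add: if_distrib[of "\<lambda>c. _ * c"] cong: if_cong)
  qed
  have comb_act: "?L g (comb v) = comb (\<sigma> g *\<^sub>v v)" if g: "g \<in> carrier G" and v: "v \<in> carrier_vec n" for g v
  proof (rule ext)
    fix k assume k: "k < n"
    have "inner_on ?X (b k) (?L g (comb v)) = (\<Sum>l<n. \<sigma> g $$ (k, l) * v $ l)"
      using act[OF g combW k] by (simp add: comb_inner)
    also have "\<dots> = (\<sigma> g *\<^sub>v v) $ k" by (rule mult_mat_vec_entry[OF sD(1)[OF g] v k, symmetric])
    finally show "inner_on ?X (b k) (?L g (comb v)) = inner_on ?X (b k) (comb (\<sigma> g *\<^sub>v v))"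
      by (simp only: comb_inner[OF k])
  qed (use LW g combW in auto)
  have irr: "(n, \<sigma>) \<in> irreducible_reps G"
    unfolding irreducible_reps_iff
  proof (intro conjI orth_repD(1)[OF orth] n allI impI)
    fix S assume S: "S \<subseteq> carrier_vec n" "0\<^sub>v n \<in> S" "\<forall>v\<in>S. \<forall>w\<in>S. v + w \<in> S"
      "\<forall>c. \<forall>v\<in>S. c \<cdot>\<^sub>v v \<in> S" "\<forall>g\<in>carrier G. \<forall>w\<in>S. \<sigma> g *\<^sub>v w \<in> S"
    let ?S = "comb ` S"
    have comb_lin: "comb (v + c \<cdot>\<^sub>v w) = (\<lambda>x. comb v x + c * comb w x)" if "v \<in> S" "w \<in> S" for v w c
    proof -
      have "v \<in> carrier_vec n" "w \<in> carrier_vec n" using that S(1) by auto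
      then show ?thesis
        unfolding comb_def fun_eq_iff sum_distrib_left sum.distrib[symmetric]
        by (intro allI sum.cong refl) (simp add: algebra_simps)
    qed
    have "function_space ?S"
      unfolding function_space_def
    proof (intro conjI ballI allI)
      have "comb (0\<^sub>v n) = (\<lambda>x. 0)" by (simp add: comb_def)
      then show "(\<lambda>x. 0) \<in> ?S" using S(2) by (metis image_eqI)
      fix f h c assume "f \<in> ?S" "h \<in> ?S"
      then obtain v w where v: "v \<in> S" "f = comb v" and w: "w \<in> S" "h = comb w" by auto
      then have "v + c \<cdot>\<^sub>v w \<in> S" using S(3,4) by blast
      then show "(\<lambda>x. f x + c * h x) \<in> ?S"
        using comb_lin[OF v(1) w(1), of c] unfolding v(2) w(2) by (metis image_eqI)
    qed
    moreover have "?L h f \<in> ?S" if h: "h \<in> carrier G" and f: "f \<in> ?S" for h f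
    proof -
      obtain v where v: "v \<in> S" "f = comb v" using f by auto
      then have "?L h f = comb (\<sigma> h *\<^sub>v v)" using comb_act[OF h, of v] S(1) by auto
      then show ?thesis using S(5) h v(1) by blast
    qed
    ultimately have Sinv: "inv_space ?S" using combW WZ unfolding inv_space_def by blast
    then obtain m c where c: "onb_on ?X ?S m c" using onb by blast
    have cW: "c i \<in> W" if "i < m" for i using c that combW by (auto simp: onb_on_def)
    have on: "orthonormal_on ?X {..<m} c" using c by (simp add: onb_on_def)
    show "S = {0\<^sub>v n} \<or> S = carrier_vec n"
    proof (cases "m = 0")
      case True
      have "v = 0\<^sub>v n" if v: "v \<in> S" for v
      proof (rule eq_vecI)
        fix k assume "k < dim_vec (0\<^sub>v n)"
        then have k: "k < n" by simp
        have "comb v x = 0" if "x \<in> carrier G" for x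
          using c True v that by (auto simp: onb_on_def)
        then have "inner_on ?X (b k) (comb v) = 0" by (simp add: inner_on_def)
        then show "v $ k = 0\<^sub>v n $ k" using comb_inner[OF k] k by simp
      qed (use v S(1) in auto)
      then show ?thesis using S(2) by blast
    next
      case False
      then have "n \<le> m" using least[of m] Sinv c by (auto simp: Q_def)
      \<comment> \<open>The \<open>c i\<close> are unit vectors of \<open>W\<close>, so by Parseval
        the projections of the \<open>b k\<close> onto their span have total squared length
        \<open>m\<close>, while the \<open>b k\<close> themselves have total
        \<open>n \<le> m\<close>. Hence all residuals vanish and every \<open>b k\<close> lies in
        \<open>?S\<close>.\<close>
      define r where "r k = (\<lambda>x. b k x - (\<Sum>i<m. inner_on ?X (b k) (c i) * c i x))" for k
      have rr: "inner_on ?X (r k) (r k) = 1 - (\<Sum>i<m. (inner_on ?X (b k) (c i))\<^sup>2)" if "k < n" for k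
        using inner_on_residual(2)[OF _ on, of "b k"] b that
        by (simp add: r_def onb_on_def orthonormal_on_def)
      have "(\<Sum>k<n. \<Sum>i<m. (inner_on ?X (b k) (c i))\<^sup>2) = (\<Sum>i<m. inner_on ?X (c i) (c i))"
        by (subst sum.swap)
          (intro sum.cong refl, subst onb_parseval[OF b cW],
            auto simp: power2_eq_square inner_on_commute[of _ "c _" "b _"])
      also have "\<dots> = real m" using on by (simp add: orthonormal_on_def)
      finally have "(\<Sum>k<n. inner_on ?X (r k) (r k)) = real n - real m"
        by (simp add: rr sum_subtractf)
      then have "(\<Sum>k<n. inner_on ?X (r k) (r k)) \<le> 0" using \<open>n \<le> m\<close> by simp
      moreover have "(\<Sum>k<n. inner_on ?X (r k) (r k)) \<ge> 0" by (intro sum_nonneg inner_on_nonneg)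
      ultimately have "(\<Sum>k<n. inner_on ?X (r k) (r k)) = 0" by simp
      then have r0: "inner_on ?X (r k) (r k) = 0" if "k < n" for k
        using that by (subst (asm) sum_nonneg_eq_0_iff) (auto intro: inner_on_nonneg)
      have bS: "b k \<in> ?S" if k: "k < n" for k
      proof -
        let ?h = "\<lambda>x. \<Sum>i<m. inner_on ?X (b k) (c i) * c i x"
        have h: "?h \<in> ?S"
          by (rule function_space_sum) (use Sinv c in \<open>auto simp: inv_space_def onb_on_def\<close>)
        have "b k = ?h"
        proof
          fix x show "b k x = ?h x"
          proof (cases "x \<in> carrier G")
            case True
            then show ?thesis
              using inner_on_eq_0[OF finite_G r0[OF k]] by (simp add: r_def)
          next
            case False
            have "?h \<in> W" using h combW by auto
            then show ?thesis using W0[OF _ False] bW[OF k] by metis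
          qed
        qed
        then show ?thesis using h by simp
      qed
      have "v \<in> S" if v: "v \<in> carrier_vec n" for v
      proof -
        have "comb v \<in> ?S" unfolding comb_def[of v]
          by (rule function_space_sum) (use Sinv bS in \<open>auto simp: inv_space_def\<close>)
        then obtain w where w: "w \<in> S" "comb v = comb w" by auto
        have "v = w"
          by (rule eq_vecI) (use comb_inner[of _ v] comb_inner[of _ w] w v S(1) in \<open>auto dest: subsetD\<close>)
        then show ?thesis using w by simp
      qed
      then show ?thesis using S(1) by blast
    qed
  qed
  have "inner_on ?X (b 0) (b 0) = 0"
  proof -
    \<comment> \<open>Translation by \<open>inv h\<close> moves the value at \<open>h\<close> to the
      unit; expanding the translate in the basis exhibits \<open>b 0\<close> as a combination of
      coefficients of \<open>\<sigma>\<close>.\<close>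
    have b0: "b 0 h = (\<Sum>i<n. \<sigma> h $$ (0, i) * b i \<one>)" if h: "h \<in> carrier G" for h
    proof -
      have "b 0 h = ?L (inv h) (b 0) \<one>" using h by (simp add: left_translate_def)
      also have "\<dots> = (\<Sum>i<n. inner_on ?X (?L (inv h) (b 0)) (b i) * b i \<one>)"
        using b LW[of "inv h" "b 0"] bW[OF n] h unfolding onb_on_def by (metis inv_closed one_closed)
      also have "\<dots> = (\<Sum>i<n. \<sigma> h $$ (0, i) * b i \<one>)"
      proof (intro sum.cong refl arg_cong2[where f = "(*)"])
        fix i assume "i \<in> {..<n}"
        then have i: "i < n" by simp
        have "inner_on ?X (?L (inv h) (b 0)) (b i) = \<sigma> (inv h) $$ (i, 0)"
          unfolding \<sigma>_def matrix_rep_def using h i n by (simp add: inner_on_commute)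
        also have "\<dots> = \<sigma> h $$ (0, i)"
          using orth_repD(2)[OF orth h, symmetric] sD(1)[OF h] i n by simp
        finally show "inner_on ?X (?L (inv h) (b 0)) (b i) = \<sigma> h $$ (0, i)" .
      qed
      finally show ?thesis .
    qed
    have "inner_on ?X (b 0) (b 0) = (\<Sum>h\<in>carrier G. b 0 h * (\<Sum>i<n. \<sigma> h $$ (0, i) * b i \<one>))"
      unfolding inner_on_def by (intro sum.cong refl arg_cong2[where f = "(*)"] b0)
    also have "\<dots> = (\<Sum>i<n. (\<Sum>h\<in>carrier G. b 0 h * \<sigma> h $$ (0, i)) * b i \<one>)"
      unfolding sum_distrib_left sum_distrib_right by (subst sum.swap) (simp add: mult.assoc)
    also have "\<dots> = 0"
    proof -
      have "b 0 \<in> Z" using bW[OF n] WZ by blast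
      then show ?thesis using ZD(2)[OF _ orth irr n] by simp
    qed
    finally show ?thesis .
  qed
  then show False using b n by (simp add: onb_on_def orthonormal_on_def)
qed

end

section \<open>Endomorphisms of an irreducible orthogonal representation\<close>

text \<open>An eigenvector exists over the complex numbers. Symmetry applied to its real and
  imaginary parts shows that \<open>Im k\<close> times its squared length is 0, so the eigenvalue is
  real and at least one of the two parts is a real eigenvector.\<close>

lemma symmetric_eigenvector:
  fixes M :: "real mat"
  assumes M: "M \<in> carrier_mat n n" and sym: "transpose_mat M = M" and n: "n > 0"
  obtains c v where "v \<in> carrier_vec n" "v \<noteq> 0\<^sub>v n" "M *\<^sub>v v = c \<cdot>\<^sub>v v"
proof -
  let ?A = "map_mat complex_of_real M"
  have A: "?A \<in> carrier_mat n n" using M by simp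
  obtain k where "k \<in> spectrum ?A" using spectrum_non_empty[OF A n] by auto
  then obtain v where v: "v \<in> carrier_vec n" "v \<noteq> 0\<^sub>v n" "?A *\<^sub>v v = k \<cdot>\<^sub>v v"
    using M by (auto simp: spectrum_def eigenvalue_def eigenvector_def)
  let ?x = "vec n (\<lambda>i. Re (v $ i))" and ?y = "vec n (\<lambda>i. Im (v $ i))"
  have entry: "(\<Sum>j<n. complex_of_real (M $$ (i, j)) * v $ j) = k * v $ i" if i: "i < n" for i
  proof -
    have "(?A *\<^sub>v v) $ i = (\<Sum>j<n. ?A $$ (i, j) * v $ j)" by (rule mult_mat_vec_entry[OF A v(1) i])
    then show ?thesis unfolding v(3) using i v(1) M by simp
  qed
  have re: "(\<Sum>j<n. M $$ (i, j) * Re (v $ j)) = Re k * Re (v $ i) - Im k * Im (v $ i)" if "i < n" for i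
    using arg_cong[OF entry[OF that], of Re] by simp
  have im: "(\<Sum>j<n. M $$ (i, j) * Im (v $ j)) = Re k * Im (v $ i) + Im k * Re (v $ i)" if "i < n" for i
    using arg_cong[OF entry[OF that], of Im] by (simp add: mult.commute)
  have s: "M $$ (i, j) = M $$ (j, i)" if "i < n" "j < n" for i j
    using arg_cong[OF sym, of "\<lambda>A. A $$ (j, i)"] that M by simp
  have "(\<Sum>i<n. Im (v $ i) * (\<Sum>j<n. M $$ (i, j) * Re (v $ j))) = (\<Sum>j<n. Re (v $ j) * (\<Sum>i<n. M $$ (j, i) * Im (v $ i)))"
    unfolding sum_distrib_left by (subst sum.swap, intro sum.cong refl) (simp add: s mult_ac)
  then have "(\<Sum>i<n. Im (v $ i) * (Re k * Re (v $ i) - Im k * Im (v $ i)))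
      = (\<Sum>i<n. Re (v $ i) * (Re k * Im (v $ i) + Im k * Re (v $ i)))"
    by (simp add: re im)
  then have "Im k * (\<Sum>i<n. (Re (v $ i))\<^sup>2 + (Im (v $ i))\<^sup>2) = 0"
    by (simp add: sum_distrib_left sum.distrib sum_subtractf algebra_simps power2_eq_square)
  moreover have "(\<Sum>i<n. (Re (v $ i))\<^sup>2 + (Im (v $ i))\<^sup>2) \<noteq> 0"
  proof
    assume "(\<Sum>i<n. (Re (v $ i))\<^sup>2 + (Im (v $ i))\<^sup>2) = 0"
    then have "v $ i = 0" if "i < n" for i
      using that by (subst (asm) sum_nonneg_eq_0_iff) (auto simp: complex_eq_iff)
    then show False using v(1,2) by (auto intro!: eq_vecI)
  qed
  ultimately have k: "Im k = 0" by simp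
  have "M *\<^sub>v ?x = Re k \<cdot>\<^sub>v ?x"
    using M by (intro eq_vecI) (auto simp: mult_mat_vec_entry[of _ n n] re k simp del: index_mult_mat_vec)
  moreover have "M *\<^sub>v ?y = Re k \<cdot>\<^sub>v ?y"
    using M by (intro eq_vecI) (auto simp: mult_mat_vec_entry[of _ n n] im k simp del: index_mult_mat_vec)
  moreover have "?x \<noteq> 0\<^sub>v n \<or> ?y \<noteq> 0\<^sub>v n"
  proof (rule ccontr)
    assume "\<not> ?thesis"
    then have "?x $ i = 0 \<and> ?y $ i = 0" if "i < n" for i using that by simp
    then have "v $ i = 0" if "i < n" for i using that by (simp add: complex_eq_iff)
    then show False using v(1,2) by (auto intro!: eq_vecI)
  qed
  ultimately show ?thesis using that[of ?x] that[of ?y] by auto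
qed

context fin_group
begin

text \<open>The eigenspace of a real eigenvalue is invariant and not zero, hence everything.\<close>

lemma symmetric_endomorphism_scalar:
  assumes irr: "(n, \<sigma>) \<in> irreducible_reps G"
    and M: "M \<in> carrier_mat n n" "transpose_mat M = M" "\<And>g. g \<in> carrier G \<Longrightarrow> M * \<sigma> g = \<sigma> g * M"
  shows "\<exists>c. M = c \<cdot>\<^sub>m 1\<^sub>m n"
proof -
  have rep: "(n, \<sigma>) \<in> real_reps G" and n: "n > 0" using irr by (auto simp: irreducible_reps_iff)
  note sD = repD[OF rep]
  obtain c v where v: "v \<in> carrier_vec n" "v \<noteq> 0\<^sub>v n" "M *\<^sub>v v = c \<cdot>\<^sub>v v"
    using symmetric_eigenvector[OF M(1,2) n] .
  define W where "W = {v \<in> carrier_vec n. M *\<^sub>v v = c \<cdot>\<^sub>v v}"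
  have "W = {0\<^sub>v n} \<or> W = carrier_vec n"
  proof (rule irr[unfolded irreducible_reps_iff, THEN conjunct2, THEN conjunct2, rule_format])
    show "W \<subseteq> carrier_vec n" by (auto simp: W_def)
    show "0\<^sub>v n \<in> W" using M(1) by (auto simp: W_def)
    show "v + w \<in> W" if "v \<in> W" "w \<in> W" for v w
      using that M(1) by (simp add: W_def mult_add_distrib_mat_vec[of _ n n] smult_add_distrib_vec[of _ n])
    show "k \<cdot>\<^sub>v v \<in> W" if "v \<in> W" for k v
      using that M(1) by (simp add: W_def mult_mat_vec[of _ n n] smult_smult_assoc mult.commute)
    show "\<sigma> g *\<^sub>v v \<in> W" if g: "g \<in> carrier G" and v: "v \<in> W" for g v
    proof -
      have vc: "v \<in> carrier_vec n" "M *\<^sub>v v = c \<cdot>\<^sub>v v" using v by (auto simp: W_def)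
      have "M *\<^sub>v (\<sigma> g *\<^sub>v v) = (M * \<sigma> g) *\<^sub>v v"
        by (rule assoc_mult_mat_vec[OF M(1) sD(1)[OF g] vc(1), symmetric])
      also have "\<dots> = \<sigma> g *\<^sub>v (M *\<^sub>v v)"
        unfolding M(3)[OF g] by (rule assoc_mult_mat_vec[OF sD(1)[OF g] M(1) vc(1)])
      also have "\<dots> = c \<cdot>\<^sub>v (\<sigma> g *\<^sub>v v)"
        unfolding vc(2) by (rule mult_mat_vec[OF sD(1)[OF g] vc(1)])
      finally show ?thesis using mult_mat_vec_carrier[OF sD(1)[OF g] vc(1)] by (simp add: W_def)
    qed
  qed
  moreover have "v \<in> W" using v by (simp add: W_def)
  ultimately have W: "M *\<^sub>v w = c \<cdot>\<^sub>v w" if "w \<in> carrier_vec n" for w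
    using v(2) that by (auto simp: W_def)
  have "M = c \<cdot>\<^sub>m 1\<^sub>m n"
  proof (rule eq_matI)
    fix i j assume "i < dim_row (c \<cdot>\<^sub>m 1\<^sub>m n)" "j < dim_col (c \<cdot>\<^sub>m 1\<^sub>m n)"
    then have ij: "i < n" "j < n" by auto
    have "M $$ (i, j) = (M *\<^sub>v unit_vec n j) $ i" using M(1) ij by simp
    also have "\<dots> = c * unit_vec n j $ i" using W[of "unit_vec n j"] ij by simp
    finally show "M $$ (i, j) = (c \<cdot>\<^sub>m 1\<^sub>m n) $$ (i, j)" using ij by simp
  qed (use M(1) in auto)
  then show ?thesis ..
qed

end

section \<open>Quaternions\<close>

lemma quat_sel [simp]:
  "qre 0 = 0" "qi 0 = 0" "qj 0 = 0" "qk 0 = 0" "qre 1 = 1" "qi 1 = 0" "qj 1 = 0" "qk 1 = 0"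
  "qre (p + q) = qre p + qre q" "qi (p + q) = qi p + qi q" "qj (p + q) = qj p + qj q" "qk (p + q) = qk p + qk q"
  "qre (p - q) = qre p - qre q" "qi (p - q) = qi p - qi q" "qj (p - q) = qj p - qj q" "qk (p - q) = qk p - qk q"
  "qre (- p) = - qre p" "qi (- p) = - qi p" "qj (- p) = - qj p" "qk (- p) = - qk p"
  "qre (r *\<^sub>R p) = r * qre p" "qi (r *\<^sub>R p) = r * qi p" "qj (r *\<^sub>R p) = r * qj p" "qk (r *\<^sub>R p) = r * qk p"
  "qre (qcnj p) = qre p" "qi (qcnj p) = - qi p" "qj (qcnj p) = - qj p" "qk (qcnj p) = - qk p"
  by (simp_all add: zero_quat_def one_quat_def plus_quat_def minus_quat_def uminus_quat_def
      scaleR_quat_def qcnj_def)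

lemma quat_sel_mult:
  "qre (p * q) = qre p * qre q - qi p * qi q - qj p * qj q - qk p * qk q"
  "qi (p * q) = qre p * qi q + qi p * qre q + qj p * qk q - qk p * qj q"
  "qj (p * q) = qre p * qj q - qi p * qk q + qj p * qre q + qk p * qi q"
  "qk (p * q) = qre p * qk q + qi p * qj q - qj p * qi q + qk p * qre q"
  by (simp_all add: times_quat_def)

lemma quat_sel_sum:
  "qre (sum f A) = (\<Sum>x\<in>A. qre (f x))" "qi (sum f A) = (\<Sum>x\<in>A. qi (f x))"
  "qj (sum f A) = (\<Sum>x\<in>A. qj (f x))" "qk (sum f A) = (\<Sum>x\<in>A. qk (f x))"
  by (induction A rule: infinite_finite_induct; simp)+

lemma qcnj_simps [simp]:
  "qcnj (qcnj p) = p" "qcnj 0 = 0" "qcnj 1 = 1" "qcnj (p + q) = qcnj p + qcnj q"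
  "qcnj (p * q) = qcnj q * qcnj p" "qcnj (r *\<^sub>R p) = r *\<^sub>R qcnj p"
  by (simp_all add: quat_eq_iff quat_sel_mult)

lemma qcnj_sum: "qcnj (sum f A) = (\<Sum>x\<in>A. qcnj (f x))"
  by (induction A rule: infinite_finite_induct) auto

lemma qre_mult_commute: "qre (p * q) = qre (q * p)"
  by (simp add: quat_sel_mult)

lemma mult_qcnj: "p * qcnj p = ((qre p)\<^sup>2 + (qi p)\<^sup>2 + (qj p)\<^sup>2 + (qk p)\<^sup>2) *\<^sub>R 1"
  by (simp add: quat_eq_iff quat_sel_mult power2_eq_square)

lemma div_carrier_closed [simp]:
  "0 \<in> div_carrier D" "1 \<in> div_carrier D"
  "\<lbrakk>p \<in> div_carrier D; q \<in> div_carrier D\<rbrakk> \<Longrightarrow> p + q \<in> div_carrier D"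
  "\<lbrakk>p \<in> div_carrier D; q \<in> div_carrier D\<rbrakk> \<Longrightarrow> p - q \<in> div_carrier D"
  "\<lbrakk>p \<in> div_carrier D; q \<in> div_carrier D\<rbrakk> \<Longrightarrow> p * q \<in> div_carrier D"
  "p \<in> div_carrier D \<Longrightarrow> - p \<in> div_carrier D"
  "p \<in> div_carrier D \<Longrightarrow> r *\<^sub>R p \<in> div_carrier D"
  "p \<in> div_carrier D \<Longrightarrow> qcnj p \<in> div_carrier D"
  by (cases D; simp add: quat_sel_mult)+

lemma div_carrier_sum: "(\<And>x. x \<in> A \<Longrightarrow> f x \<in> div_carrier D) \<Longrightarrow> sum f A \<in> div_carrier D"
  by (induction A rule: infinite_finite_induct) auto

lemma div_alg_simps:
  "carrier (div_alg D) = div_carrier D" "monoid.mult (div_alg D) = (*)" "\<one>\<^bsub>div_alg D\<^esub> = 1" "\<zero>\<^bsub>div_alg D\<^esub> = 0"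
  "add (div_alg D) = (+)" "module.smult (div_alg D) = (*\<^sub>R)"
  by (simp_all add: div_alg_def)

lemma ring_div_alg: "ring (div_alg D)"
proof (intro ringI abelian_groupI monoidI)
  show "\<exists>y\<in>carrier (div_alg D). y \<oplus>\<^bsub>div_alg D\<^esub> x = \<zero>\<^bsub>div_alg D\<^esub>" if "x \<in> carrier (div_alg D)" for x
    using that by (intro bexI[of _ "- x"]) (auto simp: div_alg_simps)
qed (auto simp: div_alg_simps algebra_simps)

lemma smult_smult_mat: "a \<cdot>\<^sub>m (b \<cdot>\<^sub>m A) = (a * b :: 'a::semigroup_mult) \<cdot>\<^sub>m A"
  by (auto intro!: eq_matI simp: mult.assoc)

lemma one_smult_mat [simp]: "(1 :: 'a::monoid_mult) \<cdot>\<^sub>m A = A"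
  by (auto intro!: eq_matI)

section \<open>Schur's lemma and the theorem of Frobenius\<close>

context fin_group
begin

definition endo :: "nat \<Rightarrow> ('g \<Rightarrow> real mat) \<Rightarrow> real mat \<Rightarrow> bool" where
  "endo n \<sigma> M \<longleftrightarrow> M \<in> carrier_mat n n \<and> (\<forall>g\<in>carrier G. M * \<sigma> g = \<sigma> g * M)"

lemma endo_lincomb:
  assumes "(n, \<sigma>) \<in> real_reps G"
  shows "endo n \<sigma> (1\<^sub>m n)" "endo n \<sigma> M \<Longrightarrow> endo n \<sigma> (c \<cdot>\<^sub>m M)"
    "\<lbrakk>endo n \<sigma> M; endo n \<sigma> N\<rbrakk> \<Longrightarrow> endo n \<sigma> (M + N)" "\<lbrakk>endo n \<sigma> M; endo n \<sigma> N\<rbrakk> \<Longrightarrow> endo n \<sigma> (M * N)"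
proof -
  note sD = repD(1)[OF assms]
  show "endo n \<sigma> (1\<^sub>m n)"
    unfolding endo_def by (intro conjI ballI) (simp_all add: left_mult_one_mat[OF sD] right_mult_one_mat[OF sD])
  show "endo n \<sigma> M \<Longrightarrow> endo n \<sigma> (c \<cdot>\<^sub>m M)"
    using sD by (auto simp: endo_def mult_smult_assoc_mat[of _ n n _ n] mult_smult_distrib[of _ n n _ n])
  show "\<lbrakk>endo n \<sigma> M; endo n \<sigma> N\<rbrakk> \<Longrightarrow> endo n \<sigma> (M + N)"
    using sD by (auto simp: endo_def add_mult_distrib_mat[of _ n n _ _ n] mult_add_distrib_mat[of _ n n _ n])
  assume M: "endo n \<sigma> M" and N: "endo n \<sigma> N"
  have "(M * N) * \<sigma> g = \<sigma> g * (M * N)" if g: "g \<in> carrier G" for g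
  proof -
    have c: "M \<in> carrier_mat n n" "N \<in> carrier_mat n n" using M N by (auto simp: endo_def)
    have "(M * N) * \<sigma> g = M * (N * \<sigma> g)" by (rule assoc_mult_mat[OF c sD[OF g]])
    also have "\<dots> = M * (\<sigma> g * N)" using N g by (simp add: endo_def)
    also have "\<dots> = (M * \<sigma> g) * N" by (rule assoc_mult_mat[OF c(1) sD[OF g] c(2), symmetric])
    also have "\<dots> = (\<sigma> g * M) * N" using M g by (simp add: endo_def)
    also have "\<dots> = \<sigma> g * (M * N)" by (rule assoc_mult_mat[OF sD[OF g] c])
    finally show ?thesis .
  qed
  then show "endo n \<sigma> (M * N)" using M N by (auto simp: endo_def)
qed

text \<open>Transpose the relation at \<open>inv g\<close>; orthogonality turns the transposes of
  the values there into the values at \<open>g\<close>.\<close>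

lemma intertwiner_transpose:
  assumes \<sigma>: "orth_rep n \<sigma>" and \<tau>: "orth_rep m \<tau>" and M: "M \<in> carrier_mat n m"
    and int: "\<And>g. g \<in> carrier G \<Longrightarrow> \<sigma> g * M = M * \<tau> g" and g: "g \<in> carrier G"
  shows "\<tau> g * transpose_mat M = transpose_mat M * \<sigma> g"
proof -
  note s = repD(1)[OF orth_repD(1)[OF \<sigma>]] and t = repD(1)[OF orth_repD(1)[OF \<tau>]]
  have "transpose_mat (\<sigma> (inv g) * M) = transpose_mat (M * \<tau> (inv g))"
    using int[of "inv g"] g by simp
  moreover have "transpose_mat (\<sigma> (inv g) * M) = transpose_mat M * \<sigma> g"
    using transpose_mult[OF s M, of "inv g"] orth_repD(2)[OF \<sigma>, of "inv g"] g by simp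
  moreover have "transpose_mat (M * \<tau> (inv g)) = \<tau> g * transpose_mat M"
    using transpose_mult[OF M t, of "inv g"] orth_repD(2)[OF \<tau>, of "inv g"] g by simp
  ultimately show ?thesis by simp
qed

lemma endo_transpose: "\<lbrakk>orth_rep n \<sigma>; endo n \<sigma> M\<rbrakk> \<Longrightarrow> endo n \<sigma> (transpose_mat M)"
  using intertwiner_transpose[of n \<sigma> n \<sigma> M] by (auto simp: endo_def)

lemma symmetric_endo:
  "\<lbrakk>(n, \<sigma>) \<in> irreducible_reps G; endo n \<sigma> M; transpose_mat M = M\<rbrakk> \<Longrightarrow> \<exists>c. M = c \<cdot>\<^sub>m 1\<^sub>m n"
  by (rule symmetric_endomorphism_scalar[of n \<sigma>]) (auto simp: endo_def)

lemma mat_trace_mult_transpose: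
  fixes M :: "real mat"
  assumes "M \<in> carrier_mat n m"
  shows "mat_trace (M * transpose_mat M) = (\<Sum>i<n. \<Sum>j<m. (M $$ (i, j))\<^sup>2)"
  using assms by (simp add: mat_trace_def scalar_prod_def lessThan_atLeast0 power2_eq_square)

lemma mult_transpose_eq_0:
  fixes M :: "real mat"
  assumes M: "M \<in> carrier_mat n m" and "mat_trace (M * transpose_mat M) = 0"
  shows "M = 0\<^sub>m n m"
proof (rule eq_matI)
  have z: "(\<Sum>i<n. \<Sum>j<m. (M $$ (i, j))\<^sup>2) = 0"
    using assms mat_trace_mult_transpose[OF M] by simp
  fix i j assume "i < dim_row (0\<^sub>m n m)" "j < dim_col (0\<^sub>m n m)"
  then have ij: "i < n" "j < m" by auto
  have "(\<Sum>j<m. (M $$ (i, j))\<^sup>2) = 0"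
    using z ij by (subst (asm) sum_nonneg_eq_0_iff) (auto intro: sum_nonneg)
  then have "(M $$ (i, j))\<^sup>2 = 0"
    using ij by (subst (asm) sum_nonneg_eq_0_iff) auto
  then show "M $$ (i, j) = 0\<^sub>m n m $$ (i, j)" using ij by simp
qed (use M in auto)

lemma mat_trace_scalar: "mat_trace (c \<cdot>\<^sub>m 1\<^sub>m n) = real n * c"
  by (simp add: mat_trace_def)

text \<open>\<open>M\<close> times its transpose and the transpose times \<open>M\<close> are
  symmetric endomorphisms, hence scalars. If the first is 0, its trace gives \<open>M = 0\<close>;
  otherwise the scalars agree and a multiple of the transpose inverts \<open>M\<close>,
  contradicting inequivalence.\<close>

lemma intertwiner_eq_0:
  assumes \<sigma>: "orth_rep n \<sigma>" "(n, \<sigma>) \<in> irreducible_reps G"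
    and \<tau>: "orth_rep m \<tau>" "(m, \<tau>) \<in> irreducible_reps G"
    and M: "M \<in> carrier_mat n m" and int: "\<And>g. g \<in> carrier G \<Longrightarrow> \<sigma> g * M = M * \<tau> g"
    and ne: "((m, \<tau>), (n, \<sigma>)) \<notin> rep_iso_rel G"
  shows "M = 0\<^sub>m n m"
proof (rule ccontr)
  assume M0: "M \<noteq> 0\<^sub>m n m"
  let ?T = "transpose_mat M"
  have T: "?T \<in> carrier_mat m n" using M by simp
  note s = repD(1)[OF orth_repD(1)[OF \<sigma>(1)]] and t = repD(1)[OF orth_repD(1)[OF \<tau>(1)]]
  have intT: "\<tau> g * ?T = ?T * \<sigma> g" if "g \<in> carrier G" for g
    using intertwiner_transpose[OF \<sigma>(1) \<tau>(1) M] int that by blast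
  have n: "n > 0" "m > 0" using \<sigma>(2) \<tau>(2) by (auto simp: irreducible_reps_iff)
  have "endo n \<sigma> (M * ?T)"
    unfolding endo_def
  proof (intro conjI ballI)
    fix g assume g: "g \<in> carrier G"
    have "(M * ?T) * \<sigma> g = M * (?T * \<sigma> g)" by (rule assoc_mult_mat[OF M T s[OF g]])
    also have "\<dots> = (M * \<tau> g) * ?T" unfolding intT[OF g, symmetric] by (rule assoc_mult_mat[OF M t[OF g] T, symmetric])
    also have "\<dots> = \<sigma> g * (M * ?T)" unfolding int[OF g, symmetric] by (rule assoc_mult_mat[OF s[OF g] M T])
    finally show "(M * ?T) * \<sigma> g = \<sigma> g * (M * ?T)" .
  qed (use M in auto)
  then obtain c where c: "M * ?T = c \<cdot>\<^sub>m 1\<^sub>m n"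
    using symmetric_endo[OF \<sigma>(2)] M transpose_mult[OF M T] by auto
  have "endo m \<tau> (?T * M)"
    unfolding endo_def
  proof (intro conjI ballI)
    fix g assume g: "g \<in> carrier G"
    have "(?T * M) * \<tau> g = ?T * (M * \<tau> g)" by (rule assoc_mult_mat[OF T M t[OF g]])
    also have "\<dots> = (?T * \<sigma> g) * M" unfolding int[OF g, symmetric] by (rule assoc_mult_mat[OF T s[OF g] M, symmetric])
    also have "\<dots> = \<tau> g * (?T * M)" unfolding intT[OF g, symmetric] by (rule assoc_mult_mat[OF t[OF g] T M])
    finally show "(?T * M) * \<tau> g = \<tau> g * (?T * M)" .
  qed (use M in auto)
  then obtain d where d: "?T * M = d \<cdot>\<^sub>m 1\<^sub>m m"
    using symmetric_endo[OF \<tau>(2)] M transpose_mult[OF T M] by auto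
  have "c \<noteq> 0"
  proof
    assume "c = 0"
    then have "mat_trace (M * ?T) = 0" unfolding c mat_trace_scalar by simp
    then show False using mult_transpose_eq_0[OF M] M0 by simp
  qed
  have "c \<cdot>\<^sub>m M = (M * ?T) * M" using M by (simp add: c mult_smult_assoc_mat[of _ n n])
  also have "\<dots> = M * (?T * M)" by (rule assoc_mult_mat[OF M T M])
  also have "\<dots> = d \<cdot>\<^sub>m M" using M by (simp add: d mult_smult_distrib[of _ n m _ m])
  finally have cd: "c \<cdot>\<^sub>m M = d \<cdot>\<^sub>m M" .
  obtain i j where ij: "i < n" "j < m" "M $$ (i, j) \<noteq> 0"
    using M0 M by (metis carrier_matD eq_matI index_zero_mat)
  have "c = d" using arg_cong[OF cd, of "\<lambda>A. A $$ (i, j)"] ij M by simp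
  let ?Q = "(1 / c) \<cdot>\<^sub>m ?T"
  have "M * ?Q = 1\<^sub>m n"
    using M T c \<open>c \<noteq> 0\<close> by (simp add: mult_smult_distrib[of _ n m _ n] smult_smult_mat)
  moreover have "?Q * M = 1\<^sub>m m"
    using M T d \<open>c \<noteq> 0\<close> \<open>c = d\<close> by (simp add: mult_smult_assoc_mat[of _ m n _ m] smult_smult_mat)
  moreover have Q: "?Q \<in> carrier_mat m n" using T by simp
  ultimately have "n = m" using inverse_mats_square[OF M Q] by blast
  then have "((m, \<tau>), (n, \<sigma>)) \<in> rep_iso_rel G"
    unfolding rep_iso_rel_iff using orth_repD(1)[OF \<sigma>(1)] orth_repD(1)[OF \<tau>(1)] M Q int
      \<open>M * ?Q = 1\<^sub>m n\<close> \<open>?Q * M = 1\<^sub>m m\<close> by metis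
  then show False using ne by simp
qed

text \<open>The average \<open>\<Sum>g. \<sigma> g * E\<^sub>b\<^sub>d * \<tau> g\<^sup>-\<^sup>1\<close> of a matrix unit.\<close>

definition averaged_unit :: "nat \<Rightarrow> nat \<Rightarrow> ('g \<Rightarrow> real mat) \<Rightarrow> ('g \<Rightarrow> real mat) \<Rightarrow> nat \<Rightarrow> nat \<Rightarrow> real mat" where
  "averaged_unit n m \<sigma> \<tau> b d = mat n m (\<lambda>(i, j). \<Sum>g\<in>carrier G. \<sigma> g $$ (i, b) * \<tau> g $$ (j, d))"

text \<open>The substitution of \<open>inv h \<otimes> g\<close> for \<open>g\<close> moves
  \<open>h\<close> from one representation to the other, where orthogonality replaces the inverse by
  a transpose.\<close>

lemma averaged_unit_intertwines:
  assumes \<sigma>: "orth_rep n \<sigma>" and \<tau>: "orth_rep m \<tau>" and bd: "b < n" "d < m" and h: "h \<in> carrier G"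
  shows "\<sigma> h * averaged_unit n m \<sigma> \<tau> b d = averaged_unit n m \<sigma> \<tau> b d * \<tau> h"
proof (rule eq_matI)
  let ?Y = "averaged_unit n m \<sigma> \<tau> b d"
  have Y: "?Y \<in> carrier_mat n m" by (simp add: averaged_unit_def)
  note s = repD[OF orth_repD(1)[OF \<sigma>]] and t = repD[OF orth_repD(1)[OF \<tau>]]
  fix i j assume "i < dim_row (?Y * \<tau> h)" "j < dim_col (?Y * \<tau> h)"
  then have ij: "i < n" "j < m" using Y t(1)[OF h] by auto
  have "(\<sigma> h * ?Y) $$ (i, j) = (\<Sum>k<n. \<sigma> h $$ (i, k) * ?Y $$ (k, j))"
    by (rule mat_mult_entry[OF s(1)[OF h] Y ij])
  also have "\<dots> = (\<Sum>k<n. \<Sum>g\<in>carrier G. \<sigma> h $$ (i, k) * (\<sigma> g $$ (k, b) * \<tau> g $$ (j, d)))"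
    using ij by (simp add: averaged_unit_def sum_distrib_left)
  also have "\<dots> = (\<Sum>g\<in>carrier G. (\<Sum>k<n. \<sigma> h $$ (i, k) * \<sigma> g $$ (k, b)) * \<tau> g $$ (j, d))"
    by (subst sum.swap) (simp add: sum_distrib_right mult.assoc)
  also have "\<dots> = (\<Sum>g\<in>carrier G. \<sigma> (h \<otimes> g) $$ (i, b) * \<tau> g $$ (j, d))"
  proof (intro sum.cong refl arg_cong2[where f = "(*)"])
    fix g assume g: "g \<in> carrier G"
    show "(\<Sum>k<n. \<sigma> h $$ (i, k) * \<sigma> g $$ (k, b)) = \<sigma> (h \<otimes> g) $$ (i, b)"
      unfolding s(2)[OF h g] by (rule mat_mult_entry[OF s(1)[OF h] s(1)[OF g] ij(1) bd(1), symmetric])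
  qed
  also have "\<dots> = (\<Sum>g\<in>carrier G. \<sigma> (h \<otimes> (inv h \<otimes> g)) $$ (i, b) * \<tau> (inv h \<otimes> g) $$ (j, d))"
    by (rule sum_left_mult[symmetric, of "inv h" "\<lambda>g. \<sigma> (h \<otimes> g) $$ (i, b) * \<tau> g $$ (j, d)"]) (use h in simp)
  also have "\<dots> = (\<Sum>g\<in>carrier G. \<Sum>k<m. \<sigma> g $$ (i, b) * (\<tau> h $$ (k, j) * \<tau> g $$ (k, d)))"
  proof (rule sum.cong[OF refl])
    fix g assume g: "g \<in> carrier G"
    have "\<tau> (inv h \<otimes> g) $$ (j, d) = (\<Sum>k<m. \<tau> (inv h) $$ (j, k) * \<tau> g $$ (k, d))"
      using t(2)[of "inv h" g] mat_mult_entry[OF t(1) t(1), of "inv h" g j d] h g ij bd by simp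
    also have "\<dots> = (\<Sum>k<m. \<tau> h $$ (k, j) * \<tau> g $$ (k, d))"
      using orth_repD(2)[OF \<tau> h, symmetric] t(1)[OF h] ij by (intro sum.cong refl) simp
    finally show "\<sigma> (h \<otimes> (inv h \<otimes> g)) $$ (i, b) * \<tau> (inv h \<otimes> g) $$ (j, d)
        = (\<Sum>k<m. \<sigma> g $$ (i, b) * (\<tau> h $$ (k, j) * \<tau> g $$ (k, d)))"
      using h g by (simp add: m_assoc[symmetric] sum_distrib_left)
  qed
  also have "\<dots> = (\<Sum>k<m. ?Y $$ (i, k) * \<tau> h $$ (k, j))"
    using ij by (subst sum.swap) (simp add: averaged_unit_def sum_distrib_left sum_distrib_right mult_ac)
  also have "\<dots> = (?Y * \<tau> h) $$ (i, j)"
    by (rule mat_mult_entry[OF Y t(1)[OF h] ij, symmetric])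
  finally show "(\<sigma> h * ?Y) $$ (i, j) = (?Y * \<tau> h) $$ (i, j)" .
qed (use repD(1)[OF orth_repD(1)[OF \<sigma>] h] repD(1)[OF orth_repD(1)[OF \<tau>] h] in \<open>auto simp: averaged_unit_def\<close>)

text \<open>These sums are the entries of an averaged matrix unit, which intertwines and therefore
  vanishes.\<close>

lemma inequivalent_coefficients_orthogonal:
  assumes \<sigma>: "orth_rep n \<sigma>" "(n, \<sigma>) \<in> irreducible_reps G"
    and \<tau>: "orth_rep m \<tau>" "(m, \<tau>) \<in> irreducible_reps G"
    and ne: "((m, \<tau>), (n, \<sigma>)) \<notin> rep_iso_rel G" and i: "i < n" "b < n" "j < m" "d < m"
  shows "(\<Sum>g\<in>carrier G. \<sigma> g $$ (i, b) * \<tau> g $$ (j, d)) = 0"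
proof -
  have "averaged_unit n m \<sigma> \<tau> b d = 0\<^sub>m n m"
    using averaged_unit_intertwines[OF \<sigma>(1) \<tau>(1) i(2,4)]
    by (intro intertwiner_eq_0[OF \<sigma> \<tau> _ _ ne]) (auto simp: averaged_unit_def)
  then have "averaged_unit n m \<sigma> \<tau> b d $$ (i, j) = 0" using i by simp
  then show ?thesis using i by (simp add: averaged_unit_def)
qed

text \<open>The isomorphism is taken in the direction opposite to that in the definition of
  \<open>Ir\<close>, so that \<open>D\<close> acts on the representation. Injectivity follows in
  positive degree from the multiplicative norm of \<open>D\<close>.\<close>

definition div_structure :: "divalg \<Rightarrow> nat \<Rightarrow> ('g \<Rightarrow> real mat) \<Rightarrow> (quat \<Rightarrow> real mat) \<Rightarrow> bool" where
  "div_structure D n \<sigma> E \<longleftrightarrow> (\<forall>q\<in>div_carrier D. endo n \<sigma> (E q)) \<and>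
     (\<forall>M. endo n \<sigma> M \<longrightarrow> (\<exists>q\<in>div_carrier D. M = E q)) \<and>
     (\<forall>p\<in>div_carrier D. \<forall>q\<in>div_carrier D. E (p + q) = E p + E q \<and> E (p * q) = E p * E q) \<and>
     (\<forall>r. \<forall>q\<in>div_carrier D. E (r *\<^sub>R q) = r \<cdot>\<^sub>m E q) \<and> E 1 = 1\<^sub>m n"

lemma div_structureD:
  assumes "div_structure D n \<sigma> E"
  shows "q \<in> div_carrier D \<Longrightarrow> endo n \<sigma> (E q)"
    "endo n \<sigma> M \<Longrightarrow> \<exists>q\<in>div_carrier D. M = E q"
    "\<lbrakk>p \<in> div_carrier D; q \<in> div_carrier D\<rbrakk> \<Longrightarrow> E (p + q) = E p + E q"
    "\<lbrakk>p \<in> div_carrier D; q \<in> div_carrier D\<rbrakk> \<Longrightarrow> E (p * q) = E p * E q"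
    "q \<in> div_carrier D \<Longrightarrow> E (r *\<^sub>R q) = r \<cdot>\<^sub>m E q" "E 1 = 1\<^sub>m n"
    "q \<in> div_carrier D \<Longrightarrow> E q \<in> carrier_mat n n"
  using assms by (auto simp: div_structure_def endo_def)

lemma End_alg_simps:
  "carrier (End_alg G (n, \<sigma>)) = {M. endo n \<sigma> M}" "monoid.mult (End_alg G (n, \<sigma>)) = (*)"
  "\<one>\<^bsub>End_alg G (n, \<sigma>)\<^esub> = 1\<^sub>m n" "add (End_alg G (n, \<sigma>)) = (+)"
  "module.smult (End_alg G (n, \<sigma>)) = (\<cdot>\<^sub>m)"
  by (auto simp: End_alg_def endo_def module_mat_def)

text \<open>For injectivity: if \<open>E\<close> kills \<open>r\<close>, then it kills
  \<open>r\<close> times its conjugate, a real multiple of 1, and \<open>E 1\<close> is not zero; so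
  this multiple, the squared norm of \<open>r\<close>, is 0.\<close>

lemma div_structure_alg_isos:
  assumes E: "div_structure D n \<sigma> E" and n: "n > 0"
  shows "alg_isos (End_alg G (n, \<sigma>)) (div_alg D) \<noteq> {}"
proof -
  note ED = div_structureD[OF E]
  have inj: "inj_on E (div_carrier D)"
  proof (rule inj_onI)
    fix p q assume pq: "p \<in> div_carrier D" "q \<in> div_carrier D" "E p = E q"
    let ?r = "p - q"
    have r: "?r \<in> div_carrier D" using pq by simp
    have "E ?r = E p + (-1) \<cdot>\<^sub>m E q"
      using ED(3)[of p "(-1) *\<^sub>R q"] ED(5)[of q "-1"] pq by simp
    then have "E ?r = 0\<^sub>m n n"
      using ED(7)[OF pq(1)] ED(7)[OF pq(2)] pq(3) by (auto intro!: eq_matI)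
    then have "E (?r * qcnj ?r) = 0\<^sub>m n n"
      using ED(4)[OF r, of "qcnj ?r"] ED(7)[of "qcnj ?r"] r by simp
    then have "((qre ?r)\<^sup>2 + (qi ?r)\<^sup>2 + (qj ?r)\<^sup>2 + (qk ?r)\<^sup>2) \<cdot>\<^sub>m 1\<^sub>m n = (0\<^sub>m n n :: real mat)"
      unfolding mult_qcnj using ED(5)[of 1] ED(6) by simp
    from arg_cong[OF this, of "\<lambda>A. A $$ (0, 0)"] n
    have "(qre ?r)\<^sup>2 + (qi ?r)\<^sup>2 + (qj ?r)\<^sup>2 + (qk ?r)\<^sup>2 = 0" by simp
    then have "qre ?r = 0 \<and> qi ?r = 0 \<and> qj ?r = 0 \<and> qk ?r = 0"
      by (simp only: add_nonneg_eq_0_iff zero_le_power2 add_nonneg_nonneg power_eq_0_iff)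
    then show "p = q" by (simp add: quat_eq_iff)
  qed
  have bij: "bij_betw E (carrier (div_alg D)) (carrier (End_alg G (n, \<sigma>)))"
    using inj ED(1,2) by (auto simp: bij_betw_def div_alg_simps End_alg_simps)
  have iso: "E \<in> ring_iso (div_alg D) (End_alg G (n, \<sigma>))"
    by (intro ring_iso_memI bij) (auto simp: div_alg_simps End_alg_simps ED)
  define h where "h = inv_into (carrier (div_alg D)) E"
  have "h \<in> ring_iso (End_alg G (n, \<sigma>)) (div_alg D)"
    unfolding h_def by (rule ring_iso_set_sym[OF ring_div_alg iso])
  moreover have "h \<in> lin_maps (End_alg G (n, \<sigma>)) (div_alg D)"
  proof -
    have hE: "h (E q) = q" if "q \<in> div_carrier D" for q
      using inj that by (simp add: h_def div_alg_simps inv_into_f_f)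
    have "h (r \<cdot>\<^sub>m M) = r *\<^sub>R h M" if "endo n \<sigma> M" for r M
    proof -
      obtain q where "q \<in> div_carrier D" "M = E q" using ED(2)[OF \<open>endo n \<sigma> M\<close>] by blast
      then show ?thesis using hE[of q] hE[of "r *\<^sub>R q"] ED(5)[of q r] by simp
    qed
    then show ?thesis
      using ring_iso_memE[OF \<open>h \<in> ring_iso _ _\<close>]
      by (auto simp: lin_maps_def LinearCombinations.module_hom_def End_alg_simps div_alg_simps)
  qed
  ultimately show ?thesis by (auto simp: alg_isos_def)
qed

text \<open>The inverse of the given isomorphism is followed by conjugation with an equivalence
  \<open>P\<close>. This carries the type of a class over to its orthogonal member.\<close>

lemma alg_isos_div_structure:
  assumes "alg_isos (End_alg G (N, \<rho>)) (div_alg D) \<noteq> {}" and eq: "((N, \<rho>), (N, \<sigma>)) \<in> rep_iso_rel G"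
  shows "\<exists>E. div_structure D N \<sigma> E"
proof -
  obtain h where h: "h \<in> ring_iso (End_alg G (N, \<rho>)) (div_alg D)" "h \<in> lin_maps (End_alg G (N, \<rho>)) (div_alg D)"
    using assms(1) by (auto simp: alg_isos_def)
  obtain P Q where P: "P \<in> carrier_mat N N" and Q: "Q \<in> carrier_mat N N" and PQ: "P * Q = 1\<^sub>m N" "Q * P = 1\<^sub>m N"
    and P\<rho>: "\<And>g. g \<in> carrier G \<Longrightarrow> P * \<rho> g = \<sigma> g * P"
    and rep: "(N, \<rho>) \<in> real_reps G" "(N, \<sigma>) \<in> real_reps G"
    using eq unfolding rep_iso_rel_iff by blast
  note r = repD(1)[OF rep(1)] and s = repD(1)[OF rep(2)]
  note hE = ring_iso_memE[OF h(1), unfolded End_alg_simps div_alg_simps mem_Collect_eq]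
  have hs: "h (c \<cdot>\<^sub>m M) = c *\<^sub>R h M" if "endo N \<rho> M" for c M
    using h(2) that by (auto simp: lin_maps_def LinearCombinations.module_hom_def End_alg_simps div_alg_simps)
  define F where "F = inv_into {M. endo N \<rho> M} h"
  have bij: "bij_betw h {M. endo N \<rho> M} (div_carrier D)" by (rule hE(5))
  have F: "endo N \<rho> (F q)" "h (F q) = q" if "q \<in> div_carrier D" for q
    using bij that unfolding F_def bij_betw_def
    by (metis (no_types, lifting) inv_into_into mem_Collect_eq, metis (no_types, lifting) f_inv_into_f)
  have Fh: "F (h M) = M" if "endo N \<rho> M" for M
    using bij that unfolding F_def bij_betw_def by (simp add: inv_into_f_f)
  note el = endo_lincomb[OF rep(1)]
  have Fc: "F q \<in> carrier_mat N N" if "q \<in> div_carrier D" for q using F(1)[OF that] by (simp add: endo_def)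
  have F_add: "F (p + q) = F p + F q" if "p \<in> div_carrier D" "q \<in> div_carrier D" for p q
    using Fh[OF el(3)[OF F(1)[OF that(1)] F(1)[OF that(2)]]] hE(3) F that by simp
  have F_mult: "F (p * q) = F p * F q" if "p \<in> div_carrier D" "q \<in> div_carrier D" for p q
    using Fh[OF el(4)[OF F(1)[OF that(1)] F(1)[OF that(2)]]] hE(2) F that by simp
  have F_smult: "F (c *\<^sub>R q) = c \<cdot>\<^sub>m F q" if "q \<in> div_carrier D" for c q
    using Fh[OF el(2)[OF F(1)[OF that]]] hs F that by simp
  have F_one: "F 1 = 1\<^sub>m N" using Fh[OF el(1)] hE(4) by simp
  define E where "E q = P * F q * Q" for q
  note ca = assoc_mult_mat[of _ N N _ N _ N]
  have conj_endo: "endo N \<tau>' (A * M * B)"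
    if M: "endo N \<tau> M" and A: "A \<in> carrier_mat N N" and B: "B \<in> carrier_mat N N" and AB: "B * A = 1\<^sub>m N" "A * B = 1\<^sub>m N"
      and t: "\<And>g. g \<in> carrier G \<Longrightarrow> \<tau> g \<in> carrier_mat N N" "\<And>g. g \<in> carrier G \<Longrightarrow> \<tau>' g \<in> carrier_mat N N"
      and int: "\<And>g. g \<in> carrier G \<Longrightarrow> A * \<tau> g = \<tau>' g * A" for \<tau> \<tau>' M A B
    unfolding endo_def
  proof (intro conjI ballI)
    have Mc: "M \<in> carrier_mat N N" using M by (simp add: endo_def)
    show "A * M * B \<in> carrier_mat N N" using A B Mc by auto
    fix g assume g: "g \<in> carrier G"
    have tc: "\<tau> g \<in> carrier_mat N N" "\<tau>' g \<in> carrier_mat N N" using t g by auto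
    have "B * \<tau>' g = B * \<tau>' g * (A * B)" using AB(2) tc B by simp
    also have "\<dots> = B * (\<tau>' g * A) * B" using A B tc by (simp add: ca)
    also have "\<dots> = (B * A) * \<tau> g * B" unfolding int[OF g, symmetric] using A B tc by (simp add: ca)
    also have "\<dots> = \<tau> g * B" using AB(1) tc B by simp
    finally have intB: "B * \<tau>' g = \<tau> g * B" .
    have "A * M * B * \<tau>' g = A * M * (B * \<tau>' g)" using A B Mc tc by (simp add: ca)
    also have "\<dots> = A * (M * \<tau> g) * B" unfolding intB using A B Mc tc by (simp add: ca)
    also have "\<dots> = A * (\<tau> g * M) * B" using M g by (simp add: endo_def)
    also have "\<dots> = (A * \<tau> g) * M * B" using A B Mc tc by (simp add: ca)
    also have "\<dots> = \<tau>' g * (A * M * B)" unfolding int[OF g] using A B Mc tc by (simp add: ca)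
    finally show "A * M * B * \<tau>' g = \<tau>' g * (A * M * B)" .
  qed
  have Q\<sigma>: "Q * \<sigma> g = \<rho> g * Q" if g: "g \<in> carrier G" for g
  proof -
    have "Q * \<sigma> g = Q * \<sigma> g * (P * Q)" using PQ s[OF g] Q by simp
    also have "\<dots> = Q * (\<sigma> g * P) * Q" using P Q s[OF g] by (simp add: ca)
    also have "\<dots> = (Q * P) * \<rho> g * Q" unfolding P\<rho>[OF g, symmetric] using P Q r[OF g] by (simp add: ca)
    also have "\<dots> = \<rho> g * Q" using PQ r[OF g] Q by simp
    finally show ?thesis .
  qed
  have "div_structure D N \<sigma> E"
    unfolding div_structure_def
  proof (intro conjI ballI allI impI)
    show "endo N \<sigma> (E q)" if "q \<in> div_carrier D" for q
      unfolding E_def by (rule conj_endo[OF F(1)[OF that] P Q PQ(2,1) r s P\<rho>])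
    show "\<exists>q\<in>div_carrier D. M = E q" if M: "endo N \<sigma> M" for M
    proof
      have e: "endo N \<rho> (Q * M * P)" by (rule conj_endo[OF M Q P PQ(1,2) s r Q\<sigma>])
      have Mc: "M \<in> carrier_mat N N" using M by (simp add: endo_def)
      show "h (Q * M * P) \<in> div_carrier D" using hE(1) e by simp
      have "E (h (Q * M * P)) = P * (Q * M * P) * Q" by (simp add: E_def Fh[OF e])
      also have "\<dots> = (P * Q) * M * (P * Q)" using P Q Mc by (simp add: ca)
      finally show "M = E (h (Q * M * P))" using PQ Mc by simp
    qed
    fix p q assume pq: "p \<in> div_carrier D" "q \<in> div_carrier D"
    show "E (p + q) = E p + E q"
      using P Q Fc pq by (simp add: E_def F_add mult_add_distrib_mat[of _ N N _ N] add_mult_distrib_mat[of _ N N _ _ N])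
    have "E p * E q = P * F p * (Q * P) * F q * Q"
      using P Q Fc[OF pq(1)] Fc[OF pq(2)] by (simp add: E_def ca)
    then show "E (p * q) = E p * E q"
      using P Q Fc[OF pq(1)] Fc[OF pq(2)] PQ by (simp add: E_def F_mult[OF pq] ca)
  next
    show "E (c *\<^sub>R q) = c \<cdot>\<^sub>m E q" if "q \<in> div_carrier D" for c q
      using P Q Fc[OF that] by (simp add: E_def F_smult[OF that] mult_smult_distrib[of _ N N _ N] mult_smult_assoc_mat[of _ N N _ N])
    show "E 1 = 1\<^sub>m N" using P PQ by (simp add: E_def F_one)
  qed
  then show ?thesis by blast
qed

text \<open>These will be the purely imaginary elements of the division algebra.\<close>

definition skew_endo :: "nat \<Rightarrow> ('g \<Rightarrow> real mat) \<Rightarrow> real mat \<Rightarrow> bool" where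
  "skew_endo n \<sigma> M \<longleftrightarrow> endo n \<sigma> M \<and> transpose_mat M = (-1) \<cdot>\<^sub>m M"

context
  fixes n \<sigma>
  assumes orth: "orth_rep n \<sigma>" and irr: "(n, \<sigma>) \<in> irreducible_reps G"
begin

private abbreviation "CM \<equiv> carrier_mat n n :: real mat set"

lemma degree_pos: "n > 0" using irr by (simp add: irreducible_reps_iff)

lemma skew_endo_carrier: "skew_endo n \<sigma> M \<Longrightarrow> M \<in> CM" "endo n \<sigma> M \<Longrightarrow> M \<in> CM"
  by (auto simp: skew_endo_def endo_def)

lemma skew_endo_entry: "\<lbrakk>skew_endo n \<sigma> M; i < n; j < n\<rbrakk> \<Longrightarrow> M $$ (j, i) = - M $$ (i, j)"
proof -
  assume M: "skew_endo n \<sigma> M" and ij: "i < n" "j < n"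
  have "transpose_mat M $$ (i, j) = ((-1) \<cdot>\<^sub>m M) $$ (i, j)"
    using M by (simp only: skew_endo_def)
  then show "M $$ (j, i) = - M $$ (i, j)"
    using skew_endo_carrier(1)[OF M] ij by simp
qed

lemma skew_endoI: "\<lbrakk>endo n \<sigma> M; \<And>i j. \<lbrakk>i < n; j < n\<rbrakk> \<Longrightarrow> M $$ (j, i) = - M $$ (i, j)\<rbrakk> \<Longrightarrow> skew_endo n \<sigma> M"
  unfolding skew_endo_def
proof
  assume M: "endo n \<sigma> M" and skew: "\<And>i j. \<lbrakk>i < n; j < n\<rbrakk> \<Longrightarrow> M $$ (j, i) = - M $$ (i, j)"
  show "transpose_mat M = (-1) \<cdot>\<^sub>m M"
  proof (rule eq_matI)
    fix i j assume "i < dim_row ((-1) \<cdot>\<^sub>m M)" "j < dim_col ((-1) \<cdot>\<^sub>m M)"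
    then have "i < n" "j < n" "M \<in> CM" using M by (auto simp: endo_def)
    then show "transpose_mat M $$ (i, j) = ((-1) \<cdot>\<^sub>m M) $$ (i, j)" using skew[of i j] by simp
  qed (use M in \<open>auto simp: endo_def\<close>)
qed

lemma skew_endo_lincomb:
  "skew_endo n \<sigma> M \<Longrightarrow> skew_endo n \<sigma> (c \<cdot>\<^sub>m M)"
  "\<lbrakk>skew_endo n \<sigma> M; skew_endo n \<sigma> N\<rbrakk> \<Longrightarrow> skew_endo n \<sigma> (M + N)"
proof -
  note el = endo_lincomb[OF orth_repD(1)[OF orth]]
  show "skew_endo n \<sigma> (c \<cdot>\<^sub>m M)" if M: "skew_endo n \<sigma> M"
  proof (rule skew_endoI)
    show "(c \<cdot>\<^sub>m M) $$ (j, i) = - (c \<cdot>\<^sub>m M) $$ (i, j)" if "i < n" "j < n" for i j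
      using skew_endo_carrier(1)[OF M] skew_endo_entry[OF M that] that by simp
  qed (use M in \<open>auto simp: skew_endo_def intro: el\<close>)
  show "skew_endo n \<sigma> (M + N)" if MN: "skew_endo n \<sigma> M" "skew_endo n \<sigma> N"
  proof (rule skew_endoI)
    show "(M + N) $$ (j, i) = - (M + N) $$ (i, j)" if "i < n" "j < n" for i j
      using skew_endo_carrier(1)[OF MN(1)] skew_endo_carrier(1)[OF MN(2)]
        skew_endo_entry[OF MN(1) that] skew_endo_entry[OF MN(2) that] that by simp
  qed (use MN in \<open>auto simp: skew_endo_def intro: el\<close>)
qed

text \<open>The square of a skew matrix is symmetric, hence scalar here, and minus that scalar times
  \<open>n\<close> is the sum of the squares of the entries of \<open>N\<close>.\<close>

lemma skew_endo_square:
  assumes N: "skew_endo n \<sigma> N"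
  shows "\<exists>s\<ge>0. N * N = (- s) \<cdot>\<^sub>m 1\<^sub>m n \<and> (s = 0 \<longrightarrow> N = 0\<^sub>m n n)"
proof -
  note c = skew_endo_carrier(1)[OF N]
  have tN: "transpose_mat N = (-1) \<cdot>\<^sub>m N" and eN: "endo n \<sigma> N" using N by (auto simp: skew_endo_def)
  have "transpose_mat (N * N) = N * N"
    using transpose_mult[OF c c] c unfolding tN
    by (simp add: mult_smult_distrib[of _ n n _ n] mult_smult_assoc_mat[of _ n n _ n] smult_smult_mat)
  then obtain t where t: "N * N = t \<cdot>\<^sub>m 1\<^sub>m n"
    using symmetric_endo[OF irr endo_lincomb(4)[OF orth_repD(1)[OF orth] eN eN]] by auto
  have NT: "N * transpose_mat N = (- t) \<cdot>\<^sub>m 1\<^sub>m n"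
    unfolding tN using c by (simp add: mult_smult_distrib[of _ n n _ n] t smult_smult_mat)
  then have "real n * (- t) = (\<Sum>i<n. \<Sum>j<n. (N $$ (i, j))\<^sup>2)"
    using mat_trace_mult_transpose[OF c] mat_trace_scalar[of "- t" n] by simp
  moreover have "\<dots> \<ge> 0" by (intro sum_nonneg) simp
  ultimately have "0 \<le> real n * (- t)" by linarith
  then have "- t \<ge> 0" using degree_pos zero_le_mult_iff[of "real n" "- t"] by simp
  moreover have "N = 0\<^sub>m n n" if "t = 0"
    using mult_transpose_eq_0[OF c] NT mat_trace_scalar[of "- t" n] that by simp
  ultimately show ?thesis using t by (intro exI[of _ "- t"]) auto
qed

text \<open>Symmetric again, hence scalar. Up to a factor the anticommutator is the inner product of
  imaginary elements, and to anticommute means to be orthogonal.\<close>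

lemma skew_endo_anticommutator:
  assumes M: "skew_endo n \<sigma> M" and N: "skew_endo n \<sigma> N"
  shows "\<exists>t. N * M + M * N = t \<cdot>\<^sub>m 1\<^sub>m n"
proof (rule symmetric_endo[OF irr])
  note c = skew_endo_carrier(1)[OF M] skew_endo_carrier(1)[OF N]
  note el = endo_lincomb[OF orth_repD(1)[OF orth]]
  show "endo n \<sigma> (N * M + M * N)" using M N by (intro el) (auto simp: skew_endo_def)
  have t: "transpose_mat M = (-1) \<cdot>\<^sub>m M" "transpose_mat N = (-1) \<cdot>\<^sub>m N"
    using M N by (auto simp: skew_endo_def)
  have "transpose_mat (N * M + M * N) = transpose_mat (N * M) + transpose_mat (M * N)"
    using c by (intro transpose_add[of _ n n]) auto
  also have "\<dots> = M * N + N * M"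
    unfolding transpose_mult[OF c] transpose_mult[OF c(2,1)] t using c
    by (simp add: mult_smult_distrib[of _ n n _ n] mult_smult_assoc_mat[of _ n n _ n] smult_smult_mat)
  also have "\<dots> = N * M + M * N" using c by (intro comm_add_mat[of _ n n]) auto
  finally show "transpose_mat (N * M + M * N) = N * M + M * N" .
qed

text \<open>The symmetric part is scalar, so symmetric and skew parts are the real and imaginary
  parts.\<close>

lemma endo_decomposition:
  assumes M: "endo n \<sigma> M"
  shows "\<exists>c S. M = c \<cdot>\<^sub>m 1\<^sub>m n + S \<and> skew_endo n \<sigma> S"
proof -
  note el = endo_lincomb[OF orth_repD(1)[OF orth]]
  let ?T = "transpose_mat M"
  have c: "M \<in> CM" "?T \<in> CM" using M by (auto simp: endo_def)
  have T: "endo n \<sigma> ?T" by (rule endo_transpose[OF orth M])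
  have "endo n \<sigma> ((1/2) \<cdot>\<^sub>m (M + ?T))" by (intro el M T)
  moreover have "transpose_mat ((1/2) \<cdot>\<^sub>m (M + ?T)) = (1/2) \<cdot>\<^sub>m (M + ?T)"
    using c by (intro eq_matI) auto
  ultimately obtain d where d: "(1/2) \<cdot>\<^sub>m (M + ?T) = d \<cdot>\<^sub>m 1\<^sub>m n"
    using symmetric_endo[OF irr] by blast
  let ?S = "(1/2) \<cdot>\<^sub>m (M + (-1) \<cdot>\<^sub>m ?T)"
  have "skew_endo n \<sigma> ?S"
    using c by (intro skew_endoI el M T) (auto simp: field_simps)
  moreover have "M = (1/2) \<cdot>\<^sub>m (M + ?T) + ?S"
    using c by (intro eq_matI) (auto simp: field_simps)
  ultimately show ?thesis unfolding d by blast
qed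

lemma skew_endo_normalize:
  assumes N: "skew_endo n \<sigma> N" "N \<noteq> 0\<^sub>m n n"
  shows "\<exists>k. (k \<cdot>\<^sub>m N) * (k \<cdot>\<^sub>m N) = (-1) \<cdot>\<^sub>m 1\<^sub>m n"
proof -
  note c = skew_endo_carrier(1)[OF N(1)]
  obtain s where s: "s \<ge> 0" "N * N = (- s) \<cdot>\<^sub>m 1\<^sub>m n" "s = 0 \<longrightarrow> N = 0\<^sub>m n n"
    using skew_endo_square[OF N(1)] by blast
  then have "s > 0" using N(2) by auto
  then have "(1 / sqrt s) * (1 / sqrt s) * (- s) = -1" by (simp add: field_simps)
  then have "((1 / sqrt s) \<cdot>\<^sub>m N) * ((1 / sqrt s) \<cdot>\<^sub>m N) = (-1) \<cdot>\<^sub>m 1\<^sub>m n"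
    using c s(2) by (simp add: mult_smult_distrib[of _ n n _ n] mult_smult_assoc_mat[of _ n n _ n] smult_smult_mat)
  then show ?thesis by blast
qed

text \<open>One step of Gram-Schmidt for the anticommutator: that of \<open>N\<close> with
  \<open>I\<close> is a scalar \<open>t\<close>, that of \<open>I\<close> with itself is -2, so
  adding \<open>t / 2\<close> times \<open>I\<close> to \<open>N\<close> removes it.\<close>

lemma anticommuting_part:
  assumes N: "skew_endo n \<sigma> N" and I: "skew_endo n \<sigma> I" "I * I = (-1) \<cdot>\<^sub>m 1\<^sub>m n"
  shows "\<exists>t. (N + t \<cdot>\<^sub>m I) * I = (-1) \<cdot>\<^sub>m (I * (N + t \<cdot>\<^sub>m I))"
proof -
  note c = skew_endo_carrier(1)[OF N(1)] skew_endo_carrier(1)[OF I(1)]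
  obtain t where t: "N * I + I * N = t \<cdot>\<^sub>m 1\<^sub>m n" using skew_endo_anticommutator[OF I(1) N] by blast
  have NI: "(N * I) $$ (i, j) = (if i = j then t else 0) - (I * N) $$ (i, j)" if "i < n" "j < n" for i j
    using arg_cong[OF t, of "\<lambda>A. A $$ (i, j)"] that c by (simp del: index_mult_mat(1) split: if_splits)
  have "(N + (t / 2) \<cdot>\<^sub>m I) * I = N * I + (t / 2) \<cdot>\<^sub>m (I * I)"
    using c by (simp add: add_mult_distrib_mat[of _ n n _ _ n] mult_smult_assoc_mat[of _ n n _ n])
  moreover have "I * (N + (t / 2) \<cdot>\<^sub>m I) = I * N + (t / 2) \<cdot>\<^sub>m (I * I)"
    using c by (simp add: mult_add_distrib_mat[of _ n n _ n] mult_smult_distrib[of _ n n _ n])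
  moreover have "N * I + (t / 2) \<cdot>\<^sub>m (I * I) = (-1) \<cdot>\<^sub>m (I * N + (t / 2) \<cdot>\<^sub>m (I * I))"
    unfolding I(2) using c by (intro eq_matI) (auto simp: NI simp del: index_mult_mat(1))
  ultimately show ?thesis by (intro exI[of _ "t / 2"]) simp
qed

lemma anticommute_lincomb:
  assumes "A \<in> CM" "B \<in> CM" "M \<in> CM" "A * M = (-1) \<cdot>\<^sub>m (M * A)" "B * M = (-1) \<cdot>\<^sub>m (M * B)"
  shows "(A + t \<cdot>\<^sub>m B) * M = (-1) \<cdot>\<^sub>m (M * (A + t \<cdot>\<^sub>m B))"
proof -
  have "(A + t \<cdot>\<^sub>m B) * M = A * M + t \<cdot>\<^sub>m (B * M)"
    using assms(1-3) by (simp add: add_mult_distrib_mat[of _ n n _ _ n] mult_smult_assoc_mat[of _ n n _ n])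
  moreover have "M * (A + t \<cdot>\<^sub>m B) = M * A + t \<cdot>\<^sub>m (M * B)"
    using assms(1-3) by (simp add: mult_add_distrib_mat[of _ n n _ n] mult_smult_distrib[of _ n n _ n])
  ultimately show ?thesis
    unfolding assms(4,5) using assms(1-3) by (intro eq_matI) (auto simp: algebra_simps simp del: index_mult_mat(1))
qed

lemma Frobenius_real:
  assumes "\<And>S. skew_endo n \<sigma> S \<Longrightarrow> S = 0\<^sub>m n n"
  shows "div_structure DReal n \<sigma> (\<lambda>q. qre q \<cdot>\<^sub>m 1\<^sub>m n)"
  unfolding div_structure_def
proof (intro conjI ballI allI impI)
  note el = endo_lincomb[OF orth_repD(1)[OF orth]]
  show "endo n \<sigma> (qre q \<cdot>\<^sub>m 1\<^sub>m n)" for q by (intro el)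
  fix M assume "endo n \<sigma> M"
  then obtain c S where "M = c \<cdot>\<^sub>m 1\<^sub>m n + S" "skew_endo n \<sigma> S" using endo_decomposition by blast
  then have "M = c \<cdot>\<^sub>m 1\<^sub>m n" using assms[of S] by (auto intro!: eq_matI)
  then show "\<exists>q\<in>div_carrier DReal. M = qre q \<cdot>\<^sub>m 1\<^sub>m n"
    by (intro bexI[of _ "Quat c 0 0 0"]) auto
qed (auto simp: quat_sel_mult mult_smult_distrib[of _ n n _ n] mult_smult_assoc_mat[of _ n n _ n] intro!: eq_matI)

lemma Frobenius_complex:
  assumes I: "skew_endo n \<sigma> I" "I * I = (-1) \<cdot>\<^sub>m 1\<^sub>m n"
    and max: "\<And>S. \<lbrakk>skew_endo n \<sigma> S; S * I = (-1) \<cdot>\<^sub>m (I * S)\<rbrakk> \<Longrightarrow> S = 0\<^sub>m n n"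
  shows "div_structure DComplex n \<sigma> (\<lambda>q. qre q \<cdot>\<^sub>m 1\<^sub>m n + qi q \<cdot>\<^sub>m I)" (is "div_structure _ _ _ ?E")
  unfolding div_structure_def
proof (intro conjI ballI allI impI)
  note el = endo_lincomb[OF orth_repD(1)[OF orth]]
  note c = skew_endo_carrier(1)[OF I(1)]
  have eI: "endo n \<sigma> I" using I by (simp add: skew_endo_def)
  show "endo n \<sigma> (?E q)" for q by (intro el eI)
  show "\<exists>q\<in>div_carrier DComplex. M = ?E q" if M: "endo n \<sigma> M" for M
  proof -
    obtain a S where S: "M = a \<cdot>\<^sub>m 1\<^sub>m n + S" "skew_endo n \<sigma> S" using endo_decomposition[OF M] by blast
    obtain t where t: "(S + t \<cdot>\<^sub>m I) * I = (-1) \<cdot>\<^sub>m (I * (S + t \<cdot>\<^sub>m I))"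
      using anticommuting_part[OF S(2) I] by blast
    have S0: "S + t \<cdot>\<^sub>m I = 0\<^sub>m n n" by (intro max t skew_endo_lincomb S I)
    have z: "S $$ (i, j) = - (t * I $$ (i, j))" if "i < n" "j < n" for i j
      using arg_cong[OF S0, of "\<lambda>A. A $$ (i, j)"] that c by simp
    have "M = ?E (Quat a (- t) 0 0)"
      unfolding S(1) using c skew_endo_carrier(1)[OF S(2)]
      by (intro eq_matI) (auto simp: z)
    then show ?thesis by (intro bexI[of _ "Quat a (- t) 0 0"]) auto
  qed
  show "?E (p + q) = ?E p + ?E q" for p q using c by (intro eq_matI) (auto simp: algebra_simps)
  show "?E (r *\<^sub>R q) = r \<cdot>\<^sub>m ?E q" for r q using c by (intro eq_matI) (auto simp: algebra_simps)
  show "?E 1 = 1\<^sub>m n" using c by (intro eq_matI) auto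
  fix p q assume pq: "p \<in> div_carrier DComplex" "q \<in> div_carrier DComplex"
  have "?E p * ?E q = qre p \<cdot>\<^sub>m ?E q + qi p \<cdot>\<^sub>m (I * ?E q)"
    using c by (simp add: add_mult_distrib_mat[of _ n n _ _ n] mult_smult_assoc_mat[of _ n n _ n])
  also have "I * ?E q = qre q \<cdot>\<^sub>m I + qi q \<cdot>\<^sub>m (I * I)"
    using c by (simp add: mult_add_distrib_mat[of _ n n _ n] mult_smult_distrib[of _ n n _ n])
  finally show "?E (p * q) = ?E p * ?E q"
    unfolding I(2) using c pq by (auto intro!: eq_matI simp: quat_sel_mult algebra_simps)
qed

text \<open>The point is that \<open>1\<close>, \<open>I\<close>, \<open>J\<close> and
  \<open>K = I J\<close> span. After the components along \<open>I\<close>, \<open>J\<close> and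
  \<open>K\<close> are removed, the rest \<open>N\<close> anticommutes with all three; but
  anticommuting with \<open>I\<close> and \<open>J\<close> implies commuting with \<open>K\<close>,
  so \<open>K N = 0\<close>, and \<open>N = 0\<close> because \<open>K\<close> squares to
  -1.\<close>

lemma Frobenius_quaternion:
  assumes I: "skew_endo n \<sigma> I" "I * I = (-1) \<cdot>\<^sub>m 1\<^sub>m n"
    and J: "skew_endo n \<sigma> J" "J * J = (-1) \<cdot>\<^sub>m 1\<^sub>m n" and JI: "J * I = (-1) \<cdot>\<^sub>m (I * J)"
  shows "div_structure DQuat n \<sigma>
    (\<lambda>q. qre q \<cdot>\<^sub>m 1\<^sub>m n + qi q \<cdot>\<^sub>m I + qj q \<cdot>\<^sub>m J + qk q \<cdot>\<^sub>m (I * J))" (is "div_structure _ _ _ ?E")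
proof -
  define K where "K = I * J"
  note el = endo_lincomb[OF orth_repD(1)[OF orth]]
  have cI: "I \<in> CM" and cJ: "J \<in> CM" using skew_endo_carrier(1) I J by auto
  then have cK: "K \<in> CM" by (simp add: K_def)
  note c = cI cJ cK
  note assoc = assoc_mult_mat[of _ n n _ n _ n]
  note ms = mult_smult_distrib[of _ n n _ n] mult_smult_assoc_mat[of _ n n _ n] smult_smult_mat
  have eI: "endo n \<sigma> I" "endo n \<sigma> J" "endo n \<sigma> K" using I J el(4) by (auto simp: skew_endo_def K_def)
  have IJ: "I * J = K" and JI': "J * I = (-1) \<cdot>\<^sub>m K" using JI by (simp_all add: K_def)
  have IK: "I * K = (-1) \<cdot>\<^sub>m J"
    unfolding K_def using c by (simp add: assoc[symmetric] I(2) ms)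
  have KJ: "K * J = (-1) \<cdot>\<^sub>m I"
    unfolding K_def using c by (simp add: assoc J(2) ms)
  have KI: "K * I = J"
  proof -
    have "K * I = I * (J * I)" unfolding K_def using c by (simp add: assoc)
    then show ?thesis using c by (simp add: JI' ms IK)
  qed
  have JK: "J * K = I"
  proof -
    have "J * K = (J * I) * J" unfolding K_def using c by (simp add: assoc)
    then show ?thesis using c by (simp add: JI' ms KJ)
  qed
  have KK: "K * K = (-1) \<cdot>\<^sub>m 1\<^sub>m n"
  proof -
    have "K * K = I * (J * K)" using c by (simp add: K_def assoc)
    then show ?thesis by (simp add: JK I(2))
  qed
  have K: "skew_endo n \<sigma> K"
  proof -
    have "transpose_mat K = transpose_mat J * transpose_mat I"
      unfolding K_def by (rule transpose_mult[OF cI cJ])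
    also have "\<dots> = J * I" using I J c by (simp add: skew_endo_def ms)
    finally show ?thesis using eI(3) JI' by (simp add: skew_endo_def)
  qed
  show ?thesis
    unfolding div_structure_def IJ
  proof (intro conjI ballI allI impI)
    let ?E = "\<lambda>q. qre q \<cdot>\<^sub>m 1\<^sub>m n + qi q \<cdot>\<^sub>m I + qj q \<cdot>\<^sub>m J + qk q \<cdot>\<^sub>m K"
    show "endo n \<sigma> (?E q)" for q by (intro el eI)
    show "\<exists>q\<in>div_carrier DQuat. M = ?E q" if M: "endo n \<sigma> M" for M
    proof -
      obtain a S where S: "M = a \<cdot>\<^sub>m 1\<^sub>m n + S" "skew_endo n \<sigma> S" using endo_decomposition[OF M] by blast
      note cS = skew_endo_carrier(1)[OF S(2)]
      obtain r where r: "(S + r \<cdot>\<^sub>m I) * I = (-1) \<cdot>\<^sub>m (I * (S + r \<cdot>\<^sub>m I))"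
        using anticommuting_part[OF S(2) I] by blast
      have S1: "skew_endo n \<sigma> (S + r \<cdot>\<^sub>m I)" by (intro skew_endo_lincomb S I)
      obtain s where s: "(S + r \<cdot>\<^sub>m I + s \<cdot>\<^sub>m J) * J = (-1) \<cdot>\<^sub>m (J * (S + r \<cdot>\<^sub>m I + s \<cdot>\<^sub>m J))"
        using anticommuting_part[OF S1 J] by blast
      have S2: "skew_endo n \<sigma> (S + r \<cdot>\<^sub>m I + s \<cdot>\<^sub>m J)" by (intro skew_endo_lincomb S1 J)
      obtain t where t: "(S + r \<cdot>\<^sub>m I + s \<cdot>\<^sub>m J + t \<cdot>\<^sub>m K) * K = (-1) \<cdot>\<^sub>m (K * (S + r \<cdot>\<^sub>m I + s \<cdot>\<^sub>m J + t \<cdot>\<^sub>m K))"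
        using anticommuting_part[OF S2 K KK] by blast
      define N where "N = S + r \<cdot>\<^sub>m I + s \<cdot>\<^sub>m J + t \<cdot>\<^sub>m K"
      have cN: "N \<in> CM" using cS c by (simp add: N_def)
      \<comment> \<open>Removing the later components does not disturb this, as \<open>J\<close> and
        \<open>K\<close> anticommute with \<open>I\<close>.\<close>
      have NI: "N * I = (-1) \<cdot>\<^sub>m (I * N)"
        unfolding N_def using cS c by (intro anticommute_lincomb r) (auto simp: JI' IJ KI IK smult_smult_mat)
      have NJ: "N * J = (-1) \<cdot>\<^sub>m (J * N)"
        unfolding N_def using cS c by (intro anticommute_lincomb s) (auto simp: KJ JK smult_smult_mat)
      have NK: "N * K = (-1) \<cdot>\<^sub>m (K * N)" unfolding N_def by (rule t)
      have "N * K = (N * I) * J" unfolding K_def using c cN by (simp add: assoc)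
      also have "\<dots> = (-1) \<cdot>\<^sub>m (I * (N * J))" unfolding NI using c cN by (simp add: ms assoc)
      also have "\<dots> = K * N" unfolding NJ using c cN by (simp add: ms assoc[symmetric] IJ)
      finally have NK': "N * K = K * N" .
      have "K * N = 0\<^sub>m n n"
      proof (rule eq_matI)
        fix i j assume "i < dim_row (0\<^sub>m n n)" "j < dim_col (0\<^sub>m n n)"
        then have "(K * N) $$ (i, j) = - (K * N) $$ (i, j)"
          using arg_cong[OF trans[OF NK'[symmetric] NK], of "\<lambda>A. A $$ (i, j)"] cK cN
          by (simp del: index_mult_mat(1))
        then show "(K * N) $$ (i, j) = 0\<^sub>m n n $$ (i, j)"
          using \<open>i < dim_row (0\<^sub>m n n)\<close> \<open>j < dim_col (0\<^sub>m n n)\<close> by simp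
      qed (use cK cN in auto)
      then have "K * (K * N) = 0\<^sub>m n n" using cK by simp
      moreover have "K * (K * N) = (-1) \<cdot>\<^sub>m N" using cK cN by (simp add: assoc[symmetric] KK ms)
      ultimately have N0: "(-1) \<cdot>\<^sub>m N = 0\<^sub>m n n" by simp
      have z: "S $$ (i, j) = - (r * I $$ (i, j)) - s * J $$ (i, j) - t * K $$ (i, j)" if "i < n" "j < n" for i j
        using arg_cong[OF N0, of "\<lambda>A. A $$ (i, j)"] that c cS by (simp add: N_def)
      have "M = ?E (Quat a (- r) (- s) (- t))"
        unfolding S(1) using c cS by (intro eq_matI) (auto simp: z)
      then show ?thesis by (intro bexI[of _ "Quat a (- r) (- s) (- t)"]) auto
    qed
    show "?E (p + q) = ?E p + ?E q" for p q using c by (intro eq_matI) (auto simp: algebra_simps)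
    show "?E (r *\<^sub>R q) = r \<cdot>\<^sub>m ?E q" for r q using c by (intro eq_matI) (auto simp: algebra_simps)
    show "?E 1 = 1\<^sub>m n" using c by (intro eq_matI) auto
    fix p q
    have right: "X * ?E q = qre q \<cdot>\<^sub>m X + qi q \<cdot>\<^sub>m (X * I) + qj q \<cdot>\<^sub>m (X * J) + qk q \<cdot>\<^sub>m (X * K)" if "X \<in> CM" for X
      using c that by (simp add: mult_add_distrib_mat[of _ n n _ n] ms)
    have "?E p * ?E q = qre p \<cdot>\<^sub>m ?E q + qi p \<cdot>\<^sub>m (I * ?E q) + qj p \<cdot>\<^sub>m (J * ?E q) + qk p \<cdot>\<^sub>m (K * ?E q)"
      using c by (simp add: add_mult_distrib_mat[of _ n n _ _ n] ms)
    also have "\<dots> = ?E (p * q)"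
      unfolding right[OF cI] right[OF cJ] right[OF cK] I(2) J(2) KK IJ JI' IK KI JK KJ
      using c by (intro eq_matI) (auto simp: quat_sel_mult algebra_simps)
    finally show "?E (p * q) = ?E p * ?E q" ..
  qed
qed

text \<open>The case distinction asks for an imaginary unit and then for a second one orthogonal to
  it; the quaternion case shows that the process ends there.\<close>

theorem Frobenius: "\<exists>D E. div_structure D n \<sigma> E"
proof (cases "\<forall>S. skew_endo n \<sigma> S \<longrightarrow> S = 0\<^sub>m n n")
  case True
  then show ?thesis using Frobenius_real by blast
next
  case False
  then obtain I0 where "skew_endo n \<sigma> I0" "I0 \<noteq> 0\<^sub>m n n" by blast
  then obtain I where I: "skew_endo n \<sigma> I" "I * I = (-1) \<cdot>\<^sub>m 1\<^sub>m n"
    using skew_endo_normalize skew_endo_lincomb(1) by blast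
  show ?thesis
  proof (cases "\<forall>S. skew_endo n \<sigma> S \<longrightarrow> S * I = (-1) \<cdot>\<^sub>m (I * S) \<longrightarrow> S = 0\<^sub>m n n")
    case True
    then show ?thesis using Frobenius_complex[OF I] by blast
  next
    case False
    then obtain J0 where J0: "skew_endo n \<sigma> J0" "J0 * I = (-1) \<cdot>\<^sub>m (I * J0)" "J0 \<noteq> 0\<^sub>m n n" by blast
    then obtain k where k: "(k \<cdot>\<^sub>m J0) * (k \<cdot>\<^sub>m J0) = (-1) \<cdot>\<^sub>m 1\<^sub>m n"
      using skew_endo_normalize by blast
    have "(k \<cdot>\<^sub>m J0) * I = (-1) \<cdot>\<^sub>m (I * (k \<cdot>\<^sub>m J0))"
      using skew_endo_carrier(1)[OF J0(1)] skew_endo_carrier(1)[OF I(1)] J0(2)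
      by (simp add: mult_smult_distrib[of _ n n _ n] mult_smult_assoc_mat[of _ n n _ n] smult_smult_mat mult.commute)
    then show ?thesis
      using Frobenius_quaternion[OF I skew_endo_lincomb(1)[OF J0(1)] k] by blast
  qed
qed

text \<open>\<open>E\<close> is arbitrary, so imaginary elements have to be recognized
  algebraically: they square to a non-positive real. If \<open>E p\<close> is \<open>a\<close> plus
  a skew \<open>S\<close>, the cross term \<open>2 a S\<close> must be scalar; for
  \<open>a \<noteq> 0\<close> this makes \<open>S\<close> zero and \<open>a^2\<close> non-positive,
  which is absurd. So \<open>E p\<close> is skew.\<close>

lemma div_structure_transpose:
  assumes E: "div_structure D n \<sigma> E" and q: "q \<in> div_carrier D"
  shows "transpose_mat (E q) = E (qcnj q)"
proof -
  note ED = div_structureD[OF E]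
  have imag: "transpose_mat (E p) = (-1) \<cdot>\<^sub>m E p" if p: "p \<in> div_carrier D" "qre p = 0" for p
  proof -
    obtain a S where S: "E p = a \<cdot>\<^sub>m 1\<^sub>m n + S" "skew_endo n \<sigma> S"
      using endo_decomposition[OF ED(1)[OF p(1)]] by blast
    note cS = skew_endo_carrier(1)[OF S(2)]
    obtain s where s: "s \<ge> 0" "S * S = (- s) \<cdot>\<^sub>m 1\<^sub>m n" "s = 0 \<longrightarrow> S = 0\<^sub>m n n"
      using skew_endo_square[OF S(2)] by blast
    define m where "m = (qi p)\<^sup>2 + (qj p)\<^sup>2 + (qk p)\<^sup>2"
    have "p * p = (- m) *\<^sub>R 1"
      using p(2) by (simp add: quat_eq_iff quat_sel_mult m_def power2_eq_square)
    then have "E p * E p = (- m) \<cdot>\<^sub>m 1\<^sub>m n"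
      using ED(4)[OF p(1) p(1)] ED(5)[of 1 "- m"] ED(6) by simp
    moreover have "E p * E p = (a * a - s) \<cdot>\<^sub>m 1\<^sub>m n + (2 * a) \<cdot>\<^sub>m S"
    proof -
      have "E p * E p = a \<cdot>\<^sub>m (a \<cdot>\<^sub>m 1\<^sub>m n + S) + (a \<cdot>\<^sub>m S + S * S)"
        unfolding S(1) using cS by (simp add: add_mult_distrib_mat[of _ n n _ _ n] mult_add_distrib_mat[of _ n n _ n]
          mult_smult_distrib[of _ n n _ n] mult_smult_assoc_mat[of _ n n _ n])
      then show ?thesis unfolding s(2) using cS by (auto intro!: eq_matI simp: algebra_simps)
    qed
    ultimately have sq: "(- m) \<cdot>\<^sub>m 1\<^sub>m n = (a * a - s) \<cdot>\<^sub>m 1\<^sub>m n + (2 * a) \<cdot>\<^sub>m S" by simp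
    have entry: "(- m) * (if i = j then 1 else 0) = (a * a - s) * (if i = j then 1 else 0) + 2 * a * S $$ (i, j)"
      if "i < n" "j < n" for i j
      using arg_cong[OF sq, of "\<lambda>A. A $$ (i, j)"] that cS by auto
    have "a = 0"
    proof (rule ccontr)
      assume a: "a \<noteq> 0"
      have diag: "S $$ (i, i) = 0" if "i < n" for i
        using skew_endo_entry[OF S(2) that that] by simp
      have "S = 0\<^sub>m n n"
      proof (rule eq_matI)
        fix i j assume "i < dim_row (0\<^sub>m n n)" "j < dim_col (0\<^sub>m n n)"
        then have ij: "i < n" "j < n" by auto
        show "S $$ (i, j) = 0\<^sub>m n n $$ (i, j)"
          using entry[OF ij] diag[OF ij(1)] a ij by (cases "i = j") auto
      qed (use cS in auto)
      then have "S * S = 0\<^sub>m n n" by simp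
      then have "((- s) \<cdot>\<^sub>m 1\<^sub>m n) $$ (0, 0) = (0\<^sub>m n n :: real mat) $$ (0, 0)"
        unfolding s(2) by simp
      then have "s = 0" using degree_pos by simp
      then have "- m = a * a" using entry[OF degree_pos degree_pos] diag[OF degree_pos] by simp
      moreover have "m \<ge> 0" by (simp add: m_def)
      moreover have "a * a > 0" using a by (auto simp: zero_less_mult_iff linorder_neq_iff)
      ultimately show False by linarith
    qed
    then have "E p = S" unfolding S(1) using cS by (auto intro!: eq_matI)
    then show ?thesis using S(2) by (simp add: skew_endo_def)
  qed
  let ?p = "q - qre q *\<^sub>R 1"
  have p: "?p \<in> div_carrier D" "qre ?p = 0" using q by auto
  have decomp: "q = qre q *\<^sub>R 1 + ?p" "qcnj q = qre q *\<^sub>R 1 + (-1) *\<^sub>R ?p"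
    by (simp_all add: quat_eq_iff)
  have one: "E (qre q *\<^sub>R 1) = qre q \<cdot>\<^sub>m 1\<^sub>m n" using ED(5)[of 1 "qre q"] ED(6) by simp
  have "E (qre q *\<^sub>R 1 + ?p) = qre q \<cdot>\<^sub>m 1\<^sub>m n + E ?p"
    using ED(3)[of "qre q *\<^sub>R 1" ?p] p by (simp only: one div_carrier_closed simp_thms)
  then have Eq: "E q = qre q \<cdot>\<^sub>m 1\<^sub>m n + E ?p" by (simp only: decomp(1)[symmetric])
  have "E (qre q *\<^sub>R 1 + (-1) *\<^sub>R ?p) = qre q \<cdot>\<^sub>m 1\<^sub>m n + (-1) \<cdot>\<^sub>m E ?p"
    using ED(3)[of "qre q *\<^sub>R 1" "(-1) *\<^sub>R ?p"] ED(5)[OF p(1), of "-1"] p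
    by (simp only: one div_carrier_closed simp_thms)
  then have Ec: "E (qcnj q) = qre q \<cdot>\<^sub>m 1\<^sub>m n + (-1) \<cdot>\<^sub>m E ?p" by (simp only: decomp(2))
  show ?thesis
    unfolding Ec imag[OF p, symmetric] Eq using ED(7)[OF p(1)]
    by (subst transpose_add[of _ n n]) (auto intro!: eq_matI)
qed

end

end

section \<open>Hermitian structure over the endomorphism algebra\<close>

fun div_units :: "divalg \<Rightarrow> quat set" where
  "div_units DReal = {1}"
| "div_units DComplex = {1, Quat 0 1 0 0}"
| "div_units DQuat = {1, Quat 0 1 0 0, Quat 0 0 1 0, Quat 0 0 0 1}"

lemma div_units_simps [simp]: "finite (div_units D)" "1 \<in> div_units D" "u \<in> div_units D \<Longrightarrow> u \<in> div_carrier D"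
  by (cases D; auto)+

lemma div_units_orthonormal:
  "\<lbrakk>u \<in> div_units D; u' \<in> div_units D\<rbrakk> \<Longrightarrow> qre (qcnj u * u') = (if u = u' then 1 else 0)"
proof -
  have "\<forall>u\<in>div_units D. \<forall>u'\<in>div_units D. qre (qcnj u * u') = (if u = u' then 1 else 0)"
    by (cases D) (simp_all add: quat_sel_mult quat_eq_iff)
  then show "\<lbrakk>u \<in> div_units D; u' \<in> div_units D\<rbrakk> \<Longrightarrow> qre (qcnj u * u') = (if u = u' then 1 else 0)" by blast
qed

lemma div_units_closed:
  "\<lbrakk>u \<in> div_units D; u' \<in> div_units D\<rbrakk> \<Longrightarrow> \<exists>u''\<in>div_units D. \<exists>s. qcnj u * u' = s *\<^sub>R u''"
proof -
  assume uu: "u \<in> div_units D" "u' \<in> div_units D"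
  have "\<forall>u\<in>div_units D. \<forall>u'\<in>div_units D. \<exists>u''\<in>div_units D. qcnj u * u' = 1 *\<^sub>R u'' \<or> qcnj u * u' = (-1) *\<^sub>R u''"
    by (cases D) (simp_all add: quat_eq_iff quat_sel_mult, intro exI[of _ "Quat 0 0 0 1"], simp)
  then show ?thesis using uu by blast
qed

lemma div_units_expansion:
  assumes "p \<in> div_carrier D"
  shows "p = (\<Sum>u\<in>div_units D. qre (p * qcnj u) *\<^sub>R u)"
  using assms by (cases D; auto simp: quat_eq_iff quat_sel_mult)

lemma div_units_expansion_qcnj:
  assumes "b \<in> div_carrier D"
  shows "b = (\<Sum>u\<in>div_units D. qre (u * b) *\<^sub>R qcnj u)"
proof -
  have "qcnj b = (\<Sum>u\<in>div_units D. qre (u * b) *\<^sub>R u)"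
    using div_units_expansion[of "qcnj b" D] assms
    by (simp add: qcnj_simps(5)[symmetric] del: qcnj_simps(5))
  then have "qcnj (qcnj b) = qcnj (\<Sum>u\<in>div_units D. qre (u * b) *\<^sub>R u)" by (rule arg_cong)
  then show ?thesis by (simp add: qcnj_sum)
qed

text \<open>Take for \<open>p\<close> the conjugate of the difference: the real part is then its
  squared norm. Identities in \<open>D\<close> are thereby reduced to identities between real
  numbers.\<close>

lemma qre_eqI:
  assumes "a \<in> div_carrier D" "b \<in> div_carrier D" "\<And>p. p \<in> div_carrier D \<Longrightarrow> qre (p * a) = qre (p * b)"
  shows "a = b"
proof -
  have "qre (qcnj (a - b) * (a - b)) = 0"
    using assms(3)[of "qcnj (a - b)"] assms(1,2) by (simp only: right_diff_distrib quat_sel) simp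
  then have "(qre (a - b))\<^sup>2 + (qi (a - b))\<^sup>2 + (qj (a - b))\<^sup>2 + (qk (a - b))\<^sup>2 = 0"
    by (simp add: quat_sel_mult power2_eq_square algebra_simps)
  then have "qre (a - b) = 0 \<and> qi (a - b) = 0 \<and> qj (a - b) = 0 \<and> qk (a - b) = 0"
    by (simp only: add_nonneg_eq_0_iff zero_le_power2 add_nonneg_nonneg power_eq_0_iff)
  then show ?thesis by (simp add: quat_eq_iff)
qed

text \<open>Vectors are functions vanishing from \<open>n\<close> on, so that
  \<open>inner_on\<close> applies and equality of vectors is equality of functions.\<close>

definition vecs :: "nat \<Rightarrow> (nat \<Rightarrow> real) set" where
  "vecs n = {f. \<forall>i\<ge>n. f i = 0}"

definition apply_mat :: "nat \<Rightarrow> real mat \<Rightarrow> (nat \<Rightarrow> real) \<Rightarrow> nat \<Rightarrow> real" where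
  "apply_mat n M f = (\<lambda>i. if i < n then \<Sum>j<n. M $$ (i, j) * f j else 0)"

definition std_basis :: "nat \<Rightarrow> nat \<Rightarrow> real" where
  "std_basis a = (\<lambda>i. if i = a then 1 else 0)"

lemma apply_mat_vecs [simp]: "apply_mat n M f \<in> vecs n"
  by (simp add: apply_mat_def vecs_def)

lemma std_basis_vecs [simp]: "a < n \<Longrightarrow> std_basis a \<in> vecs n"
  by (simp add: std_basis_def vecs_def)

lemma apply_mat_mult:
  assumes "A \<in> carrier_mat n n" "B \<in> carrier_mat n n"
  shows "apply_mat n (A * B) f = apply_mat n A (apply_mat n B f)"
proof
  fix i show "apply_mat n (A * B) f i = apply_mat n A (apply_mat n B f) i"
  proof (cases "i < n")
    case True
    then have "apply_mat n (A * B) f i = (\<Sum>j<n. (\<Sum>k<n. A $$ (i, k) * B $$ (k, j)) * f j)"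
      using mat_mult_entry[OF assms] by (simp add: apply_mat_def del: index_mult_mat(1))
    also have "\<dots> = (\<Sum>k<n. A $$ (i, k) * (\<Sum>j<n. B $$ (k, j) * f j))"
      unfolding sum_distrib_left sum_distrib_right by (subst sum.swap) (simp add: mult.assoc)
    finally show ?thesis using True by (simp add: apply_mat_def)
  qed (simp add: apply_mat_def)
qed

lemma apply_mat_one: "f \<in> vecs n \<Longrightarrow> apply_mat n (1\<^sub>m n) f = f"
proof
  fix i assume f: "f \<in> vecs n"
  show "apply_mat n (1\<^sub>m n) f i = f i"
  proof (cases "i < n")
    case True
    then have "apply_mat n (1\<^sub>m n) f i = (\<Sum>j<n. if i = j then f j else 0)"
      unfolding apply_mat_def by (simp add: if_distrib[of "\<lambda>c. c * _"] cong: if_cong)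
    then show ?thesis using True by simp
  qed (use f in \<open>simp add: apply_mat_def vecs_def\<close>)
qed

lemma inner_apply_mat:
  "M \<in> carrier_mat n n \<Longrightarrow>
    inner_on {..<n} (apply_mat n M f) h = inner_on {..<n} f (apply_mat n (transpose_mat M) h)"
  unfolding inner_on_def apply_mat_def
  by (simp add: sum_distrib_left sum_distrib_right) (subst sum.swap, simp add: mult_ac)

lemma inner_apply_mat_sum:
  "inner_on {..<n} f (apply_mat n M h) = (\<Sum>i<n. \<Sum>j<n. f i * h j * M $$ (i, j))"
  by (simp add: inner_on_def apply_mat_def sum_distrib_left mult_ac)

lemma inner_std_basis: "a < n \<Longrightarrow> inner_on {..<n} (std_basis a) f = f a"
  by (simp add: inner_on_def std_basis_def if_distrib[of "\<lambda>c. c * _"] cong: if_cong)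

lemma apply_mat_std_basis: "\<lbrakk>a < n; b < n\<rbrakk> \<Longrightarrow> apply_mat n M (std_basis b) a = M $$ (a, b)"
  by (simp add: apply_mat_def std_basis_def if_distrib[of "\<lambda>c. _ * c"] cong: if_cong)

context fin_group
begin

context
  fixes n \<sigma> D E
  assumes orth: "orth_rep n \<sigma>" and irr: "(n, \<sigma>) \<in> irreducible_reps G"
    and E: "div_structure D n \<sigma> E"
begin

private abbreviation ip (infix "\<bullet>\<bullet>" 70) where "x \<bullet>\<bullet> y \<equiv> inner_on {..<n} x y"
private abbreviation "act g x \<equiv> apply_mat n (\<sigma> g) x"
private abbreviation "scal q x \<equiv> apply_mat n (E q) x"

lemma scal_act_adjoint:
  "q \<in> div_carrier D \<Longrightarrow> scal q x \<bullet>\<bullet> y = x \<bullet>\<bullet> scal (qcnj q) y"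
  "g \<in> carrier G \<Longrightarrow> act g x \<bullet>\<bullet> y = x \<bullet>\<bullet> act (inv g) y"
  using inner_apply_mat[OF div_structureD(7)[OF E], of q x y] div_structure_transpose[OF orth irr E, of q]
    inner_apply_mat[OF repD(1)[OF orth_repD(1)[OF orth]], of g x y] orth_repD(2)[OF orth, of g]
  by auto

lemma scal_act_mult:
  "\<lbrakk>p \<in> div_carrier D; q \<in> div_carrier D\<rbrakk> \<Longrightarrow> scal (p * q) x = scal p (scal q x)"
  "\<lbrakk>g \<in> carrier G; h \<in> carrier G\<rbrakk> \<Longrightarrow> act (g \<otimes> h) x = act g (act h x)"
  "\<lbrakk>q \<in> div_carrier D; g \<in> carrier G\<rbrakk> \<Longrightarrow> scal q (act g x) = act g (scal q x)"
proof -
  note ED = div_structureD[OF E] and sD = repD[OF orth_repD(1)[OF orth]]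
  show "scal (p * q) x = scal p (scal q x)" if "p \<in> div_carrier D" "q \<in> div_carrier D"
    using apply_mat_mult[OF ED(7)[OF that(1)] ED(7)[OF that(2)]] ED(4)[OF that] by simp
  show "act (g \<otimes> h) x = act g (act h x)" if "g \<in> carrier G" "h \<in> carrier G"
    using apply_mat_mult[OF sD(1)[OF that(1)] sD(1)[OF that(2)]] sD(2)[OF that] by simp
  show "scal q (act g x) = act g (scal q x)" if "q \<in> div_carrier D" "g \<in> carrier G"
    using apply_mat_mult[OF ED(7)[OF that(1)] sD(1)[OF that(2)], of x]
      apply_mat_mult[OF sD(1)[OF that(2)] ED(7)[OF that(1)], of x] ED(1)[OF that(1)] that(2)
    by (simp add: endo_def)
qed

lemma scal_act_one: "x \<in> vecs n \<Longrightarrow> scal 1 x = x" "x \<in> vecs n \<Longrightarrow> act \<one> x = x"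
  using div_structureD(6)[OF E] repD(3)[OF orth_repD(1)[OF orth]] by (simp_all add: apply_mat_one)

lemma scal_sum:
  assumes "finite U" "\<And>u. u \<in> U \<Longrightarrow> u \<in> div_carrier D"
  shows "scal (\<Sum>u\<in>U. c u *\<^sub>R u) x = (\<lambda>i. \<Sum>u\<in>U. c u * scal u x i)"
  using assms
proof (induction U)
  case empty
  have "E 0 = 0 \<cdot>\<^sub>m E 1" using div_structureD(5)[OF E, of 1 0] by simp
  then show ?case using div_structureD(6)[OF E] by (auto simp: apply_mat_def fun_eq_iff)
next
  case (insert u U)
  note ED = div_structureD[OF E]
  have d: "(\<Sum>u\<in>U. c u *\<^sub>R u) \<in> div_carrier D" "u \<in> div_carrier D"
    using insert by (auto intro: div_carrier_sum)
  have "E (\<Sum>u\<in>insert u U. c u *\<^sub>R u) = c u \<cdot>\<^sub>m E u + E (\<Sum>u\<in>U. c u *\<^sub>R u)"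
    using insert ED(3)[of "c u *\<^sub>R u"] ED(5) d by simp
  then have "scal (\<Sum>u\<in>insert u U. c u *\<^sub>R u) x = (\<lambda>i. c u * scal u x i + scal (\<Sum>u\<in>U. c u *\<^sub>R u) x i)"
    using ED(7)[OF d(1)] ED(7)[OF d(2)]
    by (auto simp: apply_mat_def fun_eq_iff sum.distrib sum_distrib_left algebra_simps)
  then show ?case using insert by (simp add: fun_eq_iff)
qed

text \<open>The \<open>D\<close>-valued hermitian form, assembled from its real components. It is
  determined by the property in \<open>qre_hform\<close>, and is linear over \<open>D\<close> in the
  first argument and conjugate-linear in the second.\<close>

definition hform :: "(nat \<Rightarrow> real) \<Rightarrow> (nat \<Rightarrow> real) \<Rightarrow> quat" where
  "hform x y = (\<Sum>u\<in>div_units D. (scal u x \<bullet>\<bullet> y) *\<^sub>R qcnj u)"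

lemma hform_closed [simp]: "hform x y \<in> div_carrier D"
  by (auto simp: hform_def intro: div_carrier_sum)

lemma qre_hform:
  assumes p: "p \<in> div_carrier D"
  shows "qre (p * hform x y) = scal p x \<bullet>\<bullet> y"
proof -
  have "scal p x \<bullet>\<bullet> y = scal (\<Sum>u\<in>div_units D. qre (p * qcnj u) *\<^sub>R u) x \<bullet>\<bullet> y"
    using div_units_expansion[OF p] by simp
  also have "\<dots> = (\<Sum>u\<in>div_units D. qre (p * qcnj u) * (scal u x \<bullet>\<bullet> y))"
    by (subst scal_sum) (auto simp: inner_on_sum)
  finally show ?thesis
    by (simp add: hform_def sum_distrib_left quat_sel_sum mult.commute)
qed

lemma hform_scal: "q \<in> div_carrier D \<Longrightarrow> hform (scal q x) y = q * hform x y"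
  by (rule qre_eqI[of _ D]) (simp_all add: qre_hform scal_act_mult(1)[symmetric] mult.assoc[symmetric])

text \<open>The adjoint of multiplication by \<open>p\<close> is multiplication by its conjugate;
  this is where transposition being the conjugation is used.\<close>

lemma hform_commute: "hform y x = qcnj (hform x y)"
proof (rule qre_eqI[of _ D])
  fix p assume p: "p \<in> div_carrier D"
  have "qre (p * hform y x) = scal p y \<bullet>\<bullet> x" by (rule qre_hform[OF p])
  also have "\<dots> = scal (qcnj p) x \<bullet>\<bullet> y" using p by (simp add: scal_act_adjoint inner_on_commute[of _ y])
  also have "\<dots> = qre (qcnj p * hform x y)" using p by (simp add: qre_hform)
  also have "\<dots> = qre (p * qcnj (hform x y))" by (simp add: quat_sel_mult)
  finally show "qre (p * hform y x) = qre (p * qcnj (hform x y))" .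
qed simp_all

lemma hform_scal_right: "q \<in> div_carrier D \<Longrightarrow> hform x (scal q y) = hform x y * qcnj q"
  using hform_commute[of x "scal q y"] hform_commute[of x y] by (simp add: hform_scal)

lemma hform_act: "g \<in> carrier G \<Longrightarrow> hform (act g x) y = hform x (act (inv g) y)"
  by (rule qre_eqI[of _ D]) (simp_all add: qre_hform scal_act_mult(3) scal_act_adjoint(2))

lemma inner_eq_qre_hform: "x \<in> vecs n \<Longrightarrow> x \<bullet>\<bullet> y = qre (hform x y)"
  using qre_hform[of 1 x y] scal_act_one(1)[of x] by simp

text \<open>The units act as isometries, and distinct units send \<open>f\<close> to orthogonal
  vectors because the form is real at \<open>f\<close>, \<open>f\<close>. So the construction of
  orthonormal bases applies with the units as operators, and Parseval for the resulting real basis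
  reassembles to Parseval for the form.\<close>

lemma hermitian_basis_exists:
  obtains m v where "\<And>k. k < m \<Longrightarrow> v k \<in> vecs n"
    and "\<And>k l. \<lbrakk>k < m; l < m\<rbrakk> \<Longrightarrow> hform (v k) (v l) = (if k = l then 1 else 0)"
    and "\<And>x y. \<lbrakk>x \<in> vecs n; y \<in> vecs n\<rbrakk> \<Longrightarrow> hform x y = (\<Sum>k<m. hform x (v k) * hform (v k) y)"
    and "m * card (div_units D) = n"
proof (rule orthonormal_basis_exists[of "{..<n}" "div_units D" "vecs n" "\<lambda>u f. scal u f"])
  show "finite {..<n}" "finite (div_units D)" "div_units D \<noteq> {}"
    using div_units_simps(2)[of D] by (auto simp del: div_units_simps(2))
  show "function_space (vecs n)" by (simp add: function_space_def vecs_def)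
  show "scal u f \<in> vecs n" for u f by simp
  have mult: "scal u f \<bullet>\<bullet> scal u' h = scal (qcnj u' * u) f \<bullet>\<bullet> h"
    if "u \<in> div_units D" "u' \<in> div_units D" for u u' f h
    using that by (simp add: scal_act_mult(1) scal_act_adjoint(1))
  show "scal u f \<bullet>\<bullet> scal u' f = (if u = u' then f \<bullet>\<bullet> f else 0)"
    if u: "u \<in> div_units D" "u' \<in> div_units D" and f: "f \<in> vecs n" for u u' f
  proof -
    have "hform f f = qcnj (hform f f)" by (rule hform_commute)
    then have real: "hform f f = (f \<bullet>\<bullet> f) *\<^sub>R 1"
      using inner_eq_qre_hform[OF f, of f] by (simp add: quat_eq_iff)
    have "scal u f \<bullet>\<bullet> scal u' f = qre ((qcnj u' * u) * hform f f)"
      unfolding mult[OF u] using u by (intro qre_hform[symmetric]) simp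
    also have "\<dots> = (f \<bullet>\<bullet> f) * qre (qcnj u' * u)" unfolding real by simp
    finally show ?thesis using div_units_orthonormal[OF u(2,1)] by auto
  qed
  show "\<exists>u''\<in>div_units D. \<exists>s. \<forall>f\<in>vecs n. \<forall>h\<in>vecs n. scal u f \<bullet>\<bullet> scal u' h = s * (f \<bullet>\<bullet> scal u'' h)"
    if u: "u \<in> div_units D" "u' \<in> div_units D" for u u'
  proof -
    obtain u'' s where s: "u'' \<in> div_units D" "qcnj u * u' = s *\<^sub>R u''" using div_units_closed[OF u] by blast
    have "scal u f \<bullet>\<bullet> scal u' h = s * (f \<bullet>\<bullet> scal u'' h)" for f h
    proof -
      have "scal u f \<bullet>\<bullet> scal u' h = f \<bullet>\<bullet> scal (qcnj u * u') h"
        using u by (simp add: scal_act_mult(1) scal_act_adjoint(1))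
      also have "\<dots> = f \<bullet>\<bullet> (\<lambda>i. s * scal u'' h i)"
        using scal_sum[of "{u''}" "\<lambda>_. s" h] s by simp
      also have "\<dots> = s * (f \<bullet>\<bullet> scal u'' h)" by (simp add: inner_on_def sum_distrib_left mult_ac)
      finally show ?thesis .
    qed
    then show ?thesis using s(1) by blast
  qed
next
  fix m :: nat and v
  assume v: "\<And>k. k < m \<Longrightarrow> v k \<in> vecs n"
    and on: "orthonormal_on {..<n} ({..<m} \<times> div_units D) (\<lambda>(k, u). scal u (v k))"
    and ex: "\<And>f i. \<lbrakk>f \<in> vecs n; i \<in> {..<n}\<rbrakk> \<Longrightarrow>
      f i = (\<Sum>(k, u)\<in>{..<m} \<times> div_units D. (f \<bullet>\<bullet> scal u (v k)) * scal u (v k) i)"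
  have on': "scal u (v k) \<bullet>\<bullet> scal u' (v l) = (if k = l \<and> u = u' then 1 else 0)"
    if "k < m" "l < m" "u \<in> div_units D" "u' \<in> div_units D" for k l u u'
    using on that unfolding orthonormal_on_def by force
  have "hform (v k) (v l) = (if k = l then 1 else 0)" if kl: "k < m" "l < m" for k l
  proof -
    have "hform (v k) (v l) = (\<Sum>u\<in>div_units D. (if k = l \<and> u = 1 then 1 else 0) *\<^sub>R qcnj u)"
      unfolding hform_def using on'[OF kl _ div_units_simps(2)] v[OF kl(2)]
      by (intro sum.cong refl) (simp add: scal_act_one)
    also have "\<dots> = (\<Sum>u\<in>div_units D. if u = 1 then (if k = l then 1 else 0) else 0)"
      by (intro sum.cong refl) auto
    finally show ?thesis by simp
  qed
  moreover have "hform x y = (\<Sum>k<m. hform x (v k) * hform (v k) y)" if x: "x \<in> vecs n" and y: "y \<in> vecs n" for x y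
  proof (rule qre_eqI[of _ D])
    fix p assume p: "p \<in> div_carrier D"
    have "qre (p * hform x y) = scal p x \<bullet>\<bullet> y" by (rule qre_hform[OF p])
    also have "\<dots> = scal p x \<bullet>\<bullet> (\<lambda>i. \<Sum>(k, u)\<in>{..<m} \<times> div_units D. (y \<bullet>\<bullet> scal u (v k)) * scal u (v k) i)"
      unfolding inner_on_def[of _ "scal p x"]
      by (intro sum.cong refl arg_cong2[where f = "(*)"]) (rule ex[OF y])
    also have "\<dots> = (\<Sum>q\<in>{..<m} \<times> div_units D. (y \<bullet>\<bullet> scal (snd q) (v (fst q))) * (scal p x \<bullet>\<bullet> scal (snd q) (v (fst q))))"
      unfolding case_prod_beta by (rule inner_on_sum(2))
    also have "\<dots> = (\<Sum>k<m. \<Sum>u\<in>div_units D. (y \<bullet>\<bullet> scal u (v k)) * (scal p x \<bullet>\<bullet> scal u (v k)))"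
      by (simp add: sum.cartesian_product')
    also have "\<dots> = (\<Sum>k<m. qre (p * (hform x (v k) * hform (v k) y)))"
    proof (rule sum.cong[OF refl])
      fix k
      let ?a = "p * hform x (v k)" and ?b = "hform (v k) y"
      have "(\<Sum>u\<in>div_units D. (y \<bullet>\<bullet> scal u (v k)) * (scal p x \<bullet>\<bullet> scal u (v k)))
          = (\<Sum>u\<in>div_units D. qre (u * ?b) * qre (?a * qcnj u))"
      proof (intro sum.cong refl arg_cong2[where f = "(*)"])
        fix u assume u: "u \<in> div_units D"
        show "y \<bullet>\<bullet> scal u (v k) = qre (u * ?b)" using u by (simp add: qre_hform inner_on_commute[of _ y])
        have "scal p x \<bullet>\<bullet> scal u (v k) = qre (p * hform x (scal u (v k)))" using p by (simp add: qre_hform)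
        then show "scal p x \<bullet>\<bullet> scal u (v k) = qre (?a * qcnj u)"
          using u by (simp add: hform_scal_right mult.assoc)
      qed
      also have "\<dots> = qre (?a * (\<Sum>u\<in>div_units D. qre (u * ?b) *\<^sub>R qcnj u))"
        by (simp add: sum_distrib_left quat_sel_sum)
      also have "\<dots> = qre (?a * ?b)" using div_units_expansion_qcnj[OF hform_closed] by simp
      finally show "(\<Sum>u\<in>div_units D. (y \<bullet>\<bullet> scal u (v k)) * (scal p x \<bullet>\<bullet> scal u (v k)))
          = qre (p * (hform x (v k) * hform (v k) y))" by (simp only: mult.assoc)
    qed
    also have "\<dots> = qre (p * (\<Sum>k<m. hform x (v k) * hform (v k) y))"
      by (simp add: sum_distrib_left quat_sel_sum)
    finally show "qre (p * hform x y) = qre (p * (\<Sum>k<m. hform x (v k) * hform (v k) y))" .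
  qed (auto intro: div_carrier_sum)
  moreover have "m * card (div_units D) = n"
  proof -
    \<comment> \<open>The squared entries of the real orthonormal basis are counted twice: by
      position, where the expansion of a standard vector gives 1, and by basis vector, where the
      length is 1.\<close>
    have "(\<Sum>p\<in>{..<m} \<times> div_units D. (scal (snd p) (v (fst p)) i)\<^sup>2) = 1" if i: "i < n" for i
    proof -
      have "std_basis i i = (\<Sum>p\<in>{..<m} \<times> div_units D. (std_basis i \<bullet>\<bullet> scal (snd p) (v (fst p))) * scal (snd p) (v (fst p)) i)"
        unfolding case_prod_beta[symmetric] using ex[of "std_basis i" i] i by (simp add: case_prod_beta)
      then show ?thesis using i by (simp add: inner_std_basis power2_eq_square) (simp add: std_basis_def)
    qed
    then have "real n = (\<Sum>i<n. \<Sum>p\<in>{..<m} \<times> div_units D. (scal (snd p) (v (fst p)) i)\<^sup>2)" by simp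
    also have "\<dots> = (\<Sum>p\<in>{..<m} \<times> div_units D. scal (snd p) (v (fst p)) \<bullet>\<bullet> scal (snd p) (v (fst p)))"
      by (subst sum.swap) (simp add: inner_on_def power2_eq_square)
    also have "\<dots> = (\<Sum>p\<in>{..<m} \<times> div_units D. 1)"
      by (intro sum.cong refl) (auto simp: on')
    also have "\<dots> = real (m * card (div_units D))" by (simp add: card_cartesian_product)
    finally show ?thesis by (simp only: of_nat_eq_iff)
  qed
  ultimately show ?thesis using v that by blast
qed

text \<open>At a standard vector the form is real and equals 1, so each diagonal entry of
  \<open>E q\<close> is the real part of \<open>q\<close>.\<close>

lemma trace_scal: "q \<in> div_carrier D \<Longrightarrow> mat_trace (E q) = real n * qre q"
proof -
  assume q: "q \<in> div_carrier D"
  note ED = div_structureD[OF E]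
  have "mat_trace (E q) = (\<Sum>i<n. scal q (std_basis i) \<bullet>\<bullet> std_basis i)"
    using ED(7)[OF q]
    by (simp add: mat_trace_def inner_on_commute[of _ "apply_mat _ _ _"] inner_std_basis apply_mat_std_basis)
  also have "\<dots> = (\<Sum>i<n. qre q)"
  proof (rule sum.cong[OF refl])
    fix i assume "i \<in> {..<n}"
    then have i: "std_basis i \<in> vecs n" "i < n" by auto
    have "hform (std_basis i) (std_basis i) = qcnj (hform (std_basis i) (std_basis i))" by (rule hform_commute)
    then have "hform (std_basis i) (std_basis i) = 1"
      using inner_eq_qre_hform[OF i(1), of "std_basis i"] inner_std_basis[OF i(2), of "std_basis i"]
      by (simp add: quat_eq_iff) (simp add: std_basis_def)
    then show "scal q (std_basis i) \<bullet>\<bullet> std_basis i = qre q" using qre_hform[OF q] by (metis mult_1_right)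
  qed
  finally show ?thesis by simp
qed

text \<open>The matrices \<open>(g b) (g b')^T\<close> sum to an endomorphism, hence to some
  \<open>E q\<close>, and the left side is its coefficient at \<open>a\<close>, \<open>a'\<close>.
  To find \<open>q\<close>, multiply by \<open>E p\<close> and take the trace: one evaluation gives
  \<open>n Re (p q)\<close>, the other \<open>|G|\<close> times the real part of \<open>p\<close>
  times the form at \<open>b\<close>, \<open>b'\<close>.\<close>

theorem Schur_orthogonality:
  "(\<Sum>g\<in>carrier G. (a \<bullet>\<bullet> act g b) * (a' \<bullet>\<bullet> act g b'))
    = real (Coset.order G) / real n * qre (hform a a' * hform b' b)"
  if a: "a \<in> vecs n" "a' \<in> vecs n" and b: "b \<in> vecs n" "b' \<in> vecs n"
proof -
  note ED = div_structureD[OF E] and sD = repD[OF orth_repD(1)[OF orth]]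
  define Y where "Y = mat n n (\<lambda>(i, j). \<Sum>g\<in>carrier G. act g b i * act g b' j)"
  have Y: "Y \<in> carrier_mat n n" by (simp add: Y_def)
  have Ysum: "Y $$ (i, j) = (\<Sum>s<n. \<Sum>t<n. b s * b' t * averaged_unit n n \<sigma> \<sigma> s t $$ (i, j))"
    if ij: "i < n" "j < n" for i j
  proof -
    have "Y $$ (i, j) = (\<Sum>g\<in>carrier G. \<Sum>s<n. \<Sum>t<n. b s * b' t * (\<sigma> g $$ (i, s) * \<sigma> g $$ (j, t)))"
      using ij by (simp add: Y_def apply_mat_def sum_distrib_left sum_distrib_right mult_ac)
    also have "\<dots> = (\<Sum>s<n. \<Sum>g\<in>carrier G. \<Sum>t<n. b s * b' t * (\<sigma> g $$ (i, s) * \<sigma> g $$ (j, t)))"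
      by (rule sum.swap)
    also have "\<dots> = (\<Sum>s<n. \<Sum>t<n. b s * b' t * averaged_unit n n \<sigma> \<sigma> s t $$ (i, j))"
      using ij by (intro sum.cong[OF refl], subst sum.swap) (simp add: averaged_unit_def sum_distrib_left)
    finally show ?thesis .
  qed
  have "endo n \<sigma> Y"
    unfolding endo_def
  proof (intro conjI ballI Y)
    fix h assume h: "h \<in> carrier G"
    show "Y * \<sigma> h = \<sigma> h * Y"
    proof (rule eq_matI)
      fix i j assume "i < dim_row (\<sigma> h * Y)" "j < dim_col (\<sigma> h * Y)"
      then have ij: "i < n" "j < n" using Y sD(1)[OF h] by auto
      have A: "averaged_unit n n \<sigma> \<sigma> s t \<in> carrier_mat n n" for s t by (simp add: averaged_unit_def)
      have "(Y * \<sigma> h) $$ (i, j) = (\<Sum>k<n. \<Sum>s<n. \<Sum>t<n. b s * b' t * averaged_unit n n \<sigma> \<sigma> s t $$ (i, k) * \<sigma> h $$ (k, j))"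
        unfolding mat_mult_entry[OF Y sD(1)[OF h] ij] using ij by (simp add: Ysum sum_distrib_right)
      also have "\<dots> = (\<Sum>s<n. \<Sum>k<n. \<Sum>t<n. b s * b' t * averaged_unit n n \<sigma> \<sigma> s t $$ (i, k) * \<sigma> h $$ (k, j))"
        by (rule sum.swap)
      also have "\<dots> = (\<Sum>s<n. \<Sum>t<n. b s * b' t * (averaged_unit n n \<sigma> \<sigma> s t * \<sigma> h) $$ (i, j))"
        unfolding mat_mult_entry[OF A sD(1)[OF h] ij]
        by (rule sum.cong[OF refl], subst sum.swap) (simp add: sum_distrib_left mult.assoc)
      also have "\<dots> = (\<Sum>s<n. \<Sum>t<n. b s * b' t * (\<sigma> h * averaged_unit n n \<sigma> \<sigma> s t) $$ (i, j))"
        using averaged_unit_intertwines[OF orth orth _ _ h] by (intro sum.cong refl) simp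
      also have "\<dots> = (\<Sum>s<n. \<Sum>k<n. \<Sum>t<n. \<sigma> h $$ (i, k) * (b s * b' t * averaged_unit n n \<sigma> \<sigma> s t $$ (k, j)))"
        unfolding mat_mult_entry[OF sD(1)[OF h] A ij]
        by (rule sum.cong[OF refl], unfold sum_distrib_left, subst sum.swap) (simp add: mult_ac)
      also have "\<dots> = (\<Sum>k<n. \<Sum>s<n. \<Sum>t<n. \<sigma> h $$ (i, k) * (b s * b' t * averaged_unit n n \<sigma> \<sigma> s t $$ (k, j)))"
        by (rule sum.swap)
      also have "\<dots> = (\<sigma> h * Y) $$ (i, j)"
        unfolding mat_mult_entry[OF sD(1)[OF h] Y ij] using ij by (simp add: Ysum sum_distrib_left)
      finally show "(Y * \<sigma> h) $$ (i, j) = (\<sigma> h * Y) $$ (i, j)" .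
    qed (use Y sD(1)[OF h] in auto)
  qed
  then obtain q where q: "q \<in> div_carrier D" "Y = E q" using ED(2) by blast
  have n: "n > 0" using irr by (simp add: irreducible_reps_iff)
  have "q = (real (Coset.order G) / real n) *\<^sub>R hform b b'"
  proof (rule qre_eqI[of _ D])
    fix p assume p: "p \<in> div_carrier D"
    have Ep: "E p \<in> carrier_mat n n" by (rule ED(7)[OF p])
    have "real n * qre (p * q) = mat_trace (E p * Y)"
      using trace_scal[of "p * q"] ED(4)[OF p q(1)] p q by simp
    also have "\<dots> = (\<Sum>i<n. \<Sum>j<n. E p $$ (i, j) * Y $$ (j, i))"
      using Ep Y by (simp add: mat_trace_def mat_mult_entry[OF Ep Y] del: index_mult_mat(1))
    also have "\<dots> = (\<Sum>i<n. \<Sum>j<n. \<Sum>g\<in>carrier G. act g b' i * act g b j * E p $$ (i, j))"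
      by (simp add: Y_def sum_distrib_left mult_ac)
    also have "\<dots> = (\<Sum>i<n. \<Sum>g\<in>carrier G. \<Sum>j<n. act g b' i * act g b j * E p $$ (i, j))"
      by (intro sum.cong refl sum.swap)
    also have "\<dots> = (\<Sum>g\<in>carrier G. \<Sum>i<n. \<Sum>j<n. act g b' i * act g b j * E p $$ (i, j))"
      by (rule sum.swap)
    also have "\<dots> = (\<Sum>g\<in>carrier G. act g b' \<bullet>\<bullet> scal p (act g b))"
      by (simp add: inner_apply_mat_sum)
    also have "\<dots> = (\<Sum>g\<in>carrier G. b' \<bullet>\<bullet> scal p b)"
    proof (rule sum.cong[OF refl])
      fix g assume g: "g \<in> carrier G"
      have "act g b' \<bullet>\<bullet> scal p (act g b) = b' \<bullet>\<bullet> act (inv g) (act g (scal p b))"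
        using g p by (simp add: scal_act_mult(3) scal_act_adjoint(2))
      then show "act g b' \<bullet>\<bullet> scal p (act g b) = b' \<bullet>\<bullet> scal p b"
        using g by (simp add: scal_act_mult(2)[symmetric] scal_act_one)
    qed
    also have "\<dots> = real (Coset.order G) * qre (p * hform b b')"
      using p by (simp add: qre_hform inner_on_commute[of _ b'] Coset.order_def)
    finally show "qre (p * q) = qre (p * ((real (Coset.order G) / real n) *\<^sub>R hform b b'))"
      using n by (simp add: field_simps)
  qed (use q in auto)
  note qeq = this
  have "(\<Sum>g\<in>carrier G. (a \<bullet>\<bullet> act g b) * (a' \<bullet>\<bullet> act g b'))
      = (\<Sum>g\<in>carrier G. \<Sum>i<n. \<Sum>j<n. a i * a' j * (act g b i * act g b' j))"
    by (simp add: inner_on_def sum_product mult_ac)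
  also have "\<dots> = (\<Sum>i<n. \<Sum>g\<in>carrier G. \<Sum>j<n. a i * a' j * (act g b i * act g b' j))"
    by (rule sum.swap)
  also have "\<dots> = (\<Sum>i<n. \<Sum>j<n. \<Sum>g\<in>carrier G. a i * a' j * (act g b i * act g b' j))"
    by (intro sum.cong refl sum.swap)
  also have "\<dots> = a \<bullet>\<bullet> apply_mat n Y a'"
    by (simp add: inner_apply_mat_sum Y_def sum_distrib_left)
  also have "\<dots> = qre (hform a a' * qcnj q)"
    unfolding q(2) using q(1) by (simp add: inner_eq_qre_hform a hform_scal_right)
  also have "\<dots> = real (Coset.order G) / real n * qre (hform a a' * hform b' b)"
    unfolding qeq using hform_commute[of b' b] by simp
  finally show ?thesis .
qed

end

end

section \<open>Unitary matrices over the endomorphism algebra\<close>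

lemma mat_alg_simps:
  "carrier (mat_alg D n) = {M \<in> carrier_mat n n. \<forall>i<n. \<forall>j<n. M $$ (i, j) \<in> div_carrier D}"
  "monoid.mult (mat_alg D n) = (*)" "\<one>\<^bsub>mat_alg D n\<^esub> = 1\<^sub>m n" "\<zero>\<^bsub>mat_alg D n\<^esub> = 0\<^sub>m n n"
  "add (mat_alg D n) = (+)" "module.smult (mat_alg D n) = (\<lambda>r. map_mat ((*\<^sub>R) r))"
  by (simp_all add: mat_alg_def)

lemma mat_mult_entry_quat:
  fixes A B :: "quat mat"
  shows "\<lbrakk>A \<in> carrier_mat m n; B \<in> carrier_mat n p; i < m; j < p\<rbrakk> \<Longrightarrow>
    (A * B) $$ (i, j) = (\<Sum>k<n. A $$ (i, k) * B $$ (k, j))"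
  by (simp add: scalar_prod_def lessThan_atLeast0)

context fin_group
begin

text \<open>Collects what is used of a unitary representation over \<open>D\<close>, so that the
  real representation space can be forgotten. The last two clauses say that the real coefficients of
  \<open>R\<close> and of \<open>\<sigma>\<close> span the same functions: one direction transfers
  orthogonality between classes, the other completeness.\<close>

definition unitary_model ::
  "divalg \<Rightarrow> nat \<Rightarrow> ('g \<Rightarrow> real mat) \<Rightarrow> nat \<Rightarrow> ('g \<Rightarrow> quat mat) \<Rightarrow> bool" where
  "unitary_model D n \<sigma> m R \<longleftrightarrow> m * card (div_units D) = n \<and>
    (\<forall>g\<in>carrier G. R g \<in> carrier (mat_alg D m)) \<and> R \<one> = 1\<^sub>m m \<and>
    (\<forall>g\<in>carrier G. \<forall>h\<in>carrier G. R (g \<otimes> h) = R g * R h) \<and>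
    (\<forall>g\<in>carrier G. R (inv g) = transpose_mat (map_mat qcnj (R g))) \<and>
    (\<forall>p\<in>div_carrier D. \<forall>q\<in>div_carrier D. \<forall>k<m. \<forall>l<m. \<forall>k'<m. \<forall>l'<m.
      (\<Sum>g\<in>carrier G. qre (p * R g $$ (k, l)) * qre (q * R g $$ (k', l')))
        = (if k = k' \<and> l = l' then real (Coset.order G) / real n * qre (p * qcnj q) else 0)) \<and>
    (\<forall>p\<in>div_carrier D. \<forall>k<m. \<forall>l<m. \<exists>c. \<forall>g\<in>carrier G.
      qre (p * R g $$ (k, l)) = (\<Sum>a<n. \<Sum>b<n. c a b * \<sigma> g $$ (a, b))) \<and>
    (\<forall>a<n. \<forall>b<n. \<exists>p q. \<forall>g\<in>carrier G.
      \<sigma> g $$ (a, b) = (\<Sum>k<m. \<Sum>l<m. qre (p k * R g $$ (k, l) * q l)))"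

text \<open>\<open>R g\<close> is the matrix of \<open>g\<close> in a hermitian basis, with entries
  the form at \<open>v k\<close> and \<open>g (v l)\<close>. Parseval puts the two values of the
  form in the order of the matrix product, so \<open>R\<close> is multiplicative over the
  quaternions as well.\<close>

lemma unitary_model_exists:
  assumes orth: "orth_rep n \<sigma>" and irr: "(n, \<sigma>) \<in> irreducible_reps G" and E: "div_structure D n \<sigma> E"
  shows "\<exists>m R. unitary_model D n \<sigma> m R"
proof -
  let ?h = "hform n D E" and ?act = "\<lambda>g. apply_mat n (\<sigma> g)" and ?scal = "\<lambda>q. apply_mat n (E q)"
  note adj = scal_act_adjoint[OF orth irr E] and mult = scal_act_mult[OF orth irr E] and one = scal_act_one[OF orth irr E]
  note h_closed = hform_closed[OF orth irr E] and h_commute = hform_commute[OF orth irr E]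
    and h_act = hform_act[OF orth irr E] and h_scal = hform_scal[OF orth irr E]
    and h_scal_right = hform_scal_right[OF orth irr E] and qre_h = qre_hform[OF orth irr E]
    and inner_h = inner_eq_qre_hform[OF orth irr E]
  obtain m v where v: "\<And>k. k < m \<Longrightarrow> v k \<in> vecs n"
    and on: "\<And>k l. \<lbrakk>k < m; l < m\<rbrakk> \<Longrightarrow> ?h (v k) (v l) = (if k = l then 1 else 0)"
    and pars: "\<And>x y. \<lbrakk>x \<in> vecs n; y \<in> vecs n\<rbrakk> \<Longrightarrow> ?h x y = (\<Sum>k<m. ?h x (v k) * ?h (v k) y)"
    and mn: "m * card (div_units D) = n"
    using hermitian_basis_exists[OF orth irr E] by blast
  define R where "R g = mat m m (\<lambda>(k, l). ?h (v k) (?act g (v l)))" for g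
  have R: "R g $$ (k, l) = ?h (v k) (?act g (v l))" if "k < m" "l < m" for g k l
    using that by (simp add: R_def)
  have Rc: "R g \<in> carrier_mat m m" for g by (simp add: R_def)
  have Re: "qre (p * R g $$ (k, l)) = inner_on {..<n} (?scal p (v k)) (?act g (v l))"
    if "p \<in> div_carrier D" "k < m" "l < m" for p g k l
    using that by (simp add: R qre_h)
  have act_pars: "?h x (?act g y) = (\<Sum>k<m. ?h x (?act g (v k)) * ?h (v k) y)"
    if "x \<in> vecs n" "y \<in> vecs n" "g \<in> carrier G" for x y g
  proof -
    have "?h x (?act g y) = ?h (?act (inv g) x) y" using h_act[of "inv g" x y] that by simp
    also have "\<dots> = (\<Sum>k<m. ?h (?act (inv g) x) (v k) * ?h (v k) y)" by (rule pars) (simp_all add: that)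
    also have "\<dots> = (\<Sum>k<m. ?h x (?act g (v k)) * ?h (v k) y)"
      using h_act[of "inv g" x] that by (intro sum.cong refl) simp
    finally show ?thesis .
  qed
  have "unitary_model D n \<sigma> m R"
    unfolding unitary_model_def
  proof (intro conjI ballI allI impI mn)
    show "R g \<in> carrier (mat_alg D m)" for g
      using Rc by (simp add: mat_alg_simps R h_closed)
    show "R \<one> = 1\<^sub>m m"
      by (intro eq_matI) (simp_all add: R_def one v on)
    show "R (g \<otimes> h) = R g * R h" if gh: "g \<in> carrier G" "h \<in> carrier G" for g h
    proof (rule eq_matI)
      fix i j assume "i < dim_row (R g * R h)" "j < dim_col (R g * R h)"
      then have ij: "i < m" "j < m" using Rc by (auto simp: R_def)
      have "R (g \<otimes> h) $$ (i, j) = ?h (v i) (?act g (?act h (v j)))" using ij gh by (simp add: R mult)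
      also have "\<dots> = (\<Sum>k<m. R g $$ (i, k) * R h $$ (k, j))"
        using act_pars[OF v[OF ij(1)] _ gh(1), of "?act h (v j)"] ij by (simp add: R)
      also have "\<dots> = (R g * R h) $$ (i, j)" by (rule mat_mult_entry_quat[OF Rc Rc ij, symmetric])
      finally show "R (g \<otimes> h) $$ (i, j) = (R g * R h) $$ (i, j)" .
    qed (simp_all add: R_def)
    show "R (inv g) = transpose_mat (map_mat qcnj (R g))" if g: "g \<in> carrier G" for g
    proof (rule eq_matI)
      fix i j assume "i < dim_row (transpose_mat (map_mat qcnj (R g)))" "j < dim_col (transpose_mat (map_mat qcnj (R g)))"
      then have ij: "i < m" "j < m" by (auto simp: R_def)
      have "?h (v i) (?act (inv g) (v j)) = ?h (?act g (v i)) (v j)" using h_act[OF g] by simp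
      also have "\<dots> = qcnj (?h (v j) (?act g (v i)))" by (rule h_commute)
      finally show "R (inv g) $$ (i, j) = transpose_mat (map_mat qcnj (R g)) $$ (i, j)"
        using ij Rc[of g] by (simp add: R)
    qed (simp_all add: R_def)
    show "(\<Sum>g\<in>carrier G. qre (p * R g $$ (k, l)) * qre (q * R g $$ (k', l')))
        = (if k = k' \<and> l = l' then real (Coset.order G) / real n * qre (p * qcnj q) else 0)"
      if pq: "p \<in> div_carrier D" "q \<in> div_carrier D" and k: "k < m" "l < m" "k' < m" "l' < m" for p q k l k' l'
    proof -
      have "(\<Sum>g\<in>carrier G. qre (p * R g $$ (k, l)) * qre (q * R g $$ (k', l')))
          = real (Coset.order G) / real n * qre (?h (?scal p (v k)) (?scal q (v k')) * ?h (v l') (v l))"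
        using Schur_orthogonality[OF orth irr E, of "?scal p (v k)" "?scal q (v k')" "v l" "v l'"] v k pq
        by (simp add: Re)
      also have "?h (?scal p (v k)) (?scal q (v k')) = (if k = k' then p * qcnj q else 0)"
        using pq k by (simp add: h_scal h_scal_right on)
      finally show ?thesis using k by (auto simp: on)
    qed
    show "\<exists>c. \<forall>g\<in>carrier G. qre (p * R g $$ (k, l)) = (\<Sum>a<n. \<Sum>b<n. c a b * \<sigma> g $$ (a, b))"
      if "p \<in> div_carrier D" "k < m" "l < m" for p k l
      using that by (intro exI[of _ "\<lambda>a b. ?scal p (v k) a * v l b"]) (simp add: Re inner_apply_mat_sum)
    show "\<exists>p q. \<forall>g\<in>carrier G. \<sigma> g $$ (a, b) = (\<Sum>k<m. \<Sum>l<m. qre (p k * R g $$ (k, l) * q l))"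
      if ab: "a < n" "b < n" for a b
    proof (intro exI ballI)
      fix g assume g: "g \<in> carrier G"
      let ?ea = "std_basis a" and ?eb = "std_basis b"
      have "\<sigma> g $$ (a, b) = inner_on {..<n} ?ea (?act g ?eb)"
        using ab by (simp add: inner_std_basis apply_mat_std_basis)
      also have "\<dots> = qre (?h ?ea (?act g ?eb))" using ab by (simp add: inner_h)
      also have "?h ?ea (?act g ?eb) = (\<Sum>k<m. ?h ?ea (v k) * ?h (v k) (?act g ?eb))"
        using ab by (intro pars) simp_all
      also have "\<dots> = (\<Sum>k<m. \<Sum>l<m. ?h ?ea (v k) * R g $$ (k, l) * ?h (v l) ?eb)"
      proof (rule sum.cong[OF refl])
        fix k assume "k \<in> {..<m}"
        then have k: "k < m" by simp
        have "?h (v k) (?act g ?eb) = (\<Sum>l<m. ?h (v k) (?act g (v l)) * ?h (v l) ?eb)"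
          by (rule act_pars) (simp_all add: v k ab g)
        also have "\<dots> = (\<Sum>l<m. R g $$ (k, l) * ?h (v l) ?eb)"
          by (intro sum.cong refl) (simp add: R k)
        finally show "?h ?ea (v k) * ?h (v k) (?act g ?eb) = (\<Sum>l<m. ?h ?ea (v k) * R g $$ (k, l) * ?h (v l) ?eb)"
          by (simp only: sum_distrib_left mult.assoc)
      qed
      finally show "\<sigma> g $$ (a, b) = (\<Sum>k<m. \<Sum>l<m. qre (?h ?ea (v k) * R g $$ (k, l) * ?h (v l) ?eb))"
        by (simp add: quat_sel_sum)
    qed
  qed
  then show ?thesis by blast
qed

section \<open>Isomorphism classes\<close>

lemma equiv_rep_iso_rel: "equiv (real_reps G) (rep_iso_rel G)"
proof (intro equivI)
  show "rep_iso_rel G \<subseteq> real_reps G \<times> real_reps G"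
    by (auto simp: rep_iso_rel_def)
  show "refl_on (real_reps G) (rep_iso_rel G)"
  proof (rule refl_onI)
    fix r assume r: "r \<in> real_reps G"
    obtain n \<rho> where r': "r = (n, \<rho>)" by (cases r)
    have "1\<^sub>m n * \<rho> g = \<rho> g * 1\<^sub>m n" if "g \<in> carrier G" for g
      using left_mult_one_mat[OF repD(1)[of n \<rho>]] right_mult_one_mat[OF repD(1)[of n \<rho>]] r r' that by auto
    then have "((n, \<rho>), (n, \<rho>)) \<in> rep_iso_rel G"
      unfolding rep_iso_rel_iff using r r' by (intro conjI exI[of _ "1\<^sub>m n"]) auto
    then show "(r, r) \<in> rep_iso_rel G" by (simp add: r')
  qed
  show "sym (rep_iso_rel G)"
  proof (rule symI)
    fix r s assume rs: "(r, s) \<in> rep_iso_rel G"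
    obtain n \<rho> m \<sigma> where e: "r = (n, \<rho>)" "s = (m, \<sigma>)" by (cases r, cases s)
    obtain P Q where PQ: "P \<in> carrier_mat n n" "Q \<in> carrier_mat n n" "P * Q = 1\<^sub>m n" "Q * P = 1\<^sub>m n"
      "\<And>g. g \<in> carrier G \<Longrightarrow> P * \<rho> g = \<sigma> g * P" and reps: "(n, \<rho>) \<in> real_reps G" "(m, \<sigma>) \<in> real_reps G" "n = m"
      using rs unfolding e rep_iso_rel_iff by blast
    have "Q * \<sigma> g = \<rho> g * Q" if g: "g \<in> carrier G" for g
    proof -
      have c: "\<rho> g \<in> carrier_mat n n" "\<sigma> g \<in> carrier_mat n n" using repD(1) reps g by auto
      note a = assoc_mult_mat[of _ n n _ n _ n]
      have "Q * \<sigma> g = Q * \<sigma> g * (P * Q)" using PQ(2,3) c by simp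
      also have "\<dots> = Q * (\<sigma> g * P) * Q" using PQ(1,2) c by (simp add: a)
      also have "\<dots> = (Q * P) * \<rho> g * Q" unfolding PQ(5)[OF g, symmetric] using PQ(1,2) c by (simp add: a)
      also have "\<dots> = \<rho> g * Q" using PQ(2,4) c by simp
      finally show ?thesis .
    qed
    then show "(s, r) \<in> rep_iso_rel G"
      unfolding e rep_iso_rel_iff using PQ(1-4) reps by blast
  qed
  show "trans (rep_iso_rel G)"
  proof (rule transI)
    fix r s t assume rs: "(r, s) \<in> rep_iso_rel G" and st: "(s, t) \<in> rep_iso_rel G"
    obtain n \<rho> m \<sigma> l \<tau> where e: "r = (n, \<rho>)" "s = (m, \<sigma>)" "t = (l, \<tau>)" by (cases r, cases s, cases t)
    obtain P Q where PQ: "P \<in> carrier_mat n n" "Q \<in> carrier_mat n n" "P * Q = 1\<^sub>m n" "Q * P = 1\<^sub>m n"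
      "\<And>g. g \<in> carrier G \<Longrightarrow> P * \<rho> g = \<sigma> g * P" and reps: "(n, \<rho>) \<in> real_reps G" "n = m"
      using rs unfolding e rep_iso_rel_iff by blast
    obtain P' Q' where PQ': "P' \<in> carrier_mat n n" "Q' \<in> carrier_mat n n" "P' * Q' = 1\<^sub>m n" "Q' * P' = 1\<^sub>m n"
      "\<And>g. g \<in> carrier G \<Longrightarrow> P' * \<sigma> g = \<tau> g * P'" and reps': "(n, \<sigma>) \<in> real_reps G" "(l, \<tau>) \<in> real_reps G" "n = l"
      using st \<open>n = m\<close> unfolding e rep_iso_rel_iff by blast
    note a = assoc_mult_mat[of _ n n _ n _ n]
    have "(P' * P) * (Q * Q') = P' * (P * Q) * Q'" "(Q * Q') * (P' * P) = Q * (Q' * P') * P"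
      using PQ(1,2) PQ'(1,2) by (simp_all add: a)
    then have "(P' * P) * (Q * Q') = 1\<^sub>m n" "(Q * Q') * (P' * P) = 1\<^sub>m n"
      using PQ(1-4) PQ'(1-4) by simp_all
    moreover have "(P' * P) * \<rho> g = \<tau> g * (P' * P)" if g: "g \<in> carrier G" for g
    proof -
      have c: "\<rho> g \<in> carrier_mat n n" "\<sigma> g \<in> carrier_mat n n" "\<tau> g \<in> carrier_mat n n" using repD(1) reps reps' g by auto
      have "(P' * P) * \<rho> g = P' * (P * \<rho> g)" using PQ(1) PQ'(1) c by (simp add: a)
      also have "\<dots> = (P' * \<sigma> g) * P" unfolding PQ(5)[OF g] using PQ(1) PQ'(1) c by (simp add: a)
      also have "\<dots> = \<tau> g * (P' * P)" unfolding PQ'(5)[OF g] using PQ(1) PQ'(1) c by (simp add: a)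
      finally show ?thesis .
    qed
    moreover have "P' * P \<in> carrier_mat n n" "Q * Q' \<in> carrier_mat n n" using PQ(1,2) PQ'(1,2) by auto
    ultimately show "(r, t) \<in> rep_iso_rel G"
      unfolding e rep_iso_rel_iff using reps reps' by blast
  qed
qed

text \<open>Invariant subspaces are pulled back along the equivalence.\<close>

lemma irreducible_equivalent:
  assumes irr: "(N, \<rho>) \<in> irreducible_reps G" and eq: "((N, \<rho>), (N, \<sigma>)) \<in> rep_iso_rel G"
  shows "(N, \<sigma>) \<in> irreducible_reps G"
proof -
  obtain P Q where P: "P \<in> carrier_mat N N" and Q: "Q \<in> carrier_mat N N" and PQ: "P * Q = 1\<^sub>m N"
    and P\<rho>: "\<And>g. g \<in> carrier G \<Longrightarrow> P * \<rho> g = \<sigma> g * P"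
    and rep: "(N, \<rho>) \<in> real_reps G" "(N, \<sigma>) \<in> real_reps G"
    using eq unfolding rep_iso_rel_iff by blast
  note r = repD(1)[OF rep(1)] and s = repD(1)[OF rep(2)]
  have PQv: "P *\<^sub>v (Q *\<^sub>v v) = v" if "v \<in> carrier_vec N" for v
    using assoc_mult_mat_vec[OF P Q that] PQ that by simp
  have P0: "P *\<^sub>v 0\<^sub>v N = 0\<^sub>v N"
  proof (rule eq_vecI)
    fix i assume "i < dim_vec (0\<^sub>v N)"
    then show "(P *\<^sub>v 0\<^sub>v N) $ i = 0\<^sub>v N $ i"
      using mult_mat_vec_entry[OF P zero_carrier_vec, of i] by simp
  qed (use P in auto)
  show ?thesis
    unfolding irreducible_reps_iff
  proof (intro conjI rep allI impI)
    show "N > 0" using irr by (simp add: irreducible_reps_iff)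
    fix S assume S: "S \<subseteq> carrier_vec N" "0\<^sub>v N \<in> S" "\<forall>v\<in>S. \<forall>w\<in>S. v + w \<in> S" "\<forall>c. \<forall>v\<in>S. c \<cdot>\<^sub>v v \<in> S"
      "\<forall>g\<in>carrier G. \<forall>w\<in>S. \<sigma> g *\<^sub>v w \<in> S"
    define W where "W = {v \<in> carrier_vec N. P *\<^sub>v v \<in> S}"
    have "W = {0\<^sub>v N} \<or> W = carrier_vec N"
    proof (rule irr[unfolded irreducible_reps_iff, THEN conjunct2, THEN conjunct2, rule_format])
      show "W \<subseteq> carrier_vec N" by (auto simp: W_def)
      show "0\<^sub>v N \<in> W" using P0 S(2) by (simp add: W_def)
      show "v + w \<in> W" if "v \<in> W" "w \<in> W" for v w
        using that P S(3) by (simp add: W_def mult_add_distrib_mat_vec[of _ N N])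
      show "k \<cdot>\<^sub>v v \<in> W" if "v \<in> W" for k v
        using that P S(4) by (simp add: W_def mult_mat_vec[of _ N N])
      show "\<rho> g *\<^sub>v v \<in> W" if g: "g \<in> carrier G" and v: "v \<in> W" for g v
      proof -
        have vc: "v \<in> carrier_vec N" "P *\<^sub>v v \<in> S" using v by (auto simp: W_def)
        have "P *\<^sub>v (\<rho> g *\<^sub>v v) = \<sigma> g *\<^sub>v (P *\<^sub>v v)"
          using assoc_mult_mat_vec[OF P r[OF g] vc(1)] assoc_mult_mat_vec[OF s[OF g] P vc(1)] P\<rho>[OF g] by simp
        then show ?thesis using S(5) g vc mult_mat_vec_carrier[OF r[OF g] vc(1)] by (simp add: W_def)
      qed
    qed
    then show "S = {0\<^sub>v N} \<or> S = carrier_vec N"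
    proof
      assume W0: "W = {0\<^sub>v N}"
      have "s = 0\<^sub>v N" if s: "s \<in> S" for s
      proof -
        have sc: "s \<in> carrier_vec N" using s S(1) by auto
        then have "Q *\<^sub>v s \<in> W" using s PQv[OF sc] mult_mat_vec_carrier[OF Q sc] by (simp add: W_def)
        then have "Q *\<^sub>v s = 0\<^sub>v N" using W0 by simp
        then show ?thesis using PQv[OF sc] P0 by simp
      qed
      then show ?thesis using S(2) by blast
    next
      assume W: "W = carrier_vec N"
      have "v \<in> S" if v: "v \<in> carrier_vec N" for v
      proof -
        have "Q *\<^sub>v v \<in> W" unfolding W by (rule mult_mat_vec_carrier[OF Q v])
        then show ?thesis using PQv[OF v] by (simp add: W_def)
      qed
      then show ?thesis using S(1) by blast
    qed
  qed
qed

text \<open>The three algebras are told apart by whether -1 has a square root and whether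
  multiplication commutes, properties of the endomorphism algebra alone. Hence a class has only one
  type.\<close>

lemma div_structure_unique:
  assumes E: "div_structure D n \<sigma> E" and E': "div_structure D' n \<sigma> E'" and n: "n > 0"
  shows "D = D'"
proof -
  define root where "root \<longleftrightarrow> (\<exists>M. endo n \<sigma> M \<and> M * M = (-1) \<cdot>\<^sub>m 1\<^sub>m n)"
  define comm where "comm \<longleftrightarrow> (\<forall>M N. endo n \<sigma> M \<longrightarrow> endo n \<sigma> N \<longrightarrow> M * N = N * M)"
  have real: "\<not> root" if E: "div_structure DReal n \<sigma> E" for E
  proof
    note ED = div_structureD[OF E]
    assume root
    then obtain M where M: "endo n \<sigma> M" "M * M = (-1) \<cdot>\<^sub>m 1\<^sub>m n" by (auto simp: root_def)
    obtain q where q: "q \<in> div_carrier DReal" "M = E q" using ED(2)[OF M(1)] by blast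
    have "q * q = (qre q * qre q) *\<^sub>R 1" using q(1) by (simp add: quat_eq_iff quat_sel_mult)
    then have "(-1) \<cdot>\<^sub>m 1\<^sub>m n = (qre q * qre q) \<cdot>\<^sub>m (1\<^sub>m n :: real mat)"
      using M(2) ED(4)[OF q(1) q(1)] ED(5)[of 1 "qre q * qre q"] ED(6) q(2) by simp
    from arg_cong[OF this, of "\<lambda>A. A $$ (0, 0)"] n have "qre q * qre q = -1" by simp
    then show False using zero_le_square[of "qre q"] by simp
  qed
  have root: "root" if E: "div_structure D n \<sigma> E" and i: "Quat 0 1 0 0 \<in> div_carrier D" for D E
  proof -
    note ED = div_structureD[OF E]
    have "Quat 0 1 0 0 * Quat 0 1 0 0 = (-1) *\<^sub>R 1" by (simp add: quat_eq_iff quat_sel_mult)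
    then have "E (Quat 0 1 0 0) * E (Quat 0 1 0 0) = (-1) \<cdot>\<^sub>m 1\<^sub>m n"
      using ED(4)[OF i i] ED(5)[of 1 "-1"] ED(6) by simp
    then show ?thesis using ED(1)[OF i] by (auto simp: root_def)
  qed
  have complex: "comm" if E: "div_structure DComplex n \<sigma> E" for E
    unfolding comm_def
  proof (intro allI impI)
    note ED = div_structureD[OF E]
    fix M N assume "endo n \<sigma> M" "endo n \<sigma> N"
    then obtain p q where pq: "p \<in> div_carrier DComplex" "q \<in> div_carrier DComplex" "M = E p" "N = E q"
      using ED(2) by metis
    have "p * q = q * p" using pq(1,2) by (simp add: quat_eq_iff quat_sel_mult)
    then show "M * N = N * M" using ED(4)[OF pq(1,2)] ED(4)[OF pq(2,1)] pq(3,4) by simp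
  qed
  have quat: "\<not> comm" if E: "div_structure DQuat n \<sigma> E" for E
  proof
    assume comm
    note ED = div_structureD[OF E, simplified]
    let ?i = "Quat 0 1 0 0" and ?j = "Quat 0 0 1 0" and ?k = "Quat 0 0 0 1"
    have "E ?i * E ?j = E ?j * E ?i" using \<open>comm\<close> ED(1) by (auto simp: comm_def)
    then have "E (?i * ?j) = E (?j * ?i)" by (simp add: ED(4))
    moreover have "?i * ?j = ?k" "?j * ?i = (-1) *\<^sub>R ?k" by (simp_all add: quat_eq_iff quat_sel_mult)
    ultimately have k: "E ?k = (-1) \<cdot>\<^sub>m E ?k" using ED(5)[of "-1" ?k] by simp
    have c: "E ?k \<in> carrier_mat n n" by (rule ED(7))
    have "E ?k $$ (i, j) = 0" if "i < n" "j < n" for i j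
      using arg_cong[OF k, of "\<lambda>A. A $$ (i, j)"] that c by simp
    then have "E ?k = 0\<^sub>m n n" using c by (intro eq_matI) auto
    then have "E (?k * ?k) = 0\<^sub>m n n" using ED(4)[of ?k ?k] by simp
    moreover have "?k * ?k = (-1) *\<^sub>R 1" by (simp add: quat_eq_iff quat_sel_mult)
    ultimately have "(-1) \<cdot>\<^sub>m 1\<^sub>m n = (0\<^sub>m n n :: real mat)" using ED(5)[of "-1" 1] ED(6) by simp
    from arg_cong[OF this, of "\<lambda>A. A $$ (0, 0)"] n show False by simp
  qed
  have char: "root \<longleftrightarrow> D \<noteq> DReal" "root \<Longrightarrow> comm \<longleftrightarrow> D = DComplex" if "div_structure D n \<sigma> E" for D E
    using that real root[of D E] complex quat by (cases D; auto)+
  show ?thesis using char[OF E] char[OF E'] by (cases D; cases D'; auto)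
qed

text \<open>Equivalent representations have the same degree, so the arbitrary choice in
  \<open>rep_dim\<close> does no harm. The class has an orthogonal member, which inherits
  irreducibility and type from the given one.\<close>

lemma Ir_model:
  assumes "\<pi> \<in> Ir G D"
  shows "\<exists>\<sigma> m R E. (rep_dim \<pi>, \<sigma>) \<in> \<pi> \<and> orth_rep (rep_dim \<pi>) \<sigma> \<and> (rep_dim \<pi>, \<sigma>) \<in> irreducible_reps G \<and>
    div_structure D (rep_dim \<pi>) \<sigma> E \<and> unitary_model D (rep_dim \<pi>) \<sigma> m R"
proof -
  obtain N \<rho> where r: "(N, \<rho>) \<in> irreducible_reps G" "alg_isos (End_alg G (N, \<rho>)) (div_alg D) \<noteq> {}"
    and \<pi>: "\<pi> = rep_iso_rel G `` {(N, \<rho>)}"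
    using assms unfolding Ir_def quotient_def by auto
  have rep: "(N, \<rho>) \<in> real_reps G" using r(1) by (simp add: irreducible_reps_iff)
  have refl: "((N, \<rho>), (N, \<rho>)) \<in> rep_iso_rel G" using equiv_rep_iso_rel rep by (auto simp: equiv_def refl_on_def)
  have "(SOME r. r \<in> \<pi>) \<in> \<pi>" by (rule someI[of _ "(N, \<rho>)"]) (use refl in \<open>simp add: \<pi>\<close>)
  then have N: "rep_dim \<pi> = N" unfolding rep_dim_def \<pi> by (auto simp: rep_iso_rel_def)
  obtain \<sigma> where \<sigma>: "orth_rep N \<sigma>" "((N, \<rho>), (N, \<sigma>)) \<in> rep_iso_rel G" using equivalent_orth_rep[OF rep] by blast
  have irr: "(N, \<sigma>) \<in> irreducible_reps G" by (rule irreducible_equivalent[OF r(1) \<sigma>(2)])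
  obtain E where E: "div_structure D N \<sigma> E" using alg_isos_div_structure[OF r(2) \<sigma>(2)] by blast
  obtain m R where "unitary_model D N \<sigma> m R" using unitary_model_exists[OF \<sigma>(1) irr E] by blast
  then show ?thesis unfolding N using \<sigma> irr E by (auto simp: \<pi>)
qed

lemma Ir_class: "\<lbrakk>\<pi> \<in> Ir G D; r \<in> \<pi>\<rbrakk> \<Longrightarrow> \<pi> = rep_iso_rel G `` {r}"
proof -
  assume p: "\<pi> \<in> Ir G D" "r \<in> \<pi>"
  obtain s where s: "\<pi> = rep_iso_rel G `` {s}" using p(1) unfolding Ir_def quotient_def by auto
  then have "(s, r) \<in> rep_iso_rel G" using p(2) by auto
  then show ?thesis using s equiv_class_eq[OF equiv_rep_iso_rel] by auto
qed

text \<open>Here the theorem of Frobenius enters: no irreducible class is missing from the three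
  families.\<close>

lemma irreducible_in_Ir:
  assumes "orth_rep n \<sigma>" "(n, \<sigma>) \<in> irreducible_reps G"
  shows "\<exists>D. rep_iso_rel G `` {(n, \<sigma>)} \<in> Ir G D"
proof -
  obtain D E where "div_structure D n \<sigma> E" using Frobenius[OF assms] by blast
  then have "alg_isos (End_alg G (n, \<sigma>)) (div_alg D) \<noteq> {}"
    by (rule div_structure_alg_isos) (use assms(2) in \<open>simp add: irreducible_reps_iff\<close>)
  then show ?thesis using assms(2) by (auto simp: Ir_def quotient_def)
qed

end

section \<open>Dimension and center of the simple components\<close>

lemma finsum_div_alg:
  assumes "finite A" "f \<in> A \<rightarrow> div_carrier D"
  shows "finsum (div_alg D) f A = sum f A"
  using assms
proof (induction A)
  case empty
  then show ?case
    using ring_div_alg[of D] by (simp add: abelian_monoid.finsum_empty ring_def abelian_group_def div_alg_simps)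
next
  case (insert a A)
  then show ?case
    using ring_div_alg[of D]
    by (subst abelian_monoid.finsum_insert) (auto simp: ring_def abelian_group_def div_alg_simps)
qed

text \<open>The dimension in the definitions is the abstract one. The units are checked to be a
  basis, with coordinates read off by their orthonormality.\<close>

lemma div_dim_eq: "div_dim D = card (div_units D)"
proof -
  have "Module.module (class_ring :: real ring) (div_alg D)"
    using ring_div_alg[of D]
    by (intro moduleI) (auto simp: class_cring.is_cring ring_def div_alg_simps scaleR_add_left scaleR_add_right)
  then have vs: "vectorspace (class_ring :: real ring) (div_alg D)"
    by (intro vectorspace.intro class_field)
  interpret vectorspace "class_ring :: real ring" "div_alg D" by (rule vs)
  have lc: "lincomb a (div_units D) = (\<Sum>u\<in>div_units D. a u *\<^sub>R u)" for a
    unfolding lincomb_def by (subst finsum_div_alg) (auto simp: div_alg_simps)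
  have coeff: "qre ((\<Sum>u\<in>div_units D. a u *\<^sub>R u) * qcnj v) = a v" if v: "v \<in> div_units D" for a v
  proof -
    have "qre ((\<Sum>u\<in>div_units D. a u *\<^sub>R u) * qcnj v) = (\<Sum>u\<in>div_units D. a u * qre (qcnj v * u))"
      by (simp add: sum_distrib_right quat_sel_sum qre_mult_commute)
    also have "\<dots> = (\<Sum>u\<in>div_units D. if u = v then a u else 0)"
      using v by (intro sum.cong refl) (simp add: div_units_orthonormal)
    finally show ?thesis using v by simp
  qed
  have "basis (div_units D)"
  proof (subst basis_criterion)
    show "\<forall>v. v \<in> carrier (div_alg D) \<longrightarrow>
        (\<exists>!a. a \<in> div_units D \<rightarrow>\<^sub>E carrier (class_ring :: real ring) \<and> lincomb a (div_units D) = v)"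
    proof (intro allI impI)
      fix v assume "v \<in> carrier (div_alg D)"
      then have v: "v \<in> div_carrier D" by (simp add: div_alg_simps)
      let ?a = "\<lambda>u\<in>div_units D. qre (v * qcnj u)"
      show "\<exists>!a. a \<in> div_units D \<rightarrow>\<^sub>E carrier (class_ring :: real ring) \<and> lincomb a (div_units D) = v"
      proof (rule ex1I[of _ ?a])
        show "?a \<in> div_units D \<rightarrow>\<^sub>E carrier (class_ring :: real ring) \<and> lincomb ?a (div_units D) = v"
          unfolding lc using div_units_expansion[OF v] by (auto cong: sum.cong)
        fix a assume a: "a \<in> div_units D \<rightarrow>\<^sub>E carrier (class_ring :: real ring) \<and> lincomb a (div_units D) = v"
        show "a = ?a"
        proof (rule extensionalityI[of _ "div_units D"])
          show "a \<in> extensional (div_units D)" using a by (auto simp: PiE_def)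
          show "a u = ?a u" if "u \<in> div_units D" for u
            using coeff[OF that, of a] a that unfolding lc by simp
        qed simp
      qed
    qed
  qed (auto simp: div_alg_simps)
  then show ?thesis unfolding div_dim_def by (intro dim_basis) simp_all
qed

lemma card_div_units: "real (card (div_units D)) > 0"
  using div_units_simps(1,2)[of D] by (auto simp: card_gt_0_iff simp del: div_units_simps(2))

text \<open>The unit 1 contributes 1 and each of the \<open>d - 1\<close> imaginary units
  contributes -1.\<close>

lemma sum_div_units_squares: "(\<Sum>u\<in>div_units D. qcnj u * qcnj u) = (2 - real (card (div_units D))) *\<^sub>R 1"
  by (cases D) (simp_all add: quat_eq_iff quat_sel_mult)

lemma of_real_quat: "of_real r = r *\<^sub>R (1 :: quat)"
  by (simp add: of_real_def)

text \<open>Compare entries in the commutation with \<open>q\<close> times a matrix unit: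
  off-diagonal entries vanish, diagonal ones agree, and their common value commutes with
  \<open>q\<close>.\<close>

lemma mat_alg_centralD:
  assumes A: "A \<in> carrier (mat_alg D m)" and m: "m > 0"
    and comm: "\<And>M. M \<in> carrier (mat_alg D m) \<Longrightarrow> A * M = M * A"
  shows "A $$ (0, 0) \<in> center (div_alg D)" "A = A $$ (0, 0) \<cdot>\<^sub>m 1\<^sub>m m"
proof -
  have Ac: "A \<in> carrier_mat m m" and Ae: "\<And>i j. \<lbrakk>i < m; j < m\<rbrakk> \<Longrightarrow> A $$ (i, j) \<in> div_carrier D"
    using A by (auto simp: mat_alg_simps)
  define U where "U q k l = mat m m (\<lambda>(i, j). if i = k \<and> j = l then q else 0 :: quat)" for q k l
  have U: "U q k l \<in> carrier (mat_alg D m)" if "q \<in> div_carrier D" for q k l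
    using that by (auto simp: U_def mat_alg_simps)
  have Uc: "U q k l \<in> carrier_mat m m" for q k l by (simp add: U_def)
  have AU: "(A * U q k l) $$ (i, j) = (if j = l then A $$ (i, k) * q else 0)" if "i < m" "j < m" "k < m" for q k l i j
    unfolding mat_mult_entry_quat[OF Ac Uc that(1,2)] using that
    by (auto simp: U_def if_distrib[of "\<lambda>c. _ * c"] cong: if_cong)
  have UA: "(U q k l * A) $$ (i, j) = (if i = k then q * A $$ (l, j) else 0)" if "i < m" "j < m" "l < m" for q k l i j
    unfolding mat_mult_entry_quat[OF Uc Ac that(1,2)] using that
    by (auto simp: U_def if_distrib[of "\<lambda>c. c * _"] cong: if_cong)
  have key: "(if j = l then A $$ (i, k) * q else 0) = (if i = k then q * A $$ (l, j) else 0)"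
    if "i < m" "j < m" "k < m" "l < m" "q \<in> div_carrier D" for i j k l q
    using arg_cong[OF comm[OF U[OF that(5), of k l]], of "\<lambda>B. B $$ (i, j)"] that AU UA by simp
  have "A $$ (0, 0) * q = q * A $$ (0, 0)" if "q \<in> div_carrier D" for q
    using key[of 0 0 0 0 q] m that by simp
  then show "A $$ (0, 0) \<in> center (div_alg D)"
    using Ae m by (simp add: center_def div_alg_simps)
  show "A = A $$ (0, 0) \<cdot>\<^sub>m 1\<^sub>m m"
  proof (rule eq_matI)
    fix i j assume "i < dim_row (A $$ (0, 0) \<cdot>\<^sub>m 1\<^sub>m m)" "j < dim_col (A $$ (0, 0) \<cdot>\<^sub>m 1\<^sub>m m)"
    then have ij: "i < m" "j < m" by auto
    show "A $$ (i, j) = (A $$ (0, 0) \<cdot>\<^sub>m 1\<^sub>m m) $$ (i, j)"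
    proof (cases "i = j")
      case True
      then show ?thesis using key[of i 0 i 0 1] ij m by simp
    next
      case False
      then show ?thesis using key[of i j j j 1] ij by simp
    qed
  qed (use Ac in auto)
qed

lemma scalar_mat_central:
  assumes "a \<in> center (div_alg D)" and M: "M \<in> carrier (mat_alg D m)"
  shows "(a \<cdot>\<^sub>m 1\<^sub>m m) * M = M * (a \<cdot>\<^sub>m 1\<^sub>m m)"
proof (rule eq_matI)
  have Mc: "M \<in> carrier_mat m m" and ac: "a \<cdot>\<^sub>m 1\<^sub>m m \<in> carrier_mat m m" using M by (auto simp: mat_alg_simps)
  fix i j assume "i < dim_row (M * (a \<cdot>\<^sub>m 1\<^sub>m m))" "j < dim_col (M * (a \<cdot>\<^sub>m 1\<^sub>m m))"
  then have ij: "i < m" "j < m" using Mc by auto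
  have "a * M $$ (i, j) = M $$ (i, j) * a"
    using assms ij by (simp add: center_def div_alg_simps mat_alg_simps)
  moreover have "(\<Sum>k<m. (a \<cdot>\<^sub>m 1\<^sub>m m) $$ (i, k) * M $$ (k, j)) = (\<Sum>k<m. if i = k then a * M $$ (k, j) else 0)"
    using ij by (intro sum.cong refl) auto
  moreover have "(\<Sum>k<m. M $$ (i, k) * (a \<cdot>\<^sub>m 1\<^sub>m m) $$ (k, j)) = (\<Sum>k<m. if j = k then M $$ (i, k) * a else 0)"
    using ij by (intro sum.cong refl) auto
  ultimately show "((a \<cdot>\<^sub>m 1\<^sub>m m) * M) $$ (i, j) = (M * (a \<cdot>\<^sub>m 1\<^sub>m m)) $$ (i, j)"
    unfolding mat_mult_entry_quat[OF ac Mc ij] mat_mult_entry_quat[OF Mc ac ij] using ij by simp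
qed (use M in \<open>auto simp: mat_alg_simps\<close>)

section \<open>The Fourier transform\<close>

context fin_group
begin

definition ir_degree :: "divalg \<Rightarrow> 'g real_rep set \<Rightarrow> nat" where
  "ir_degree D \<pi> = rep_dim \<pi> div div_dim D"

text \<open>Both representations are selected in one choice, so that the unitary matrices are a
  model of the very orthogonal representation chosen with them.\<close>

definition ir_pair :: "divalg \<Rightarrow> 'g real_rep set \<Rightarrow> ('g \<Rightarrow> real mat) \<times> ('g \<Rightarrow> quat mat)" where
  "ir_pair D \<pi> = (SOME p. (rep_dim \<pi>, fst p) \<in> \<pi> \<and> orth_rep (rep_dim \<pi>) (fst p) \<and>
     (rep_dim \<pi>, fst p) \<in> irreducible_reps G \<and> (\<exists>E. div_structure D (rep_dim \<pi>) (fst p) E) \<and>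
     unitary_model D (rep_dim \<pi>) (fst p) (ir_degree D \<pi>) (snd p))"

definition ir_rep :: "divalg \<Rightarrow> 'g real_rep set \<Rightarrow> 'g \<Rightarrow> real mat" where
  "ir_rep D \<pi> = fst (ir_pair D \<pi>)"

definition ir_matrix :: "divalg \<Rightarrow> 'g real_rep set \<Rightarrow> 'g \<Rightarrow> quat mat" where
  "ir_matrix D \<pi> = snd (ir_pair D \<pi>)"

lemma ir_rep_props:
  assumes "\<pi> \<in> Ir G D"
  shows "(rep_dim \<pi>, ir_rep D \<pi>) \<in> \<pi>" "orth_rep (rep_dim \<pi>) (ir_rep D \<pi>)"
    "(rep_dim \<pi>, ir_rep D \<pi>) \<in> irreducible_reps G" "\<exists>E. div_structure D (rep_dim \<pi>) (ir_rep D \<pi>) E"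
    "unitary_model D (rep_dim \<pi>) (ir_rep D \<pi>) (ir_degree D \<pi>) (ir_matrix D \<pi>)"
proof -
  obtain \<sigma> m R E where s: "(rep_dim \<pi>, \<sigma>) \<in> \<pi>" "orth_rep (rep_dim \<pi>) \<sigma>" "(rep_dim \<pi>, \<sigma>) \<in> irreducible_reps G"
    "div_structure D (rep_dim \<pi>) \<sigma> E" "unitary_model D (rep_dim \<pi>) \<sigma> m R"
    using Ir_model[OF assms] by blast
  have "m * card (div_units D) = rep_dim \<pi>" using s(5) by (simp add: unitary_model_def)
  \<comment> \<open>The division in \<open>ir_degree\<close> is exact, since the real degree is
    \<open>m\<close> times the number of units.\<close>
  then have "ir_degree D \<pi> = m"
    using card_div_units[of D] unfolding ir_degree_def div_dim_eq by (metis div_mult_self_is_m of_nat_0_less_iff)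
  then have "\<exists>p. (rep_dim \<pi>, fst p) \<in> \<pi> \<and> orth_rep (rep_dim \<pi>) (fst p) \<and>
     (rep_dim \<pi>, fst p) \<in> irreducible_reps G \<and> (\<exists>E. div_structure D (rep_dim \<pi>) (fst p) E) \<and>
     unitary_model D (rep_dim \<pi>) (fst p) (ir_degree D \<pi>) (snd p)"
    using s by (intro exI[of _ "(\<sigma>, R)"]) auto
  from someI_ex[OF this, folded ir_pair_def]
  show "(rep_dim \<pi>, ir_rep D \<pi>) \<in> \<pi>" "orth_rep (rep_dim \<pi>) (ir_rep D \<pi>)"
    "(rep_dim \<pi>, ir_rep D \<pi>) \<in> irreducible_reps G" "\<exists>E. div_structure D (rep_dim \<pi>) (ir_rep D \<pi>) E"
    "unitary_model D (rep_dim \<pi>) (ir_rep D \<pi>) (ir_degree D \<pi>) (ir_matrix D \<pi>)"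
    by (simp_all add: ir_rep_def ir_matrix_def)
qed

lemma ir_matrix_props:
  assumes "\<pi> \<in> Ir G D"
  defines "m \<equiv> ir_degree D \<pi>" and "R \<equiv> ir_matrix D \<pi>"
  shows "m * card (div_units D) = rep_dim \<pi>" "m > 0" "rep_dim \<pi> > 0"
    "g \<in> carrier G \<Longrightarrow> R g \<in> carrier (mat_alg D m)" "R \<one> = 1\<^sub>m m"
    "\<lbrakk>g \<in> carrier G; h \<in> carrier G\<rbrakk> \<Longrightarrow> R (g \<otimes> h) = R g * R h"
    "g \<in> carrier G \<Longrightarrow> R (inv g) = transpose_mat (map_mat qcnj (R g))"
    "\<lbrakk>p \<in> div_carrier D; q \<in> div_carrier D; k < m; l < m; k' < m; l' < m\<rbrakk> \<Longrightarrow>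
      (\<Sum>g\<in>carrier G. qre (p * R g $$ (k, l)) * qre (q * R g $$ (k', l')))
        = (if k = k' \<and> l = l' then real (Coset.order G) / real (rep_dim \<pi>) * qre (p * qcnj q) else 0)"
    "\<lbrakk>p \<in> div_carrier D; k < m; l < m\<rbrakk> \<Longrightarrow> \<exists>c. \<forall>g\<in>carrier G.
      qre (p * R g $$ (k, l)) = (\<Sum>a<rep_dim \<pi>. \<Sum>b<rep_dim \<pi>. c a b * ir_rep D \<pi> g $$ (a, b))"
    "\<lbrakk>a < rep_dim \<pi>; b < rep_dim \<pi>\<rbrakk> \<Longrightarrow> \<exists>p q. \<forall>g\<in>carrier G.
      ir_rep D \<pi> g $$ (a, b) = (\<Sum>k<m. \<Sum>l<m. qre (p k * R g $$ (k, l) * q l))"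
proof -
  note u = ir_rep_props(5)[OF assms(1), folded m_def R_def, unfolded unitary_model_def]
  show mn: "m * card (div_units D) = rep_dim \<pi>" using u by blast
  show N: "rep_dim \<pi> > 0" using ir_rep_props(3)[OF assms(1)] by (simp add: irreducible_reps_iff)
  show "m > 0" using mn N by (cases m) auto
qed (use ir_rep_props(5)[OF assms(1), folded m_def R_def] in \<open>unfold unitary_model_def, blast\<close>)+

text \<open>Distinct indices could still name one class under two types;
  \<open>div_structure_unique\<close> excludes this.\<close>

lemma ir_inequivalent:
  assumes \<pi>: "\<pi> \<in> Ir G D" and \<pi>': "\<pi>' \<in> Ir G D'" and ne: "(D, \<pi>) \<noteq> (D', \<pi>')"
  shows "((rep_dim \<pi>', ir_rep D' \<pi>'), (rep_dim \<pi>, ir_rep D \<pi>)) \<notin> rep_iso_rel G"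
proof
  assume rel: "((rep_dim \<pi>', ir_rep D' \<pi>'), (rep_dim \<pi>, ir_rep D \<pi>)) \<in> rep_iso_rel G"
  have "\<pi>' = \<pi>"
    using Ir_class[OF \<pi> ir_rep_props(1)[OF \<pi>]] Ir_class[OF \<pi>' ir_rep_props(1)[OF \<pi>']]
      equiv_class_eq[OF equiv_rep_iso_rel rel] by simp
  obtain E where E: "div_structure D (rep_dim \<pi>) (ir_rep D \<pi>) E" using ir_rep_props(4)[OF \<pi>] by blast
  obtain E' where "div_structure D' (rep_dim \<pi>) (ir_rep D' \<pi>) E'" using ir_rep_props(4)[OF \<pi>'] \<open>\<pi>' = \<pi>\<close> by auto
  \<comment> \<open>The members chosen for \<open>D\<close> and \<open>D'\<close> may differ even
    within one class, so the structure is first carried over to a common representation.\<close>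
  then have "alg_isos (End_alg G (rep_dim \<pi>, ir_rep D' \<pi>)) (div_alg D') \<noteq> {}"
    using ir_matrix_props(3)[OF \<pi>] by (rule div_structure_alg_isos)
  then obtain E'' where "div_structure D' (rep_dim \<pi>) (ir_rep D \<pi>) E''"
    using alg_isos_div_structure rel \<open>\<pi>' = \<pi>\<close> by blast
  then have "D = D'" using div_structure_unique[OF E] ir_matrix_props(3)[OF \<pi>] by blast
  then show False using ne \<open>\<pi>' = \<pi>\<close> by simp
qed

text \<open>Real coefficients of the unitary matrices are combinations of those of the orthogonal
  representations, where orthogonality is known.\<close>

lemma ir_coefficients_orthogonal:
  assumes \<pi>: "\<pi> \<in> Ir G D" and \<pi>': "\<pi>' \<in> Ir G D'" and ne: "(D, \<pi>) \<noteq> (D', \<pi>')"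
    and p: "p \<in> div_carrier D" "k < ir_degree D \<pi>" "l < ir_degree D \<pi>"
    and q: "q \<in> div_carrier D'" "k' < ir_degree D' \<pi>'" "l' < ir_degree D' \<pi>'"
  shows "(\<Sum>g\<in>carrier G. qre (p * ir_matrix D \<pi> g $$ (k, l)) * qre (q * ir_matrix D' \<pi>' g $$ (k', l'))) = 0"
proof -
  let ?n = "rep_dim \<pi>" and ?n' = "rep_dim \<pi>'"
  obtain c where c: "\<forall>g\<in>carrier G. qre (p * ir_matrix D \<pi> g $$ (k, l)) = (\<Sum>a<?n. \<Sum>b<?n. c a b * ir_rep D \<pi> g $$ (a, b))"
    using ir_matrix_props(9)[OF \<pi> p] by blast
  obtain d where d: "\<forall>g\<in>carrier G. qre (q * ir_matrix D' \<pi>' g $$ (k', l')) = (\<Sum>a<?n'. \<Sum>b<?n'. d a b * ir_rep D' \<pi>' g $$ (a, b))"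
    using ir_matrix_props(9)[OF \<pi>' q] by blast
  let ?A = "{..<?n} \<times> {..<?n}" and ?B = "{..<?n'} \<times> {..<?n'}"
  have "(\<Sum>g\<in>carrier G. qre (p * ir_matrix D \<pi> g $$ (k, l)) * qre (q * ir_matrix D' \<pi>' g $$ (k', l')))
      = (\<Sum>g\<in>carrier G. (\<Sum>s\<in>?A. c (fst s) (snd s) * ir_rep D \<pi> g $$ s) * (\<Sum>t\<in>?B. d (fst t) (snd t) * ir_rep D' \<pi>' g $$ t))"
    using c d by (intro sum.cong refl) (simp add: sum.cartesian_product')
  also have "\<dots> = (\<Sum>g\<in>carrier G. \<Sum>s\<in>?A. \<Sum>t\<in>?B. c (fst s) (snd s) * d (fst t) (snd t) * (ir_rep D \<pi> g $$ s * ir_rep D' \<pi>' g $$ t))"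
    unfolding sum_product by (intro sum.cong refl) (simp add: mult_ac)
  also have "\<dots> = (\<Sum>s\<in>?A. \<Sum>g\<in>carrier G. \<Sum>t\<in>?B. c (fst s) (snd s) * d (fst t) (snd t) * (ir_rep D \<pi> g $$ s * ir_rep D' \<pi>' g $$ t))"
    by (rule sum.swap)
  also have "\<dots> = (\<Sum>s\<in>?A. \<Sum>t\<in>?B. \<Sum>g\<in>carrier G. c (fst s) (snd s) * d (fst t) (snd t) * (ir_rep D \<pi> g $$ s * ir_rep D' \<pi>' g $$ t))"
    by (rule sum.cong[OF refl], rule sum.swap)
  also have "\<dots> = 0"
  proof (rule sum.neutral, rule ballI, rule sum.neutral, rule ballI)
    fix s t assume st: "s \<in> ?A" "t \<in> ?B"
    have "(\<Sum>g\<in>carrier G. ir_rep D \<pi> g $$ s * ir_rep D' \<pi>' g $$ t) = 0"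
      using inequivalent_coefficients_orthogonal[OF ir_rep_props(2,3)[OF \<pi>] ir_rep_props(2,3)[OF \<pi>'] ir_inequivalent[OF \<pi> \<pi>' ne],
          of "fst s" "snd s" "fst t" "snd t"] st by auto
    then show "(\<Sum>g\<in>carrier G. c (fst s) (snd s) * d (fst t) (snd t) * (ir_rep D \<pi> g $$ s * ir_rep D' \<pi>' g $$ t)) = 0"
      by (simp add: sum_distrib_left[symmetric])
  qed
  finally show ?thesis .
qed

abbreviation all_irreps :: "(divalg \<times> 'g real_rep set) set" where
  "all_irreps \<equiv> (SIGMA D:UNIV. Ir G D)"

lemma UNIV_divalg: "(UNIV :: divalg set) = {DReal, DComplex, DQuat}"
  using divalg.exhaust by auto

text \<open>One corner coefficient is taken from each class and scaled by the square root of
  \<open>N/|G|\<close>, the reciprocal of its squared length. These are orthonormal functions on the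
  group, so there are at most \<open>|G|\<close> of them.\<close>

lemma finite_Ir: "finite all_irreps" "finite (Ir G D)"
proof -
  define c where "c = (\<lambda>(D, \<pi>) g. sqrt (real (rep_dim \<pi>) / real (Coset.order G)) * qre (1 * ir_matrix D \<pi> g $$ (0, 0)))"
  have on: "orthonormal_on (carrier G) all_irreps c"
    unfolding orthonormal_on_def
  proof (intro ballI)
    fix i j assume i: "i \<in> all_irreps" and j: "j \<in> all_irreps"
    obtain D \<pi> D' \<pi>' where ij: "i = (D, \<pi>)" "j = (D', \<pi>')" by (cases i, cases j)
    then have \<pi>: "\<pi> \<in> Ir G D" and \<pi>': "\<pi>' \<in> Ir G D'" using i j by auto
    have e: "inner_on (carrier G) (c i) (c j)
      = sqrt (real (rep_dim \<pi>) / real (Coset.order G)) * sqrt (real (rep_dim \<pi>') / real (Coset.order G)) *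
        (\<Sum>g\<in>carrier G. qre (1 * ir_matrix D \<pi> g $$ (0, 0)) * qre (1 * ir_matrix D' \<pi>' g $$ (0, 0)))"
      by (simp add: inner_on_def c_def ij sum_distrib_left mult_ac)
    show "inner_on (carrier G) (c i) (c j) = (if i = j then 1 else 0)"
    proof (cases "i = j")
      case True
      then show ?thesis
        unfolding e using ij ir_matrix_props(8)[OF \<pi>, of 1 1 0 0 0 0] ir_matrix_props(2,3)[OF \<pi>] order_pos by simp
    next
      case False
      then show ?thesis
        unfolding e using ir_coefficients_orthogonal[OF \<pi> \<pi>', of 1 0 0 1 0 0] ij
          ir_matrix_props(2)[OF \<pi>] ir_matrix_props(2)[OF \<pi>'] by simp
    qed
  qed
  have "card F \<le> card (carrier G)" if F: "F \<subseteq> all_irreps" "finite F" for F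
  proof (rule orthonormal_card_le[OF finite_G F(2), of c])
    show "orthonormal_on (carrier G) F c" using on F(1) unfolding orthonormal_on_def by blast
  qed
  then show fin: "finite all_irreps"
    using finite_if_finite_subsets_card_bdd[of all_irreps "card (carrier G)"] by blast
  have "Ir G D = snd ` (all_irreps \<inter> {D} \<times> UNIV)" by force
  then show "finite (Ir G D)" using fin by simp
qed

section \<open>The transform and its compatibility with the operations\<close>

definition fourier :: "('g \<Rightarrow> real) \<Rightarrow> divalg \<Rightarrow> 'g real_rep set \<Rightarrow> quat mat" where
  "fourier x D \<pi> = mat (ir_degree D \<pi>) (ir_degree D \<pi>)
     (\<lambda>(k, l). \<Sum>g\<in>carrier G. x g *\<^sub>R ir_matrix D \<pi> g $$ (k, l))"

lemma fourier_entry: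
  "\<lbrakk>k < ir_degree D \<pi>; l < ir_degree D \<pi>\<rbrakk> \<Longrightarrow> fourier x D \<pi> $$ (k, l) = (\<Sum>g\<in>carrier G. x g *\<^sub>R ir_matrix D \<pi> g $$ (k, l))"
  by (simp add: fourier_def)

lemma qre_fourier:
  "\<lbrakk>k < ir_degree D \<pi>; l < ir_degree D \<pi>\<rbrakk> \<Longrightarrow>
    qre (p * fourier x D \<pi> $$ (k, l)) = (\<Sum>g\<in>carrier G. x g * qre (p * ir_matrix D \<pi> g $$ (k, l)))"
  by (simp add: fourier_entry sum_distrib_left quat_sel_sum)

lemma fourier_carrier:
  assumes \<pi>: "\<pi> \<in> Ir G D"
  shows "fourier x D \<pi> \<in> carrier (mat_alg D (ir_degree D \<pi>))" "fourier x D \<pi> \<in> carrier_mat (ir_degree D \<pi>) (ir_degree D \<pi>)"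
  using ir_matrix_props(4)[OF \<pi>] by (auto simp: mat_alg_simps fourier_def intro!: div_carrier_sum)

lemma fourier_linear:
  "fourier (\<lambda>g. x g + y g) D \<pi> = fourier x D \<pi> + fourier y D \<pi>"
  "fourier (\<lambda>g. r * x g) D \<pi> = map_mat ((*\<^sub>R) r) (fourier x D \<pi>)"
  "fourier (\<lambda>g. 0) D \<pi> = 0\<^sub>m (ir_degree D \<pi>) (ir_degree D \<pi>)"
  by (auto simp: fourier_def scaleR_add_left sum.distrib scaleR_sum_right intro!: eq_matI)

lemma fourier_one:
  assumes \<pi>: "\<pi> \<in> Ir G D"
  shows "fourier \<one>\<^bsub>KG\<^esub> D \<pi> = 1\<^sub>m (ir_degree D \<pi>)"
proof (rule eq_matI)
  fix k l assume "k < dim_row (1\<^sub>m (ir_degree D \<pi>))" "l < dim_col (1\<^sub>m (ir_degree D \<pi>))"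
  then have kl: "k < ir_degree D \<pi>" "l < ir_degree D \<pi>" by auto
  have "fourier \<one>\<^bsub>KG\<^esub> D \<pi> $$ (k, l) = (\<Sum>g\<in>carrier G. if g = \<one> then ir_matrix D \<pi> g $$ (k, l) else 0)"
    unfolding fourier_entry[OF kl] by (intro sum.cong refl) (simp add: KG_simps)
  then show "fourier \<one>\<^bsub>KG\<^esub> D \<pi> $$ (k, l) = 1\<^sub>m (ir_degree D \<pi>) $$ (k, l)"
    using finite_G kl by (simp add: ir_matrix_props(5)[OF \<pi>])
qed (auto simp: fourier_def)

lemma fourier_mult:
  assumes \<pi>: "\<pi> \<in> Ir G D"
  shows "fourier (x \<star> y) D \<pi> = fourier x D \<pi> * fourier y D \<pi>"
proof (rule eq_matI)
  let ?m = "ir_degree D \<pi>" and ?R = "ir_matrix D \<pi>"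
  have Rc: "?R g \<in> carrier_mat ?m ?m" if "g \<in> carrier G" for g
    using ir_matrix_props(4)[OF \<pi> that] by (simp add: mat_alg_simps)
  fix k l assume "k < dim_row (fourier x D \<pi> * fourier y D \<pi>)" "l < dim_col (fourier x D \<pi> * fourier y D \<pi>)"
  then have kl: "k < ?m" "l < ?m" by (auto simp: fourier_def)
  show "fourier (x \<star> y) D \<pi> $$ (k, l) = (fourier x D \<pi> * fourier y D \<pi>) $$ (k, l)"
  \<comment> \<open>Testing by real parts turns the entries into real functions on the group, for
    which \<open>sum_conv\<close> evaluates the convolution. Tests run over all quaternions, so no
    membership in \<open>D\<close> has to be tracked.\<close>
  proof (rule qre_eqI[of _ DQuat])
    fix p
    have "qre (p * fourier (x \<star> y) D \<pi> $$ (k, l))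
        = (\<Sum>a\<in>carrier G. \<Sum>b\<in>carrier G. x a * y b * qre (p * ?R (a \<otimes> b) $$ (k, l)))"
      unfolding qre_fourier[OF kl] by (rule sum_conv)
    also have "\<dots> = (\<Sum>a\<in>carrier G. \<Sum>b\<in>carrier G. \<Sum>j<?m. x a * y b * qre (p * (?R a $$ (k, j) * ?R b $$ (j, l))))"
      by (intro sum.cong refl)
        (simp add: ir_matrix_props(6)[OF \<pi>] mat_mult_entry_quat[OF Rc Rc kl] sum_distrib_left quat_sel_sum del: index_mult_mat(1))
    also have "\<dots> = (\<Sum>a\<in>carrier G. \<Sum>j<?m. \<Sum>b\<in>carrier G. x a * y b * qre (p * (?R a $$ (k, j) * ?R b $$ (j, l))))"
      by (rule sum.cong[OF refl], rule sum.swap)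
    also have "\<dots> = (\<Sum>j<?m. \<Sum>a\<in>carrier G. \<Sum>b\<in>carrier G. x a * y b * qre (p * (?R a $$ (k, j) * ?R b $$ (j, l))))"
      by (rule sum.swap)
    also have "\<dots> = qre (p * (\<Sum>j<?m. fourier x D \<pi> $$ (k, j) * fourier y D \<pi> $$ (j, l)))"
    proof -
      have "fourier x D \<pi> $$ (k, j) * fourier y D \<pi> $$ (j, l)
          = (\<Sum>a\<in>carrier G. \<Sum>b\<in>carrier G. (x a * y b) *\<^sub>R (?R a $$ (k, j) * ?R b $$ (j, l)))" if "j < ?m" for j
        unfolding fourier_entry[OF kl(1) that] fourier_entry[OF that kl(2)] sum_product
        by (intro sum.cong refl) (simp add: mult.commute)
      then show ?thesis by (simp add: sum_distrib_left quat_sel_sum)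
    qed
    also have "\<dots> = qre (p * (fourier x D \<pi> * fourier y D \<pi>) $$ (k, l))"
      by (simp only: mat_mult_entry_quat[OF fourier_carrier(2)[OF \<pi>] fourier_carrier(2)[OF \<pi>] kl])
    finally show "qre (p * fourier (x \<star> y) D \<pi> $$ (k, l)) = qre (p * (fourier x D \<pi> * fourier y D \<pi>) $$ (k, l))" .
  qed simp_all
qed (auto simp: fourier_def)

lemma fourier_star:
  assumes \<pi>: "\<pi> \<in> Ir G D"
  shows "fourier (group_star G x) D \<pi> = transpose_mat (map_mat qcnj (fourier x D \<pi>))"
proof (rule eq_matI)
  let ?m = "ir_degree D \<pi>" and ?R = "ir_matrix D \<pi>"
  fix k l assume "k < dim_row (transpose_mat (map_mat qcnj (fourier x D \<pi>)))" "l < dim_col (transpose_mat (map_mat qcnj (fourier x D \<pi>)))"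
  then have kl: "k < ?m" "l < ?m" by (auto simp: fourier_def)
  have "fourier (group_star G x) D \<pi> $$ (k, l) = (\<Sum>g\<in>carrier G. x (inv g) *\<^sub>R ?R g $$ (k, l))"
    unfolding fourier_entry[OF kl] by (intro sum.cong refl) (simp add: group_star_def)
  also have "\<dots> = (\<Sum>g\<in>carrier G. x g *\<^sub>R ?R (inv g) $$ (k, l))"
    using sum_inverse[of "\<lambda>g. x (inv g) *\<^sub>R ?R g $$ (k, l)"] by (simp cong: sum.cong)
  also have "\<dots> = (\<Sum>g\<in>carrier G. x g *\<^sub>R qcnj (?R g $$ (l, k)))"
  proof (rule sum.cong[OF refl])
    fix g assume g: "g \<in> carrier G"
    have "?R g \<in> carrier_mat ?m ?m" using ir_matrix_props(4)[OF \<pi> g] by (simp add: mat_alg_simps)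
    then show "x g *\<^sub>R ?R (inv g) $$ (k, l) = x g *\<^sub>R qcnj (?R g $$ (l, k))"
      using kl by (simp add: ir_matrix_props(7)[OF \<pi> g])
  qed
  also have "\<dots> = transpose_mat (map_mat qcnj (fourier x D \<pi>)) $$ (k, l)"
    using kl fourier_carrier(2)[OF \<pi>, of x] by (simp add: fourier_entry qcnj_sum)
  finally show "fourier (group_star G x) D \<pi> $$ (k, l) = transpose_mat (map_mat qcnj (fourier x D \<pi>)) $$ (k, l)" .
qed (auto simp: fourier_def)

text \<open>Completeness concerns the coefficients of arbitrary orthogonal irreducible
  representations. Each is equivalent to the chosen member of its class, whose coefficients are
  combinations of those of the unitary matrices; the latter are orthogonal to \<open>x\<close> by
  assumption.\<close>

lemma fourier_injective:
  assumes x: "x \<in> carrier KG" and F: "\<And>D \<pi>. \<pi> \<in> Ir G D \<Longrightarrow> fourier x D \<pi> = 0\<^sub>m (ir_degree D \<pi>) (ir_degree D \<pi>)"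
  shows "x = \<zero>\<^bsub>KG\<^esub>"
  unfolding KG_simps
proof (rule coefficients_complete)
  show "x g = 0" if "g \<notin> carrier G" for g using x that by (simp add: KG_simps)
  fix n \<sigma> a b assume \<sigma>: "orth_rep n \<sigma>" "(n, \<sigma>) \<in> irreducible_reps G" and ab: "a < n" "b < n"
  let ?\<pi> = "rep_iso_rel G `` {(n, \<sigma>)}"
  obtain D where \<pi>: "?\<pi> \<in> Ir G D" using irreducible_in_Ir[OF \<sigma>] by blast
  let ?s = "ir_rep D ?\<pi>" and ?N = "rep_dim ?\<pi>" and ?m = "ir_degree D ?\<pi>"
  have "((n, \<sigma>), (?N, ?s)) \<in> rep_iso_rel G" using ir_rep_props(1)[OF \<pi>] by simp
  then have rel: "((?N, ?s), (n, \<sigma>)) \<in> rep_iso_rel G" using equiv_rep_iso_rel by (meson equivE symE)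
  then have N: "?N = n" unfolding rep_iso_rel_iff by (elim conjE)
  from rel have "\<exists>P Q. P \<in> carrier_mat n n \<and> Q \<in> carrier_mat n n \<and> P * Q = 1\<^sub>m n \<and> Q * P = 1\<^sub>m n \<and>
      (\<forall>g\<in>carrier G. P * ?s g = \<sigma> g * P)" unfolding rep_iso_rel_iff N by (elim conjE)
  then obtain P Q where PQ: "P \<in> carrier_mat n n" "Q \<in> carrier_mat n n" "P * Q = 1\<^sub>m n"
    "\<And>g. g \<in> carrier G \<Longrightarrow> P * ?s g = \<sigma> g * P" by (elim exE conjE) (auto dest: bspec)
  have s0: "(\<Sum>g\<in>carrier G. x g * ?s g $$ (c, d)) = 0" if cd: "c < n" "d < n" for c d
  proof -
    obtain p q where pq: "\<forall>g\<in>carrier G. ?s g $$ (c, d) = (\<Sum>k<?m. \<Sum>l<?m. qre (p k * ir_matrix D ?\<pi> g $$ (k, l) * q l))"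
      using ir_matrix_props(10)[OF \<pi>, of c d] cd N by auto
    have "(\<Sum>g\<in>carrier G. x g * ?s g $$ (c, d))
        = (\<Sum>g\<in>carrier G. \<Sum>k<?m. \<Sum>l<?m. x g * qre (q l * p k * ir_matrix D ?\<pi> g $$ (k, l)))"
    proof (rule sum.cong[OF refl])
      fix g assume g: "g \<in> carrier G"
      have "qre (p k * ir_matrix D ?\<pi> g $$ (k, l) * q l) = qre (q l * p k * ir_matrix D ?\<pi> g $$ (k, l))" for k l
        by (subst qre_mult_commute) (simp only: mult.assoc)
      then show "x g * ?s g $$ (c, d) = (\<Sum>k<?m. \<Sum>l<?m. x g * qre (q l * p k * ir_matrix D ?\<pi> g $$ (k, l)))"
        using pq g by (simp add: sum_distrib_left)
    qed
    also have "\<dots> = (\<Sum>k<?m. \<Sum>g\<in>carrier G. \<Sum>l<?m. x g * qre (q l * p k * ir_matrix D ?\<pi> g $$ (k, l)))"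
      by (rule sum.swap)
    also have "\<dots> = (\<Sum>k<?m. \<Sum>l<?m. \<Sum>g\<in>carrier G. x g * qre (q l * p k * ir_matrix D ?\<pi> g $$ (k, l)))"
      by (rule sum.cong[OF refl], rule sum.swap)
    also have "\<dots> = (\<Sum>k<?m. \<Sum>l<?m. qre (q l * p k * fourier x D ?\<pi> $$ (k, l)))"
      by (intro sum.cong refl) (simp add: qre_fourier)
    also have "\<dots> = 0" by (simp add: F[OF \<pi>])
    finally show ?thesis .
  qed
  have entry: "\<sigma> g $$ (a, b) = (\<Sum>c<n. \<Sum>d<n. P $$ (a, c) * (?s g $$ (c, d) * Q $$ (d, b)))" if g: "g \<in> carrier G" for g
  proof -
    have sc: "?s g \<in> carrier_mat n n" "\<sigma> g \<in> carrier_mat n n"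
      using repD(1)[OF orth_repD(1)[OF ir_rep_props(2)[OF \<pi>]] g] repD(1)[OF orth_repD(1)[OF \<sigma>(1)] g] N by auto
    have "P * (?s g * Q) = \<sigma> g * (P * Q)"
      using assoc_mult_mat[OF PQ(1) sc(1) PQ(2)] assoc_mult_mat[OF sc(2) PQ(1,2)] PQ(4)[OF g] by simp
    then have "\<sigma> g = P * (?s g * Q)" using PQ(3) sc by simp
    moreover have "(P * (?s g * Q)) $$ (a, b) = (\<Sum>c<n. P $$ (a, c) * (?s g * Q) $$ (c, b))"
      by (rule mat_mult_entry[OF PQ(1) _ ab]) (use sc PQ in auto)
    moreover have "(?s g * Q) $$ (c, b) = (\<Sum>d<n. ?s g $$ (c, d) * Q $$ (d, b))" if "c < n" for c
      by (rule mat_mult_entry[OF sc(1) PQ(2) that ab(2)])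
    ultimately show ?thesis by (simp add: sum_distrib_left)
  qed
  have "(\<Sum>g\<in>carrier G. x g * \<sigma> g $$ (a, b))
      = (\<Sum>g\<in>carrier G. \<Sum>c<n. \<Sum>d<n. P $$ (a, c) * Q $$ (d, b) * (x g * ?s g $$ (c, d)))"
    by (intro sum.cong refl) (simp add: entry sum_distrib_left mult_ac)
  also have "\<dots> = (\<Sum>c<n. \<Sum>g\<in>carrier G. \<Sum>d<n. P $$ (a, c) * Q $$ (d, b) * (x g * ?s g $$ (c, d)))"
    by (rule sum.swap)
  also have "\<dots> = (\<Sum>c<n. \<Sum>d<n. \<Sum>g\<in>carrier G. P $$ (a, c) * Q $$ (d, b) * (x g * ?s g $$ (c, d)))"
    by (rule sum.cong[OF refl], rule sum.swap)
  also have "\<dots> = 0"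
    by (simp add: sum_distrib_left[symmetric] s0)
  finally show "(\<Sum>g\<in>carrier G. x g * \<sigma> g $$ (a, b)) = 0" .
qed

section \<open>The inversion formula and its consequences\<close>

definition ir_weight :: "'g real_rep set \<Rightarrow> real" where
  "ir_weight \<pi> = real (rep_dim \<pi>) / real (Coset.order G)"

text \<open>The inner double sum is the real part of the trace of the conjugate transpose of
  \<open>y\<close> times \<open>R g\<close>. By unitarity it is also that of \<open>y\<close> times
  \<open>R (inv g)\<close>, the usual form. The weight is the reciprocal of the constant in Schur
  orthogonality.\<close>

definition inverse_fourier :: "(divalg \<Rightarrow> 'g real_rep set \<Rightarrow> quat mat) \<Rightarrow> 'g \<Rightarrow> real" where
  "inverse_fourier y = (\<lambda>g. if g \<in> carrier G then
     \<Sum>(D, \<pi>)\<in>all_irreps. ir_weight \<pi> * (\<Sum>k<ir_degree D \<pi>. \<Sum>l<ir_degree D \<pi>.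
       qre (qcnj (y D \<pi> $$ (k, l)) * ir_matrix D \<pi> g $$ (k, l))) else 0)"

text \<open>Schur orthogonality keeps one class and one entry, with constant \<open>\<mu>\<close>
  times \<open>|G|/N\<close>, which is 1. This gives surjectivity of the transform.\<close>

lemma fourier_inverse_fourier:
  assumes y: "\<And>D \<pi>. \<pi> \<in> Ir G D \<Longrightarrow> y D \<pi> \<in> carrier (mat_alg D (ir_degree D \<pi>))" and \<pi>: "\<pi> \<in> Ir G D"
  shows "fourier (inverse_fourier y) D \<pi> = y D \<pi>"
proof (rule eq_matI)
  let ?m = "ir_degree D \<pi>"
  have yc: "y D \<pi> \<in> carrier_mat ?m ?m" using y[OF \<pi>] by (simp add: mat_alg_simps)
  fix k l assume "k < dim_row (y D \<pi>)" "l < dim_col (y D \<pi>)"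
  then have kl: "k < ?m" "l < ?m" using yc by auto
  show "fourier (inverse_fourier y) D \<pi> $$ (k, l) = y D \<pi> $$ (k, l)"
  proof (rule qre_eqI[of _ D])
    show "fourier (inverse_fourier y) D \<pi> $$ (k, l) \<in> div_carrier D" "y D \<pi> $$ (k, l) \<in> div_carrier D"
      using fourier_carrier(1)[OF \<pi>] y[OF \<pi>] kl by (simp_all add: mat_alg_simps)
    fix p assume p: "p \<in> div_carrier D"
    define c where "c i k' l' g = qre (qcnj (y (fst i) (snd i) $$ (k', l')) * ir_matrix (fst i) (snd i) g $$ (k', l'))" for i k' l' g
    let ?d = "\<lambda>i. ir_degree (fst i) (snd i)"
    let ?p = "\<lambda>g. qre (p * ir_matrix D \<pi> g $$ (k, l))"
    have inner: "(\<Sum>g\<in>carrier G. (\<Sum>k'<?d i. \<Sum>l'<?d i. c i k' l' g) * ?p g)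
        = (if i = (D, \<pi>) then real (Coset.order G) / real (rep_dim \<pi>) * qre (p * y D \<pi> $$ (k, l)) else 0)"
      if i: "i \<in> all_irreps" for i
    proof -
      have "(\<Sum>g\<in>carrier G. (\<Sum>k'<?d i. \<Sum>l'<?d i. c i k' l' g) * ?p g) = (\<Sum>g\<in>carrier G. \<Sum>k'<?d i. \<Sum>l'<?d i. c i k' l' g * ?p g)"
        by (simp add: sum_distrib_right)
      also have "\<dots> = (\<Sum>k'<?d i. \<Sum>g\<in>carrier G. \<Sum>l'<?d i. c i k' l' g * ?p g)"
        by (rule sum.swap)
      also have "\<dots> = (\<Sum>k'<?d i. \<Sum>l'<?d i. \<Sum>g\<in>carrier G. c i k' l' g * ?p g)"
        by (rule sum.cong[OF refl], rule sum.swap)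
      finally have eq: "(\<Sum>g\<in>carrier G. (\<Sum>k'<?d i. \<Sum>l'<?d i. c i k' l' g) * ?p g)
        = (\<Sum>k'<?d i. \<Sum>l'<?d i. \<Sum>g\<in>carrier G. c i k' l' g * ?p g)" .
      show ?thesis
      proof (cases "i = (D, \<pi>)")
        case True
        have "(\<Sum>g\<in>carrier G. c i k' l' g * ?p g)
            = (if l' = l then if k' = k then real (Coset.order G) / real (rep_dim \<pi>) * qre (p * y D \<pi> $$ (k, l)) else 0 else 0)"
          if "k' < ?m" "l' < ?m" for k' l'
        proof -
          have "qcnj (y D \<pi> $$ (k', l')) \<in> div_carrier D" using y[OF \<pi>] that by (simp add: mat_alg_simps)
          then have "(\<Sum>g\<in>carrier G. c i k' l' g * ?p g)
              = (if k' = k \<and> l' = l then real (Coset.order G) / real (rep_dim \<pi>) * qre (qcnj (y D \<pi> $$ (k', l')) * qcnj p) else 0)"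
            unfolding c_def using True ir_matrix_props(8)[OF \<pi> _ p that kl] by simp
          moreover have "qre (qcnj (y D \<pi> $$ (k, l)) * qcnj p) = qre (p * y D \<pi> $$ (k, l))"
            by (simp add: qcnj_simps(5)[symmetric] del: qcnj_simps(5))
          ultimately show ?thesis by auto
        qed
        then show ?thesis unfolding eq using True kl by simp
      next
        case False
        have "(\<Sum>g\<in>carrier G. c i k' l' g * ?p g) = 0" if "k' < ?d i" "l' < ?d i" for k' l'
        proof -
          have "snd i \<in> Ir G (fst i)" using i by auto
          moreover from this have "qcnj (y (fst i) (snd i) $$ (k', l')) \<in> div_carrier (fst i)"
            using y that by (auto simp: mat_alg_simps)
          ultimately show ?thesis
            unfolding c_def using False that p kl by (intro ir_coefficients_orthogonal \<pi>) auto
        qed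
        then show ?thesis unfolding eq using False by simp
      qed
    qed
    have "qre (p * fourier (inverse_fourier y) D \<pi> $$ (k, l))
        = (\<Sum>g\<in>carrier G. \<Sum>i\<in>all_irreps. ir_weight (snd i) * ((\<Sum>k'<?d i. \<Sum>l'<?d i. c i k' l' g) * ?p g))"
      unfolding qre_fourier[OF kl]
      by (intro sum.cong refl) (simp add: inverse_fourier_def case_prod_beta c_def sum_distrib_right mult.assoc)
    also have "\<dots> = (\<Sum>i\<in>all_irreps. ir_weight (snd i) * (\<Sum>g\<in>carrier G. (\<Sum>k'<?d i. \<Sum>l'<?d i. c i k' l' g) * ?p g))"
      by (subst sum.swap) (simp add: sum_distrib_left)
    also have "\<dots> = (\<Sum>i\<in>all_irreps. if i = (D, \<pi>) then qre (p * y D \<pi> $$ (k, l)) else 0)"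
      using order_pos ir_matrix_props(3)[OF \<pi>] by (intro sum.cong refl) (auto simp: inner ir_weight_def)
    also have "\<dots> = qre (p * y D \<pi> $$ (k, l))" using finite_Ir(1) \<pi> by simp
    finally show "qre (p * fourier (inverse_fourier y) D \<pi> $$ (k, l)) = qre (p * y D \<pi> $$ (k, l))" .
  qed
qed (use y[OF \<pi>] in \<open>auto simp: fourier_def mat_alg_simps\<close>)

lemma inverse_fourier_carrier: "inverse_fourier y \<in> carrier KG"
  by (simp add: inverse_fourier_def KG_simps)

lemma fourier_eqD:
  assumes "x \<in> carrier KG" "y \<in> carrier KG" "\<And>D \<pi>. \<pi> \<in> Ir G D \<Longrightarrow> fourier x D \<pi> = fourier y D \<pi>"
  shows "x = y"
proof -
  have "(\<lambda>g. x g + (-1) * y g) = \<zero>\<^bsub>KG\<^esub>"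
  proof (rule fourier_injective)
    show "(\<lambda>g. x g + (-1) * y g) \<in> carrier KG" using assms(1,2) by (simp add: KG_simps)
    show "fourier (\<lambda>g. x g + (-1) * y g) D \<pi> = 0\<^sub>m (ir_degree D \<pi>) (ir_degree D \<pi>)" if "\<pi> \<in> Ir G D" for D \<pi>
      unfolding fourier_linear assms(3)[OF that] by (auto simp: fourier_def intro!: eq_matI)
  qed
  then show ?thesis by (auto simp: KG_simps fun_eq_iff)
qed

text \<open>Injectivity makes the right inverse two-sided; at the unit of the group \<open>R\<close>
  is the identity matrix, so that only traces remain.\<close>

lemma Plancherel_at_one:
  assumes x: "x \<in> carrier KG"
  shows "x \<one> = (\<Sum>(D, \<pi>)\<in>all_irreps. ir_weight \<pi> * qre (mat_trace (fourier x D \<pi>)))"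
proof -
  have "x = inverse_fourier (fourier x)"
    by (rule fourier_eqD[OF x inverse_fourier_carrier])
      (simp add: fourier_inverse_fourier fourier_carrier(1))
  then have "x \<one> = inverse_fourier (fourier x) \<one>" by (rule fun_cong)
  also have "\<dots> = (\<Sum>(D, \<pi>)\<in>all_irreps. ir_weight \<pi> * qre (mat_trace (fourier x D \<pi>)))"
    unfolding inverse_fourier_def
  proof (simp, intro sum.cong refl, clarify)
    fix D \<pi> assume \<pi>: "\<pi> \<in> Ir G D"
    let ?m = "ir_degree D \<pi>"
    have "(\<Sum>k<?m. \<Sum>l<?m. qre (qcnj (fourier x D \<pi> $$ (k, l)) * ir_matrix D \<pi> \<one> $$ (k, l)))
        = (\<Sum>k<?m. \<Sum>l<?m. if k = l then qre (fourier x D \<pi> $$ (k, l)) else 0)"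
      by (intro sum.cong refl) (simp add: ir_matrix_props(5)[OF \<pi>])
    also have "\<dots> = qre (mat_trace (fourier x D \<pi>))"
      using fourier_carrier(2)[OF \<pi>, of x] by (simp add: mat_trace_def quat_sel_sum)
    finally show "ir_weight \<pi> * (\<Sum>k<?m. \<Sum>l<?m. qre (qcnj (fourier x D \<pi> $$ (k, l)) * ir_matrix D \<pi> \<one> $$ (k, l)))
      = ir_weight \<pi> * qre (mat_trace (fourier x D \<pi>))" by simp
  qed
  finally show ?thesis .
qed

text \<open>A Frobenius-Schur computation for the sum of the squares of the \<open>R g\<close>. Both
  factors are expanded in the units; Schur orthogonality keeps equal units and \<open>k = 0\<close>,
  and what remains is the sum of the squared conjugate units. The corner entry determines the
  matrix, as the square sum is central.\<close>

lemma fourier_square_sum: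
  assumes \<pi>: "\<pi> \<in> Ir G D"
  shows "fourier square_sum D \<pi> $$ (0, 0) = of_real ((2 - real (card (div_units D))) / ir_weight \<pi>)"
proof -
  let ?m = "ir_degree D \<pi>" and ?R = "ir_matrix D \<pi>" and ?U = "div_units D"
  note m = ir_matrix_props(2)[OF \<pi>]
  have Rc: "?R g \<in> carrier_mat ?m ?m" and Re: "\<And>i j. \<lbrakk>i < ?m; j < ?m\<rbrakk> \<Longrightarrow> ?R g $$ (i, j) \<in> div_carrier D"
    if "g \<in> carrier G" for g
    using ir_matrix_props(4)[OF \<pi> that] by (auto simp: mat_alg_simps)
  have "fourier square_sum D \<pi> $$ (0, 0) = (\<Sum>x\<in>carrier G. \<Sum>g\<in>carrier G. if x = g \<otimes> g then ?R x $$ (0, 0) else 0)"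
    unfolding fourier_entry[OF m m] square_sum_def scaleR_sum_left by (intro sum.cong refl) auto
  also have "\<dots> = (\<Sum>g\<in>carrier G. ?R (g \<otimes> g) $$ (0, 0))"
    by (subst sum.swap) (use finite_G in simp)
  also have "\<dots> = (\<Sum>g\<in>carrier G. \<Sum>k<?m. \<Sum>u\<in>?U. \<Sum>u'\<in>?U.
      (qre (u * ?R g $$ (0, k)) * qre (u' * ?R g $$ (k, 0))) *\<^sub>R (qcnj u * qcnj u'))"
  proof (rule sum.cong[OF refl])
    fix g assume g: "g \<in> carrier G"
    have "?R (g \<otimes> g) $$ (0, 0) = (\<Sum>k<?m. ?R g $$ (0, k) * ?R g $$ (k, 0))"
      unfolding ir_matrix_props(6)[OF \<pi> g g] by (rule mat_mult_entry_quat[OF Rc[OF g] Rc[OF g] m m])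
    also have "\<dots> = (\<Sum>k<?m. (\<Sum>u\<in>?U. qre (u * ?R g $$ (0, k)) *\<^sub>R qcnj u) * (\<Sum>u\<in>?U. qre (u * ?R g $$ (k, 0)) *\<^sub>R qcnj u))"
      using m Re[OF g] by (intro sum.cong refl arg_cong2[where f = "(*)"] div_units_expansion_qcnj) auto
    finally show "?R (g \<otimes> g) $$ (0, 0) = (\<Sum>k<?m. \<Sum>u\<in>?U. \<Sum>u'\<in>?U.
      (qre (u * ?R g $$ (0, k)) * qre (u' * ?R g $$ (k, 0))) *\<^sub>R (qcnj u * qcnj u'))"
      by (simp add: sum_product mult.commute)
  qed
  also have "\<dots> = (\<Sum>k<?m. \<Sum>g\<in>carrier G. \<Sum>u\<in>?U. \<Sum>u'\<in>?U.
      (qre (u * ?R g $$ (0, k)) * qre (u' * ?R g $$ (k, 0))) *\<^sub>R (qcnj u * qcnj u'))"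
    by (rule sum.swap)
  also have "\<dots> = (\<Sum>k<?m. \<Sum>u\<in>?U. \<Sum>g\<in>carrier G. \<Sum>u'\<in>?U.
      (qre (u * ?R g $$ (0, k)) * qre (u' * ?R g $$ (k, 0))) *\<^sub>R (qcnj u * qcnj u'))"
    by (rule sum.cong[OF refl], rule sum.swap)
  also have "\<dots> = (\<Sum>k<?m. \<Sum>u\<in>?U. \<Sum>u'\<in>?U. (\<Sum>g\<in>carrier G.
      qre (u * ?R g $$ (0, k)) * qre (u' * ?R g $$ (k, 0))) *\<^sub>R (qcnj u * qcnj u'))"
    unfolding scaleR_sum_left by (rule sum.cong[OF refl], rule sum.cong[OF refl], rule sum.swap)
  \<comment> \<open>The two coefficients sit at \<open>(0, k)\<close> and \<open>(k, 0)\<close>,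
    which coincide for \<open>k = 0\<close> only.\<close>
  also have "\<dots> = (\<Sum>k<?m. \<Sum>u\<in>?U. \<Sum>u'\<in>?U.
      if k = 0 then if u' = u then (1 / ir_weight \<pi>) *\<^sub>R (qcnj u * qcnj u) else 0 else 0)"
  proof (intro sum.cong refl)
    fix k u u' assume "k \<in> {..<?m}" and u: "u \<in> ?U" "u' \<in> ?U"
    then have k: "k < ?m" by simp
    have "qre (u * qcnj u') = (if u' = u then 1 else 0)"
      using div_units_orthonormal[OF u(2,1)] by (simp add: qre_mult_commute[of u])
    then show "(\<Sum>g\<in>carrier G. qre (u * ?R g $$ (0, k)) * qre (u' * ?R g $$ (k, 0))) *\<^sub>R (qcnj u * qcnj u')
        = (if k = 0 then if u' = u then (1 / ir_weight \<pi>) *\<^sub>R (qcnj u * qcnj u) else 0 else 0)"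
      using ir_matrix_props(8)[OF \<pi>, of u u' 0 k k 0] u m k by (auto simp: ir_weight_def)
  qed
  also have "\<dots> = (\<Sum>k<?m. if k = 0 then (\<Sum>u\<in>?U. (1 / ir_weight \<pi>) *\<^sub>R (qcnj u * qcnj u)) else 0)"
    by (intro sum.cong refl) simp
  also have "\<dots> = (1 / ir_weight \<pi>) *\<^sub>R (\<Sum>u\<in>?U. qcnj u * qcnj u)"
    using m by (simp add: scaleR_sum_right)
  also have "\<dots> = of_real ((2 - real (card ?U)) / ir_weight \<pi>)"
    unfolding sum_div_units_squares of_real_quat by simp
  finally show ?thesis .
qed

end

section \<open>The isomorphism over the reals\<close>

text \<open>The outer index ranges over all of \<open>divalg\<close>, so the restriction there
  disappears and only the inner one is left.\<close>

lemma alg_sum2_simps: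
  "carrier (alg_sum UNIV (\<lambda>D. alg_sum (J D) (B D))) = {y. \<forall>D. y D \<in> (\<Pi>\<^sub>E i\<in>J D. carrier (B D i))}"
  "monoid.mult (alg_sum UNIV (\<lambda>D. alg_sum (J D) (B D))) = (\<lambda>x y D. \<lambda>i\<in>J D. x D i \<otimes>\<^bsub>B D i\<^esub> y D i)"
  "\<one>\<^bsub>alg_sum UNIV (\<lambda>D. alg_sum (J D) (B D))\<^esub> = (\<lambda>D. \<lambda>i\<in>J D. \<one>\<^bsub>B D i\<^esub>)"
  "\<zero>\<^bsub>alg_sum UNIV (\<lambda>D. alg_sum (J D) (B D))\<^esub> = (\<lambda>D. \<lambda>i\<in>J D. \<zero>\<^bsub>B D i\<^esub>)"
  "add (alg_sum UNIV (\<lambda>D. alg_sum (J D) (B D))) = (\<lambda>x y D. \<lambda>i\<in>J D. x D i \<oplus>\<^bsub>B D i\<^esub> y D i)"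
  "module.smult (alg_sum UNIV (\<lambda>D. alg_sum (J D) (B D))) = (\<lambda>k x D. \<lambda>i\<in>J D. k \<odot>\<^bsub>B D i\<^esub> x D i)"
  by (auto simp: alg_sum_def PiE_UNIV_domain restrict_UNIV)

lemma alg_sum2_eqI:
  assumes "x \<in> carrier (alg_sum UNIV (\<lambda>D. alg_sum (J D) (B D)))" "y \<in> carrier (alg_sum UNIV (\<lambda>D. alg_sum (J D) (B D)))"
    and "\<And>D i. i \<in> J D \<Longrightarrow> x D i = y D i"
  shows "x = y"
proof
  fix D
  show "x D = y D"
    using assms by (intro PiE_ext[of "x D" "J D" "\<lambda>i. carrier (B D i)" "y D"]) (simp_all add: alg_sum2_simps)
qed

lemma scalar_mat_mult_entry:
  fixes a b :: quat
  assumes m: "m > 0"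
  shows "((a \<cdot>\<^sub>m 1\<^sub>m m) * (b \<cdot>\<^sub>m 1\<^sub>m m)) $$ (0, 0) = a * b"
proof -
  have "((a \<cdot>\<^sub>m 1\<^sub>m m) * (b \<cdot>\<^sub>m 1\<^sub>m m)) $$ (0, 0) = (\<Sum>k<m. (a \<cdot>\<^sub>m 1\<^sub>m m) $$ (0, k) * (b \<cdot>\<^sub>m 1\<^sub>m m) $$ (k, 0))"
    by (rule mat_mult_entry_quat) (use m in auto)
  also have "\<dots> = (\<Sum>k<m. if k = 0 then a * b else 0)"
    using m by (intro sum.cong refl) auto
  finally show ?thesis using m by simp
qed

context fin_group
begin

lemma fourier_structure_map:
  "structure_map KG (alg_sum UNIV (\<lambda>D. alg_sum (Ir G D) (\<lambda>\<pi>. mat_alg D (ir_degree D \<pi>)))) (\<lambda>x D. \<lambda>\<pi>\<in>Ir G D. fourier x D \<pi>)"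
  (is "structure_map _ ?Y ?h")
  unfolding structure_map_def
proof (intro conjI ballI allI)
  show "bij_betw ?h (carrier KG) (carrier ?Y)"
  proof (intro bij_betw_imageI inj_onI subset_antisym subsetI)
    fix x y assume x: "x \<in> carrier KG" and y: "y \<in> carrier KG" and eq: "?h x = ?h y"
    show "x = y"
    proof (rule fourier_eqD[OF x y])
      fix D \<pi> assume "\<pi> \<in> Ir G D"
      then show "fourier x D \<pi> = fourier y D \<pi>" using fun_cong[OF fun_cong[OF eq, of D], of \<pi>] by simp
    qed
  next
    fix y assume "y \<in> ?h ` carrier KG"
    then show "y \<in> carrier ?Y" by (auto simp: alg_sum2_simps fourier_carrier(1))
  next
    fix y assume y: "y \<in> carrier ?Y"
    then have yc: "y D \<pi> \<in> carrier (mat_alg D (ir_degree D \<pi>))" if "\<pi> \<in> Ir G D" for D \<pi>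
      using y that unfolding alg_sum2_simps by (blast intro: PiE_mem)
    have "fourier (inverse_fourier y) D \<pi> = y D \<pi>" if "\<pi> \<in> Ir G D" for D \<pi>
      using yc that by (rule fourier_inverse_fourier)
    then have "y = ?h (inverse_fourier y)"
      by (intro alg_sum2_eqI[OF y]) (auto simp: alg_sum2_simps fourier_carrier(1) yc)
    then show "y \<in> ?h ` carrier KG" using inverse_fourier_carrier by blast
  qed
qed (auto simp: KG_simps(3-5) fourier_one alg_sum2_simps mat_alg_simps fourier_linear fourier_mult fun_eq_iff restrict_def)

lemma fourier_dim [simp]: "dim_row (fourier x D \<pi>) = ir_degree D \<pi>" "dim_col (fourier x D \<pi>) = ir_degree D \<pi>"
  by (simp_all add: fourier_def)

text \<open>As the transform is onto, the image of a central element commutes with all matrices of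
  the component.\<close>

lemma fourier_central:
  assumes x: "x \<in> center KG" and \<pi>: "\<pi> \<in> Ir G D"
  shows "fourier x D \<pi> $$ (0, 0) \<in> center (div_alg D)"
    "fourier x D \<pi> = fourier x D \<pi> $$ (0, 0) \<cdot>\<^sub>m 1\<^sub>m (ir_degree D \<pi>)"
proof -
  have comm: "fourier x D \<pi> * M = M * fourier x D \<pi>" if M: "M \<in> carrier (mat_alg D (ir_degree D \<pi>))" for M
  proof -
    define y where "y D' \<pi>' = (if (D', \<pi>') = (D, \<pi>) then M else 0\<^sub>m (ir_degree D' \<pi>') (ir_degree D' \<pi>'))" for D' \<pi>'
    have "fourier (inverse_fourier y) D \<pi> = y D \<pi>"
      by (rule fourier_inverse_fourier[OF _ \<pi>]) (use M in \<open>auto simp: y_def mat_alg_simps\<close>)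
    then have F: "fourier (inverse_fourier y) D \<pi> = M" by (simp add: y_def)
    have "x \<star> inverse_fourier y = inverse_fourier y \<star> x"
      using x inverse_fourier_carrier[of y] by (simp add: center_def)
    then show ?thesis using fourier_mult[OF \<pi>, of x "inverse_fourier y"] fourier_mult[OF \<pi>, of "inverse_fourier y" x] F by simp
  qed
  show "fourier x D \<pi> $$ (0, 0) \<in> center (div_alg D)"
    "fourier x D \<pi> = fourier x D \<pi> $$ (0, 0) \<cdot>\<^sub>m 1\<^sub>m (ir_degree D \<pi>)"
    by (rule mat_alg_centralD[OF fourier_carrier(1)[OF \<pi>] ir_matrix_props(2)[OF \<pi>] comm]; assumption)+
qed

text \<open>Images of central elements are scalar matrices, so the corner entry records them
  completely.\<close>

lemma fourier_center_structure_map: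
  "structure_map (center_alg KG) (alg_sum UNIV (\<lambda>D. alg_sum (Ir G D) (\<lambda>\<pi>. center_alg (div_alg D))))
     (\<lambda>x D. \<lambda>\<pi>\<in>Ir G D. fourier x D \<pi> $$ (0, 0))"
  (is "structure_map _ ?Y ?h")
  unfolding structure_map_def
proof (intro conjI ballI allI)
  note m = ir_matrix_props(2)
  have ca: "carrier (center_alg (div_alg D)) = center (div_alg D)" for D by (simp add: center_alg_def)
  have sc: "x \<in> carrier KG" if "x \<in> center KG" for x :: "'g \<Rightarrow> real" using that by (simp add: center_def)
  show "bij_betw ?h (carrier (center_alg KG)) (carrier ?Y)"
    unfolding center_alg_simps
  proof (intro bij_betw_imageI inj_onI subset_antisym subsetI)
    fix x y assume x: "x \<in> center KG" and y: "y \<in> center KG" and eq: "?h x = ?h y"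
    show "x = y"
    proof (rule fourier_eqD[OF sc[OF x] sc[OF y]])
      fix D \<pi> assume \<pi>: "\<pi> \<in> Ir G D"
      then have "fourier x D \<pi> $$ (0, 0) = fourier y D \<pi> $$ (0, 0)" using fun_cong[OF fun_cong[OF eq, of D], of \<pi>] by simp
      then show "fourier x D \<pi> = fourier y D \<pi>"
        using fourier_central(2)[OF x \<pi>] fourier_central(2)[OF y \<pi>] by simp
    qed
  next
    fix y assume "y \<in> ?h ` center KG"
    then show "y \<in> carrier ?Y" by (auto simp: alg_sum2_simps ca fourier_central(1))
  next
    fix y assume y: "y \<in> carrier ?Y"
    then have yc: "y D \<pi> \<in> center (div_alg D)" if "\<pi> \<in> Ir G D" for D \<pi>
      using y that unfolding alg_sum2_simps ca by (blast intro: PiE_mem)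
    \<comment> \<open>A family of central scalars is lifted through scalar matrices; that the lift
      is central is checked after the transform, which is injective.\<close>
    define z where "z = inverse_fourier (\<lambda>D \<pi>. y D \<pi> \<cdot>\<^sub>m 1\<^sub>m (ir_degree D \<pi>))"
    have Fz: "fourier z D \<pi> = y D \<pi> \<cdot>\<^sub>m 1\<^sub>m (ir_degree D \<pi>)" if \<pi>: "\<pi> \<in> Ir G D" for D \<pi>
      unfolding z_def using yc by (intro fourier_inverse_fourier[OF _ \<pi>]) (auto simp: mat_alg_simps center_def div_alg_simps)
    have zc: "z \<in> carrier KG" unfolding z_def by (rule inverse_fourier_carrier)
    have "z \<star> w = w \<star> z" if w: "w \<in> carrier KG" for w
    proof (rule fourier_eqD[OF conv_carrier conv_carrier])
      fix D \<pi> assume \<pi>: "\<pi> \<in> Ir G D"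
      show "fourier (z \<star> w) D \<pi> = fourier (w \<star> z) D \<pi>"
        unfolding fourier_mult[OF \<pi>] Fz[OF \<pi>] by (rule scalar_mat_central[OF yc[OF \<pi>] fourier_carrier(1)[OF \<pi>]])
    qed
    then have z: "z \<in> center KG" using zc by (simp add: center_def)
    have "y = ?h z"
      by (rule alg_sum2_eqI[OF y]) (auto simp: alg_sum2_simps ca Fz m yc)
    then show "y \<in> ?h ` center KG" using z by blast
  qed
  show "?h \<zero>\<^bsub>center_alg KG\<^esub> = \<zero>\<^bsub>?Y\<^esub>" "?h \<one>\<^bsub>center_alg KG\<^esub> = \<one>\<^bsub>?Y\<^esub>"
    by (auto simp: center_alg_simps KG_simps(3) alg_sum2_simps fourier_linear fourier_one m fun_eq_iff restrict_def center_alg_def div_alg_simps)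
  fix x :: "'g \<Rightarrow> real" assume "x \<in> carrier (center_alg KG)"
  then have x: "x \<in> center KG" by (simp add: center_alg_simps)
  show "?h (k \<odot>\<^bsub>center_alg KG\<^esub> x) = k \<odot>\<^bsub>?Y\<^esub> ?h x" for k
    using m
    by (auto simp: center_alg_simps KG_simps(5) alg_sum2_simps fourier_linear fun_eq_iff restrict_def center_alg_def div_alg_simps)
  fix y :: "'g \<Rightarrow> real" assume "y \<in> carrier (center_alg KG)"
  then have y: "y \<in> center KG" by (simp add: center_alg_simps)
  show "?h (x \<oplus>\<^bsub>center_alg KG\<^esub> y) = ?h x \<oplus>\<^bsub>?Y\<^esub> ?h y"
    using m
    by (auto simp: center_alg_simps KG_simps(4) alg_sum2_simps fourier_linear fun_eq_iff restrict_def center_alg_def div_alg_simps)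
  have "fourier (x \<star> y) D \<pi> $$ (0, 0) = fourier x D \<pi> $$ (0, 0) * fourier y D \<pi> $$ (0, 0)" if \<pi>: "\<pi> \<in> Ir G D" for D \<pi>
  proof -
    have "fourier (x \<star> y) D \<pi> $$ (0, 0) = ((fourier x D \<pi> $$ (0, 0) \<cdot>\<^sub>m 1\<^sub>m (ir_degree D \<pi>)) * (fourier y D \<pi> $$ (0, 0) \<cdot>\<^sub>m 1\<^sub>m (ir_degree D \<pi>))) $$ (0, 0)"
      unfolding fourier_mult[OF \<pi>] fourier_central(2)[OF x \<pi>, symmetric] fourier_central(2)[OF y \<pi>, symmetric] ..
    then show ?thesis unfolding scalar_mat_mult_entry[OF m[OF \<pi>]] .
  qed
  then show "?h (x \<otimes>\<^bsub>center_alg KG\<^esub> y) = ?h x \<otimes>\<^bsub>?Y\<^esub> ?h y"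
    by (auto simp: center_alg_simps alg_sum2_simps fun_eq_iff restrict_def center_alg_def div_alg_simps)
qed

lemma H_rep_eq: "H_rep G D \<pi> = H_ecf D (ir_degree D \<pi>) (ir_weight \<pi>)"
  by (simp add: H_rep_def ir_degree_def ir_weight_def)

lemma sum_all_irreps: "(\<Sum>(D, \<pi>)\<in>all_irreps. F D \<pi>) = (\<Sum>D\<in>UNIV. \<Sum>\<pi>\<in>Ir G D. F D \<pi>)"
  by (subst sum.Sigma) (simp_all add: UNIV_divalg finite_Ir)

lemma fourier_B_fun:
  "x \<in> carrier KG \<Longrightarrow> (\<Sum>D\<in>UNIV. \<Sum>\<pi>\<in>Ir G D. B_fun (H_rep G D \<pi>) (fourier x D \<pi>)) = x \<one>"
  by (simp add: Plancherel_at_one sum_all_irreps H_rep_eq H_ecf_def)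

text \<open>A scalar \<open>a\<close> has trace \<open>m a\<close>. With \<open>N = m d\<close>,
  dividing \<open>\<mu> m\<close> by \<open>|G|\<close> gives \<open>\<mu>^2 / d\<close>, the
  constant prescribed for the \<open>A\<close>-part.\<close>

lemma fourier_A_fun:
  assumes x: "x \<in> center KG"
  shows "(\<Sum>D\<in>UNIV. \<Sum>\<pi>\<in>Ir G D. A_fun (H_rep G D \<pi>) (fourier x D \<pi> $$ (0, 0))) = x \<one> / real (Coset.order G)"
proof -
  have "A_fun (H_rep G D \<pi>) (fourier x D \<pi> $$ (0, 0)) = B_fun (H_rep G D \<pi>) (fourier x D \<pi>) / real (Coset.order G)"
    if \<pi>: "\<pi> \<in> Ir G D" for D \<pi>
  proof -
    let ?a = "fourier x D \<pi> $$ (0, 0)" and ?m = "ir_degree D \<pi>"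
    have "mat_trace (?a \<cdot>\<^sub>m 1\<^sub>m ?m) = of_nat ?m * ?a" by (simp add: mat_trace_def)
    moreover have "of_nat k * q = real k *\<^sub>R q" for k and q :: quat
      by (metis of_real_of_nat_eq scaleR_conv_of_real)
    ultimately have "qre (mat_trace (fourier x D \<pi>)) = real ?m * qre ?a"
      using fourier_central(2)[OF x \<pi>] by (simp add: quat_sel)
    moreover have "real (rep_dim \<pi>) = real ?m * real (div_dim D)"
      using ir_matrix_props(1)[OF \<pi>] by (simp add: div_dim_eq flip: of_nat_mult)
    moreover have "real (div_dim D) > 0" using card_div_units by (simp add: div_dim_eq)
    ultimately show ?thesis
      by (simp add: H_rep_eq H_ecf_def ir_weight_def power2_eq_square)
  qed
  then have "(\<Sum>D\<in>UNIV. \<Sum>\<pi>\<in>Ir G D. A_fun (H_rep G D \<pi>) (fourier x D \<pi> $$ (0, 0)))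
      = (\<Sum>D\<in>UNIV. \<Sum>\<pi>\<in>Ir G D. B_fun (H_rep G D \<pi>) (fourier x D \<pi>)) / real (Coset.order G)"
    by (simp add: sum_divide_distrib)
  then show ?thesis using x fourier_B_fun[of x] by (simp add: center_def)
qed

lemma fourier_star_corner:
  assumes \<pi>: "\<pi> \<in> Ir G D"
  shows "fourier (group_star G x) D \<pi> $$ (0, 0) = qcnj (fourier x D \<pi> $$ (0, 0))"
  using ir_matrix_props(2)[OF \<pi>] fourier_carrier(2)[OF \<pi>, of x] by (simp add: fourier_star[OF \<pi>])

lemma real_regular_isomorphism:
  "(regular_ecf G :: (real, 'g \<Rightarrow> real, 'g \<Rightarrow> real) ecf_data)
     \<cong>\<^sub>E ecf_sum UNIV (\<lambda>D. ecf_sum (Ir G D) (\<lambda>\<pi>. H_rep G D \<pi>))" (is "?X \<cong>\<^sub>E ?Y")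
proof (rule ecf_transport)
  show "is_ecf ?X" by (rule is_ecf_regular)
  show "dual_frames (A_alg ?X) (A_fun ?X) (carrier G) (\<lambda>g. class_sum (\<delta> g)) (\<lambda>g x. class_sum (\<delta> (inv g)) x / of_nat (Coset.order G))"
    by (simp add: regular_ecf_def dual_frames_center)
  show "dual_frames (B_alg ?X) (B_fun ?X) (carrier G) \<delta> (\<lambda>g. \<delta> (inv g))"
    by (simp add: regular_ecf_def dual_frames_group_alg)
  show "structure_map (A_alg ?X) (A_alg ?Y) (\<lambda>x D. \<lambda>\<pi>\<in>Ir G D. fourier x D \<pi> $$ (0, 0))"
    using fourier_center_structure_map by (simp add: regular_ecf_def ecf_sum_def H_rep_eq H_ecf_def)
  show "structure_map (B_alg ?X) (B_alg ?Y) (\<lambda>x D. \<lambda>\<pi>\<in>Ir G D. fourier x D \<pi>)"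
    using fourier_structure_map by (simp add: regular_ecf_def ecf_sum_def H_rep_eq H_ecf_def)
  show "U_elem ?Y = (\<lambda>D. \<lambda>\<pi>\<in>Ir G D. fourier (U_elem ?X) D \<pi> $$ (0, 0))"
    by (simp add: regular_ecf_def ecf_sum_def H_rep_eq H_ecf_def square_sum_eq fourier_square_sum div_dim_eq restrict_def fun_eq_iff)
  fix x assume "x \<in> carrier (A_alg ?X)"
  then have x: "x \<in> center KG" by (simp add: regular_ecf_def center_alg_simps)
  show "A_fun ?Y (\<lambda>D. \<lambda>\<pi>\<in>Ir G D. fourier x D \<pi> $$ (0, 0)) = A_fun ?X x"
    using fourier_A_fun[OF x] by (simp add: regular_ecf_def ecf_sum_def)
  show "AB_hom ?Y (\<lambda>D. \<lambda>\<pi>\<in>Ir G D. fourier x D \<pi> $$ (0, 0)) = (\<lambda>D. \<lambda>\<pi>\<in>Ir G D. fourier (AB_hom ?X x) D \<pi>)"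
    using fourier_central(2)[OF x, symmetric] by (simp add: regular_ecf_def ecf_sum_def H_rep_eq H_ecf_def restrict_def fun_eq_iff)
  show "A_star ?Y (\<lambda>D. \<lambda>\<pi>\<in>Ir G D. fourier x D \<pi> $$ (0, 0)) = (\<lambda>D. \<lambda>\<pi>\<in>Ir G D. fourier (A_star ?X x) D \<pi> $$ (0, 0))"
    by (simp add: regular_ecf_def ecf_sum_def H_rep_eq H_ecf_def fourier_star_corner restrict_def fun_eq_iff)
next
  fix x assume "x \<in> carrier (B_alg ?X)"
  then have x: "x \<in> carrier KG" by (simp add: regular_ecf_def)
  show "B_fun ?Y (\<lambda>D. \<lambda>\<pi>\<in>Ir G D. fourier x D \<pi>) = B_fun ?X x"
    using fourier_B_fun[OF x] by (simp add: regular_ecf_def ecf_sum_def)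
  show "B_star ?Y (\<lambda>D. \<lambda>\<pi>\<in>Ir G D. fourier x D \<pi>) = (\<lambda>D. \<lambda>\<pi>\<in>Ir G D. fourier (B_star ?X x) D \<pi>)"
    by (simp add: regular_ecf_def ecf_sum_def H_rep_eq H_ecf_def fourier_star restrict_def fun_eq_iff)
qed

section \<open>The isomorphism over the complex numbers\<close>

abbreviation re_part :: "('g \<Rightarrow> complex) \<Rightarrow> 'g \<Rightarrow> real" where "re_part z \<equiv> \<lambda>g. Re (z g)"

abbreviation im_part :: "('g \<Rightarrow> complex) \<Rightarrow> 'g \<Rightarrow> real" where "im_part z \<equiv> \<lambda>g. Im (z g)"

lemma re_im_eqI: "\<lbrakk>re_part z = re_part w; im_part z = im_part w\<rbrakk> \<Longrightarrow> z = w"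
  by (simp add: fun_eq_iff complex_eq_iff)

text \<open>The difference is written with a factor -1 because the maps in play preserve sums and
  multiples.\<close>

lemma re_im_conv:
  "re_part (z \<star> w) = (\<lambda>g. (re_part z \<star> re_part w) g + (-1) * (im_part z \<star> im_part w) g)"
  "im_part (z \<star> w) = (\<lambda>g. (re_part z \<star> im_part w) g + (im_part z \<star> re_part w) g)"
proof -
  show "re_part (z \<star> w) = (\<lambda>g. (re_part z \<star> re_part w) g + (-1) * (im_part z \<star> im_part w) g)"
  proof
    fix x
    have "Re ((z \<star> w) x) = (\<Sum>a\<in>carrier G. \<Sum>b\<in>carrier G.
        (if a \<otimes> b = x then Re (z a) * Re (w b) else 0) - (if a \<otimes> b = x then Im (z a) * Im (w b) else 0))"
      unfolding conv_eq_sum Re_sum by (intro sum.cong refl) simp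
    then show "Re ((z \<star> w) x) = (re_part z \<star> re_part w) x + (-1) * (im_part z \<star> im_part w) x"
      unfolding conv_eq_sum sum_subtractf by simp
  qed
  show "im_part (z \<star> w) = (\<lambda>g. (re_part z \<star> im_part w) g + (im_part z \<star> re_part w) g)"
  proof
    fix x
    have "Im ((z \<star> w) x) = (\<Sum>a\<in>carrier G. \<Sum>b\<in>carrier G.
        (if a \<otimes> b = x then Re (z a) * Im (w b) else 0) + (if a \<otimes> b = x then Im (z a) * Re (w b) else 0))"
      unfolding conv_eq_sum Im_sum by (intro sum.cong refl) simp
    then show "Im ((z \<star> w) x) = (re_part z \<star> im_part w) x + (im_part z \<star> re_part w) x"
      unfolding conv_eq_sum sum.distrib .
  qed
qed

lemma re_im_simps:
  "re_part (group_star G z) = group_star G (re_part z)" "im_part (group_star G z) = group_star G (im_part z)"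
  "re_part \<one>\<^bsub>KG\<^esub> = \<one>\<^bsub>KG\<^esub>" "im_part \<one>\<^bsub>KG\<^esub> = \<zero>\<^bsub>KG\<^esub>" "re_part \<zero>\<^bsub>KG\<^esub> = \<zero>\<^bsub>KG\<^esub>" "im_part \<zero>\<^bsub>KG\<^esub> = \<zero>\<^bsub>KG\<^esub>"
  "re_part square_sum = square_sum" "im_part square_sum = \<zero>\<^bsub>KG\<^esub>"
  by (auto simp: group_star_def KG_simps square_sum_def fun_eq_iff if_distrib[of Re] if_distrib[of Im] cong: if_cong)

lemma re_im_carrier: "z \<in> carrier KG \<longleftrightarrow> re_part z \<in> carrier KG \<and> im_part z \<in> carrier KG"
  by (auto simp: KG_simps complex_eq_iff)

lemma re_im_center: "z \<in> center KG \<longleftrightarrow> re_part z \<in> center KG \<and> im_part z \<in> center KG"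
  unfolding center_iff re_im_carrier[of z] by (auto simp: complex_eq_iff)

text \<open>One statement for both parts: \<open>S\<close> is the group algebra or its center.
  Subtraction in the complexification is defined by additive inverses, which are not among the
  operations preserved by a structure map; \<open>minus\<close> expresses it through those.\<close>

lemma structure_map_complexify:
  fixes B :: "divalg \<Rightarrow> 'g real_rep set \<Rightarrow> (real, 'c) module"
  assumes h: "structure_map (KG\<lparr>carrier := S\<rparr>) (alg_sum UNIV (\<lambda>D. alg_sum (Ir G D) (B D))) h"
    and S: "\<And>x y. \<lbrakk>x \<in> S; y \<in> S\<rbrakk> \<Longrightarrow> x \<star> y \<in> S" "\<And>r x. x \<in> S \<Longrightarrow> (\<lambda>g. r * x g) \<in> S"
      "\<And>x y. \<lbrakk>x \<in> S; y \<in> S\<rbrakk> \<Longrightarrow> (\<lambda>g. x g + y g) \<in> S"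
    and minus: "\<And>D \<pi> x y. \<lbrakk>x \<in> carrier (B D \<pi>); y \<in> carrier (B D \<pi>)\<rbrakk> \<Longrightarrow>
      x \<ominus>\<^bsub>B D \<pi>\<^esub> y = x \<oplus>\<^bsub>B D \<pi>\<^esub> (-1) \<odot>\<^bsub>B D \<pi>\<^esub> y"
  shows "structure_map (KG\<lparr>carrier := {z. re_part z \<in> S \<and> im_part z \<in> S}\<rparr>)
      (alg_sum UNIV (\<lambda>D. alg_sum (Ir G D) (\<lambda>\<pi>. alg_complexification (B D \<pi>))))
      (\<lambda>z D. \<lambda>\<pi>\<in>Ir G D. (h (re_part z) D \<pi>, h (im_part z) D \<pi>))"
    (is "structure_map ?K ?Y ?h")
proof -
  let ?R = "alg_sum UNIV (\<lambda>D. alg_sum (Ir G D) (B D))"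
  note hD = structure_mapD[OF h]
  have hc: "h x D \<pi> \<in> carrier (B D \<pi>)" if "x \<in> S" "\<pi> \<in> Ir G D" for x D \<pi>
    using hD(3)[of x] that unfolding alg_sum2_simps by (auto intro: PiE_mem)
  have h_add: "h (\<lambda>g. x g + y g) D \<pi> = h x D \<pi> \<oplus>\<^bsub>B D \<pi>\<^esub> h y D \<pi>"
    and h_mult: "h (x \<star> y) D \<pi> = h x D \<pi> \<otimes>\<^bsub>B D \<pi>\<^esub> h y D \<pi>"
    if "x \<in> S" "y \<in> S" "\<pi> \<in> Ir G D" for x y D \<pi>
    using fun_cong[OF fun_cong[OF hD(4)[of x y], of D], of \<pi>] fun_cong[OF fun_cong[OF hD(5)[of x y], of D], of \<pi>] that
    by (simp_all add: alg_sum2_simps KG_simps(4))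
  have h_smult: "h (\<lambda>g. r * x g) D \<pi> = r \<odot>\<^bsub>B D \<pi>\<^esub> h x D \<pi>" if "x \<in> S" "\<pi> \<in> Ir G D" for x r D \<pi>
    using fun_cong[OF fun_cong[OF hD(6)[of x r], of D], of \<pi>] that by (simp add: alg_sum2_simps KG_simps(5))
  have h_minus: "h (\<lambda>g. x g + (-1) * y g) D \<pi> = h x D \<pi> \<ominus>\<^bsub>B D \<pi>\<^esub> h y D \<pi>"
    if "x \<in> S" "y \<in> S" "\<pi> \<in> Ir G D" for x y D \<pi>
    unfolding h_add[OF that(1) S(2)[OF that(2)] that(3)] h_smult[OF that(2,3)] minus[OF hc[OF that(1,3)] hc[OF that(2,3)]] ..
  have h_const: "h \<one>\<^bsub>KG\<^esub> D \<pi> = \<one>\<^bsub>B D \<pi>\<^esub>" "h \<zero>\<^bsub>KG\<^esub> D \<pi> = \<zero>\<^bsub>B D \<pi>\<^esub>" if "\<pi> \<in> Ir G D" for D \<pi>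
    using fun_cong[OF fun_cong[OF hD(2), of D], of \<pi>] fun_cong[OF fun_cong[OF hD(1), of D], of \<pi>] that
    by (simp_all add: alg_sum2_simps)
  have hR: "h x \<in> carrier ?R" if "x \<in> S" for x using hD(3)[of x] that by simp
  have inj: "x = y" if "x \<in> S" "y \<in> S" "\<And>D \<pi>. \<pi> \<in> Ir G D \<Longrightarrow> h x D \<pi> = h y D \<pi>" for x y
    using alg_sum2_eqI[OF hR[OF that(1)] hR[OF that(2)] that(3)] structure_map_inj[OF h, of x y] that(1,2) by simp
  show ?thesis
    unfolding structure_map_def
  proof (intro conjI ballI allI)
    show "bij_betw ?h (carrier ?K) (carrier ?Y)"
    proof (intro bij_betw_imageI inj_onI subset_antisym subsetI)
      fix z w assume z: "z \<in> carrier ?K" and w: "w \<in> carrier ?K" and eq: "?h z = ?h w"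
      have "h (re_part z) D \<pi> = h (re_part w) D \<pi> \<and> h (im_part z) D \<pi> = h (im_part w) D \<pi>" if "\<pi> \<in> Ir G D" for D \<pi>
        using fun_cong[OF fun_cong[OF eq, of D], of \<pi>] that by simp
      then show "z = w" using z w by (intro re_im_eqI inj) auto
    next
      fix y assume "y \<in> ?h ` carrier ?K"
      then show "y \<in> carrier ?Y" by (auto simp: alg_sum2_simps alg_complexification_def hc)
    next
      fix y assume y: "y \<in> carrier ?Y"
      then have yc: "y D \<pi> \<in> carrier (B D \<pi>) \<times> carrier (B D \<pi>)" if "\<pi> \<in> Ir G D" for D \<pi>
        using y that unfolding alg_sum2_simps alg_complexification_def by (auto dest: PiE_mem)
      \<comment> \<open>The two families of components have separate real preimages, which become
        the real and imaginary parts.\<close>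
      have "(\<lambda>D. \<lambda>\<pi>\<in>Ir G D. fst (y D \<pi>)) \<in> carrier ?R" "(\<lambda>D. \<lambda>\<pi>\<in>Ir G D. snd (y D \<pi>)) \<in> carrier ?R"
        using yc unfolding alg_sum2_simps by (auto simp: mem_Times_iff)
      then obtain x x' where x: "x \<in> S" "(\<lambda>D. \<lambda>\<pi>\<in>Ir G D. fst (y D \<pi>)) = h x"
        and x': "x' \<in> S" "(\<lambda>D. \<lambda>\<pi>\<in>Ir G D. snd (y D \<pi>)) = h x'"
        by (elim structure_map_surj[OF h]) auto
      have "fst (y D \<pi>) = h x D \<pi>" "snd (y D \<pi>) = h x' D \<pi>" if "\<pi> \<in> Ir G D" for D \<pi>
        using fun_cong[OF fun_cong[OF x(2), of D], of \<pi>] fun_cong[OF fun_cong[OF x'(2), of D], of \<pi>] that by simp_all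
      then have "y = ?h (\<lambda>g. Complex (x g) (x' g))"
        using x(1) x'(1) by (intro alg_sum2_eqI[OF y]) (auto simp: alg_sum2_simps alg_complexification_def hc prod_eq_iff)
      then show "y \<in> ?h ` carrier ?K" by (rule image_eqI[where f = ?h and x = "\<lambda>g. Complex (x g) (x' g)"]) (use x(1) x'(1) in simp)
    qed
    show "?h \<zero>\<^bsub>?K\<^esub> = \<zero>\<^bsub>?Y\<^esub>" "?h \<one>\<^bsub>?K\<^esub> = \<one>\<^bsub>?Y\<^esub>"
      by (auto simp: alg_sum2_simps re_im_simps h_const alg_complexification_def fun_eq_iff restrict_def)
    fix z assume "z \<in> carrier ?K"
    then have z: "re_part z \<in> S" "im_part z \<in> S" by auto
    show "?h (k \<odot>\<^bsub>?K\<^esub> z) = k \<odot>\<^bsub>?Y\<^esub> ?h z" for k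
    proof -
      have "re_part (\<lambda>g. k * z g) = (\<lambda>g. Re k * re_part z g + (-1) * (Im k * im_part z g))"
        "im_part (\<lambda>g. k * z g) = (\<lambda>g. Re k * im_part z g + Im k * re_part z g)" by auto
      then have "h (re_part (\<lambda>g. k * z g)) D \<pi> = (Re k \<odot>\<^bsub>B D \<pi>\<^esub> h (re_part z) D \<pi>) \<ominus>\<^bsub>B D \<pi>\<^esub> (Im k \<odot>\<^bsub>B D \<pi>\<^esub> h (im_part z) D \<pi>)"
        "h (im_part (\<lambda>g. k * z g)) D \<pi> = (Re k \<odot>\<^bsub>B D \<pi>\<^esub> h (im_part z) D \<pi>) \<oplus>\<^bsub>B D \<pi>\<^esub> (Im k \<odot>\<^bsub>B D \<pi>\<^esub> h (re_part z) D \<pi>)"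
        if "\<pi> \<in> Ir G D" for D \<pi>
        using h_minus[OF S(2)[OF z(1)] S(2)[OF z(2)] that] h_add[OF S(2)[OF z(2)] S(2)[OF z(1)] that] h_smult[OF z(1) that] h_smult[OF z(2) that]
        by simp_all
      then show ?thesis
        by (auto simp: KG_simps(5) alg_sum2_simps alg_complexification_def fun_eq_iff restrict_def)
    qed
    fix w assume "w \<in> carrier ?K"
    then have w: "re_part w \<in> S" "im_part w \<in> S" by auto
    show "?h (z \<oplus>\<^bsub>?K\<^esub> w) = ?h z \<oplus>\<^bsub>?Y\<^esub> ?h w"
      using z w by (auto simp: KG_simps(4) alg_sum2_simps alg_complexification_def h_add fun_eq_iff restrict_def)
    show "?h (z \<otimes>\<^bsub>?K\<^esub> w) = ?h z \<otimes>\<^bsub>?Y\<^esub> ?h w"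
    proof -
      have "h (re_part (z \<star> w)) D \<pi> = (h (re_part z) D \<pi> \<otimes>\<^bsub>B D \<pi>\<^esub> h (re_part w) D \<pi>) \<ominus>\<^bsub>B D \<pi>\<^esub> (h (im_part z) D \<pi> \<otimes>\<^bsub>B D \<pi>\<^esub> h (im_part w) D \<pi>)"
        "h (im_part (z \<star> w)) D \<pi> = (h (re_part z) D \<pi> \<otimes>\<^bsub>B D \<pi>\<^esub> h (im_part w) D \<pi>) \<oplus>\<^bsub>B D \<pi>\<^esub> (h (im_part z) D \<pi> \<otimes>\<^bsub>B D \<pi>\<^esub> h (re_part w) D \<pi>)"
        if "\<pi> \<in> Ir G D" for D \<pi>
        unfolding re_im_conv
        using h_minus[OF S(1)[OF z(1) w(1)] S(1)[OF z(2) w(2)] that] h_add[OF S(1)[OF z(1) w(2)] S(1)[OF z(2) w(1)] that]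
          h_mult[OF z(1) w(1) that] h_mult[OF z(2) w(2) that] h_mult[OF z(1) w(2) that] h_mult[OF z(2) w(1) that]
        by simp_all
      then show ?thesis
        by (auto simp: alg_sum2_simps alg_complexification_def fun_eq_iff restrict_def)
    qed
  qed
qed

lemma a_minus_eqI:
  assumes "abelian_group C" "x \<in> carrier C" "y \<in> carrier C" "y' \<in> carrier C" "y' \<oplus>\<^bsub>C\<^esub> y = \<zero>\<^bsub>C\<^esub>"
  shows "x \<ominus>\<^bsub>C\<^esub> y = x \<oplus>\<^bsub>C\<^esub> y'"
  using abelian_group.minus_equality[OF assms(1,5,3,4)] by (simp add: a_minus_def)

text \<open>Additive inverses are determined by the group laws of addition, so these are checked
  here by hand.\<close>

lemma mat_alg_minus:
  assumes "x \<in> carrier (mat_alg D m)" "y \<in> carrier (mat_alg D m)"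
  shows "x \<ominus>\<^bsub>mat_alg D m\<^esub> y = x \<oplus>\<^bsub>mat_alg D m\<^esub> (-1) \<odot>\<^bsub>mat_alg D m\<^esub> y"
proof (rule a_minus_eqI)
  have inv: "\<exists>y\<in>carrier (mat_alg D m). y \<oplus>\<^bsub>mat_alg D m\<^esub> x = \<zero>\<^bsub>mat_alg D m\<^esub>" if "x \<in> carrier (mat_alg D m)" for x
    using that by (intro bexI[of _ "(-1) \<odot>\<^bsub>mat_alg D m\<^esub> x"]) (auto simp: mat_alg_simps intro!: eq_matI)
  show "abelian_group (mat_alg D m)"
  proof (rule abelian_groupI)
    fix x y z assume x: "x \<in> carrier (mat_alg D m)" and y: "y \<in> carrier (mat_alg D m)" and z: "z \<in> carrier (mat_alg D m)"
    then have c: "x \<in> carrier_mat m m" "y \<in> carrier_mat m m" "z \<in> carrier_mat m m" by (simp_all add: mat_alg_simps)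
    show "x \<oplus>\<^bsub>mat_alg D m\<^esub> y \<in> carrier (mat_alg D m)" using x y by (auto simp: mat_alg_simps)
    show "x \<oplus>\<^bsub>mat_alg D m\<^esub> y \<oplus>\<^bsub>mat_alg D m\<^esub> z = x \<oplus>\<^bsub>mat_alg D m\<^esub> (y \<oplus>\<^bsub>mat_alg D m\<^esub> z)"
      using c unfolding mat_alg_simps by (rule assoc_add_mat)
    show "x \<oplus>\<^bsub>mat_alg D m\<^esub> y = y \<oplus>\<^bsub>mat_alg D m\<^esub> x"
      using c(1,2) unfolding mat_alg_simps by (rule comm_add_mat)
    show "\<zero>\<^bsub>mat_alg D m\<^esub> \<oplus>\<^bsub>mat_alg D m\<^esub> x = x" using c(1) unfolding mat_alg_simps by (rule left_add_zero_mat)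
  qed (use inv in \<open>simp_all add: mat_alg_simps\<close>)
qed (use assms in \<open>auto simp: mat_alg_simps intro!: eq_matI\<close>)

lemma center_div_alg_minus:
  assumes "x \<in> carrier (center_alg (div_alg D))" "y \<in> carrier (center_alg (div_alg D))"
  shows "x \<ominus>\<^bsub>center_alg (div_alg D)\<^esub> y = x \<oplus>\<^bsub>center_alg (div_alg D)\<^esub> (-1) \<odot>\<^bsub>center_alg (div_alg D)\<^esub> y"
proof (rule a_minus_eqI)
  have inv: "\<exists>y\<in>carrier (center_alg (div_alg D)). y \<oplus>\<^bsub>center_alg (div_alg D)\<^esub> x = \<zero>\<^bsub>center_alg (div_alg D)\<^esub>"
    if "x \<in> carrier (center_alg (div_alg D))" for x
    using that by (intro bexI[of _ "-x"]) (auto simp: center_alg_def center_def div_alg_simps)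
  show "abelian_group (center_alg (div_alg D))"
    by (rule abelian_groupI) (use inv in \<open>auto simp: center_alg_def center_def div_alg_simps algebra_simps\<close>)
qed (use assms in \<open>auto simp: center_alg_def center_def div_alg_simps\<close>)

text \<open>The axioms on the left hold over every field of characteristic 0, so only the map has to
  come from the real case; those on the right follow by transport.\<close>

lemma complex_regular_isomorphism:
  "(regular_ecf G :: (complex, 'g \<Rightarrow> complex, 'g \<Rightarrow> complex) ecf_data)
     \<cong>\<^sub>E ecf_sum UNIV (\<lambda>D. ecf_sum (Ir G D) (\<lambda>\<pi>. ecf_complexification (H_rep G D \<pi>)))" (is "?X \<cong>\<^sub>E ?Y")
proof (rule ecf_transport)
  let ?f = "\<lambda>x D. \<lambda>\<pi>\<in>Ir G D. fourier x D \<pi> $$ (0, 0)" and ?g = "\<lambda>x D. \<lambda>\<pi>\<in>Ir G D. fourier x D \<pi>"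
  let ?F = "\<lambda>z D. \<lambda>\<pi>\<in>Ir G D. (fourier (re_part z) D \<pi> $$ (0, 0), fourier (im_part z) D \<pi> $$ (0, 0))"
  let ?H = "\<lambda>z D. \<lambda>\<pi>\<in>Ir G D. (fourier (re_part z) D \<pi>, fourier (im_part z) D \<pi>)"
  note defs = regular_ecf_def ecf_sum_def ecf_complexification_def
  have sum_Complex: "(\<Sum>i\<in>I. Complex (a i) (b i)) = Complex (sum a I) (sum b I)" for a b and I :: "'i set"
    by (simp add: complex_eq_iff)
  show "is_ecf ?X" by (rule is_ecf_regular)
  show "dual_frames (A_alg ?X) (A_fun ?X) (carrier G) (\<lambda>g. class_sum (\<delta> g)) (\<lambda>g x. class_sum (\<delta> (inv g)) x / of_nat (Coset.order G))"
    by (simp add: regular_ecf_def dual_frames_center)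
  show "dual_frames (B_alg ?X) (B_fun ?X) (carrier G) \<delta> (\<lambda>g. \<delta> (inv g))"
    by (simp add: regular_ecf_def dual_frames_group_alg)
  have "structure_map (KG\<lparr>carrier := {z. re_part z \<in> center KG \<and> im_part z \<in> center KG}\<rparr>)
      (alg_sum UNIV (\<lambda>D. alg_sum (Ir G D) (\<lambda>\<pi>. alg_complexification (center_alg (div_alg D)))))
      (\<lambda>z D. \<lambda>\<pi>\<in>Ir G D. (?f (re_part z) D \<pi>, ?f (im_part z) D \<pi>))"
  proof (rule structure_map_complexify)
    show "structure_map (KG\<lparr>carrier := center KG\<rparr>) (alg_sum UNIV (\<lambda>D. alg_sum (Ir G D) (\<lambda>\<pi>. center_alg (div_alg D)))) ?f"
      using fourier_center_structure_map by (simp add: center_alg_def[of KG])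
    interpret Z: frobenius_pair "center_alg (KG :: (real, _) module)" norm_coeff by (rule frobenius_pair_center)
    show "x \<star> y \<in> center KG" if "x \<in> center KG" "y \<in> center KG" for x y :: "'g \<Rightarrow> real"
      using Z.m_closed[of x y] that by (simp add: center_alg_simps)
    show "(\<lambda>g. x g + y g) \<in> center KG" if "x \<in> center KG" "y \<in> center KG" for x y :: "'g \<Rightarrow> real"
      using that by (simp add: center_iff KG_simps)
    show "(\<lambda>g. r * x g) \<in> center KG" if "x \<in> center KG" for r and x :: "'g \<Rightarrow> real"
      using that by (simp add: center_iff KG_simps)
  qed (rule center_div_alg_minus)
  \<comment> \<open>A complex function is central exactly if its real and imaginary parts are, so
    this carrier is the complex center.\<close>
  moreover have "KG\<lparr>carrier := {z. re_part z \<in> center KG \<and> im_part z \<in> center KG}\<rparr> = center_alg KG"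
    unfolding center_alg_def re_im_center[symmetric] by simp
  ultimately show "structure_map (A_alg ?X) (A_alg ?Y) ?F"
    by (simp add: defs H_rep_eq H_ecf_def cong: restrict_cong)
  have "structure_map (KG\<lparr>carrier := {z. re_part z \<in> carrier KG \<and> im_part z \<in> carrier KG}\<rparr>)
      (alg_sum UNIV (\<lambda>D. alg_sum (Ir G D) (\<lambda>\<pi>. alg_complexification (mat_alg D (ir_degree D \<pi>)))))
      (\<lambda>z D. \<lambda>\<pi>\<in>Ir G D. (?g (re_part z) D \<pi>, ?g (im_part z) D \<pi>))"
  proof (rule structure_map_complexify)
    show "structure_map (KG\<lparr>carrier := carrier KG\<rparr>) (alg_sum UNIV (\<lambda>D. alg_sum (Ir G D) (\<lambda>\<pi>. mat_alg D (ir_degree D \<pi>)))) ?g"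
      using fourier_structure_map by simp
  qed (simp_all add: conv_carrier mat_alg_minus, simp_all add: KG_simps)
  moreover have "KG\<lparr>carrier := {z. re_part z \<in> carrier KG \<and> im_part z \<in> carrier KG}\<rparr> = KG"
    unfolding re_im_carrier[symmetric] by simp
  ultimately show "structure_map (B_alg ?X) (B_alg ?Y) ?H"
    by (simp add: defs H_rep_eq H_ecf_def cong: restrict_cong)
  \<comment> \<open>The square sum takes integer values, so its imaginary part and with it the
    second component vanish.\<close>
  show "U_elem ?Y = ?F (U_elem ?X)"
    using ir_matrix_props(2)
    by (auto simp: defs square_sum_eq re_im_simps KG_simps(3) fourier_linear H_rep_eq H_ecf_def fourier_square_sum div_dim_eq center_alg_def div_alg_simps restrict_def fun_eq_iff)
  fix z assume "z \<in> carrier (A_alg ?X)"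
  then have z: "re_part z \<in> center KG" "im_part z \<in> center KG"
    using re_im_center[of z] by (simp_all add: regular_ecf_def center_alg_simps)
  show "A_fun ?Y (?F z) = A_fun ?X z"
    using fourier_A_fun[OF z(1)] fourier_A_fun[OF z(2)] by (simp add: defs sum_Complex complex_eq_iff)
  show "AB_hom ?Y (?F z) = ?H (AB_hom ?X z)"
    using fourier_central(2)[OF z(1), symmetric] fourier_central(2)[OF z(2), symmetric]
    by (simp add: defs H_rep_eq H_ecf_def restrict_def fun_eq_iff)
  show "A_star ?Y (?F z) = ?F (A_star ?X z)"
    by (simp add: defs H_rep_eq H_ecf_def re_im_simps fourier_star_corner restrict_def fun_eq_iff)
next
  fix z assume "z \<in> carrier (B_alg (regular_ecf G :: (complex, 'g \<Rightarrow> complex, 'g \<Rightarrow> complex) ecf_data))"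
  then have z: "re_part z \<in> carrier KG" "im_part z \<in> carrier KG"
    using re_im_carrier[of z] by (simp_all add: regular_ecf_def)
  have sum_Complex: "(\<Sum>i\<in>I. Complex (a i) (b i)) = Complex (sum a I) (sum b I)" for a b and I :: "'i set"
    by (simp add: complex_eq_iff)
  show "B_fun ?Y (\<lambda>D. \<lambda>\<pi>\<in>Ir G D. (fourier (re_part z) D \<pi>, fourier (im_part z) D \<pi>)) = B_fun ?X z"
    using fourier_B_fun[OF z(1)] fourier_B_fun[OF z(2)]
    by (simp add: regular_ecf_def ecf_sum_def ecf_complexification_def sum_Complex complex_eq_iff)
  show "B_star ?Y (\<lambda>D. \<lambda>\<pi>\<in>Ir G D. (fourier (re_part z) D \<pi>, fourier (im_part z) D \<pi>))
      = (\<lambda>D. \<lambda>\<pi>\<in>Ir G D. (fourier (re_part (B_star ?X z)) D \<pi>, fourier (im_part (B_star ?X z)) D \<pi>))"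
    by (simp add: regular_ecf_def ecf_sum_def ecf_complexification_def H_rep_eq H_ecf_def re_im_simps fourier_star restrict_def fun_eq_iff)
qed

end

theorem theorem6:
  fixes G :: "('g, 'm) monoid_scheme"
  assumes "group G" and "finite (carrier G)"
  shows "(regular_ecf G :: (real, 'g \<Rightarrow> real, 'g \<Rightarrow> real) ecf_data)
        \<cong>\<^sub>E ecf_sum {DReal, DComplex, DQuat} (\<lambda>D. ecf_sum (Ir G D) (\<lambda>\<pi>. H_rep G D \<pi>))
    \<and> (regular_ecf G :: (complex, 'g \<Rightarrow> complex, 'g \<Rightarrow> complex) ecf_data)
        \<cong>\<^sub>E ecf_sum {DReal, DComplex, DQuat}
              (\<lambda>D. ecf_sum (Ir G D) (\<lambda>\<pi>. ecf_complexification (H_rep G D \<pi>)))"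
proof -
  interpret fin_group G using assms by (intro fin_group.intro fin_group_axioms.intro)
  show ?thesis
    using real_regular_isomorphism complex_regular_isomorphism unfolding UNIV_divalg by (rule conjI)
qed

end
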